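(* Let $\Phi$ be an edge-monotone graph parameter such that for every $k$, the values of $\Phi$ on $k$-vertex graphs lie in $\{0,\dots,c_\Phi(k)\}$, where $c_\Phi$ is a computable function. Let $\alpha\in\mathbb{N}$ with $\alpha\ge 2$ and $\varepsilon>0$ be such that $c_\Phi(k)=\lfloor (1-\varepsilon)k^{1/\alpha}\rfloor$. \begin{itemize} \item If $\Phi$ is nontrivial, then $\#\mathrm{IndSub}(\Phi)$ and $\#\mathrm{cp\text{-}IndSub}(\Phi)$ are both $\#\mathrm{W}[1]$-hard. \item Assuming ETH, there exists a constant $\delta>0$ (depending only on $\alpha$ and $\varepsilon$) such that for every $k\ge 3$ on which $\Phi$ is nontrivial, no algorithm (that reads the whole input) computes for every graph $G$ the number $\#\mathrm{IndSub}_{(\Phi,k)}(G)$ (or, for every $k$-vertex $H$ and $H$-colored $G$, the number $\#\mathrm{cpIndSub}_{(\Phi,H)}(G)$) in time $O(|V(G)|^{\delta k^{\beta}})$, where $\beta=1-1/\alpha$. \end{itemize}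
   Context: All graphs are finite, simple and undirected. A graph parameter is a computable isomorphism-invariant function from graphs to $\mathbb{Q}$. $\Phi$ is nontrivial on $n$ if it is not constant on $n$-vertex graphs; nontrivial if nontrivial on infinitely many $n$. An edge-subgraph of $G$ has vertex set $V(G)$ and edge set a subset of $E(G)$; $\Phi$ is edge-monotone if $\Phi(G)\le\Phi(H)$ whenever $H$ is an edge-subgraph of $G$. $\#\mathrm{IndSub}_{(\Phi,k)}(G)=\sum_{A\subseteq V(G),|A|=k}\Phi(G[A])$; $\#\mathrm{IndSub}(\Phi)$ takes $(k,G)$, parameter $k$. An $H$-colored graph is $G$ with a homomorphism $c:V(G)\to V(H)$; $A\subseteq V(G)$, $|A|=|V(H)|$, is colorful if $c(A)=V(H)$; $\#\mathrm{cpIndSub}_{(\Phi,H)}(G)=\sum_{A\text{ colorful}}\Phi(G[A])$; $\#\mathrm{cp\text{-}IndSub}(\Phi)$ takes $(H,G)$, parameter $|V(H)|$. $\#\mathrm{W}[1]$-hard means there is a parameterized Turing reduction from $\#\textsc{Clique}$ (counting $k$-cliques, parameter $k$). ETH is the Exponential-Time Hypothesis. *)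

theory Defs
  imports Complex_Main "HOL-Library.Log_Nat"
begin

section \<open>Graphs and graph parameters\<close>

text \<open>Every finite graph is isomorphic to one whose vertices are natural numbers.\<close>

type_synonym graph = "nat set \<times> nat set set"

abbreviation verts :: "graph \<Rightarrow> nat set" where "verts \<equiv> fst"
abbreviation edges :: "graph \<Rightarrow> nat set set" where "edges \<equiv> snd"

definition is_graph :: "graph \<Rightarrow> bool" where
  "is_graph G \<longleftrightarrow> finite (verts G) \<and> (\<forall>e\<in>edges G. e \<subseteq> verts G \<and> card e = 2)"

definition isomorphic :: "graph \<Rightarrow> graph \<Rightarrow> bool" where
  "isomorphic G H \<longleftrightarrow>
     (\<exists>f. bij_betw f (verts G) (verts H) \<and> edges H = (\<lambda>e. f ` e) ` edges G)"

definition induced :: "graph \<Rightarrow> nat set \<Rightarrow> graph" where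
  "induced G A = (A, {e \<in> edges G. e \<subseteq> A})"

definition edge_subgraph :: "graph \<Rightarrow> graph \<Rightarrow> bool" where
  "edge_subgraph H G \<longleftrightarrow> verts H = verts G \<and> edges H \<subseteq> edges G"

definition edge_monotone :: "(graph \<Rightarrow> rat) \<Rightarrow> bool" where
  "edge_monotone \<Phi> \<longleftrightarrow>
     (\<forall>G H. is_graph G \<and> is_graph H \<and> edge_subgraph H G \<longrightarrow> \<Phi> G \<le> \<Phi> H)"

definition nontrivial_on :: "(graph \<Rightarrow> rat) \<Rightarrow> nat \<Rightarrow> bool" where
  "nontrivial_on \<Phi> n \<longleftrightarrow>
     \<not> (\<exists>q. \<forall>G. is_graph G \<and> card (verts G) = n \<longrightarrow> \<Phi> G = q)"

definition nontrivial :: "(graph \<Rightarrow> rat) \<Rightarrow> bool" where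
  "nontrivial \<Phi> \<longleftrightarrow> infinite {n. nontrivial_on \<Phi> n}"

definition is_coloring :: "graph \<Rightarrow> graph \<Rightarrow> (nat \<Rightarrow> nat) \<Rightarrow> bool" where
  "is_coloring H G c \<longleftrightarrow>
     c ` verts G \<subseteq> verts H \<and> (\<forall>u v. {u, v} \<in> edges G \<longrightarrow> {c u, c v} \<in> edges H)"

definition num_cliques :: "nat \<Rightarrow> graph \<Rightarrow> nat" where
  "num_cliques k G =
     card {A. A \<subseteq> verts G \<and> card A = k \<and> (\<forall>u\<in>A. \<forall>v\<in>A. u \<noteq> v \<longrightarrow> {u, v} \<in> edges G)}"

definition num_IndSub :: "(graph \<Rightarrow> rat) \<Rightarrow> nat \<Rightarrow> graph \<Rightarrow> rat" where
  "num_IndSub \<Phi> k G = (\<Sum>A | A \<subseteq> verts G \<and> card A = k. \<Phi> (induced G A))"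

definition num_cpIndSub :: "(graph \<Rightarrow> rat) \<Rightarrow> graph \<Rightarrow> graph \<Rightarrow> (nat \<Rightarrow> nat) \<Rightarrow> rat" where
  "num_cpIndSub \<Phi> H G c =
     (\<Sum>A | A \<subseteq> verts G \<and> card A = card (verts H) \<and> c ` A = verts H. \<Phi> (induced G A))"


section \<open>Algorithms\<close>

text \<open>
  The machine model is a random access machine with addition, cut-off subtraction and halving
  under the uniform cost measure, with structured control flow. There is no multiplication,
  so each step lengthens the largest number, apart from those read, by at most one bit,
  and the model is polynomially equivalent to multi-tape Turing machines. The input is a
  read-only list of natural numbers; work memory is initially zero.
\<close>

datatype instr =
    Const nat nat       \<comment> \<open>\<open>m[r] := v\<close>\<close>
  | Add nat nat nat     \<comment> \<open>\<open>m[r] := m[s] + m[t]\<close>\<close>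
  | Sub nat nat nat     \<comment> \<open>\<open>m[r] := m[s] - m[t]\<close>, cut off at 0\<close>
  | Half nat nat        \<comment> \<open>\<open>m[r] := m[s] div 2\<close>\<close>
  | Load nat nat        \<comment> \<open>\<open>m[r] := m[m[s]]\<close>\<close>
  | Store nat nat       \<comment> \<open>\<open>m[m[r]] := m[s]\<close>\<close>
  | InLen nat           \<comment> \<open>\<open>m[r] :=\<close> length of the input\<close>
  | Input nat nat       \<comment> \<open>\<open>m[r] :=\<close> input cell number \<open>m[s]\<close>, or 0 beyond the end\<close>
  | Query nat nat nat   \<comment> \<open>query the word of length \<open>m[s]\<close> at address \<open>m[r]\<close>, answer to address \<open>m[t]\<close>\<close>

datatype prog =
    Do instr
  | Seq prog prog
  | IfNz nat prog prog
  | WhileNz nat prog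

record config =
  mem :: "nat \<Rightarrow> nat"
  steps :: nat
  inputs_read :: "nat set"
  queries :: "nat list set"

definition init :: config where
  "init = \<lparr>mem = (\<lambda>_. 0), steps = 0, inputs_read = {}, queries = {}\<rparr>"

definition tick :: "nat \<Rightarrow> config \<Rightarrow> config" where
  "tick n s = s\<lparr>steps := steps s + n\<rparr>"

definition assign :: "nat \<Rightarrow> nat \<Rightarrow> config \<Rightarrow> config" where
  "assign r v s = s\<lparr>mem := (mem s)(r := v)\<rparr>"

definition write_block :: "nat \<Rightarrow> nat list \<Rightarrow> (nat \<Rightarrow> nat) \<Rightarrow> (nat \<Rightarrow> nat)" where
  "write_block a w m = (\<lambda>i. if a \<le> i \<and> i < a + length w then w ! (i - a) else m i)"

text \<open>
  A query is charged for its length and for the length of the answer. A unit charge would allow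
  exponentially long queries to untouched memory.
\<close>

fun do_instr :: "(nat list \<Rightarrow> nat list) \<Rightarrow> nat list \<Rightarrow> instr \<Rightarrow> config \<Rightarrow> config" where
  "do_instr orc x (Const r v) s = tick 1 (assign r v s)"
| "do_instr orc x (Add r a b) s = tick 1 (assign r (mem s a + mem s b) s)"
| "do_instr orc x (Sub r a b) s = tick 1 (assign r (mem s a - mem s b) s)"
| "do_instr orc x (Half r a) s = tick 1 (assign r (mem s a div 2) s)"
| "do_instr orc x (Load r a) s = tick 1 (assign r (mem s (mem s a)) s)"
| "do_instr orc x (Store r a) s = tick 1 (assign (mem s r) (mem s a) s)"
| "do_instr orc x (InLen r) s = tick 1 (assign r (length x) s)"
| "do_instr orc x (Input r a) s =
     (let i = mem s a in
      tick 1 (assign r (if i < length x then x ! i else 0)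
        (s\<lparr>inputs_read := insert i (inputs_read s)\<rparr>)))"
| "do_instr orc x (Query r l t) s =
     (let w = map (mem s) [mem s r ..< mem s r + mem s l]; y = orc w in
      tick (1 + length w + length y)
        (s\<lparr>mem := write_block (mem s t) y (mem s), queries := insert w (queries s)\<rparr>))"

inductive exec :: "(nat list \<Rightarrow> nat list) \<Rightarrow> nat list \<Rightarrow> prog \<Rightarrow> config \<Rightarrow> config \<Rightarrow> bool"
  for orc :: "nat list \<Rightarrow> nat list" and x :: "nat list" where
  Do: "exec orc x (Do i) s (do_instr orc x i s)"
| Seq: "exec orc x p s s' \<Longrightarrow> exec orc x q s' s'' \<Longrightarrow> exec orc x (Seq p q) s s''"
| IfTrue: "mem s r \<noteq> 0 \<Longrightarrow> exec orc x p (tick 1 s) s' \<Longrightarrow> exec orc x (IfNz r p q) s s'"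
| IfFalse: "mem s r = 0 \<Longrightarrow> exec orc x q (tick 1 s) s' \<Longrightarrow> exec orc x (IfNz r p q) s s'"
| WhileFalse: "mem s r = 0 \<Longrightarrow> exec orc x (WhileNz r p) s (tick 1 s)"
| WhileTrue: "mem s r \<noteq> 0 \<Longrightarrow> exec orc x p (tick 1 s) s' \<Longrightarrow>
    exec orc x (WhileNz r p) s' s'' \<Longrightarrow> exec orc x (WhileNz r p) s s''"

inductive_cases exec_DoE: "exec orc x (Do i) s s'"
inductive_cases exec_SeqE: "exec orc x (Seq p q) s s'"
inductive_cases exec_IfE: "exec orc x (IfNz r p q) s s'"
inductive_cases exec_WhileE: "exec orc x (WhileNz r p) s s'"

lemma exec_deterministic: "exec orc x p s s1 \<Longrightarrow> exec orc x p s s2 \<Longrightarrow> s1 = s2"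
proof (induction arbitrary: s2 rule: exec.induct)
  case (Do i s)
  then show ?case by (elim exec_DoE) simp
next
  case (Seq p s s' q s'')
  from Seq.prems show ?case
  proof (rule exec_SeqE)
    fix t
    assume t: "exec orc x p s t" "exec orc x q t s2"
    from Seq.IH(1)[OF t(1)] have "s' = t" .
    with t(2) have "exec orc x q s' s2" by simp
    then show ?thesis by (rule Seq.IH(2))
  qed
next
  case (IfTrue s r p s' q)
  from IfTrue.prems IfTrue.hyps(1) have "exec orc x p (tick 1 s) s2"
    by (auto elim: exec_IfE)
  then show ?case by (rule IfTrue.IH)
next
  case (IfFalse s r q s' p)
  from IfFalse.prems IfFalse.hyps(1) have "exec orc x q (tick 1 s) s2"
    by (auto elim: exec_IfE)
  then show ?case by (rule IfFalse.IH)
next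
  case (WhileFalse s r p)
  then show ?case by (auto elim: exec_WhileE)
next
  case (WhileTrue s r p s' s'')
  from WhileTrue.prems show ?case
  proof (rule exec_WhileE)
    assume "mem s r = 0"
    with WhileTrue.hyps(1) show ?thesis by simp
  next
    fix t
    assume t: "exec orc x p (tick (Suc 0) s) t" "exec orc x (WhileNz r p) t s2"
    from t(1) have "exec orc x p (tick 1 s) t" by simp
    then have "s' = t" by (rule WhileTrue.IH(1))
    with t(2) have "exec orc x (WhileNz r p) s' s2" by simp
    then show ?thesis by (rule WhileTrue.IH(2))
  qed
qed

text \<open>A rational is output, or returned by an oracle, in lowest terms as positive part and
  negative part of the numerator, followed by the denominator.\<close>

definition enc_rat :: "rat \<Rightarrow> nat list" where
  "enc_rat q = (case quotient_of q of (a, b) \<Rightarrow> [nat a, nat (- a), nat b])"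

definition outputs :: "config \<Rightarrow> rat \<Rightarrow> bool" where
  "outputs s q \<longleftrightarrow> map (mem s) [0..<3] = enc_rat q"

definition input_size :: "nat list \<Rightarrow> nat" where
  "input_size x = (\<Sum>a\<leftarrow>x. Suc (floorlog 2 a))"

text \<open>An ordinary run is one with the trivial oracle.\<close>

definition run :: "prog \<Rightarrow> nat list \<Rightarrow> config \<Rightarrow> bool" where
  "run p x s \<longleftrightarrow> exec (\<lambda>_. []) x p init s"

definition computes :: "prog \<Rightarrow> 'a set \<Rightarrow> ('a \<Rightarrow> nat list) \<Rightarrow> ('a \<Rightarrow> rat) \<Rightarrow> bool" where
  "computes p X enc F \<longleftrightarrow> (\<forall>x\<in>X. \<exists>s. run p (enc x) s \<and> outputs s (F x))"

definition reads_whole_input :: "prog \<Rightarrow> 'a set \<Rightarrow> ('a \<Rightarrow> nat list) \<Rightarrow> bool" where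
  "reads_whole_input p X enc \<longleftrightarrow>
     (\<forall>x\<in>X. \<forall>s. run p (enc x) s \<longrightarrow> {..<length (enc x)} \<subseteq> inputs_read s)"

definition runs_within :: "prog \<Rightarrow> 'a set \<Rightarrow> ('a \<Rightarrow> nat list) \<Rightarrow> ('a \<Rightarrow> real) \<Rightarrow> bool" where
  "runs_within p X enc T \<longleftrightarrow> (\<forall>x\<in>X. \<forall>s. run p (enc x) s \<longrightarrow> real (steps s) \<le> T x)"

text \<open>Running time \<open>O(f(n))\<close> where \<open>n\<close> is the value of the measure \<open>\<mu>\<close> on the input.\<close>

definition runs_in_O ::
  "prog \<Rightarrow> 'a set \<Rightarrow> ('a \<Rightarrow> nat list) \<Rightarrow> ('a \<Rightarrow> nat) \<Rightarrow> (nat \<Rightarrow> real) \<Rightarrow> bool" where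
  "runs_in_O p X enc \<mu> f \<longleftrightarrow>
     (\<exists>C N. runs_within p {x \<in> X. N \<le> \<mu> x} enc (\<lambda>x. C * f (\<mu> x)))"

definition computable_fun :: "(nat \<Rightarrow> nat) \<Rightarrow> bool" where
  "computable_fun f \<longleftrightarrow> (\<exists>p. computes p UNIV (\<lambda>k. [k]) (\<lambda>k. of_nat (f k)))"


section \<open>Encodings\<close>

text \<open>Number of vertices, followed by the rows of the adjacency matrix with respect to the
  increasing order of the vertices.\<close>

definition enc_graph :: "graph \<Rightarrow> nat list" where
  "enc_graph G =
     (let vs = sorted_list_of_set (verts G) in
      length vs # concat (map (\<lambda>u. map (\<lambda>v. of_bool ({u, v} \<in> edges G)) vs) vs))"

text \<open>The colors of the vertices of \<open>G\<close> are given by their positions in the increasing order of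
  the vertices of \<open>H\<close>.\<close>

definition enc_colored :: "graph \<times> graph \<times> (nat \<Rightarrow> nat) \<Rightarrow> nat list" where
  "enc_colored = (\<lambda>(H, G, c).
     enc_graph H @ enc_graph G @
     map (\<lambda>v. card {w \<in> verts H. w < c v}) (sorted_list_of_set (verts G)))"

definition graph_parameter :: "(graph \<Rightarrow> rat) \<Rightarrow> bool" where
  "graph_parameter \<Phi> \<longleftrightarrow>
     (\<forall>G H. is_graph G \<and> is_graph H \<and> isomorphic G H \<longrightarrow> \<Phi> G = \<Phi> H) \<and>
     (\<exists>p. computes p {G. is_graph G} enc_graph \<Phi>)"


section \<open>Parameterized counting problems\<close>

record 'a param_problem =
  instances :: "'a set"
  encode :: "'a \<Rightarrow> nat list"
  param :: "'a \<Rightarrow> nat"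
  answer :: "'a \<Rightarrow> rat"

definition CLIQUE :: "(nat \<times> graph) param_problem" where
  "CLIQUE = \<lparr>instances = {(k, G). is_graph G}, encode = (\<lambda>(k, G). k # enc_graph G),
     param = fst, answer = (\<lambda>(k, G). of_nat (num_cliques k G))\<rparr>"

definition INDSUB :: "(graph \<Rightarrow> rat) \<Rightarrow> (nat \<times> graph) param_problem" where
  "INDSUB \<Phi> = \<lparr>instances = {(k, G). is_graph G}, encode = (\<lambda>(k, G). k # enc_graph G),
     param = fst, answer = (\<lambda>(k, G). num_IndSub \<Phi> k G)\<rparr>"

definition colored_graphs :: "(graph \<times> graph \<times> (nat \<Rightarrow> nat)) set" where
  "colored_graphs = {(H, G, c). is_graph H \<and> is_graph G \<and> is_coloring H G c}"

definition CPINDSUB :: "(graph \<Rightarrow> rat) \<Rightarrow> (graph \<times> graph \<times> (nat \<Rightarrow> nat)) param_problem" where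
  "CPINDSUB \<Phi> = \<lparr>instances = colored_graphs, encode = enc_colored,
     param = (\<lambda>(H, G, c). card (verts H)), answer = (\<lambda>(H, G, c). num_cpIndSub \<Phi> H G c)\<rparr>"

definition oracle_for :: "'b param_problem \<Rightarrow> (nat list \<Rightarrow> nat list) \<Rightarrow> bool" where
  "oracle_for Q orc \<longleftrightarrow> (\<forall>y\<in>instances Q. orc (encode Q y) = enc_rat (answer Q y))"

text \<open>The reduction runs in fixed-parameter tractable time and only asks for instances of the
  target problem whose parameter is bounded in terms of the parameter of the input.\<close>

definition param_turing_reducible :: "'a param_problem \<Rightarrow> 'b param_problem \<Rightarrow> bool" where
  "param_turing_reducible P Q \<longleftrightarrow>
     (\<exists>p f g d. computable_fun f \<and> computable_fun g \<and>
        (\<forall>orc. oracle_for Q orc \<longrightarrow>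
          (\<forall>x\<in>instances P. \<exists>s.
             exec orc (encode P x) p init s \<and>
             outputs s (answer P x) \<and>
             steps s \<le> f (param P x) * input_size (encode P x) ^ d \<and>
             (\<forall>w\<in>queries s. \<exists>y\<in>instances Q. w = encode Q y \<and> param Q y \<le> g (param P x)))))"

definition W1_hard :: "'b param_problem \<Rightarrow> bool" where
  "W1_hard Q \<longleftrightarrow> param_turing_reducible CLIQUE Q"


section \<open>The Exponential-Time Hypothesis\<close>

text \<open>A formula is a number \<open>n\<close> of variables with a list of clauses over the variables
  \<open>0, \<dots>, n - 1\<close>; the literal \<open>(v, b)\<close> is true if variable \<open>v\<close> has value \<open>b\<close>.\<close>

type_synonym cnf = "nat \<times> (nat \<times> bool) list list"

definition three_cnf :: "cnf set" where
  "three_cnf = {(n, cls). \<forall>cl\<in>set cls. length cl \<le> 3 \<and> (\<forall>(v, b)\<in>set cl. v < n)}"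

definition satisfiable :: "cnf \<Rightarrow> bool" where
  "satisfiable = (\<lambda>(n, cls). \<exists>a. \<forall>cl\<in>set cls. \<exists>(v, b)\<in>set cl. a v = b)"

definition enc_cnf :: "cnf \<Rightarrow> nat list" where
  "enc_cnf = (\<lambda>(n, cls).
     n # length cls # concat (map (\<lambda>cl. length cl # map (\<lambda>(v, b). 2 * v + of_bool b) cl) cls))"

text \<open>The polynomial factor in the input size is needed because clauses may be repeated.\<close>

definition ETH :: bool where
  "ETH \<longleftrightarrow> (\<exists>\<delta>::real. \<delta> > 0 \<and>
     \<not> (\<exists>p C d. computes p three_cnf enc_cnf (\<lambda>F. of_bool (satisfiable F)) \<and>
          runs_within p three_cnf enc_cnf
            (\<lambda>F. C * 2 powr (\<delta> * real (fst F)) * real (input_size (enc_cnf F)) ^ d)))"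


section \<open>Fixed pattern size\<close>

text \<open>An algorithm for fixed \<open>k\<close> may depend on \<open>k\<close> and gets only the graph, respectively the pair of
  a \<open>k\<close>-vertex graph \<open>H\<close> and an \<open>H\<close>-colored graph, as input.\<close>

definition IndSub_in_time :: "(graph \<Rightarrow> rat) \<Rightarrow> nat \<Rightarrow> (nat \<Rightarrow> real) \<Rightarrow> bool" where
  "IndSub_in_time \<Phi> k f \<longleftrightarrow>
     (\<exists>p. reads_whole_input p {G. is_graph G} enc_graph \<and>
          computes p {G. is_graph G} enc_graph (num_IndSub \<Phi> k) \<and>
          runs_in_O p {G. is_graph G} enc_graph (\<lambda>G. card (verts G)) f)"

definition cpIndSub_in_time :: "(graph \<Rightarrow> rat) \<Rightarrow> nat \<Rightarrow> (nat \<Rightarrow> real) \<Rightarrow> bool" where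
  "cpIndSub_in_time \<Phi> k f \<longleftrightarrow>
     (let X = {(H, G, c) \<in> colored_graphs. card (verts H) = k} in
      \<exists>p. reads_whole_input p X enc_colored \<and>
          computes p X enc_colored (\<lambda>(H, G, c). num_cpIndSub \<Phi> H G c) \<and>
          runs_in_O p X enc_colored (\<lambda>(H, G, c). card (verts G)) f)"

definition bounded_by :: "(graph \<Rightarrow> rat) \<Rightarrow> (nat \<Rightarrow> nat) \<Rightarrow> bool" where
  "bounded_by \<Phi> c \<longleftrightarrow> (\<forall>G. is_graph G \<longrightarrow> \<Phi> G \<in> of_nat ` {0..c (card (verts G))})"

text \<open>The bound \<open>c\<close> is determined by \<open>\<alpha>\<close> and \<open>\<epsilon>\<close>, but it need not be computable for
  every real \<open>\<epsilon>\<close>.\<close>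

definition admissible :: "nat \<Rightarrow> real \<Rightarrow> (graph \<Rightarrow> rat) \<Rightarrow> bool" where
  "admissible \<alpha> \<epsilon> \<Phi> \<longleftrightarrow>
     graph_parameter \<Phi> \<and> edge_monotone \<Phi> \<and>
     (\<exists>c. computable_fun c \<and> bounded_by \<Phi> c \<and>
        (\<forall>k. int (c k) = \<lfloor>(1 - \<epsilon>) * real k powr (1 / real \<alpha>)\<rfloor>))"

end

theory Submission
 imports Defs "HOL-Computational_Algebra.Primes" "HOL-Library.FuncSet"
begin

text \<open>
 Write \<open>hat(T)\<close> for the alternating sum of the values of the parameter over the edge sets \<open>S \<subseteq> T\<close> on \<open>k\<close>
 vertices. Toggling a missing edge shows that the alternating sum of colored counts over the subgraphs
 of \<open>H\<close> is \<open>hat(H)\<close> times the number of colorful copies of \<open>H\<close>; if \<open>H\<close> contains the biclique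
 \<open>K(t, t)\<close>, the copies in a suitable host graph encode the \<open>t\<close>-cliques of a given graph.

 Such an \<open>H\<close> with \<open>hat(H) \<noteq> 0\<close> and \<open>t\<close> of order \<open>k / c\<close> exists: split the vertices into blocks of size a
 power of two and let the cyclic rotations of the blocks act on edge sets. Counting orbits modulo a
 power of two larger than the bound \<open>c\<close> on the values leaves only edge sets that are invariant under large rotations,
 and such a set with an edge between two blocks contains the biclique.

 For the lower bound under ETH, a sparsified 3-CNF formula is cut into \<open>t\<close> groups of clauses; the choices of
 a true literal in each clause of a group are the vertices of a graph whose \<open>t\<close>-cliques are the satisfying choices.

 All algorithms are written as combinator terms over nested pairs, which are compiled
 to the machine; a given program is executed inside a reduction by simulation.
\<close>

text \<open>A pattern with nonzero \<open>hat\<close> must also contain a large biclique. It comes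
  from two graphs \<open>X\<close> and \<open>Y\<close>, both invariant under all rotations, where
  \<open>Y\<close> is \<open>X\<close> with all edges between blocks added and the values differ.
  Their difference is the signed sum of \<open>hat\<close> over the sets inside \<open>Y\<close> but
  not inside \<open>X\<close>; it is nonzero and smaller than the modulus, so a nonzero term
  survives among the sets with short orbits, and it has an edge between blocks. Such a pair exists,
  as otherwise the complete graph could be thinned to the empty graph at constant value: deleting
  the edges between blocks is then free, and relabelling turns most edges inside blocks into edges
  between blocks.

  Two demands of uniformity shape the algorithmic half. Finding the pattern for a given clique size
  takes a time without a known bound, yet the reduction needs a computable one; hence the cost of a
  term is itself computed by a term. The constant in the ETH bound may depend neither on \<Phi> nor
  on \<open>k\<close>; hence simulating a hypothetical program must cost a power of its time whose
  exponent is fixed before the program.\<close>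

section \<open>Orbit counting modulo powers of two\<close>

text \<open>Orbits of \<open>g\<close> have 2-power length. A point moved by the
  \<open>2 ^ j\<close>-th iterate lies in an orbit whose length is a multiple of
  \<open>2 ^ Suc j\<close>, and \<open>w\<close> is constant on it; the induction removes one such
  orbit at a time.\<close>

lemma sum_not_fixed_dvd:
 fixes w :: "'a => int"
 assumes "finite X" "g ` X \<subseteq> X" "inj_on g X" "!!x. x \<in> X ==> w (g x) = w x"
  "!!x. x \<in> X ==> (g ^^ (2 ^ m)) x = x"
 shows "2 ^ Suc j dvd (\<Sum>x | x \<in> X \<and> (g ^^ (2 ^ j)) x ~= x. w x)"
 using assms
proof (induction "card X" arbitrary: X rule: less_induct)
 case less
 have cl: "(g ^^ i) x \<in> X" if "x \<in> X" for i x using that less.prems(2) by (induction i) auto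
 show ?case
 proof (cases "\<exists>x\<in>X. (g ^^ (2 ^ j)) x ~= x")
  case False
  then have e: "{x. x \<in> X \<and> (g ^^ (2 ^ j)) x ~= x} = {}" by blast
  show ?thesis unfolding e by simp
 next
  case True
  then obtain x where x: "x \<in> X" "(g ^^ (2 ^ j)) x ~= x" by blast
  define d where "d = (LEAST n. 0 < n \<and> (g ^^ n) x = x)"
  have ex: "0 < (2::nat) ^ m \<and> (g ^^ (2 ^ m)) x = x" using less.prems(5) x by simp
  have d: "0 < d" "(g ^^ d) x = x" using LeastI[of "%n. 0 < n \<and> (g ^^ n) x = x", OF ex] by (auto simp: d_def)
  have least: "\<not> (0 < n \<and> (g ^^ n) x = x)" if "n < d" for n
   using not_less_Least[of n "%n. 0 < n \<and> (g ^^ n) x = x"] that by (auto simp: d_def)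
  have dvd: "d dvd n" if "(g ^^ n) x = x" for n
  proof -
   have "(g ^^ (n mod d)) x = x" using funpow_mod_eq[OF d(2), of n] that by simp
   then have "\<not> 0 < n mod d" using least[of "n mod d"] d(1) by auto
   then show ?thesis by auto
  qed
  obtain i where i: "d = 2 ^ i" using dvd[OF conjunct2[OF ex]] by (auto simp: divides_primepow_nat)
  have "j < i"
  proof (rule ccontr)
   assume "\<not> j < i"
   then obtain q where "(2::nat) ^ j = d * q" unfolding i by (metis le_imp_power_dvd dvdE not_less)
   moreover have "(g ^^ (d * q)) x = x" using d(2) by (induction q) (auto simp: funpow_add)
   ultimately show False using x(2) by simp
  qed
  then have dd: "2 ^ Suc j dvd int d" using le_imp_power_dvd[of "Suc j" i "2::int"] unfolding i by simp
  define Ob where "Ob = (%i. (g ^^ i) x) ` {..<d}"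
  have inj_pow: "(g ^^ a) y = (g ^^ a) z ==> y \<in> X ==> z \<in> X ==> y = z" for a y z
  proof (induction a)
   case (Suc a)
   then have "(g ^^ a) y = (g ^^ a) z" using cl less.prems(3) by (auto dest: inj_onD)
   then show ?case using Suc by blast
  qed simp
  have inj: "inj_on (%i. (g ^^ i) x) {..<d}"
  proof (rule linorder_inj_onI)
   fix a b assume ab: "a < b" "a \<in> {..<d}" "b \<in> {..<d}"
   show "(g ^^ a) x ~= (g ^^ b) x"
   proof
    assume "(g ^^ a) x = (g ^^ b) x"
    moreover have "(g ^^ b) x = (g ^^ a) ((g ^^ (b - a)) x)" using ab by (simp flip: funpow_add comp_apply[of "g ^^ a"])
    ultimately have "(g ^^ (b - a)) x = x" using inj_pow[of a x "(g ^^ (b - a)) x"] cl x(1) by simp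
    moreover have "b - a < d" using ab by auto
    ultimately show False using least[of "b - a"] ab by auto
   qed
  qed auto
  have wx: "w ((g ^^ i) x) = w x" for i using cl[OF x(1)] less.prems(4) by (induction i) auto
  have gO: "g ` Ob = Ob"
  proof (rule card_subset_eq[symmetric, THEN sym])
   show "finite Ob" by (simp add: Ob_def)
   show sub: "g ` Ob \<subseteq> Ob"
   proof
    fix y assume "y \<in> g ` Ob"
    then obtain i where i: "i < d" "y = (g ^^ Suc i) x" by (auto simp: Ob_def)
    show "y \<in> Ob"
    proof (cases "Suc i = d")
     case True
     then have "y = (g ^^ 0) x" using i d by simp
     then show ?thesis using d(1) unfolding Ob_def by blast
    next
     case False
     then show ?thesis using i by (auto simp: Ob_def simp del: funpow.simps)
    qed
   qed
   have "inj_on g Ob" by (rule inj_on_subset[OF less.prems(3)]) (auto simp: Ob_def cl x)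
   then show "card (g ` Ob) = card Ob" by (rule card_image)
  qed
  have OX: "Ob \<subseteq> X" by (auto simp: Ob_def cl x)
  have nf: "(g ^^ (2 ^ j)) y ~= y" if "y \<in> Ob" for y
  proof
   assume a: "(g ^^ (2 ^ j)) y = y"
   from that obtain i where i: "y = (g ^^ i) x" by (auto simp: Ob_def)
   have "(g ^^ i) ((g ^^ (2 ^ j)) x) = (g ^^ i) x"
    using a unfolding i by (metis add.commute comp_apply funpow_add)
   then show False using inj_pow[of i] cl x by metis
  qed
  have IH: "2 ^ Suc j dvd (\<Sum>x | x \<in> X - Ob \<and> (g ^^ (2 ^ j)) x ~= x. w x)"
  proof (rule less.hyps)
   have "x \<in> Ob" unfolding Ob_def using d(1) by (intro image_eqI[of _ _ 0]) auto
   then show "card (X - Ob) < card X" using less.prems(1) x(1) by (intro psubset_card_mono) auto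
   show "g ` (X - Ob) \<subseteq> X - Ob"
   proof
    fix y assume "y \<in> g ` (X - Ob)"
    then obtain z where z: "z \<in> X" "z \<notin> Ob" "y = g z" by blast
    moreover have "y \<notin> Ob"
    proof
     assume "y \<in> Ob"
     then obtain z' where "z' \<in> Ob" "y = g z'" using gO by blast
     then show False using z OX less.prems(3) by (metis inj_onD subsetD)
    qed
    ultimately show "y \<in> X - Ob" using less.prems(2) by blast
   qed
  qed (use less.prems in \<open>auto intro: inj_on_subset\<close>)
  have split: "{x. x \<in> X \<and> (g ^^ (2 ^ j)) x ~= x} = Ob \<union> {x. x \<in> X - Ob \<and> (g ^^ (2 ^ j)) x ~= x}"
   using OX nf by blast
  have "(\<Sum>x | x \<in> X \<and> (g ^^ (2 ^ j)) x ~= x. w x) = sum w Ob + (\<Sum>x | x \<in> X - Ob \<and> (g ^^ (2 ^ j)) x ~= x. w x)"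
   unfolding split using less.prems(1) by (intro sum.union_disjoint) (auto simp: Ob_def)
  moreover have "sum w Ob = int d * w x"
   unfolding Ob_def using inj by (simp add: sum.reindex wx)
  ultimately show ?thesis using IH dd by simp
 qed
qed

section \<open>Alternating sums over edge sets and rotations of blocks\<close>

definition pairs :: "nat => nat set set" where
 "pairs k = {e. e \<subseteq> {..<k} \<and> card e = 2}"

text \<open>Up to the sign \<open>(-1) ^ card T\<close> this is Moebius inversion over the subset
  lattice. Without that sign the transform is an involution, which is what \<open>moebius\<close>
  uses.\<close>

definition hat :: "(nat set set => int) => nat set set => int" where
 "hat \<phi> T = (\<Sum>S\<in>Pow T. (-1) ^ card S * \<phi> S)"

text \<open>\<open>Q\<close> need not be symmetric: an edge is present as soon as one of its
  orientations satisfies \<open>Q\<close>.\<close>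

definition gE :: "nat => (nat => nat => bool) => nat set set" where
 "gE k Q = {{u, v} | u v. u < k \<and> v < k \<and> u ~= v \<and> Q u v}"

lemma gE_pairs: "gE k Q \<subseteq> pairs k" by (auto simp: gE_def pairs_def)

lemma finite_pairs: "finite (pairs k)"
 by (rule finite_subset[of _ "Pow {..<k}"]) (auto simp: pairs_def)

lemma gE_top: "gE k (%u v. True) = pairs k"
proof
 show "pairs k \<subseteq> gE k (%u v. True)"
 proof
  fix e assume "e \<in> pairs k"
  then obtain u v where "e = {u, v}" "u ~= v" "e \<subseteq> {..<k}" by (auto simp: pairs_def card_2_iff)
  then show "e \<in> gE k (%u v. True)" by (auto simp: gE_def)
 qed
qed (rule gE_pairs)

lemma gE_embed:
 assumes "inj_on h {..<k}" "h ` {..<k} \<subseteq> {..<k}"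
  "!!u v. u < k ==> v < k ==> u ~= v ==> Q u v ==> Q' (h u) (h v) \<or> Q' (h v) (h u)"
 shows "(`) h ` gE k Q \<subseteq> gE k Q'"
proof
 fix e assume "e \<in> (`) h ` gE k Q"
 then obtain u v where uv: "u < k" "v < k" "u ~= v" "Q u v" "e = {h u, h v}" by (auto simp: gE_def)
 then have "h u < k" "h v < k" "h u ~= h v" using assms(1,2) by (auto dest: inj_onD)
 moreover have "e = {h v, h u}" using uv(5) by auto
 ultimately show "e \<in> gE k Q'" using assms(3)[OF uv(1-4)] uv(5) unfolding gE_def mem_Collect_eq by metis
qed

text \<open>The parameter restricted to graphs with vertex set \<open>{..<k}\<close>, as an integer
  function of the edge set. As in \<open>edge_monotone\<close>, more edges mean a smaller
  value.\<close>

locale edge_param =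
 fixes k :: nat and \<phi> :: "nat set set => int" and c :: nat
 assumes iso: "!!f E. bij_betw f {..<k} {..<k} ==> E \<subseteq> pairs k ==> \<phi> ((`) f ` E) = \<phi> E"
  and mono: "!!E F. E \<subseteq> F ==> F \<subseteq> pairs k ==> \<phi> F \<le> \<phi> E"
  and range: "!!E. E \<subseteq> pairs k ==> 0 \<le> \<phi> E \<and> \<phi> E \<le> int c"
begin

lemma image_inj:
 assumes "bij_betw f {..<k} {..<k}" shows "inj_on ((`) f) (pairs k)"
proof (rule inj_onI)
 fix e e' assume "e \<in> pairs k" "e' \<in> pairs k" "f ` e = f ` e'"
 then show "e = e'" using assms inj_on_image_eq_iff[of f "{..<k}" e e'] by (auto simp: bij_betw_def pairs_def)
qed

lemma image_pairs:
 assumes "bij_betw f {..<k} {..<k}" "E \<subseteq> pairs k" shows "(`) f ` E \<subseteq> pairs k"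
proof
 fix e assume "e \<in> (`) f ` E"
 then obtain d where d: "d \<in> E" "e = f ` d" by blast
 then have "d \<subseteq> {..<k}" "card d = 2" using assms by (auto simp: pairs_def)
 moreover from this have "card (f ` d) = 2" using assms(1) by (metis bij_betw_def card_image inj_on_subset)
 ultimately show "e \<in> pairs k" using d assms(1) by (auto simp: pairs_def bij_betw_def)
qed

lemma hat_iso:
 assumes f: "bij_betw f {..<k} {..<k}" and T: "T \<subseteq> pairs k"
 shows "hat \<phi> ((`) f ` T) = hat \<phi> T"
proof -
 have inj: "inj_on ((`) f) T" by (rule inj_on_subset[OF image_inj[OF f] T])
 have "bij_betw ((`) ((`) f)) (Pow T) (Pow ((`) f ` T))"
  by (rule bij_betw_Pow) (use inj in \<open>simp add: bij_betw_def\<close>)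
 then have "hat \<phi> ((`) f ` T) = (\<Sum>S\<in>Pow T. (-1) ^ card ((`) f ` S) * \<phi> ((`) f ` S))"
  unfolding hat_def by (rule sum.reindex_bij_betw[symmetric])
 also have "\<dots> = (\<Sum>S\<in>Pow T. (-1) ^ card S * \<phi> S)"
 proof (rule sum.cong)
  fix S assume "S \<in> Pow T"
  then show "(-1) ^ card ((`) f ` S) * \<phi> ((`) f ` S) = (-1) ^ card S * \<phi> S"
   using iso[OF f, of S] T card_image[OF inj_on_subset[OF inj, of S]] by auto
 qed simp
 finally show ?thesis by (simp add: hat_def)
qed

lemma moebius: "finite E ==> \<phi> E = (\<Sum>T\<in>Pow E. (-1) ^ card T * hat \<phi> T)"
 by (rule inclusion_exclusion_symmetric) (auto simp: hat_def)

text \<open>\<open>\<phi> Y - \<phi> X\<close> is the signed sum of \<open>hat\<close> over the sets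
  contained in \<open>Y\<close> but not in \<open>X\<close>. Discarding, for one rotation after
  another, the sets not fixed by its \<open>2 ^ j\<close>-th power changes the sum by multiples of
  \<open>2 ^ Suc j\<close> only. A nonzero number of absolute value at most \<open>c\<close> is no
  such multiple, so the sum over the fixed sets cannot vanish.\<close>

lemma hat_nonzero_fixed:
 fixes r j m :: nat and \<rho> :: "nat => nat => nat"
 assumes XY: "X \<subseteq> Y" "Y \<subseteq> pairs k" "\<phi> X ~= \<phi> Y" and c: "c < 2 ^ Suc j"
  and rot: "!!b. b < r ==> bij_betw (\<rho> b) {..<k} {..<k}"
  and ord: "!!b u. b < r ==> u < k ==> (\<rho> b ^^ (2 ^ m)) u = u"
  and comm: "!!a b u. a < r ==> b < r ==> u < k ==> \<rho> a (\<rho> b u) = \<rho> b (\<rho> a u)"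
  and inv: "!!b. b < r ==> (`) (\<rho> b) ` X = X" "!!b. b < r ==> (`) (\<rho> b) ` Y = Y"
 shows "\<exists>T \<subseteq> Y. \<not> T \<subseteq> X \<and> hat \<phi> T ~= 0 \<and> (\<forall>b<r. \<forall>e\<in>T. (\<rho> b ^^ (2 ^ j)) ` e \<in> T)"
proof -
 define R where "R b T = (`) (\<rho> b) ` T" for b T
 define w where "w T = (-1) ^ card T * hat \<phi> T" for T
 \<comment> \<open>\<open>XX b\<close> keeps the sets fixed by the powers of the first
   \<open>b\<close> rotations; \<open>XX 0\<close> imposes no symmetry.\<close>
 define XX where "XX b = {T. T \<subseteq> Y \<and> \<not> T \<subseteq> X \<and> (\<forall>a<b. (R a ^^ (2 ^ j)) T = T)}" for b
 have fin: "finite Y" "finite X" using XY finite_subset[OF _ finite_pairs] by (meson subset_trans)+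
 have finX: "finite (XX b)" for b by (rule finite_subset[of _ "Pow Y"]) (auto simp: XX_def fin)
 have Rpow: "(R b ^^ n) T = (`) (\<rho> b ^^ n) ` T" for b n T
 proof (induction n)
  case (Suc n)
  have "(R b ^^ Suc n) T = R b ((R b ^^ n) T)" by simp
  also have "\<dots> = (`) (\<rho> b) ` (`) (\<rho> b ^^ n) ` T" unfolding Suc by (simp add: R_def)
  also have "\<dots> = (`) (\<rho> b ^^ Suc n) ` T" by (simp add: image_image image_comp o_def)
  finally show ?case .
 qed (simp add: image_def)
 have Rinj: "inj_on (R b) (Pow Y)" if "b < r" for b
  unfolding R_def using inj_on_image_Pow[OF inj_on_subset[OF image_inj[OF rot[OF that]] XY(2)]] .
 have Rcomm: "R a (R b T) = R b (R a T)" if "a < r" "b < r" "T \<subseteq> Y" for a b T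
 proof -
  have "\<rho> a ` \<rho> b ` e = \<rho> b ` \<rho> a ` e" if "e \<in> T" for e
  proof -
   have "!!u. u \<in> e ==> u < k" using that \<open>T \<subseteq> Y\<close> XY(2) by (auto simp: pairs_def)
   then show ?thesis using comm[OF \<open>a < r\<close> \<open>b < r\<close>] by (simp add: image_image cong: image_cong)
  qed
  then show ?thesis unfolding R_def by (simp add: image_image cong: image_cong)
 qed
 have Ysub: "R b T \<subseteq> Y" if "b < r" "T \<subseteq> Y" for b T unfolding R_def using inv(2)[OF that(1)] that(2) by blast
 have Rcommpow: "(R a ^^ n) (R b T) = R b ((R a ^^ n) T) \<and> (R a ^^ n) T \<subseteq> Y" if "a < r" "b < r" "T \<subseteq> Y" for a b n T
  using that by (induction n) (auto simp: Rcomm Ysub)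
 have step: "2 ^ Suc j dvd sum w (XX b) - sum w (XX (Suc b))" if b: "b < r" for b
 proof -
  have "2 ^ Suc j dvd (\<Sum>T | T \<in> XX b \<and> (R b ^^ (2 ^ j)) T ~= T. w T)"
  proof (rule sum_not_fixed_dvd[where m = m])
   \<comment> \<open>Commutation keeps a set fixed by the earlier rotations; invariance of
     \<open>X\<close> and \<open>Y\<close> keeps it inside \<open>Y\<close> and not inside
     \<open>X\<close>.\<close>
   show "R b ` XX b \<subseteq> XX b"
   proof
    fix S assume "S \<in> R b ` XX b"
    then obtain T where T: "T \<subseteq> Y" "\<not> T \<subseteq> X" "!!a. a < b ==> (R a ^^ (2 ^ j)) T = T" "S = R b T" by (auto simp: XX_def)
    have "\<not> R b T \<subseteq> X"
    proof
     assume "R b T \<subseteq> X"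
     then have "(`) (\<rho> b) ` T \<subseteq> (`) (\<rho> b) ` X" using inv(1)[OF b] by (simp add: R_def)
     have "T \<subseteq> X"
     proof
      fix e assume e: "e \<in> T"
      with \<open>(`) (\<rho> b) ` T \<subseteq> (`) (\<rho> b) ` X\<close> obtain e' where "e' \<in> X" "\<rho> b ` e = \<rho> b ` e'" by blast
      then show "e \<in> X" using inj_onD[OF image_inj[OF rot[OF b]], of e e'] e T(1) XY(1,2) by blast
     qed
     then show False using T(2) by blast
    qed
    moreover have "(R a ^^ (2 ^ j)) S = S" if "a < b" for a
     using Rcommpow[of a b T "2 ^ j"] T that b by simp
    ultimately show "S \<in> XX b" using Ysub[OF b T(1)] T(4) by (auto simp: XX_def)
   qed
   show "inj_on (R b) (XX b)" by (rule inj_on_subset[OF Rinj[OF b]]) (auto simp: XX_def)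
   fix T assume "T \<in> XX b"
   then have TY: "T \<subseteq> pairs k" "T \<subseteq> Y" using XY by (auto simp: XX_def)
   show "w (R b T) = w T" unfolding w_def R_def
    using hat_iso[OF rot[OF b] TY(1)] card_image[OF inj_on_subset[OF image_inj[OF rot[OF b]] TY(1)]] by simp
   have "(\<rho> b ^^ (2 ^ m)) ` e = e" if "e \<in> T" for e
    using ord[OF b] that TY by (auto simp: pairs_def image_def subset_iff)
   then show "(R b ^^ (2 ^ m)) T = T" unfolding Rpow by (simp add: image_def)
  qed (rule finX)
  moreover have "sum w (XX b) = (\<Sum>T | T \<in> XX b \<and> (R b ^^ (2 ^ j)) T ~= T. w T) + sum w (XX (Suc b))"
  proof -
   have e: "XX (Suc b) = {T \<in> XX b. (R b ^^ (2 ^ j)) T = T}"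
    unfolding XX_def less_Suc_eq by blast
   then have "XX b = {T. T \<in> XX b \<and> (R b ^^ (2 ^ j)) T ~= T} \<union> XX (Suc b)" by blast
   then have "sum w (XX b) = sum w ({T. T \<in> XX b \<and> (R b ^^ (2 ^ j)) T ~= T} \<union> XX (Suc b))" by simp
   also have "\<dots> = sum w {T. T \<in> XX b \<and> (R b ^^ (2 ^ j)) T ~= T} + sum w (XX (Suc b))"
    by (rule sum.union_disjoint) (use finite_subset[OF _ finX[of b]] e in auto)
   finally show ?thesis .
  qed
  ultimately show ?thesis by simp
 qed
 have "b \<le> r ==> 2 ^ Suc j dvd sum w (XX 0) - sum w (XX b)" for b
 proof (induction b)
  case (Suc b)
  have "sum w (XX 0) - sum w (XX (Suc b)) = (sum w (XX 0) - sum w (XX b)) + (sum w (XX b) - sum w (XX (Suc b)))" by simp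
  then show ?case using Suc step[of b] by (metis dvd_add Suc_leD Suc_le_lessD)
 qed simp
 then have dvd: "2 ^ Suc j dvd sum w (XX 0) - sum w (XX r)" by simp
 have "\<phi> Y - \<phi> X = sum w (XX 0)"
 proof -
  have "Pow Y = Pow X \<union> XX 0" using XY(1) by (auto simp: XX_def)
  then have "sum w (Pow Y) = sum w (Pow X) + sum w (XX 0)"
   using sum.union_disjoint[of "Pow X" "XX 0" w] finX fin by (auto simp: XX_def)
  then show ?thesis using moebius[OF fin(1)] moebius[OF fin(2)] by (simp add: w_def)
 qed
 moreover have "\<not> 2 ^ Suc j dvd \<phi> Y - \<phi> X"
 proof
  assume "2 ^ Suc j dvd \<phi> Y - \<phi> X"
  then have "\<bar>2 ^ Suc j\<bar> \<le> \<bar>\<phi> Y - \<phi> X\<bar>" using XY(3) by (intro dvd_imp_le_int) auto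
  moreover have "\<bar>\<phi> Y - \<phi> X\<bar> \<le> int c" using range[OF subset_trans[OF XY(1,2)]] range[OF XY(2)] by linarith
  moreover have "int c < 2 ^ Suc j" using c by (metis of_nat_less_iff of_nat_numeral of_nat_power)
  ultimately show False by simp
 qed
 ultimately have "sum w (XX r) ~= 0" using dvd by auto
 then obtain T where T: "T \<in> XX r" "w T ~= 0" by (meson sum.neutral)
 have "(\<rho> b ^^ (2 ^ j)) ` e \<in> T" if "b < r" "e \<in> T" for b e
 proof -
  have "(R b ^^ (2 ^ j)) T = T" using T(1) that by (auto simp: XX_def)
  then show ?thesis using that(2) unfolding Rpow by blast
 qed
 then show ?thesis using T by (intro exI[of _ T]) (auto simp: XX_def w_def)
qed

end

text \<open>There are \<open>r\<close> blocks of \<open>2 ^ m\<close> consecutive vertices, and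
  fewer vertices than one block are left over. Four blocks are what makes the relabelling
  \<open>lab\<close> halve the width of a circulant graph; \<open>c < 2 ^ Suc j\<close> makes
  \<open>2 ^ Suc j\<close> a usable modulus.\<close>

locale blocks = edge_param +
 fixes r m j :: nat
 assumes r4: "4 \<le> r" and rk: "r * 2 ^ m \<le> k" and kr: "k < r * 2 ^ m + 2 ^ m"
  and jm: "j \<le> m" and cj: "c < 2 ^ Suc j" and nontriv: "\<phi> {} ~= \<phi> (pairs k)"
begin

definition s :: nat where "s = 2 ^ m"

definition cross :: "nat => nat => bool" where
 "cross u v \<longleftrightarrow> u < r * s \<and> v < r * s \<and> u div s ~= v div s"

definition rot :: "nat => nat => nat" where
 "rot b u = (if u < r * s \<and> u div s = b then b * s + (u mod s + 1) mod s else u)"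

lemma s_pos: "0 < s" by (simp add: s_def)
lemma rsk: "r * s \<le> k" "k < r * s + s" using rk kr by (auto simp: s_def)

lemma blk_pos: assumes "b < r" "x < s" shows "b * s + x < r * s" "(b * s + x) div s = b" "(b * s + x) mod s = x"
proof -
 have "b * s + x < (b + 1) * s" using assms by simp
 also have "\<dots> \<le> r * s" using assms by (intro mult_right_mono) auto
 finally show "b * s + x < r * s" .
qed (use assms in auto)

lemma blk_less: "u < r * s ==> u div s < r"
 by (simp add: less_mult_imp_div_less)

lemma rot_pow: "(rot b ^^ i) u = (if u < r * s \<and> u div s = b then b * s + (u mod s + i) mod s else u)"
proof (induction i)
 case 0
 have "u div s * s + u mod s = u" by simp
 then show ?case by auto
next
 case (Suc i)
 show ?case
 proof (cases "u < r * s \<and> u div s = b")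
  case True
  then have "b < r" using blk_less by auto
  note bp = blk_pos[OF this mod_less_divisor[OF s_pos], of "u mod s + i"]
  have "(rot b ^^ Suc i) u = rot b (b * s + (u mod s + i) mod s)" using Suc True by simp
  also have "\<dots> = b * s + ((u mod s + i) mod s + 1) mod s" using bp by (simp add: rot_def)
  also have "\<dots> = b * s + (u mod s + Suc i) mod s" by (simp add: mod_Suc_eq)
  finally show ?thesis using True by simp
 next
  case False
  then show ?thesis using Suc by (auto simp: rot_def)
 qed
qed

lemma rot_facts:
 assumes "b < r"
 shows "rot b u < r * s \<longleftrightarrow> u < r * s" "rot b u div s = u div s"
  "rot b u mod s = (if u < r * s \<and> u div s = b then (u mod s + 1) mod s else u mod s)"
 using blk_pos[OF assms mod_less_divisor[OF s_pos], of "u mod s + 1"] by (auto simp: rot_def)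

lemma rot_k: assumes "b < r" "u < k" shows "rot b u < k"
 using rot_facts(1)[OF assms(1), of u] assms(2) rsk by (cases "u < r * s") (auto simp: rot_def)

lemma Suc_mod_inj: assumes "x < n" "y < n" "(x + 1) mod n = (y + 1) mod n" shows "x = (y::nat)"
 using assms by (auto simp: mod_Suc split: if_splits)

lemma rot_inj: assumes "b < r" shows "inj (rot b)"
proof (rule injI)
 fix u v assume e: "rot b u = rot b v"
 have d: "u div s = v div s" using rot_facts(2)[OF assms] e by metis
 have i: "u < r * s \<longleftrightarrow> v < r * s" using rot_facts(1)[OF assms] e by metis
 have "u mod s = v mod s"
 proof (cases "u < r * s \<and> u div s = b")
  case True
  then have "(u mod s + 1) mod s = (v mod s + 1) mod s" using rot_facts(3)[OF assms] e d i by metis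
  then show ?thesis by (rule Suc_mod_inj[OF mod_less_divisor[OF s_pos] mod_less_divisor[OF s_pos]])
 next
  case False
  then show ?thesis using e d i by (auto simp: rot_def)
 qed
 with d show "u = v" by (metis div_mult_mod_eq)
qed

lemma rot_bij: assumes "b < r" shows "bij_betw (rot b) {..<k} {..<k}"
proof -
 have "inj_on (rot b) {..<k}" using rot_inj[OF assms] by (rule inj_on_subset) simp
 moreover have "rot b ` {..<k} \<subseteq> {..<k}" using rot_k[OF assms] by auto
 ultimately show ?thesis by (simp add: bij_betw_def endo_inj_surj)
qed

definition rinv :: "(nat => nat => bool) => bool" where
 "rinv Q \<longleftrightarrow> (\<forall>b<r. \<forall>u v. Q u v --> Q (rot b u) (rot b v))"

lemma rinv_gE: assumes "rinv Q" "b < r" shows "(`) (rot b) ` gE k Q = gE k Q"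
proof (rule card_subset_eq)
 show "finite (gE k Q)" by (rule finite_subset[OF gE_pairs finite_pairs])
 show "(`) (rot b) ` gE k Q \<subseteq> gE k Q"
  by (rule gE_embed) (use rot_bij[OF assms(2)] assms in \<open>auto simp: bij_betw_def rinv_def\<close>)
 show "card ((`) (rot b) ` gE k Q) = card (gE k Q)"
  by (rule card_image[OF inj_on_subset[OF image_inj[OF rot_bij[OF assms(2)]] gE_pairs]])
qed

definition biclique :: "nat set set => bool" where
 "biclique T \<longleftrightarrow> (\<exists>P Q. P \<subseteq> {..<k} \<and> Q \<subseteq> {..<k} \<and> P \<inter> Q = {} \<and> card P = 2 ^ (m - j) \<and>
   card Q = 2 ^ (m - j) \<and> (\<forall>p\<in>P. \<forall>q\<in>Q. {p, q} \<in> T))"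

text \<open>Under the \<open>2 ^ j\<close>-th power of the rotation of its block, a vertex runs
  through a coset of the subgroup of order \<open>2 ^ (m - j)\<close> in the integers modulo
  \<open>s\<close>.\<close>

lemma coset_card: "card ((%i. a * s + (x + 2 ^ j * i) mod s) ` {..<2 ^ (m - j)}) = 2 ^ (m - j)"
proof -
 have "inj_on (%i. a * s + (x + 2 ^ j * i) mod s) {..<2 ^ (m - j)}"
 proof (rule linorder_inj_onI)
  fix i l assume il: "i < l" "i \<in> {..<(2::nat) ^ (m - j)}" "l \<in> {..<(2::nat) ^ (m - j)}"
  show "a * s + (x + 2 ^ j * i) mod s ~= a * s + (x + 2 ^ j * l) mod s"
  proof
   assume "a * s + (x + 2 ^ j * i) mod s = a * s + (x + 2 ^ j * l) mod s"
   then have "(x + 2 ^ j * l) mod s = (x + 2 ^ j * i) mod s" by simp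
   then have "s dvd (x + 2 ^ j * l) - (x + 2 ^ j * i)" using il(1) by (subst mod_eq_dvd_iff_nat[symmetric]) auto
   then have "s dvd 2 ^ j * (l - i)" by (simp add: diff_mult_distrib2)
   moreover have "s = 2 ^ j * 2 ^ (m - j)" using jm by (simp add: s_def flip: power_add)
   ultimately have "2 ^ (m - j) dvd l - i" by simp
   then have "2 ^ (m - j) \<le> l - i" using il(1) by (intro dvd_imp_le) auto
   then show False using il by auto
  qed
 qed auto
 then show ?thesis by (simp add: card_image)
qed

text \<open>The set \<open>T\<close> supplied by \<open>hat_nonzero_fixed\<close> contains an edge
  outside the graph of \<open>Q\<close>, hence an edge between two blocks \<open>a\<close> and
  \<open>b\<close>. It is closed under the powers of both rotations, and these move the two
  endpoints independently, so \<open>T\<close> contains every edge between the orbits of the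
  endpoints.\<close>

lemma from_good:
 assumes Q: "rinv Q" "\<phi> (gE k Q) ~= \<phi> (gE k (%u v. Q u v \<or> cross u v))"
 shows "\<exists>T \<subseteq> pairs k. hat \<phi> T ~= 0 \<and> biclique T"
proof -
 let ?X = "gE k Q" and ?Y = "gE k (%u v. Q u v \<or> cross u v)"
 have ci: "rinv (%u v. Q u v \<or> cross u v)" using Q(1) by (auto simp: rinv_def cross_def rot_facts)
 have "\<exists>T \<subseteq> ?Y. \<not> T \<subseteq> ?X \<and> hat \<phi> T ~= 0 \<and> (\<forall>b<r. \<forall>e\<in>T. (rot b ^^ (2 ^ j)) ` e \<in> T)"
 proof (rule hat_nonzero_fixed[where m = m])
  show "?X \<subseteq> ?Y" by (auto simp: gE_def)
  show "(rot b ^^ (2 ^ m)) u = u" if "b < r" "u < k" for b u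
   unfolding rot_pow by (auto simp: s_def div_mult_mod_eq)
  show "rot a (rot b u) = rot b (rot a u)" if "a < r" "b < r" "u < k" for a b u
  proof (cases "a = b")
   case False
   show ?thesis
    by (cases "u div s = a"; cases "u div s = b")
     (use False rot_facts[OF that(1), of u] rot_facts[OF that(2), of u] in \<open>auto simp: rot_def[of a] rot_def[of b]\<close>)
  qed simp
 qed (use Q ci cj gE_pairs rot_bij rinv_gE in auto)
 then obtain T where T: "T \<subseteq> ?Y" "\<not> T \<subseteq> ?X" "hat \<phi> T ~= 0" and cl: "!!b e. b < r ==> e \<in> T ==> (rot b ^^ (2 ^ j)) ` e \<in> T"
  by blast
 then obtain e where e: "e \<in> T" "e \<notin> ?X" "e \<in> ?Y" by blast
 then obtain u v where uv': "e = {u, v}" "u < k" "v < k" "u ~= v" "Q u v \<or> cross u v" unfolding gE_def by blast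
 moreover have "\<not> Q u v" using e(2) uv' unfolding gE_def by blast
 ultimately have uv: "{u, v} \<in> T" "cross u v" "u < k" "v < k" using e by auto
 define a b x y where "a = u div s" "b = v div s" "x = u mod s" "y = v mod s"
 have ab: "a ~= b" "a < r" "b < r" "u < r * s" "v < r * s" using uv(2) blk_less by (auto simp: cross_def a_b_x_y_def)
 have xy: "u = a * s + x mod s" "v = b * s + y mod s" by (simp_all add: a_b_x_y_def)
 \<comment> \<open>Rotating block \<open>a\<close> moves the first endpoint and fixes
   \<open>v\<close>, which lies in another block.\<close>
 have P: "{a * s + (x + 2 ^ j * i) mod s, v} \<in> T" for i
 proof (induction i)
  case 0
  then show ?case using uv(1) xy by simp
 next
  case (Suc i)
  let ?u = "a * s + (x + 2 ^ j * i) mod s"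
  note bp = blk_pos[OF ab(2) mod_less_divisor[OF s_pos], of "x + 2 ^ j * i"]
  have "(rot a ^^ (2 ^ j)) ?u = a * s + ((x + 2 ^ j * i) mod s + 2 ^ j) mod s" unfolding rot_pow using bp by simp
  also have "\<dots> = a * s + (x + 2 ^ j * Suc i) mod s"
   using mod_add_left_eq[of "x + 2 ^ j * i" s "2 ^ j"] by (simp add: add_ac)
  finally have 1: "(rot a ^^ (2 ^ j)) ?u = a * s + (x + 2 ^ j * Suc i) mod s" .
  have 2: "(rot a ^^ (2 ^ j)) v = v" unfolding rot_pow using ab by (auto simp: a_b_x_y_def)
  from cl[OF ab(2) Suc] show ?case unfolding image_insert image_empty 1 2 .
 qed
 have PQ: "{a * s + (x + 2 ^ j * i) mod s, b * s + (y + 2 ^ j * l) mod s} \<in> T" for i l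
 proof (induction l)
  case 0
  then show ?case using P[of i] xy by simp
 next
  case (Suc l)
  let ?v = "b * s + (y + 2 ^ j * l) mod s"
  let ?u = "a * s + (x + 2 ^ j * i) mod s"
  note bp = blk_pos[OF ab(3) mod_less_divisor[OF s_pos], of "y + 2 ^ j * l"]
  note ap = blk_pos[OF ab(2) mod_less_divisor[OF s_pos], of "x + 2 ^ j * i"]
  have "(rot b ^^ (2 ^ j)) ?v = b * s + ((y + 2 ^ j * l) mod s + 2 ^ j) mod s" unfolding rot_pow using bp by simp
  also have "\<dots> = b * s + (y + 2 ^ j * Suc l) mod s"
   using mod_add_left_eq[of "y + 2 ^ j * l" s "2 ^ j"] by (simp add: add_ac)
  finally have 1: "(rot b ^^ (2 ^ j)) ?v = b * s + (y + 2 ^ j * Suc l) mod s" .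
  have 2: "(rot b ^^ (2 ^ j)) ?u = ?u" unfolding rot_pow using ap ab(1) by simp
  from cl[OF ab(3) Suc] show ?case unfolding image_insert image_empty 1 2 .
 qed
 let ?P = "(%i. a * s + (x + 2 ^ j * i) mod s) ` {..<2 ^ (m - j)}"
 let ?Q = "(%i. b * s + (y + 2 ^ j * i) mod s) ` {..<2 ^ (m - j)}"
 have bpa: "a * s + z mod s < k" "(a * s + z mod s) div s = a" for z
  using blk_pos[OF ab(2) mod_less_divisor[OF s_pos], of z] rsk by auto
 have bpb: "b * s + z mod s < k" "(b * s + z mod s) div s = b" for z
  using blk_pos[OF ab(3) mod_less_divisor[OF s_pos], of z] rsk by auto
 have "?P \<inter> ?Q = {}" using bpa(2) bpb(2) ab(1) by (auto, metis)
 moreover have "?P \<subseteq> {..<k}" "?Q \<subseteq> {..<k}" using bpa(1) bpb(1) by auto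
 moreover have "\<forall>p\<in>?P. \<forall>q\<in>?Q. {p, q} \<in> T" using PQ by auto
 ultimately have "biclique T" unfolding biclique_def
  by (intro exI[of _ ?P] exI[of _ ?Q] conjI coset_card)
 moreover have "T \<subseteq> pairs k" using T(1) gE_pairs by blast
 ultimately show ?thesis using T(3) by blast
qed

text \<open>Cyclic distance less than \<open>w\<close> in the integers modulo \<open>s\<close>,
  written without subtraction.\<close>

definition near :: "nat => nat => nat => bool" where
 "near w x y \<longleftrightarrow> (x < y + w \<and> y < x + w) \<or> s + x < y + w \<or> s + y < x + w"

text \<open>A circulant graph inside each block and, with \<open>z\<close>, also every edge that
  meets a left-over vertex. Width 1 gives no edge inside a block, width \<open>s\<close> gives all
  of them.\<close>

definition Ac :: "nat => bool => nat => nat => bool" where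
 "Ac w z u v \<longleftrightarrow> (u < r * s \<and> v < r * s \<and> u div s = v div s \<and> near w (u mod s) (v mod s))
   \<or> z \<and> \<not> (u < r * s \<and> v < r * s)"

definition Jo :: "nat => bool => nat => nat => bool" where
 "Jo w z u v \<longleftrightarrow> Ac w z u v \<or> cross u v"

lemma near_rot: "x < s ==> y < s ==> near w x y ==> near w ((x + 1) mod s) ((y + 1) mod s)"
 by (auto simp: near_def mod_Suc)

lemma rinv_Ac: "rinv (Ac w z)"
 unfolding rinv_def
proof (intro allI impI)
 fix b u v assume b: "b < r" and a: "Ac w z u v"
 show "Ac w z (rot b u) (rot b v)"
 proof (cases "u < r * s \<and> v < r * s")
  case True
  then have h: "u div s = v div s" "near w (u mod s) (v mod s)" using a by (auto simp: Ac_def)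
  have "near w (rot b u mod s) (rot b v mod s)"
   using h near_rot[of "u mod s" "v mod s" w] True s_pos by (auto simp: rot_facts(3)[OF b])
  then show ?thesis using True h by (simp add: Ac_def rot_facts(1,2)[OF b])
 next
  case False
  then show ?thesis using a by (auto simp: Ac_def rot_facts(1,2)[OF b])
 qed
qed

text \<open>Goes up along the even positions and back down along the odd ones: the cycle is laid
  along a line such that cyclic distance less than \<open>w\<close> becomes linear distance less
  than \<open>2 * w\<close>.\<close>

definition fold :: "nat => nat" where
 "fold x = (if 2 * x < s then 2 * x else 2 * (s - 1 - x) + 1)"

lemma fold_less: "x < s ==> fold x < s" by (auto simp: fold_def)
lemma fold_inj: "x < s ==> y < s ==> fold x = fold y ==> x = y"
 by (auto simp: fold_def split: if_splits; presburger)
lemma fold_near: "x < s ==> y < s ==> near w x y ==> fold x < fold y + 2 * w \<and> fold y < fold x + 2 * w"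
 unfolding fold_def near_def by (simp split: if_splits) linarith

text \<open>After folding, the block vertices are numbered consecutively and dealt to the blocks in
  turn, so two of them share a block only if their numbers agree modulo \<open>r\<close>.\<close>

definition lab :: "nat => nat" where
 "lab u = (if u < r * s then (let l = (u div s) * s + fold (u mod s) in (l mod r) * s + l div r) else u)"

lemma lab_aux: assumes "l < r * s" shows "(l mod r) * s + l div r < r * s" "((l mod r) * s + l div r) div s = l mod r"
 "((l mod r) * s + l div r) mod s = l div r"
proof -
 have "0 < r" using r4 by simp
 moreover have "l div r < s" using assms by (simp add: less_mult_imp_div_less mult.commute)
 ultimately show "(l mod r) * s + l div r < r * s" "((l mod r) * s + l div r) div s = l mod r"
  "((l mod r) * s + l div r) mod s = l div r"
  using blk_pos[of "l mod r" "l div r"] by auto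
qed

lemma lab_l: assumes "u < r * s" shows "(u div s) * s + fold (u mod s) < r * s"
 using blk_pos[OF blk_less[OF assms] fold_less[of "u mod s"]] s_pos by simp

lemma lab_inb: "lab u < r * s \<longleftrightarrow> u < r * s"
 using lab_aux(1)[OF lab_l] by (auto simp: lab_def Let_def)

lemma lab_dm: assumes "u < r * s"
 shows "lab u div s = ((u div s) * s + fold (u mod s)) mod r" "lab u mod s = ((u div s) * s + fold (u mod s)) div r"
 using lab_aux(2,3)[OF lab_l[OF assms]] assms by (simp_all add: lab_def Let_def)

lemma lab_inj: "inj_on lab {..<k}"
proof (rule inj_onI)
 fix u v assume e: "lab u = lab v"
 show "u = v"
 proof (cases "u < r * s")
  case True
  then have v: "v < r * s" using lab_inb e by metis
  let ?l = "%u. (u div s) * s + fold (u mod s)"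
  have "?l u mod r = ?l v mod r" "?l u div r = ?l v div r"
   using e lab_dm[OF True] lab_dm[OF v] by simp_all
  then have l: "?l u = ?l v" by (metis div_mult_mod_eq)
  have "u div s = v div s" using l blk_pos(2)[OF blk_less fold_less] True v s_pos by (metis mod_less_divisor)
  moreover have "fold (u mod s) = fold (v mod s)" using l calculation by simp
  then have "u mod s = v mod s" using fold_inj s_pos by simp
  ultimately show ?thesis by (metis div_mult_mod_eq)
 next
  case False
  then show ?thesis using lab_inb[of u] lab_inb[of v] e by (simp add: lab_def)
 qed
qed

lemma lab_k: "lab ` {..<k} \<subseteq> {..<k}"
proof
 fix v assume "v \<in> lab ` {..<k}"
 then obtain u where u: "u < k" "v = lab u" by auto
 show "v \<in> {..<k}"
 proof (cases "u < r * s")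
  case True
  then have "lab u < r * s" using lab_inb by simp
  then show ?thesis using u rsk by simp
 next
  case False
  then show ?thesis using u by (simp add: lab_def)
 qed
qed

text \<open>Adjacent block vertices of \<open>Ac w z\<close> get numbers less than
  \<open>2 * w\<close> apart. Either they are dealt to different blocks, which is a cross edge, or
  their places inside one block differ by less than \<open>2 * w / r\<close>.\<close>

lemma lab_embed:
 assumes "2 * w \<le> r * w'" "Ac w z u v" shows "Jo w' z (lab u) (lab v)"
proof (cases "u < r * s \<and> v < r * s")
 case True
 then have h: "u div s = v div s" "near w (u mod s) (v mod s)" using assms(2) by (auto simp: Ac_def)
 let ?l = "%u. (u div s) * s + fold (u mod s)"
 have f: "?l u < ?l v + 2 * w" "?l v < ?l u + 2 * w" using fold_near[OF _ _ h(2)] s_pos h(1) by auto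
 have d: "lab u div s = ?l u mod r" "lab v div s = ?l v mod r" "lab u mod s = ?l u div r" "lab v mod s = ?l v div r"
  using lab_dm True by auto
 show ?thesis
 proof (cases "?l u mod r = ?l v mod r")
  case False
  then show ?thesis using d lab_inb True by (simp add: Jo_def cross_def)
 next
  case eq: True
  have r0: "0 < r" using r4 by simp
  have "r * (?l u div r) < r * (?l v div r) + r * w'" "r * (?l v div r) < r * (?l u div r) + r * w'"
   using f eq assms(1) mult_div_mod_eq[of r "?l u"] mult_div_mod_eq[of r "?l v"] by linarith+
  then have "?l u div r < ?l v div r + w'" "?l v div r < ?l u div r + w'"
   unfolding distrib_left[symmetric] using r0 by simp_all
  then show ?thesis using d eq lab_inb True by (simp add: Jo_def Ac_def near_def)
 qed
next
 case False
 then show ?thesis using assms(2) lab_inb by (auto simp: Jo_def Ac_def)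
qed

text \<open>Call a graph bad if it has the value of the complete graph. Without a biclique,
  \<open>from_good\<close> says that an invariant graph is bad if it is so with all cross edges
  added; by monotonicity, every graph that contains a copy of a bad graph is bad. Alternating the
  two leads from the complete graph to the empty one, against nontriviality.\<close>

lemma exists_hat_biclique: "\<exists>T \<subseteq> pairs k. hat \<phi> T ~= 0 \<and> biclique T"
proof (rule ccontr)
 assume neg: "\<not> ?thesis"
 define bad where "bad Q \<longleftrightarrow> \<phi> (gE k Q) = \<phi> (pairs k)" for Q
 have step: "bad Q" if "rinv Q" "bad (%u v. Q u v \<or> cross u v)" for Q
  using from_good[OF that(1)] neg that(2) by (auto simp: bad_def)
 have embed: "bad Q'" if "bad Q" "inj_on h {..<k}" "h ` {..<k} \<subseteq> {..<k}"
  "!!u v. u < k ==> v < k ==> u ~= v ==> Q u v ==> Q' (h u) (h v) \<or> Q' (h v) (h u)" for Q Q' h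
 proof -
  have "(`) h ` gE k Q \<subseteq> gE k Q'" by (rule gE_embed[OF that(2,3)]) (rule that(4))
  then have "\<phi> (gE k Q') \<le> \<phi> ((`) h ` gE k Q)" by (rule mono[OF _ gE_pairs])
  also have "\<dots> = \<phi> (gE k Q)" using that(2,3) by (intro iso gE_pairs) (simp add: bij_betw_def endo_inj_surj)
  finally show ?thesis using that(1) mono[OF gE_pairs order_refl, of Q'] by (simp add: bad_def)
 qed
 have JA: "bad (Ac w z)" if "bad (Jo w z)" for w z
  by (rule step[OF rinv_Ac]) (use that in \<open>simp add: Jo_def[abs_def]\<close>)
 \<comment> \<open>Deleting the cross edges and relabelling replaces the width \<open>w\<close> by
   \<open>(w + 1) div 2\<close>, which is smaller unless \<open>w = 1\<close>.\<close>
 have down: "bad (Ac 1 z)" if "bad (Jo w z)" "1 \<le> w" for w z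
  using that
 proof (induction w rule: less_induct)
  case (less w)
  show ?case
  proof (cases "w = 1")
   case True
   then show ?thesis using JA less by simp
  next
   case False
   let ?w = "(w + 1) div 2"
   have "2 * w \<le> 4 * ?w" by simp
   also have "\<dots> \<le> r * ?w" using r4 by (rule mult_right_mono) simp
   finally have "bad (Jo ?w z)"
    by (intro embed[OF JA[OF less.prems(1)] lab_inj lab_k] disjI1 lab_embed)
   then show ?thesis by (intro less.IH[of ?w]) (use False less.prems in auto)
  qed
 qed
 have allnear: "near s x y" if "x < s" "y < s" for x y using that by (auto simp: near_def)
 have "bad (%u v. True)" by (simp add: bad_def gE_top)
 then have "bad (Jo s True)"
  by (rule embed[of _ "%x. x"]) (auto simp: Jo_def Ac_def cross_def allnear s_pos)
 then have 1: "bad (Ac 1 True)" using down s_pos by simp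
 \<comment> \<open>Now every edge meets one of the fewer than \<open>s\<close> left-over vertices.
   Exchanging these with vertices of block 0 makes every edge meet block 0. The cross edges among
   them can be deleted, and \<open>Xs\<close> is what remains.\<close>
 define Xs where "Xs u v \<longleftrightarrow> u < r * s \<and> u div s = 0 \<and> (v < r * s --> v div s = 0)" for u v
 have Xinv: "rinv Xs" unfolding rinv_def Xs_def by (auto simp: rot_facts)
 have rs2: "2 * s \<le> r * s" using r4 by (intro mult_right_mono) auto
 define N where "N = r * s"
 have NN: "N \<le> k" "k < N + s" "2 * s \<le> N" "0 < s" using rsk rs2 s_pos by (auto simp: N_def)
 have d0: "u div s = 0 \<longleftrightarrow> u < s" for u using s_pos by (auto simp: div_eq_0_iff)
 define h where "h u = (if N \<le> u then u - N else if u < k - N then u + N else u)" for u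
 have "bad (%u v. Xs u v \<or> cross u v)"
 proof (rule embed[OF 1, of h])
  show "inj_on h {..<k}" using NN by (intro inj_onI) (auto simp: h_def split: if_splits)
  show "h ` {..<k} \<subseteq> {..<k}" using NN by (auto simp: h_def)
  fix u v assume uv: "u < k" "v < k" "u ~= v" "Ac 1 True u v"
  have "h u < s \<or> h v < s"
  proof (cases "u < N \<and> v < N")
   case True
   then have "u div s = v div s" "u mod s = v mod s" using uv(4) mod_less_divisor[OF s_pos, of u] mod_less_divisor[OF s_pos, of v]
    by (auto simp: Ac_def near_def N_def)
   then show ?thesis using uv(3) by (metis div_mult_mod_eq)
  next
   case False
   then show ?thesis using uv(1,2) NN by (auto simp: h_def)
  qed
  moreover have "Xs x y \<or> cross x y" if "x < s" for x y
   using that NN by (auto simp: Xs_def cross_def d0 simp flip: N_def)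
  ultimately show "(Xs (h u) (h v) \<or> cross (h u) (h v)) \<or> (Xs (h v) (h u) \<or> cross (h v) (h u))" by blast
 qed
 then have 2: "bad Xs" by (rule step[OF Xinv])
 \<comment> \<open>Exchanging the left-over vertices with vertices of block 1 turns the edges from
   block 0 to left-over vertices into cross edges. No edge meets a left-over vertex any more, so the
   descent can be repeated with \<open>z\<close> false.\<close>
 define h' where "h' u = (if N \<le> u then u - N + s else if s \<le> u \<and> u < k - N + s then u - s + N else u)" for u
 have "bad (Jo s False)"
 proof (rule embed[OF 2, of h'])
  show "inj_on h' {..<k}" using NN by (intro inj_onI) (auto simp: h'_def split: if_splits)
  show "h' ` {..<k} \<subseteq> {..<k}" using NN by (auto simp: h'_def)
  fix u v assume uv: "u < k" "v < k" "u ~= v" "Xs u v"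
  have "u < s" "v < s \<or> N \<le> v" using uv(4) by (auto simp: Xs_def d0 simp flip: N_def)
  then have "h' u < r * s" "h' v < r * s" using NN uv by (auto simp: h'_def simp flip: N_def)
  then show "Jo s False (h' u) (h' v) \<or> Jo s False (h' v) (h' u)"
   by (auto simp: Jo_def Ac_def cross_def allnear s_pos)
 qed
 then have "bad (Ac 1 False)" using down s_pos by simp
 moreover have "gE k (Ac 1 False) = {}"
 proof -
  have "u = v" if "Ac 1 False u v" for u v
  proof -
   have "u div s = v div s" "u mod s = v mod s" using that mod_less_divisor[OF s_pos, of u] mod_less_divisor[OF s_pos, of v]
    by (auto simp: Ac_def near_def)
   then show ?thesis by (metis div_mult_mod_eq)
  qed
  then show ?thesis by (auto simp: gE_def)
 qed
 ultimately show False using nontriv by (simp add: bad_def)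
qed

text \<open>A permutation of the vertices moves the biclique to fixed positions without changing
  \<open>hat\<close>, so that the host graph need not know where it was.\<close>

lemma exists_hat_positions:
 assumes t: "t \<le> 2 ^ (m - j)"
 shows "\<exists>T \<subseteq> pairs k. hat \<phi> T ~= 0 \<and> (\<forall>i<t. \<forall>l<t. {i, t + l} \<in> T)"
proof -
 obtain T P Q where T: "T \<subseteq> pairs k" "hat \<phi> T ~= 0" and PQ: "P \<subseteq> {..<k}" "Q \<subseteq> {..<k}" "P \<inter> Q = {}" "card P = 2 ^ (m - j)"
   "card Q = 2 ^ (m - j)" "\<forall>p\<in>P. \<forall>q\<in>Q. {p, q} \<in> T"
  using exists_hat_biclique unfolding biclique_def by blast
 obtain P' where P': "P' \<subseteq> P" "card P' = t" using obtain_subset_with_card_n[of t P] t PQ by auto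
 obtain Q' where Q': "Q' \<subseteq> Q" "card Q' = t" using obtain_subset_with_card_n[of t Q] t PQ by auto
 have fin: "finite P'" "finite Q'" using P' Q' PQ finite_subset[of _ "{..<k}"] by (meson finite_lessThan subset_trans)+
 have c2: "card (P' \<union> Q') = 2 * t" using P' Q' PQ(3) fin by (subst card_Un_disjoint) auto
 have sub: "P' \<union> Q' \<subseteq> {..<k}" using P' Q' PQ by auto
 then have tk: "2 * t \<le> k" using card_mono[OF finite_lessThan sub] c2 by simp
 obtain f where f: "bij_betw f P' {..<t}" using fin P'(2) by (metis finite_same_card_bij card_lessThan finite_lessThan)
 obtain g where g: "bij_betw g Q' {t..<2 * t}" using finite_same_card_bij[of Q' "{t..<2 * t}"] fin Q'(2) by auto
 have "card ({..<k} - (P' \<union> Q')) = card {2 * t..<k}" using c2 sub fin by (subst card_Diff_subset) auto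
 then obtain l where l: "bij_betw l ({..<k} - (P' \<union> Q')) {2 * t..<k}"
  using finite_same_card_bij[of "{..<k} - (P' \<union> Q')" "{2 * t..<k}"] by auto
 define F where "F u = (if u \<in> P' then f u else if u \<in> Q' then g u else l u)" for u
 have "bij_betw F P' {..<t}" using f by (rule bij_betw_cong[THEN iffD1, rotated]) (auto simp: F_def)
 moreover have "bij_betw F Q' {t..<2 * t}" using g P' Q' PQ(3) by (intro bij_betw_cong[THEN iffD1, OF _ g]) (auto simp: F_def)
 ultimately have "bij_betw F (P' \<union> Q') ({..<t} \<union> {t..<2 * t})" by (rule bij_betw_combine) auto
 moreover have "bij_betw F ({..<k} - (P' \<union> Q')) {2 * t..<k}" by (intro bij_betw_cong[THEN iffD1, OF _ l]) (auto simp: F_def)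
 ultimately have "bij_betw F ((P' \<union> Q') \<union> ({..<k} - (P' \<union> Q'))) (({..<t} \<union> {t..<2 * t}) \<union> {2 * t..<k})"
  by (rule bij_betw_combine) auto
 moreover have "(P' \<union> Q') \<union> ({..<k} - (P' \<union> Q')) = {..<k}" using sub by auto
 moreover have "({..<t} \<union> {t..<2 * t}) \<union> {2 * t..<k} = {..<k}" using tk by auto
 ultimately have F: "bij_betw F {..<k} {..<k}" by simp
 have "{i, t + n} \<in> (`) F ` T" if h: "i < t" "n < t" for i n
 proof -
  have "i \<in> f ` P'" "t + n \<in> g ` Q'" using f g h by (auto simp: bij_betw_def)
  then obtain p q where "p \<in> P'" "f p = i" "q \<in> Q'" "g q = t + n" by auto
  moreover from this have "q \<notin> P'" using P' Q' PQ(3) by blast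
  ultimately have p: "p \<in> P'" "F p = i" and q: "q \<in> Q'" "F q = t + n" by (auto simp: F_def)
  have "{p, q} \<in> T" using PQ(6) P' Q' p q by blast
  moreover have "F ` {p, q} = {i, t + n}" using p q by auto
  ultimately show ?thesis by (metis imageI)
 qed
 then show ?thesis using hat_iso[OF F T(1)] T(2) image_pairs[OF F T(1)] by (intro exI[of _ "(`) F ` T"]) auto
qed

end

section \<open>Sparsification of set systems with members of size at most three\<close>

text \<open>Points stand for literals, the members of \<open>F\<close> for clauses and
  \<open>X\<close> for the set of true literals.\<close>

definition hits :: "'a set => 'a set set => bool" where
 "hits X F \<longleftrightarrow> (\<forall>c\<in>F. c \<inter> X ~= {})"

definition red :: "'a set set => 'a set set" where
 "red F = {c \<in> F. \<forall>c'\<in>F. \<not> c' \<subset> c}"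

definition lev :: "'a set set => nat => 'a set set" where "lev F q = {c \<in> F. card c = q}"

text \<open>The members of a sunflower with heart \<open>h\<close>, heart included; the proper
  petals arise by removing \<open>h\<close>.\<close>

definition petals :: "'a set set => 'a set => nat => 'a set set" where
 "petals F h q = {c \<in> F. card c = q \<and> h \<subseteq> c}"

lemma hits_red: assumes "finite F" "!!c. c \<in> F ==> finite c" shows "hits X (red F) \<longleftrightarrow> hits X F"
proof
 assume h: "hits X (red F)"
 show "hits X F" unfolding hits_def
 proof
  fix c assume "c \<in> F"
  obtain m where m: "m \<in> F" "m \<subseteq> c" "\<forall>b\<in>F. b \<subseteq> m --> m = b"
   using finite_has_minimal2[OF assms(1) \<open>c \<in> F\<close>] by blast
  then have "m \<in> red F" by (auto simp: red_def)
  then show "c \<inter> X ~= {}" using h m(2) by (auto simp: hits_def)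
 qed
qed (auto simp: hits_def red_def)

text \<open>A hitting set that misses the heart must meet every petal outside it. This is the
  branching step.\<close>

lemma hits_branch:
 assumes "hits X F" shows "hits X (insert h F) \<or> hits X ((%c. c - h) ` petals F h q \<union> F)"
proof (cases "h \<inter> X = {}")
 case True
 then have "hits X ((%c. c - h) ` petals F h q \<union> F)" using assms by (fastforce simp: hits_def petals_def)
 then show ?thesis by simp
qed (use assms in \<open>simp add: hits_def\<close>)

locale sparse =
 fixes U :: "'a set" and d :: nat
 assumes finU: "finite U" and d1: "1 \<le> d"
begin

text \<open>The last conjunct bounds the number of two-element sets through a point. Its bound is
  twice the threshold in \<open>flower\<close>: pairs are added only while all these degrees are
  below \<open>d\<close>, and one branching adds at most \<open>d\<close> more at a point.\<close>

definition inv :: "'a set set => bool" where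
 "inv F \<longleftrightarrow> (\<forall>c\<in>F. c \<subseteq> U \<and> 1 \<le> card c \<and> card c \<le> 3) \<and> (\<forall>c\<in>F. \<forall>c'\<in>F. \<not> c' \<subset> c) \<and>
   (\<forall>a. card (petals F {a} 2) \<le> 2 * d)"

text \<open>A potential that every branching lowers. A unit set weighs \<open>4 * d\<close>: this
  pays for the at most \<open>2 * d\<close> two-element sets that it absorbs and leaves a profit of
  \<open>2 * d\<close>.\<close>

definition Psi :: "'a set set => int" where
 "Psi F = 4 * int d * (int (card U) - int (card (lev F 1))) - int (card (lev F 2))"

lemma inv_fin: "inv F ==> finite F"
 by (rule finite_subset[of _ "Pow U"]) (auto simp: inv_def finU)

lemma fin_c: "inv F ==> c \<in> F ==> finite c" using finU finite_subset by (auto simp: inv_def)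

lemma unit_card: assumes "inv F" shows "card (lev F 1) = card {a\<in>U. {a} \<in> F}"
proof -
 have "lev F 1 = (%a. {a}) ` {a\<in>U. {a} \<in> F}" using assms by (auto simp: lev_def inv_def card_1_singleton_iff)
 then show ?thesis by (simp add: card_image)
qed

text \<open>In an antichain the two-element sets avoid all points that form unit sets. Double
  counting with degree at most \<open>2 * d\<close> bounds their number by \<open>d\<close> times
  the number of the other points.\<close>

lemma Psi_nonneg: assumes "inv F" shows "0 \<le> Psi F"
proof -
 let ?V = "{a\<in>U. {a} \<notin> F}"
 have fV: "finite ?V" using finU by simp
 have "2 * card (lev F 2) = (\<Sum>c\<in>lev F 2. card c)" by (simp add: lev_def)
 also have "\<dots> = (\<Sum>c\<in>lev F 2. \<Sum>a\<in>?V. of_bool (a \<in> c))"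
 proof (rule sum.cong)
  fix c assume c: "c \<in> lev F 2"
  have "c \<subseteq> ?V"
  proof
   fix a assume a: "a \<in> c"
   have "{a} ~= c" using c by (auto simp: lev_def)
   then have "{a} \<subset> c" using a by blast
   then show "a \<in> ?V" using assms c a unfolding inv_def lev_def by blast
  qed
  then have "c = ?V \<inter> c" by blast
  then have "card c = card (?V \<inter> c)" by simp
  also have "\<dots> = (\<Sum>a\<in>?V. of_bool (a \<in> c))" using fV by (simp add: sum_of_bool_eq Int_def)
  finally show "card c = (\<Sum>a\<in>?V. of_bool (a \<in> c))" .
 qed simp
 also have "\<dots> = (\<Sum>a\<in>?V. \<Sum>c\<in>lev F 2. of_bool (a \<in> c))" by (rule sum.swap)
 also have "\<dots> = (\<Sum>a\<in>?V. card (petals F {a} 2))"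
 proof (rule sum.cong)
  fix a
  have "finite (lev F 2)" using inv_fin[OF assms] by (simp add: lev_def)
  then have "(\<Sum>c\<in>lev F 2. of_bool (a \<in> c)) = card (lev F 2 \<inter> {c. a \<in> c})" by (simp add: sum_of_bool_eq)
  moreover have "lev F 2 \<inter> {c. a \<in> c} = petals F {a} 2" by (auto simp: lev_def petals_def)
  ultimately show "(\<Sum>c\<in>lev F 2. of_bool (a \<in> c)) = card (petals F {a} 2)" by simp
 qed simp
 also have "\<dots> \<le> (\<Sum>a\<in>?V. 2 * d)" using assms by (intro sum_mono) (auto simp: inv_def)
 finally have "card (lev F 2) \<le> d * card ?V" by (simp add: mult.commute)
 moreover have "card U = card (lev F 1) + card ?V"
 proof -
  have "U = {a\<in>U. {a} \<in> F} \<union> ?V" by blast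
  then have "card U = card ({a\<in>U. {a} \<in> F} \<union> ?V)" by simp
  also have "\<dots> = card {a\<in>U. {a} \<in> F} + card ?V" by (rule card_Un_disjoint) (use finU in auto)
  finally show ?thesis using unit_card[OF assms] by simp
 qed
 moreover have "int (d * card ?V) \<le> 4 * int d * int (card ?V)" by simp
 ultimately show ?thesis unfolding Psi_def by (simp only: of_nat_add) (smt (verit) of_nat_mono)
qed

lemma red_inv_sub:
 assumes "inv F" "!!c. c \<in> N ==> c \<subseteq> U \<and> 1 \<le> card c \<and> card c \<le> 3"
  "!!a. card (petals (red (N \<union> F)) {a} 2) \<le> 2 * d"
 shows "inv (red (N \<union> F))"
 unfolding inv_def
proof (intro conjI ballI allI)
 fix c assume "c \<in> red (N \<union> F)"
 then have c: "c \<in> N \<or> c \<in> F" by (auto simp: red_def)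
 then show "c \<subseteq> U" "1 \<le> card c" "card c \<le> 3" using assms(1,2) by (auto simp: inv_def)
next
 fix c c' assume "c \<in> red (N \<union> F)" "c' \<in> red (N \<union> F)"
 then show "\<not> c' \<subset> c" by (auto simp: red_def)
qed (rule assms(3))

text \<open>New unit sets destroy at most \<open>2 d\<close> two-element sets each, which pays for half of their weight.\<close>

lemma add_units:
 assumes F: "inv F" and P: "finite P" "P \<subseteq> U" "!!p. p \<in> P ==> {p} \<notin> F"
 defines "F' \<equiv> red ((%p. {p}) ` P \<union> F)"
 shows "inv F'" "Psi F' \<le> Psi F - 2 * int d * int (card P)"
proof -
 have ne: "c ~= {}" if "c \<in> F" for c using F that by (auto simp: inv_def)
 have l1: "lev F' 1 = (%p. {p}) ` P \<union> lev F 1"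
  unfolding lev_def F'_def red_def using ne by (auto simp: card_1_singleton_iff psubset_eq subset_singleton_iff)
 have c1: "card (lev F' 1) = card P + card (lev F 1)"
 proof -
  have "card ((%p. {p}) ` P \<union> lev F 1) = card ((%p. {p}) ` P) + card (lev F 1)"
   by (rule card_Un_disjoint) (use P inv_fin[OF F] in \<open>auto simp: lev_def\<close>)
  then show ?thesis using l1 by (simp add: card_image)
 qed
 have sub2: "petals F' h 2 \<subseteq> petals F h 2" for h
  by (auto simp: petals_def F'_def red_def)
 have finp: "finite (petals F h q)" for h q using inv_fin[OF F] by (simp add: petals_def)
 have "lev F 2 \<subseteq> lev F' 2 \<union> (\<Union>p\<in>P. petals F {p} 2)"
 proof
  fix c assume c: "c \<in> lev F 2"
  show "c \<in> lev F' 2 \<union> (\<Union>p\<in>P. petals F {p} 2)"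
  proof (cases "\<exists>p\<in>P. p \<in> c")
   case True
   then show ?thesis using c by (auto simp: lev_def petals_def)
  next
   case False
   have "\<not> c' \<subset> c" if "c' \<in> (%p. {p}) ` P \<union> F" for c'
   proof (cases "c' \<in> F")
    case True
    then show ?thesis using F c by (auto simp: inv_def lev_def)
   next
    case False
    then show ?thesis using that \<open>\<not> (\<exists>p\<in>P. p \<in> c)\<close> by blast
   qed
   then have "c \<in> F'" using c by (simp add: F'_def red_def lev_def)
   then show ?thesis using c by (auto simp: lev_def)
  qed
 qed
 then have "card (lev F 2) \<le> card (lev F' 2 \<union> (\<Union>p\<in>P. petals F {p} 2))"
  by (rule card_mono[rotated]) (use P inv_fin[OF F] finp in \<open>auto simp: lev_def F'_def red_def\<close>)
 also have "\<dots> \<le> card (lev F' 2) + card (\<Union>p\<in>P. petals F {p} 2)" by (rule card_Un_le)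
 also have "card (\<Union>p\<in>P. petals F {p} 2) \<le> (\<Sum>p\<in>P. card (petals F {p} 2))" by (rule card_UN_le[OF P(1)])
 also have "\<dots> \<le> (\<Sum>p\<in>P. 2 * d)" using F by (intro sum_mono) (auto simp: inv_def)
 finally have "card (lev F 2) \<le> card (lev F' 2) + card P * (2 * d)" by simp
 then have "int (card (lev F 2)) \<le> int (card (lev F' 2) + card P * (2 * d))" by (rule of_nat_mono)
 then have "int (card (lev F 2)) \<le> int (card (lev F' 2)) + 2 * int d * int (card P)"
  by (simp add: algebra_simps)
 with c1 show "Psi F' \<le> Psi F - 2 * int d * int (card P)"
  unfolding Psi_def by (simp add: algebra_simps)
 have "card (petals F' {a} 2) \<le> 2 * d" for a
  using card_mono[OF finp sub2, of "{a}"] F unfolding inv_def by (meson le_trans)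
 then show "inv F'" unfolding F'_def using F P by (intro red_inv_sub) auto
qed

text \<open>The new sets are minimal, because nothing in \<open>F\<close> lies properly inside them,
  and they absorb neither unit nor two-element sets. So each of them lowers the potential by
  one.\<close>

lemma add_pairs:
 assumes F: "inv F" and N: "finite N" "N \<inter> F = {}" "!!c. c \<in> N ==> c \<subseteq> U \<and> card c = 2"
  "!!c c'. c \<in> N ==> c' \<in> F ==> \<not> c' \<subset> c"
  "!!a. card (petals F {a} 2) + card {c \<in> N. a \<in> c} \<le> 2 * d"
 defines "F' \<equiv> red (N \<union> F)"
 shows "inv F'" "Psi F' \<le> Psi F - int (card N)"
proof -
 have fN: "finite c" if "c \<in> N \<union> F" for c using that N(3) fin_c[OF F] finU finite_subset by blast
 have lt: "card c < card c'" if "c \<subset> c'" "c' \<in> N \<union> F" for c c' using psubset_card_mono[OF fN] that by blast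
 have l1: "lev F' 1 = lev F 1"
 proof
  show "lev F' 1 \<subseteq> lev F 1" using N(3) by (fastforce simp: lev_def F'_def red_def)
  show "lev F 1 \<subseteq> lev F' 1"
  proof
   fix c assume c: "c \<in> lev F 1"
   have "\<not> c' \<subset> c" if "c' \<in> N \<union> F" for c'
   proof
    assume s: "c' \<subset> c"
    have "c \<in> N \<union> F" using c by (simp add: lev_def)
    then have "card c' < card c" by (rule lt[OF s])
    moreover have "1 \<le> card c'" using that N(3) F by (fastforce simp: inv_def)
    ultimately show False using c by (simp add: lev_def)
   qed
   then show "c \<in> lev F' 1" using c by (auto simp: lev_def F'_def red_def)
  qed
 qed
 have l2: "lev F' 2 = N \<union> lev F 2"
 proof
  show "lev F' 2 \<subseteq> N \<union> lev F 2" by (auto simp: lev_def F'_def red_def)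
  show "N \<union> lev F 2 \<subseteq> lev F' 2"
  proof
   fix c assume c: "c \<in> N \<union> lev F 2"
   then have c2: "card c = 2" "c \<in> N \<union> F" using N(3) by (auto simp: lev_def)
   have "\<not> c' \<subset> c" if "c' \<in> N \<union> F" for c'
   proof
    assume s: "c' \<subset> c"
    then have "card c' < 2" using lt[OF s c2(2)] c2 by simp
    then have "c' \<in> F" using that N(3) by fastforce
    show False
    proof (cases "c \<in> N")
     case True
     then show ?thesis using N(4)[OF True \<open>c' \<in> F\<close>] s by simp
    next
     case False
     then show ?thesis using c F \<open>c' \<in> F\<close> s by (auto simp: inv_def lev_def)
    qed
   qed
   then show "c \<in> lev F' 2" using c c2 by (auto simp: lev_def F'_def red_def)
  qed
 qed
 have "card (lev F' 2) = card N + card (lev F 2)"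
  unfolding l2 by (rule card_Un_disjoint) (use N inv_fin[OF F] in \<open>auto simp: lev_def\<close>)
 then show "Psi F' \<le> Psi F - int (card N)" unfolding Psi_def l1 by simp
 have "card (petals F' {a} 2) \<le> 2 * d" for a
 proof -
  have "petals F' {a} 2 \<subseteq> petals F {a} 2 \<union> {c \<in> N. a \<in> c}" by (auto simp: petals_def F'_def red_def)
  then have "card (petals F' {a} 2) \<le> card (petals F {a} 2 \<union> {c \<in> N. a \<in> c})"
   by (rule card_mono[rotated]) (use N(1) inv_fin[OF F] in \<open>auto simp: petals_def\<close>)
  also have "\<dots> \<le> card (petals F {a} 2) + card {c \<in> N. a \<in> c}" by (rule card_Un_le)
  finally show ?thesis using N(5)[of a] by simp
 qed
 then show "inv F'" unfolding F'_def using F N(3) by (intro red_inv_sub) auto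
qed

text \<open>Three kinds of hearts in order of priority; a later kind presupposes that the earlier
  ones do not occur. The thresholds ensure that adding all petals gains at least
  \<open>2 * d * d\<close>: either \<open>d\<close> unit petals worth \<open>2 * d\<close> each, or
  \<open>2 * d * d\<close> pairs worth 1 each.\<close>

definition flower :: "'a set set => 'a set => nat => bool" where
 "flower F h q \<longleftrightarrow> card h = 1 \<and> q = 2 \<and> d \<le> card (petals F h 2)
   \<or> card h = 2 \<and> q = 3 \<and> d \<le> card (petals F h 3) \<and> (\<forall>a. card (petals F {a} 2) < d)
   \<or> card h = 1 \<and> q = 3 \<and> 2 * d * d \<le> card (petals F h 3) \<and> (\<forall>a. card (petals F {a} 2) < d)
     \<and> (\<forall>x y. x ~= y --> card (petals F {x, y} 3) < d)"

text \<open>Adding the heart gains little and adding the petals gains much. This imbalance is what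
  keeps the branching tree small once \<open>d\<close> is large.\<close>

lemma branch:
 assumes F: "inv F" and fl: "flower F h q"
 defines "L \<equiv> red (insert h F)" and "R \<equiv> red ((%c. c - h) ` petals F h q \<union> F)"
 shows "inv L" "inv R" "Psi L \<le> Psi F - 1" "Psi R \<le> Psi F - 2 * int d * int d"
proof -
 have finp: "finite (petals F g n)" for g n using inv_fin[OF F] by (simp add: petals_def)
 have fc: "finite c" if "c \<in> F" for c using fin_c[OF F that] .
 have anti: "\<not> c' \<subset> c" if "c \<in> F" "c' \<in> F" for c c' using F that by (auto simp: inv_def)
 have FU: "c \<subseteq> U" if "c \<in> F" for c using F that by (auto simp: inv_def)
 have inj: "inj_on (%c. c - h) (petals F h n)" for n by (auto simp: inj_on_def petals_def)
 have petne: "\<exists>c. c \<in> petals F h q"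
 proof -
  have "d \<le> card (petals F h q) \<or> 2 * d * d \<le> card (petals F h q)" using fl unfolding flower_def by auto
  moreover have "0 < 2 * d * d" using d1 by simp
  ultimately have "0 < card (petals F h q)" using d1 by linarith
  then show ?thesis by (metis card.empty ex_in_conv less_numeral_extra(3))
 qed
 then obtain c0 where c0: "c0 \<in> F" "card c0 = q" "h \<subseteq> c0" by (auto simp: petals_def)
 have hq: "card h < q" using fl by (auto simp: flower_def)
 then have hc0: "h \<subset> c0" using c0 by auto
 have hF: "h \<notin> F" using anti[OF c0(1)] hc0 by blast
 have hU: "h \<subseteq> U" using FU[OF c0(1)] c0(3) by blast
 have cd: "card (c - h) = q - card h" if "c \<in> petals F h q" for c
 proof -
  have "finite h" using that fc finite_subset by (auto simp: petals_def)
  then show ?thesis using that by (auto simp: petals_def card_Diff_subset)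
 qed
 have sub: "c - h \<subset> c" if "c \<in> petals F h q" for c
 proof -
  have "h ~= {}" using fl by (auto simp: flower_def)
  then show ?thesis using that by (auto simp: petals_def)
 qed
 have nF: "c - h \<notin> F" if "c \<in> petals F h q" for c using anti[of c "c - h"] sub[OF that] that by (auto simp: petals_def)
 have nsub: "\<not> c' \<subset> c - h" if "c \<in> petals F h q" "c' \<in> F" for c c'
  using anti[of c c'] sub[OF that(1)] that by (auto simp: petals_def)
 have dd: "1 \<le> 2 * int d" using d1 by simp
 have left1: "inv L \<and> Psi L \<le> Psi F - 1" if h1: "card h = 1"
 proof -
  obtain a where a: "h = {a}" using h1 by (auto simp: card_1_singleton_iff)
  have "L = red ((%p. {p}) ` {a} \<union> F)" by (simp add: L_def a)
  then show ?thesis using add_units[OF F, of "{a}"] hU hF a dd by auto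
 qed
 have right1: "inv R \<and> Psi R \<le> Psi F - 2 * int d * int d" if q: "q - card h = 1" "d \<le> card (petals F h q)"
 proof -
  define PP where "PP = \<Union>((%c. c - h) ` petals F h q)"
  have e: "(%c. c - h) ` petals F h q = (%p. {p}) ` PP"
  proof -
   have "\<exists>p. c - h = {p}" if "c \<in> petals F h q" for c using cd[OF that] q(1) by (simp add: card_1_singleton_iff)
   then obtain g where g: "!!c. c \<in> petals F h q ==> c - h = {g c}" by metis
   then have "(%c. c - h) ` petals F h q = (%c. {g c}) ` petals F h q" by (rule image_cong[OF refl])
   then show ?thesis unfolding PP_def by auto
  qed
  have "card PP = card ((%p. {p}) ` PP)" by (simp add: card_image)
  also have "\<dots> = card (petals F h q)" unfolding e[symmetric] by (rule card_image[OF inj])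
  finally have cP: "card PP = card (petals F h q)" .
  have fP: "finite PP" unfolding PP_def
  proof (rule finite_Union)
   show "finite ((%c. c - h) ` petals F h q)" using finp by simp
   show "!!M. M \<in> (%c. c - h) ` petals F h q ==> finite M" using fc by (auto simp: petals_def)
  qed
  have PU: "PP \<subseteq> U" using FU by (auto simp: petals_def PP_def)
  have "{p} \<notin> F" if "p \<in> PP" for p
  proof -
   have "{p} \<in> (%p. {p}) ` PP" using that by (rule imageI)
   then have "{p} \<in> (%c. c - h) ` petals F h q" by (simp only: e)
   then show ?thesis using nF by auto
  qed
  from add_units[OF F fP PU this] have "inv R" "Psi R \<le> Psi F - 2 * int d * int (card PP)" by (simp_all add: R_def e)
  moreover have "2 * int d * int d \<le> 2 * int d * int (card PP)" using q(2) cP by (intro mult_left_mono) auto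
  ultimately show ?thesis by linarith
 qed
 consider (1) "card h = 1" "q = 2" "d \<le> card (petals F h 2)"
  | (2) "card h = 2" "q = 3" "d \<le> card (petals F h 3)" "\<forall>a. card (petals F {a} 2) < d"
  | (3) "card h = 1" "q = 3" "2 * d * d \<le> card (petals F h 3)" "\<forall>a. card (petals F {a} 2) < d"
     "\<forall>x y. x ~= y --> card (petals F {x, y} 3) < d"
  using fl unfolding flower_def by blast
 then have "inv L \<and> inv R \<and> Psi L \<le> Psi F - 1 \<and> Psi R \<le> Psi F - 2 * int d * int d"
 proof cases
  case 1
  then show ?thesis using left1 right1 by simp
 next
  case 2
  have "inv (red ({h} \<union> F)) \<and> Psi (red ({h} \<union> F)) \<le> Psi F - int (card {h})"
  proof (rule conjI; rule add_pairs[OF F])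
   show "!!c c'. c \<in> {h} ==> c' \<in> F ==> \<not> c' \<subset> c" using anti[OF c0(1)] c0(3) by blast
   then show "!!c c'. c \<in> {h} ==> c' \<in> F ==> \<not> c' \<subset> c" .
   show "card (petals F {a} 2) + card {c \<in> {h}. a \<in> c} \<le> 2 * d" for a
   proof -
    have "card {c \<in> {h}. a \<in> c} \<le> card {h}" by (intro card_mono) auto
    then show ?thesis using 2(4)[rule_format, of a] by simp
   qed
   then show "card (petals F {a} 2) + card {c \<in> {h}. a \<in> c} \<le> 2 * d" for a .
  qed (use hF hU 2 in auto)
  then show ?thesis using right1 2 by (simp add: L_def)
 next
  case 3
  obtain a where a: "h = {a}" using 3 by (auto simp: card_1_singleton_iff)
  let ?N = "(%c. c - h) ` petals F h q"
  have cN: "card ?N = card (petals F h q)" by (rule card_image[OF inj])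
  \<comment> \<open>A point \<open>b\<close> other than \<open>a\<close> gains one pair for each
    three-element set containing \<open>a\<close> and \<open>b\<close>, fewer than \<open>d\<close>
    by the last condition on this kind of flower.\<close>
  have deg: "card (petals F {b} 2) + card {c \<in> ?N. b \<in> c} \<le> 2 * d" for b
  proof (cases "b = a")
   case True
   then have e: "{c \<in> ?N. b \<in> c} = {}" using a by auto
   show ?thesis unfolding e using 3(4)[rule_format, of b] by simp
  next
   case False
   have "{c \<in> ?N. b \<in> c} \<subseteq> (%c. c - h) ` petals F {a, b} 3" using a 3(2) by (auto simp: petals_def)
   then have "card {c \<in> ?N. b \<in> c} \<le> card ((%c. c - h) ` petals F {a, b} 3)" by (rule card_mono[rotated]) (simp add: finp)
   also have "\<dots> \<le> card (petals F {a, b} 3)" by (rule card_image_le[OF finp])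
   finally show ?thesis using 3(4)[rule_format, of b] 3(5)[rule_format, of a b] False by simp
  qed
  have N: "finite ?N" "?N \<inter> F = {}" "!!c. c \<in> ?N ==> c \<subseteq> U \<and> card c = 2" "!!c c'. c \<in> ?N ==> c' \<in> F ==> \<not> c' \<subset> c"
  proof -
   show "finite ?N" using finp by simp
   show "?N \<inter> F = {}" using nF by blast
   fix c assume "c \<in> ?N"
   then obtain x where x: "x \<in> petals F h q" "c = x - h" by blast
   then show "c \<subseteq> U \<and> card c = 2" using FU[of x] cd[OF x(1)] 3(1,2) by (auto simp: petals_def)
   show "\<not> c' \<subset> c" if "c' \<in> F" for c' using nsub[OF x(1) that] x(2) by simp
  qed
  have "inv R" "Psi R \<le> Psi F - int (card ?N)" unfolding R_def using add_pairs[OF F N deg] by blast+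
  moreover have "int (2 * d * d) \<le> int (card ?N)" using 3 cN by (simp only: of_nat_le_iff)
  ultimately show ?thesis using left1 3 by simp
 qed
 then show "inv L" "inv R" "Psi L \<le> Psi F - 1" "Psi R \<le> Psi F - 2 * int d * int d" by blast+
qed

text \<open>Without a flower a point lies in at most one unit set, in fewer than \<open>d\<close>
  two-element sets and in fewer than \<open>2 * d * d\<close> three-element sets.\<close>

lemma leaf_card:
 assumes F: "inv F" and nf: "!!h q. \<not> flower F h q"
 shows "card F \<le> card U * (1 + d + 2 * d * d)"
proof -
 have finp: "finite (petals F g n)" for g n using inv_fin[OF F] by (simp add: petals_def)
 have 1: "card (petals F {a} 2) < d" for a using nf[of "{a}" 2] by (auto simp: flower_def)
 have 2: "card (petals F {x, y} 3) < d" if "x ~= y" for x y using nf[of "{x, y}" 3] 1 that by (auto simp: flower_def)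
 have 3: "card (petals F {a} 3) < 2 * d * d" for a using nf[of "{a}" 3] 1 2 by (auto simp: flower_def)
 have "F \<subseteq> (\<Union>a\<in>U. petals F {a} 1 \<union> petals F {a} 2 \<union> petals F {a} 3)"
 proof
  fix c assume c: "c \<in> F"
  then have "c \<subseteq> U" "card c = 1 \<or> card c = 2 \<or> card c = 3" using F by (auto simp: inv_def)
  moreover obtain a where "a \<in> c" using calculation(2) by fastforce
  ultimately show "c \<in> (\<Union>a\<in>U. petals F {a} 1 \<union> petals F {a} 2 \<union> petals F {a} 3)" using c by (auto simp: petals_def)
 qed
 then have "card F \<le> card (\<Union>a\<in>U. petals F {a} 1 \<union> petals F {a} 2 \<union> petals F {a} 3)"
  by (rule card_mono[rotated]) (simp add: finU finp)
 also have "\<dots> \<le> (\<Sum>a\<in>U. card (petals F {a} 1 \<union> petals F {a} 2 \<union> petals F {a} 3))" by (rule card_UN_le[OF finU])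
 also have "\<dots> \<le> (\<Sum>a\<in>U. 1 + d + 2 * d * d)"
 proof (rule sum_mono)
  fix a
  have "petals F {a} 1 \<subseteq> {{a}}" by (auto simp: petals_def card_1_singleton_iff)
  then have "card (petals F {a} 1) \<le> 1" using card_mono[of "{{a}}"] by fastforce
  moreover have "card (petals F {a} 1 \<union> petals F {a} 2 \<union> petals F {a} 3) \<le> card (petals F {a} 1) + card (petals F {a} 2) + card (petals F {a} 3)"
   using card_Un_le[of "petals F {a} 1 \<union> petals F {a} 2"] card_Un_le[of "petals F {a} 1" "petals F {a} 2"] by (meson add_right_mono le_trans)
  ultimately show "card (petals F {a} 1 \<union> petals F {a} 2 \<union> petals F {a} 3) \<le> 1 + d + 2 * d * d"
   using 1[of a] 3[of a] by linarith
 qed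
 finally show ?thesis by simp
qed

end

section \<open>A combinator language on nested pairs and its compilation\<close>

datatype val = A nat | P val val

text \<open>There are no variables: a term maps one value to one value, and everything still needed
  is carried along in pairs.\<close>

datatype fn = Id | Fst | Snd | Pr fn fn | Cmp fn fn | K nat | Plus | Minus | Hf
 | If fn fn fn | Whl fn fn | Ask

primrec lv :: "nat list => val" where
 "lv [] = A 0"
| "lv (a # w) = P (A a) (lv w)"

text \<open>A partial cost semantics: terms applied to values of the wrong shape have no derivation.
  Only words from \<open>V\<close> may be queried, and the length of a query enters the cost, as it
  does on the machine.\<close>

inductive ev :: "(nat list => nat list) => nat list set => fn => val => nat => val => bool"
 for orc V where
 ev_Id: "ev orc V Id x 1 x"
| ev_Fst: "ev orc V Fst (P x y) 1 x"
| ev_Snd: "ev orc V Snd (P x y) 1 y"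
| ev_Pr: "ev orc V f x t1 y ==> ev orc V g x t2 z ==> ev orc V (Pr f g) x (t1 + t2 + 1) (P y z)"
| ev_Cmp: "ev orc V f x t1 y ==> ev orc V g y t2 z ==> ev orc V (Cmp f g) x (t1 + t2 + 1) z"
| ev_K: "ev orc V (K n) x 1 (A n)"
| ev_Plus: "ev orc V Plus (P (A a) (A b)) 1 (A (a + b))"
| ev_Minus: "ev orc V Minus (P (A a) (A b)) 1 (A (a - b))"
| ev_Hf: "ev orc V Hf (A a) 1 (A (a div 2))"
| ev_IfT: "ev orc V c x t1 b ==> b ~= A 0 ==> ev orc V f x t2 y ==>
  ev orc V (If c f g) x (t1 + t2 + 1) y"
| ev_IfF: "ev orc V c x t1 (A 0) ==> ev orc V g x t2 y ==> ev orc V (If c f g) x (t1 + t2 + 1) y"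
| ev_WhF: "ev orc V c x t1 (A 0) ==> ev orc V (Whl c f) x (t1 + 1) x"
| ev_WhT: "ev orc V c x t1 b ==> b ~= A 0 ==> ev orc V f x t2 y ==> ev orc V (Whl c f) y t3 z ==>
  ev orc V (Whl c f) x (t1 + t2 + t3 + 1) z"
| ev_Ask: "w \<in> V ==> orc w = [a, b, c] ==>
  ev orc V Ask (lv w) (length w + 5) (P (A a) (P (A b) (A c)))"

fun blk :: "instr list => prog" where
 "blk [] = Do (Const 4 0)"
| "blk [i] = Do i"
| "blk (i # is) = Seq (Do i) (blk is)"

lemma exec_blk: "is ~= [] ==> exec orc x (blk is) s (fold (do_instr orc x) is s)"
 by (induction "is" arbitrary: s rule: blk.induct) (auto intro: exec.intros)

lemma ex_blkI:
 "is ~= [] ==> Q (fold (do_instr orc x) is s) ==> \<exists>s'. exec orc x (blk is) s s' \<and> Q s'"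
 using exec_blk by blast

text \<open>The code expects its argument in register \<open>d\<close> and leaves the result there.
  Register 3 holds the first free heap address, registers 4 to 7 are scratch, and arguments that are
  needed again stay in registers from 8 upwards while subterms run in higher ones.\<close>

primrec cmpl :: "fn => nat => prog" where
 "cmpl Id d = blk [Const 4 0]"
| "cmpl Fst d = blk [Load d d]"
| "cmpl Snd d = blk [Const 4 1, Add 4 d 4, Load d 4]"
| "cmpl (Pr f g) d = Seq (blk [Const 4 0, Add (d+1) d 4]) (Seq (cmpl f (d+1))
   (Seq (blk [Const 4 0, Add (d+2) d 4]) (Seq (cmpl g (d+2))
    (blk [Store 3 (d+1), Const 4 1, Add 4 3 4, Store 4 (d+2), Const 4 0, Add d 3 4,
       Const 4 2, Add 3 3 4]))))"
| "cmpl (Cmp f g) d = Seq (cmpl f d) (cmpl g d)"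
| "cmpl (K n) d = blk [Const d n]"
| "cmpl Plus d = blk [Load 5 d, Const 4 1, Add 4 d 4, Load 6 4, Add d 5 6]"
| "cmpl Minus d = blk [Load 5 d, Const 4 1, Add 4 d 4, Load 6 4, Sub d 5 6]"
| "cmpl Hf d = blk [Half d d]"
| "cmpl (If c f g) d = Seq (blk [Const 4 0, Add (d+1) d 4])
   (Seq (cmpl c (d+1)) (IfNz (d+1) (cmpl f d) (cmpl g d)))"
| "cmpl (Whl c f) d = Seq (Seq (blk [Const 4 0, Add (d+1) d 4]) (cmpl c (d+1)))
   (WhileNz (d+1) (Seq (cmpl f d) (Seq (blk [Const 4 0, Add (d+1) d 4]) (cmpl c (d+1)))))"
| "cmpl Ask d = Seq (blk [Const 4 0, Add 5 3 4])
   (Seq (WhileNz d (blk [Load 7 d, Store 5 7, Const 7 1, Add 5 5 7, Add 7 d 7, Load d 7]))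
    (blk [Sub 6 5 3, Query 3 6 5, Load 7 5, Const 6 3, Add 6 5 6, Store 6 7, Const 7 1,
       Add 5 5 7, Add 7 6 7, Store 7 5, Const 4 0, Add d 6 4, Const 4 2, Add 3 6 4]))"

text \<open>An upper bound on the number of registers above \<open>d\<close> that the code may
  touch.\<close>

primrec dep :: "fn => nat" where
 "dep Id = 0" | "dep Fst = 0" | "dep Snd = 0"
| "dep (Pr f g) = dep f + dep g + 2"
| "dep (Cmp f g) = dep f + dep g"
| "dep (K n) = 0" | "dep Plus = 0" | "dep Minus = 0" | "dep Hf = 0"
| "dep (If c f g) = dep c + dep f + dep g + 1"
| "dep (Whl c f) = dep c + dep f + 1"
| "dep Ask = 0"

text \<open>Words carry no tag, so the same word may represent a number or, as an address, a pair.
  Pair cells start at \<open>B\<close>; for positive \<open>B\<close> a pair is thus never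
  represented by 0, and whether a value is \<open>A 0\<close> is all that \<open>If\<close> and
  \<open>Whl\<close> test.\<close>

primrec rep :: "(nat => nat) => nat => nat => nat => val => bool" where
 "rep m B h w (A n) \<longleftrightarrow> w = n"
| "rep m B h w (P x y) \<longleftrightarrow> B \<le> w \<and> w + 1 < h \<and> rep m B h (m w) x \<and> rep m B h (m (w + 1)) y"

lemma rep_mono:
 "rep m B h w v ==> h \<le> h' ==> (!!a. B \<le> a ==> a < h ==> m' a = m a) ==> rep m' B h' w v"
 by (induction v arbitrary: w) (auto simp: le_Suc_eq)

lemma rep_nonzero: "rep m B h w v ==> 0 < B ==> w ~= 0 \<longleftrightarrow> v ~= A 0"
 by (cases v) auto

text \<open>Allocated heap cells are never overwritten, and saved registers below \<open>d\<close>
  survive. So an argument put aside still represents the same value after a subterm has run.\<close>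

definition frame :: "nat => nat => config => config => bool" where
 "frame d B s s' \<longleftrightarrow> mem s 3 \<le> mem s' 3 \<and>
   (\<forall>a. a < d \<and> (a < 3 \<or> 8 \<le> a) --> mem s' a = mem s a) \<and>
   (\<forall>a. B \<le> a \<and> a < mem s 3 --> mem s' a = mem s a)"

lemma frame_trans: "frame d B s s' ==> frame d' B s' s'' ==> d \<le> d' ==> frame d B s s''"
 unfolding frame_def by auto

lemma frame_rep: "frame d B s s' ==> rep (mem s) B (mem s 3) w v ==> rep (mem s') B (mem s' 3) w v"
 unfolding frame_def by (erule rep_mono) auto

lemma frame_reg: "frame d B s s' ==> 8 \<le> a ==> a < d ==> mem s' a = mem s a"
 unfolding frame_def by auto

lemma mem_tick [simp]: "mem (tick n s) = mem s" by (simp add: tick_def)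
lemma mem_assign [simp]: "mem (assign r v s) = (mem s)(r := v)" by (simp add: assign_def)
lemma steps_tick [simp]: "steps (tick n s) = steps s + n" by (simp add: tick_def)
lemma steps_assign [simp]: "steps (assign r v s) = steps s" by (simp add: assign_def)
lemma queries_tick [simp]: "queries (tick n s) = queries s" by (simp add: tick_def)
lemma queries_assign [simp]: "queries (assign r v s) = queries s" by (simp add: assign_def)

lemma write_block_apply:
 "write_block a w m i = (if a \<le> i \<and> i < a + length w then w ! (i - a) else m i)"
 by (simp add: write_block_def)

text \<open>The constant 12 is the overhead of \<open>Pr\<close>: two copies of two instructions
  each and eight instructions to build the pair.\<close>

definition runs_fn :: "(nat list => nat list) => nat list set => nat list => nat => nat => prog => nat =>
  config => config => val => bool" where
 "runs_fn orc V inp B d p t s s' y \<longleftrightarrow> exec orc inp p s s' \<and> frame d B s s' \<and>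
   rep (mem s') B (mem s' 3) (mem s' d) y \<and> steps s' \<le> steps s + 12 * t \<and>
   queries s' \<subseteq> queries s \<union> V"

text \<open>A query needs a contiguous word, so the linked list is copied to the free end of the
  heap. The loop stops at the end marker \<open>A 0\<close>, since list cells have nonzero
  addresses.\<close>

lemma exec_copy_loop:
 assumes "rep (mem s) B (mem s 3) (mem s d) (lv w)" "8 \<le> d" "d < B" "B \<le> mem s 3" "mem s 3 \<le> mem s 5"
 shows "\<exists>s'. exec orc inp (WhileNz d (blk [Load 7 d, Store 5 7, Const 7 1, Add 5 5 7, Add 7 d 7, Load d 7])) s s'
   \<and> mem s' 5 = mem s 5 + length w \<and> mem s' 3 = mem s 3
   \<and> (\<forall>i<length w. mem s' (mem s 5 + i) = w ! i)
   \<and> (\<forall>a. a < mem s 5 \<and> a \<notin> {5,7,d} --> mem s' a = mem s a)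
   \<and> steps s' = steps s + 7 * length w + 1 \<and> queries s' = queries s"
 using assms
proof (induction w arbitrary: s)
 case Nil
 then show ?case
  by (intro exI[of _ "tick 1 s"] conjI exec.WhileFalse) auto
next
 case (Cons a w)
 let ?is = "[Load 7 d, Store 5 7, Const 7 1, Add 5 5 7, Add 7 d 7, Load d 7]"
 define s1 where "s1 = fold (do_instr orc inp) ?is (tick 1 s)"
 have h: "B \<le> mem s d" "mem s d + 1 < mem s 3" "mem s (mem s d) = a"
  and r: "rep (mem s) B (mem s 3) (mem s (mem s d + 1)) (lv w)"
  using Cons.prems by auto
 have m1: "mem s1 = (mem s)(mem s 5 := a, 5 := mem s 5 + 1, 7 := mem s d + 1, d := mem s (mem s d + 1))"
  unfolding s1_def using h Cons.prems by (auto simp: fun_eq_iff)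
 have st: "steps s1 = steps s + 7" "queries s1 = queries s"
  unfolding s1_def by auto
 have r1: "rep (mem s1) B (mem s1 3) (mem s1 d) (lv w)"
  using r by (rule rep_mono[THEN back_subst[of "%u. rep (mem s1) B (mem s1 3) u (lv w)"]])
   (use Cons.prems m1 in auto)
 have "mem s1 3 = mem s 3" "mem s1 5 = mem s 5 + 1" using m1 Cons.prems by auto
 with Cons.IH[OF r1] Cons.prems obtain s' where s':
  "exec orc inp (WhileNz d (blk ?is)) s1 s'" "mem s' 5 = mem s1 5 + length w" "mem s' 3 = mem s1 3"
  "\<forall>i<length w. mem s' (mem s1 5 + i) = w ! i"
  "\<forall>a. a < mem s1 5 \<and> a \<notin> {5,7,d} --> mem s' a = mem s1 a"
  "steps s' = steps s1 + 7 * length w + 1" "queries s' = queries s1"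
  by auto
 have "exec orc inp (blk ?is) (tick 1 s) s1"
  unfolding s1_def by (rule exec_blk) simp
 with s'(1) have "exec orc inp (WhileNz d (blk ?is)) s s'"
  using h Cons.prems by (intro exec.WhileTrue[OF _ _ s'(1)]) auto
 moreover have "mem s' (mem s 5) = a" using s'(5) m1 Cons.prems by auto
 ultimately have "\<forall>i<length (a # w). mem s' (mem s 5 + i) = (a # w) ! i"
  using s'(4) m1 Cons.prems by (auto simp: nth_Cons split: nat.split)
 moreover have "\<forall>x. x < mem s 5 \<and> x \<notin> {5,7,d} --> mem s' x = mem s x"
  using s'(5) m1 Cons.prems by auto
 moreover note \<open>exec orc inp (WhileNz d (blk ?is)) s s'\<close>
 ultimately show ?case using s' st m1 Cons.prems by (intro exI[of _ s']) auto
qed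

lemma runs_copy:
 assumes "rep (mem s) B (mem s 3) (mem s d) x" "8 \<le> d" "i > 0" "d + i < B" "B \<le> mem s 3"
 shows "\<exists>s'. exec orc inp (blk [Const 4 0, Add (d+i) d 4]) s s' \<and> frame (d+i) B s s' \<and>
   rep (mem s') B (mem s' 3) (mem s' (d+i)) x \<and> steps s' = steps s + 2 \<and> queries s' = queries s
   \<and> mem s' 3 = mem s 3"
 using assms by (intro ex_blkI) (auto simp: frame_def elim!: rep_mono)

lemma write_block3: "write_block h [a, b, c] m = m(h := a, h + 1 := b, h + 2 := c)"
proof
 fix i
 consider "i < h" | "i = h" | "i = h + 1" | "i = h + 2" | "i \<ge> h + 3" by linarith
 then show "write_block h [a, b, c] m i = (m(h := a, h + 1 := b, h + 2 := c)) i"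
  by cases (auto simp: write_block_def)
qed

lemma runs_Ask:
 assumes w: "w \<in> V" "orc w = [a, b, c]"
  and rs: "rep (mem s) B (mem s 3) (mem s d) (lv w)" "8 \<le> d" "d < B" "B \<le> mem s 3"
 shows "\<exists>s'. runs_fn orc V inp B d (cmpl Ask d) (length w + 5) s s' (P (A a) (P (A b) (A c)))"
proof -
 define s1 where "s1 = fold (do_instr orc inp) [Const 4 0, Add 5 3 4] s"
 have m1: "mem s1 = (mem s)(4 := 0, 5 := mem s 3)" "steps s1 = steps s + 2" "queries s1 = queries s"
  unfolding s1_def by auto
 have "rep (mem s1) B (mem s1 3) (mem s1 d) (lv w)"
  using rs m1 by (auto elim!: rep_mono)
 from exec_copy_loop[OF this, of orc inp] rs m1 obtain s2 where s2:
  "exec orc inp (WhileNz d (blk [Load 7 d, Store 5 7, Const 7 1, Add 5 5 7, Add 7 d 7, Load d 7])) s1 s2"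
  "mem s2 5 = mem s 3 + length w" "mem s2 3 = mem s 3"
  "\<forall>i<length w. mem s2 (mem s 3 + i) = w ! i"
  "\<forall>a. a < mem s 3 \<and> a \<notin> {4,5,7,d} --> mem s2 a = mem s a"
  "steps s2 = steps s + 7 * length w + 3" "queries s2 = queries s"
  by auto
 define h where "h = mem s 3 + length w"
 have big: "8 < mem s 3" "d < mem s 3" "mem s 3 \<le> h" using rs by (auto simp: h_def)
 define s2' where "s2' = do_instr orc inp (Sub 6 5 3) s2"
 have m2': "mem s2' = (mem s2)(6 := length w)" "steps s2' = steps s2 + 1" "queries s2' = queries s2"
  unfolding s2'_def using s2(2,3) by auto
 have wd: "map (mem s2') [mem s2' 3 ..< mem s2' 3 + mem s2' 6] = w"
  using s2(2-4) big by (intro nth_equalityI) (auto simp: m2')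
 define q where "q = do_instr orc inp (Query 3 6 5) s2'"
 have qm: "mem q = (mem s2)(6 := length w, h := a, h + 1 := b, h + 2 := c)"
  "steps q = steps s2 + length w + 5" "queries q = insert w (queries s2)"
  unfolding q_def do_instr.simps wd w Let_def using s2(2) by (auto simp: m2' write_block3 h_def)
 let ?is = "[Load 7 5, Const 6 3, Add 6 5 6, Store 6 7, Const 7 1,
       Add 5 5 7, Add 7 6 7, Store 7 5, Const 4 0, Add d 6 4, Const 4 2, Add 3 6 4]"
 define s3 where "s3 = fold (do_instr orc inp) ?is q"
 have nq: "d ~= 3" "d ~= 4" "d ~= 5" "d ~= 6" "d ~= 7" "d ~= h" "d ~= Suc h" "d ~= Suc (Suc h)"
  "d ~= Suc (Suc (Suc h))" "d ~= Suc (Suc (Suc (Suc h)))" using big rs by auto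
 have nh: "h ~= 3" "h ~= 4" "h ~= 5" "h ~= 6" "h ~= 7" "Suc h ~= 3" "Suc h ~= 4" "Suc h ~= 5" "Suc h ~= 6" "Suc h ~= 7"
   using big by auto
 have q5: "mem q 5 = h" "mem q 3 = mem s 3" "mem q h = a"
  using big by (simp_all add: qm nh nh[symmetric] s2(2,3)[folded h_def])
 define q4 where "q4 = fold (do_instr orc inp) [Load 7 5, Const 6 3, Add 6 5 6, Store 6 7] q"
 have m4: "mem q4 = (mem q)(7 := a, 6 := h + 3, h + 3 := a)" "steps q4 = steps q + 4" "queries q4 = queries q"
  unfolding q4_def using big by (auto simp: q5)
 define q8 where "q8 = fold (do_instr orc inp) [Const 7 1, Add 5 5 7, Add 7 6 7, Store 7 5] q4"
 have m8: "mem q8 = (mem q4)(5 := h + 1, 7 := h + 4, h + 4 := h + 1)" "steps q8 = steps q4 + 4" "queries q8 = queries q4"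
  unfolding q8_def using big by (auto simp: m4 q5)
 have s3q: "s3 = fold (do_instr orc inp) [Const 4 0, Add d 6 4, Const 4 2, Add 3 6 4] q8"
  unfolding s3_def q8_def q4_def by (simp del: do_instr.simps)
 have m3: "mem s3 = (mem q8)(d := h + 3, 4 := 2, 3 := h + 5)" "steps s3 = steps q8 + 4" "queries s3 = queries q8"
  unfolding s3q using big by (simp_all add: m8 m4 nq nq[symmetric] add.commute)
 have fr: "mem s3 x = mem s x" if "x < mem s 3" "x < 3 \<or> 8 \<le> x" "x ~= d" for x
  using that big s2(5) by (auto simp: m3 m8 m4 qm)
 have e: "exec orc inp (cmpl Ask d) s s3"
 proof -
  have "s3 = fold (do_instr orc inp) (Sub 6 5 3 # Query 3 6 5 # ?is) s2"
   unfolding s3_def q_def s2'_def by (simp del: do_instr.simps)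
  then have 3: "exec orc inp (blk (Sub 6 5 3 # Query 3 6 5 # ?is)) s2 s3"
   using exec_blk[of "Sub 6 5 3 # Query 3 6 5 # ?is" orc inp s2] by (simp del: do_instr.simps blk.simps fold_simps)
  have 1: "exec orc inp (blk [Const 4 0, Add 5 3 4]) s s1" unfolding s1_def by (rule exec_blk) simp
  show ?thesis unfolding cmpl.simps by (rule exec.Seq[OF 1 exec.Seq[OF s2(1) 3]])
 qed
 have "mem s 3 \<le> mem s3 3" using big by (simp add: m3)
 then have "frame d B s s3" using big rs fr by (auto simp: frame_def)
 moreover have "rep (mem s3) B (mem s3 3) (mem s3 d) (P (A a) (P (A b) (A c)))"
  using big rs by (simp add: m3 m8 m4 qm nq nh nq[symmetric] nh[symmetric])
 ultimately show ?thesis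
  using e w by (intro exI[of _ s3]) (auto simp: runs_fn_def m3 m8 m4 qm s2)
qed

text \<open>Rule induction on \<open>ev\<close> treats loops like other terms: the remaining
  iterations are covered by an induction hypothesis.\<close>

lemma compile:
 "ev orc V f x t y ==> 8 \<le> d ==> d + dep f < B ==> B \<le> mem s 3 ==>
  rep (mem s) B (mem s 3) (mem s d) x ==> \<exists>s'. runs_fn orc V inp B d (cmpl f d) t s s' y"
proof (induction arbitrary: s d rule: ev.induct)
 case (ev_Id x)
 then show ?case unfolding runs_fn_def cmpl.simps
  by (intro ex_blkI) (auto simp: frame_def elim!: rep_mono)
next
 case (ev_Fst x y)
 then show ?case unfolding runs_fn_def cmpl.simps
  by (intro ex_blkI) (auto simp: frame_def elim!: rep_mono)
next
 case (ev_Snd x y)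
 then show ?case unfolding runs_fn_def cmpl.simps
  by (intro ex_blkI) (auto simp: frame_def elim!: rep_mono)
next
 case (ev_Pr f x t1 y g t2 z)
 from runs_copy[OF ev_Pr.prems(4,1), of 1 orc inp] ev_Pr.prems obtain s1 where s1:
  "exec orc inp (blk [Const 4 0, Add (d+1) d 4]) s s1" "frame (d+1) B s s1"
  "rep (mem s1) B (mem s1 3) (mem s1 (d+1)) x" "steps s1 = steps s + 2" "queries s1 = queries s"
  "mem s1 3 = mem s 3" by auto
 from ev_Pr.IH(1)[of "d+1" s1] s1 ev_Pr.prems obtain s2 where s2:
  "exec orc inp (cmpl f (d+1)) s1 s2" "frame (d+1) B s1 s2" "rep (mem s2) B (mem s2 3) (mem s2 (d+1)) y"
  "steps s2 \<le> steps s1 + 12 * t1" "queries s2 \<subseteq> queries s1 \<union> V" by (auto simp: runs_fn_def)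
 have f02: "frame (d+1) B s s2" using frame_trans[OF s1(2) s2(2)] by simp
 have x2: "rep (mem s2) B (mem s2 3) (mem s2 d) x"
  using frame_rep[OF f02 ev_Pr.prems(4)] frame_reg[OF f02, of d] ev_Pr.prems by simp
 have B2: "B \<le> mem s2 3" using f02 ev_Pr.prems by (auto simp: frame_def)
 from runs_copy[OF x2 ev_Pr.prems(1), of 2 orc inp] ev_Pr.prems B2 obtain s3 where s3:
  "exec orc inp (blk [Const 4 0, Add (d+2) d 4]) s2 s3" "frame (d+2) B s2 s3"
  "rep (mem s3) B (mem s3 3) (mem s3 (d+2)) x" "steps s3 = steps s2 + 2" "queries s3 = queries s2"
  "mem s3 3 = mem s2 3" by auto
 from ev_Pr.IH(2)[of "d+2" s3] s3 ev_Pr.prems B2 obtain s4 where s4: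
  "exec orc inp (cmpl g (d+2)) s3 s4" "frame (d+2) B s3 s4" "rep (mem s4) B (mem s4 3) (mem s4 (d+2)) z"
  "steps s4 \<le> steps s3 + 12 * t2" "queries s4 \<subseteq> queries s3 \<union> V" by (auto simp: runs_fn_def)
 have f24: "frame (d+2) B s2 s4" using frame_trans[OF s3(2) s4(2)] by simp
 have y4: "rep (mem s4) B (mem s4 3) (mem s4 (d+1)) y"
  using frame_rep[OF f24 s2(3)] frame_reg[OF f24, of "d+1"] ev_Pr.prems by simp
 have f04: "frame (d+1) B s s4" using frame_trans[OF f02 f24] by simp
 let ?is = "[Store 3 (d+1), Const 4 1, Add 4 3 4, Store 4 (d+2), Const 4 0, Add d 3 4,
       Const 4 2, Add 3 3 4]"
 define s5 where "s5 = fold (do_instr orc inp) ?is s4"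
 have B4: "B \<le> mem s4 3" using f04 ev_Pr.prems by (auto simp: frame_def)
 have m5: "mem s5 = (mem s4)(mem s4 3 := mem s4 (d+1), mem s4 3 + 1 := mem s4 (d+2), d := mem s4 3,
   4 := 2, 3 := mem s4 3 + 2)" "steps s5 = steps s4 + 8" "queries s5 = queries s4"
  unfolding s5_def using B4 ev_Pr.prems by (auto simp: fun_eq_iff)
 have f45: "frame d B s4 s5" using B4 ev_Pr.prems by (auto simp: frame_def m5)
 have "rep (mem s5) B (mem s5 3) (mem s5 (d+1)) y" "rep (mem s5) B (mem s5 3) (mem s5 (d+2)) z"
  using frame_rep[OF f45 y4] frame_rep[OF f45 s4(3)] B4 ev_Pr.prems by (auto simp: m5)
 then have "rep (mem s5) B (mem s5 3) (mem s5 d) (P y z)"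
  using B4 ev_Pr.prems by (auto simp: m5)
 moreover have "frame d B s s5"
  using f04 f45 unfolding frame_def by auto
 moreover have "exec orc inp (cmpl (Pr f g) d) s s5" unfolding cmpl.simps s5_def
  by (rule exec.Seq[OF s1(1) exec.Seq[OF s2(1) exec.Seq[OF s3(1) exec.Seq[OF s4(1) exec_blk]]]]) simp
 ultimately show ?case using s1 s2 s3 s4 m5 by (intro exI[of _ s5]) (auto simp: runs_fn_def)
next
 case (ev_Cmp f x t1 y g t2 z)
 from ev_Cmp.IH(1)[of d s] ev_Cmp.prems obtain s1 where s1: "runs_fn orc V inp B d (cmpl f d) t1 s s1 y"
  by auto
 from ev_Cmp.IH(2)[of d s1] s1 ev_Cmp.prems obtain s2 where s2: "runs_fn orc V inp B d (cmpl g d) t2 s1 s2 z"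
  by (auto simp: runs_fn_def frame_def)
 show ?case using s1 s2
  by (intro exI[of _ s2]) (auto simp: runs_fn_def intro: exec.intros elim: frame_trans)
next
 case (ev_K n x)
 then show ?case unfolding runs_fn_def cmpl.simps
  by (intro ex_blkI) (auto simp: frame_def)
next
 case (ev_Plus a b)
 then show ?case unfolding runs_fn_def cmpl.simps
  by (intro ex_blkI) (auto simp: frame_def)
next
 case (ev_Minus a b)
 then show ?case unfolding runs_fn_def cmpl.simps
  by (intro ex_blkI) (auto simp: frame_def)
next
 case (ev_Hf a)
 then show ?case unfolding runs_fn_def cmpl.simps
  by (intro ex_blkI) (auto simp: frame_def)
next
 case (ev_IfT c x t1 b f t2 y g)
 from runs_copy[OF ev_IfT.prems(4,1), of 1 orc inp] ev_IfT.prems obtain s1 where s1: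
  "exec orc inp (blk [Const 4 0, Add (d+1) d 4]) s s1" "frame (d+1) B s s1"
  "rep (mem s1) B (mem s1 3) (mem s1 (d+1)) x" "steps s1 = steps s + 2" "queries s1 = queries s"
  "mem s1 3 = mem s 3" by auto
 from ev_IfT.IH(1)[of "d+1" s1] s1 ev_IfT.prems obtain s2 where s2:
  "exec orc inp (cmpl c (d+1)) s1 s2" "frame (d+1) B s1 s2" "rep (mem s2) B (mem s2 3) (mem s2 (d+1)) b"
  "steps s2 \<le> steps s1 + 12 * t1" "queries s2 \<subseteq> queries s1 \<union> V" by (auto simp: runs_fn_def)
 have f02: "frame (d+1) B s s2" using frame_trans[OF s1(2) s2(2)] by simp
 have x2: "rep (mem s2) B (mem s2 3) (mem s2 d) x"
  using frame_rep[OF f02 ev_IfT.prems(4)] frame_reg[OF f02, of d] ev_IfT.prems by simp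
 have B2: "B \<le> mem s2 3" using f02 ev_IfT.prems by (auto simp: frame_def)
 have nz: "mem s2 (d+1) ~= 0" using rep_nonzero[OF s2(3)] ev_IfT by auto
 from ev_IfT.IH(2)[of d "tick 1 s2"] x2 B2 ev_IfT.prems obtain s3 where s3:
  "runs_fn orc V inp B d (cmpl f d) t2 (tick 1 s2) s3 y" by auto
 then have f23: "frame d B s2 s3" by (auto simp: runs_fn_def frame_def)
 have "exec orc inp (cmpl (If c f g) d) s s3" unfolding cmpl.simps
  by (rule exec.Seq[OF s1(1) exec.Seq[OF s2(1) exec.IfTrue[OF nz]]]) (use s3 in \<open>simp add: runs_fn_def\<close>)
 moreover have "frame d B s s3" using f02 f23 unfolding frame_def by auto
 ultimately show ?case using s1 s2 s3 by (intro exI[of _ s3]) (auto simp: runs_fn_def)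
next
 case (ev_IfF c x t1 g t2 y f)
 from runs_copy[OF ev_IfF.prems(4,1), of 1 orc inp] ev_IfF.prems obtain s1 where s1:
  "exec orc inp (blk [Const 4 0, Add (d+1) d 4]) s s1" "frame (d+1) B s s1"
  "rep (mem s1) B (mem s1 3) (mem s1 (d+1)) x" "steps s1 = steps s + 2" "queries s1 = queries s"
  "mem s1 3 = mem s 3" by auto
 from ev_IfF.IH(1)[of "d+1" s1] s1 ev_IfF.prems obtain s2 where s2:
  "exec orc inp (cmpl c (d+1)) s1 s2" "frame (d+1) B s1 s2" "rep (mem s2) B (mem s2 3) (mem s2 (d+1)) (A 0)"
  "steps s2 \<le> steps s1 + 12 * t1" "queries s2 \<subseteq> queries s1 \<union> V" by (auto simp: runs_fn_def)
 have f02: "frame (d+1) B s s2" using frame_trans[OF s1(2) s2(2)] by simp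
 have x2: "rep (mem s2) B (mem s2 3) (mem s2 d) x"
  using frame_rep[OF f02 ev_IfF.prems(4)] frame_reg[OF f02, of d] ev_IfF.prems by simp
 have B2: "B \<le> mem s2 3" using f02 ev_IfF.prems by (auto simp: frame_def)
 have nz: "mem s2 (d+1) = 0" using rep_nonzero[OF s2(3)] ev_IfF by auto
 from ev_IfF.IH(2)[of d "tick 1 s2"] x2 B2 ev_IfF.prems obtain s3 where s3:
  "runs_fn orc V inp B d (cmpl g d) t2 (tick 1 s2) s3 y" by auto
 then have f23: "frame d B s2 s3" by (auto simp: runs_fn_def frame_def)
 have "exec orc inp (cmpl (If c f g) d) s s3" unfolding cmpl.simps
  by (rule exec.Seq[OF s1(1) exec.Seq[OF s2(1) exec.IfFalse[OF nz]]]) (use s3 in \<open>simp add: runs_fn_def\<close>)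
 moreover have "frame d B s s3" using f02 f23 unfolding frame_def by auto
 ultimately show ?case using s1 s2 s3 by (intro exI[of _ s3]) (auto simp: runs_fn_def)
next
 case (ev_WhF c x t1 f)
 from runs_copy[OF ev_WhF.prems(4,1), of 1 orc inp] ev_WhF.prems obtain s1 where s1:
  "exec orc inp (blk [Const 4 0, Add (d+1) d 4]) s s1" "frame (d+1) B s s1"
  "rep (mem s1) B (mem s1 3) (mem s1 (d+1)) x" "steps s1 = steps s + 2" "queries s1 = queries s"
  "mem s1 3 = mem s 3" by auto
 from ev_WhF.IH(1)[of "d+1" s1] s1 ev_WhF.prems obtain s2 where s2:
  "exec orc inp (cmpl c (d+1)) s1 s2" "frame (d+1) B s1 s2" "rep (mem s2) B (mem s2 3) (mem s2 (d+1)) (A 0)"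
  "steps s2 \<le> steps s1 + 12 * t1" "queries s2 \<subseteq> queries s1 \<union> V" by (auto simp: runs_fn_def)
 have f02: "frame (d+1) B s s2" using frame_trans[OF s1(2) s2(2)] by simp
 have x2: "rep (mem s2) B (mem s2 3) (mem s2 d) x"
  using frame_rep[OF f02 ev_WhF.prems(4)] frame_reg[OF f02, of d] ev_WhF.prems by simp
 have nz: "mem s2 (d+1) = 0" using rep_nonzero[OF s2(3)] ev_WhF by auto
 have "exec orc inp (cmpl (Whl c f) d) s (tick 1 s2)" unfolding cmpl.simps
  by (rule exec.Seq[OF exec.Seq[OF s1(1) s2(1)] exec.WhileFalse[OF nz]])
 moreover have "frame d B s s2" using f02 unfolding frame_def by auto
 ultimately show ?case using s1 s2 x2 by (intro exI[of _ "tick 1 s2"]) (auto simp: runs_fn_def frame_def)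
next
 case (ev_WhT c x t1 b f t2 y t3 z)
 from runs_copy[OF ev_WhT.prems(4,1), of 1 orc inp] ev_WhT.prems obtain s1 where s1:
  "exec orc inp (blk [Const 4 0, Add (d+1) d 4]) s s1" "frame (d+1) B s s1"
  "rep (mem s1) B (mem s1 3) (mem s1 (d+1)) x" "steps s1 = steps s + 2" "queries s1 = queries s"
  "mem s1 3 = mem s 3" by auto
 from ev_WhT.IH(1)[of "d+1" s1] s1 ev_WhT.prems obtain s2 where s2:
  "exec orc inp (cmpl c (d+1)) s1 s2" "frame (d+1) B s1 s2" "rep (mem s2) B (mem s2 3) (mem s2 (d+1)) b"
  "steps s2 \<le> steps s1 + 12 * t1" "queries s2 \<subseteq> queries s1 \<union> V" by (auto simp: runs_fn_def)
 have f02: "frame (d+1) B s s2" using frame_trans[OF s1(2) s2(2)] by simp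
 have x2: "rep (mem s2) B (mem s2 3) (mem s2 d) x"
  using frame_rep[OF f02 ev_WhT.prems(4)] frame_reg[OF f02, of d] ev_WhT.prems by simp
 have B2: "B \<le> mem s2 3" using f02 ev_WhT.prems by (auto simp: frame_def)
 have nz: "mem s2 (d+1) ~= 0" using rep_nonzero[OF s2(3)] ev_WhT by auto
 from ev_WhT.IH(2)[of d "tick 1 s2"] x2 B2 ev_WhT.prems obtain s3 where s3:
  "runs_fn orc V inp B d (cmpl f d) t2 (tick 1 s2) s3 y" by auto
 then have f23: "frame d B s2 s3" by (auto simp: runs_fn_def frame_def)
 with s3 ev_WhT.prems B2 have "B \<le> mem s3 3" "rep (mem s3) B (mem s3 3) (mem s3 d) y"
  by (auto simp: runs_fn_def frame_def)
 from ev_WhT.IH(3)[OF ev_WhT.prems(1,2) this] obtain s4 where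
  s4: "runs_fn orc V inp B d (cmpl (Whl c f) d) t3 s3 s4 z" by auto
 let ?test = "Seq (blk [Const 4 0, Add (d+1) d 4]) (cmpl c (d+1))"
 let ?loop = "WhileNz (d+1) (Seq (cmpl f d) ?test)"
 \<comment> \<open>A compiled loop performs its test before the loop instruction. Splitting the run
   of the remaining iterations separates that test, which is then attached to the end of the body of
   the current iteration.\<close>
 from s4 obtain sm where sm: "exec orc inp ?test s3 sm" "exec orc inp ?loop sm s4"
  by (auto simp: runs_fn_def elim: exec_SeqE)
 have "exec orc inp (Seq (cmpl f d) ?test) (tick 1 s2) sm"
  using s3 sm(1) by (auto simp: runs_fn_def intro: exec.Seq)
 with sm(2) nz have "exec orc inp ?loop s2 s4" by (blast intro: exec.WhileTrue)
 then have "exec orc inp (cmpl (Whl c f) d) s s4" unfolding cmpl.simps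
  using s1(1) s2(1) by (blast intro: exec.Seq)
 moreover have "frame d B s s4" using f02 f23 s4 unfolding frame_def runs_fn_def by auto
 ultimately show ?case using s1 s2 s3 s4 by (intro exI[of _ s4]) (auto simp: runs_fn_def)
next
 case (ev_Ask w a b c)
 then show ?case using runs_Ask by auto
qed

text \<open>The input is read from its last cell backwards, so that each cell is put in front of the
  list built so far.\<close>

definition reader :: "nat => prog" where
 "reader B = Seq (blk [Const 3 B, InLen 9, Const 8 0])
   (WhileNz 9 (blk [Const 4 1, Sub 9 9 4, Input 5 9, Store 3 5, Const 4 1, Add 4 3 4, Store 4 8,
    Const 4 0, Add 8 3 4, Const 4 2, Add 3 3 4]))"

lemma inputs_read_simps [simp]:
 "mem (s\<lparr>inputs_read := X\<rparr>) = mem s" "steps (s\<lparr>inputs_read := X\<rparr>) = steps s"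
 "queries (s\<lparr>inputs_read := X\<rparr>) = queries s"
 by auto

lemma exec_reader_loop:
 assumes "mem s 9 \<le> length inp" "rep (mem s) B (mem s 3) (mem s 8) (lv (drop (mem s 9) inp))"
  "9 < B" "B \<le> mem s 3"
 shows "\<exists>s'. exec orc inp (WhileNz 9 (blk [Const 4 1, Sub 9 9 4, Input 5 9, Store 3 5, Const 4 1,
    Add 4 3 4, Store 4 8, Const 4 0, Add 8 3 4, Const 4 2, Add 3 3 4])) s s' \<and>
   rep (mem s') B (mem s' 3) (mem s' 8) (lv inp) \<and> B \<le> mem s' 3 \<and>
   steps s' = steps s + 12 * mem s 9 + 1 \<and> queries s' = queries s"
 using assms
proof (induction "mem s 9" arbitrary: s)
 case 0
 then show ?case by (intro exI[of _ "tick 1 s"] conjI exec.WhileFalse) auto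
next
 case (Suc i)
 let ?is = "[Const 4 1, Sub 9 9 4, Input 5 9, Store 3 5, Const 4 1,
    Add 4 3 4, Store 4 8, Const 4 0, Add 8 3 4, Const 4 2, Add 3 3 4]"
 define s1 where "s1 = fold (do_instr orc inp) ?is (tick 1 s)"
 have i: "mem s 9 = Suc i" "i < length inp" using Suc by auto
 have m1: "mem s1 = (mem s)(9 := i, 5 := inp ! i, mem s 3 := inp ! i, mem s 3 + 1 := mem s 8,
   8 := mem s 3, 4 := 2, 3 := mem s 3 + 2)" "steps s1 = steps s + 12" "queries s1 = queries s"
  unfolding s1_def using i Suc.prems by (auto simp: Let_def fun_eq_iff)
 have r: "rep (mem s1) B (mem s1 3) (mem s 8) (lv (drop (Suc i) inp))"
  using Suc.prems(2) unfolding i by (rule rep_mono) (use Suc.prems in \<open>auto simp: m1\<close>)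
 have dr: "drop i inp = inp ! i # drop (Suc i) inp" using i by (simp add: Cons_nth_drop_Suc)
 have "rep (mem s1) B (mem s1 3) (mem s1 8) (lv (drop i inp))"
  unfolding dr using r Suc.prems by (auto simp: m1)
 with Suc.hyps(1)[of s1] Suc.prems i obtain s' where s':
  "exec orc inp (WhileNz 9 (blk ?is)) s1 s'" "rep (mem s') B (mem s' 3) (mem s' 8) (lv inp)"
  "B \<le> mem s' 3" "steps s' = steps s1 + 12 * i + 1" "queries s' = queries s1"
  by (auto simp: m1)
 have "exec orc inp (blk ?is) (tick 1 s) s1" unfolding s1_def by (rule exec_blk) simp
 with s'(1) have "exec orc inp (WhileNz 9 (blk ?is)) s s'"
  using i by (intro exec.WhileTrue[OF _ _ s'(1)]) auto
 with s' i m1 show ?case by (intro exI[of _ s']) auto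
qed

definition prog_of :: "fn => prog" where
 "prog_of f = Seq (reader (10 + dep f)) (Seq (cmpl f 8)
   (blk [Load 0 8, Const 4 1, Add 4 8 4, Load 5 4, Load 1 5, Const 4 1, Add 4 5 4, Load 2 4]))"

lemma upt3: "[0..<3] = [0::nat, 1, 2]"
 by (simp add: upt_rec)

lemma prog_of_correct:
 assumes "ev orc V f (lv inp) t (P (A a) (P (A b) (A c)))"
 shows "\<exists>s. exec orc inp (prog_of f) init s \<and> map (mem s) [0..<3] = [a, b, c] \<and>
   steps s \<le> 12 * t + 12 * length inp + 12 \<and> queries s \<subseteq> V"
proof -
 let ?B = "10 + dep f"
 define s1 where "s1 = fold (do_instr orc inp) [Const 3 ?B, InLen 9, Const 8 0] init"
 have m1: "mem s1 = (%_. 0)(3 := ?B, 9 := length inp, 8 := 0)" "steps s1 = 3" "queries s1 = {}"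
  unfolding s1_def by (auto simp: init_def)
 from exec_reader_loop[of s1 inp ?B orc] m1 obtain s2 where s2:
  "exec orc inp (WhileNz 9 (blk [Const 4 1, Sub 9 9 4, Input 5 9, Store 3 5, Const 4 1,
    Add 4 3 4, Store 4 8, Const 4 0, Add 8 3 4, Const 4 2, Add 3 3 4])) s1 s2"
  "rep (mem s2) ?B (mem s2 3) (mem s2 8) (lv inp)" "?B \<le> mem s2 3"
  "steps s2 = 12 * length inp + 4" "queries s2 = {}"
  by auto
 have 1: "exec orc inp (blk [Const 3 ?B, InLen 9, Const 8 0]) init s1"
  unfolding s1_def by (rule exec_blk) simp
 have 2: "exec orc inp (reader ?B) init s2" unfolding reader_def by (rule exec.Seq[OF 1 s2(1)])
 from compile[OF assms, of 8 ?B s2 inp] s2 obtain s3 where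
  s3: "runs_fn orc V inp ?B 8 (cmpl f 8) t s2 s3 (P (A a) (P (A b) (A c)))" by auto
 let ?is = "[Load 0 8, Const 4 1, Add 4 8 4, Load 5 4, Load 1 5, Const 4 1, Add 4 5 4, Load 2 4]"
 define s4 where "s4 = fold (do_instr orc inp) ?is s3"
 have 3: "exec orc inp (blk ?is) s3 s4" unfolding s4_def by (rule exec_blk) simp
 have "exec orc inp (prog_of f) init s4" unfolding prog_of_def
  by (rule exec.Seq[OF 2 exec.Seq[OF _ 3]]) (use s3 in \<open>simp add: runs_fn_def\<close>)
 moreover have "mem s4 0 = a \<and> mem s4 1 = b \<and> mem s4 2 = c" "steps s4 = steps s3 + 8" "queries s4 = queries s3"
  unfolding s4_def using s3 by (auto simp: runs_fn_def)
 ultimately show ?thesis using s3 s2 by (intro exI[of _ s4]) (auto simp: runs_fn_def upt3)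
qed

section \<open>Evaluation cost as a computable quantity\<close>

primrec tsz :: "val => nat" where
 "tsz (A n) = 1"
| "tsz (P x y) = 1 + tsz x + tsz y"

abbreviation pev :: "fn => val => nat => val => bool" where
 "pev \<equiv> ev (%_. []) {}"

lemma pev_ev: "pev e x t y ==> ev orc V e x t y"
proof (induction rule: ev.induct)
 case (ev_IfF c x t1 g t2 y f)
 then show ?case by (intro ev.ev_IfF)
next
 case (ev_WhF c x t1 f)
 then show ?case by (intro ev.ev_WhF)
next
 case (ev_Ask w a b c)
 then show ?case by simp
qed (rule ev.intros; assumption)+

text \<open>\<open>Pr\<close> may duplicate its argument, so sizes can double with every step. The
  exponential bound is good enough for the factor of a reduction that depends on the parameter
  alone.\<close>

lemma ev_tsz: "pev e x t y ==> tsz y \<le> 2 ^ t * tsz x"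
proof (induction rule: ev.induct)
 case (ev_Pr f x t1 y g t2 z)
 have "1 \<le> tsz x" by (cases x) auto
 moreover have "2 ^ t1 * tsz x + (2 ^ t2 * tsz x) + tsz x \<le> 2 ^ (t1 + t2 + 1) * tsz x"
 proof -
  have "(2::nat) ^ t1 + 2 ^ t2 + 1 \<le> 2 ^ (t1 + t2 + 1)" if pos: "t1 > 0" "t2 > 0"
  proof -
   obtain a b where ab: "t1 = Suc a" "t2 = Suc b" using pos by (cases t1; cases t2) auto
   have "(2::nat)^a \<le> 2^a * 2^b" "(2::nat)^b \<le> 2^a * 2^b" "1 \<le> (2::nat)^a * 2^b" by auto
   then show ?thesis unfolding ab power_add power_Suc power_one_right by linarith
  qed
  moreover have "t > 0" if "pev f x t y" for f x t y using that by cases auto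
  ultimately have "(2::nat) ^ t1 + 2 ^ t2 + 1 \<le> 2 ^ (t1 + t2 + 1)" using ev_Pr.hyps by blast
  then have "(2 ^ t1 + 2 ^ t2 + 1) * tsz x \<le> 2 ^ (t1 + t2 + 1) * tsz x" by (rule mult_right_mono) simp
  then show ?thesis by (simp add: algebra_simps)
 qed
 ultimately show ?case using ev_Pr.IH by simp
next
 case (ev_Cmp f x t1 y g t2 z)
 have "tsz z \<le> 2 ^ t2 * (2 ^ t1 * tsz x)" using ev_Cmp.IH by (meson le_trans mult_le_mono2)
 also have "\<dots> \<le> 2 ^ (t1 + t2 + 1) * tsz x" by (simp add: power_add)
 finally show ?case .
next
 case (ev_K n x)
 have "1 \<le> tsz x" by (cases x) auto
 then show ?case by simp
next
 case (ev_IfT c x t1 b f t2 y g)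
 have "2 ^ t2 * tsz x \<le> 2 ^ (t1 + t2 + 1) * tsz x" by (intro mult_right_mono power_increasing) auto
 with ev_IfT show ?case by linarith
next
 case (ev_IfF c x t1 g t2 y f)
 have "2 ^ t2 * tsz x \<le> 2 ^ (t1 + t2 + 1) * tsz x" by (intro mult_right_mono power_increasing) auto
 with ev_IfF show ?case by linarith
next
 case (ev_WhT c x t1 b f t2 y t3 z)
 have "tsz z \<le> 2 ^ t3 * (2 ^ t2 * tsz x)" using ev_WhT.IH by (meson le_trans mult_le_mono2)
 also have "\<dots> = 2 ^ (t2 + t3) * tsz x" by (simp add: power_add)
 also have "\<dots> \<le> 2 ^ (t1 + t2 + t3 + 1) * tsz x" by (intro mult_right_mono power_increasing) auto
 finally show ?case .
qed auto

text \<open>\<open>timed e\<close> computes the cost of \<open>e\<close> along with its value.\<close>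

primrec timed :: "fn => fn" where
 "timed Id = Pr (K 1) Id"
| "timed Fst = Pr (K 1) Fst"
| "timed Snd = Pr (K 1) Snd"
| "timed (Pr f g) = Cmp (Pr (timed f) (timed g))
   (Pr (Cmp (Pr (Cmp Fst Fst) (Cmp (Pr (Cmp Snd Fst) (K 1)) Plus)) Plus)
     (Pr (Cmp Fst Snd) (Cmp Snd Snd)))"
| "timed (Cmp f g) = Cmp (Cmp (timed f) (Pr Fst (Cmp Snd (timed g))))
   (Pr (Cmp (Pr Fst (Cmp (Pr (Cmp Snd Fst) (K 1)) Plus)) Plus) (Cmp Snd Snd))"
| "timed (K n) = Pr (K 1) (K n)"
| "timed Plus = Pr (K 1) Plus"
| "timed Minus = Pr (K 1) Minus"
| "timed Hf = Pr (K 1) Hf"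
| "timed (If c f g) = Cmp (Pr (timed c) Id)
   (Cmp (Pr (Cmp Fst Fst) (If (Cmp Fst Snd) (Cmp Snd (timed f)) (Cmp Snd (timed g))))
    (Pr (Cmp (Pr Fst (Cmp (Pr (Cmp Snd Fst) (K 1)) Plus)) Plus) (Cmp Snd Snd)))"
| "timed (Whl c f) = Cmp (Cmp (Pr (Pr (K 0) Id) (timed c)) (Whl (Cmp Snd Snd)
   (Cmp (Pr (Cmp (Pr (Cmp Fst Fst) (Cmp Snd Fst)) Plus) (Cmp (Cmp Fst Snd) (timed f)))
    (Pr (Pr (Cmp (Pr Fst (Cmp (Pr (Cmp Snd Fst) (K 1)) Plus)) Plus) (Cmp Snd Snd))
      (Cmp (Cmp Snd Snd) (timed c))))))
   (Pr (Cmp (Pr (Cmp Fst Fst) (Cmp (Pr (Cmp Snd Fst) (K 1)) Plus)) Plus) (Cmp Fst Snd))"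
| "timed Ask = Ask"

definition pc :: "fn => val => val => bool" where
 "pc e x y \<longleftrightarrow> (\<exists>t. pev e x t y)"

lemma pc_intros:
 "pc Id x x" "pc Fst (P x y) x" "pc Snd (P x y) y"
 "pc f x y ==> pc g x z ==> pc (Pr f g) x (P y z)"
 "pc f x y ==> pc g y z ==> pc (Cmp f g) x z"
 "pc (K n) x (A n)" "n = a + b ==> pc Plus (P (A a) (A b)) (A n)" "n = a - b ==> pc Minus (P (A a) (A b)) (A n)"
 "n = a div 2 ==> pc Hf (A a) (A n)"
 by (auto simp: pc_def intro: ev.intros)

lemma pc_IfT: "pc c x b ==> b ~= A 0 ==> pc f x y ==> pc (If c f g) x y"
 and pc_IfF: "pc c x (A 0) ==> pc g x y ==> pc (If c f g) x y"
 and pc_WhF: "pc c x (A 0) ==> pc (Whl c f) x x"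
 and pc_WhT: "pc c x b ==> b ~= A 0 ==> pc f x y ==> pc (Whl c f) y z ==> pc (Whl c f) x z"
 by (auto simp: pc_def intro: ev.intros)

text \<open>The instrumented loop carries the cost so far, the current value and the next test,
  already evaluated together with its own cost. On exit, \<open>t2\<close> is the cost of the final
  test, which \<open>timed\<close> adds only after the loop; hence the accumulated
  \<open>t - t2 - 1\<close>.\<close>

lemma timed_while:
 fixes c f
 defines "b \<equiv> Cmp (Pr (Cmp (Pr (Cmp Fst Fst) (Cmp Snd Fst)) Plus) (Cmp (Cmp Fst Snd) (timed f)))
    (Pr (Pr (Cmp (Pr Fst (Cmp (Pr (Cmp Snd Fst) (K 1)) Plus)) Plus) (Cmp Snd Snd))
      (Cmp (Cmp Snd Snd) (timed c)))"
 shows "pev e x t z ==> (\<forall>e' x' t' y'. size e' < size e --> pev e' x' t' y' --> pc (timed e') x' (P (A t') y')) ==>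
  e = Whl c f ==> \<exists>t1 v. pc (timed c) x (P (A t1) v) \<and>
   (\<forall>a. \<exists>t2. pc (Whl (Cmp Snd Snd) b) (P (P (A a) x) (P (A t1) v)) (P (P (A (a + t - t2 - 1)) z) (P (A t2) (A 0)))
    \<and> t2 + 1 \<le> t)"
proof (induction rule: ev.induct)
 case (ev_WhF c' x t1 f')
 then have "pc (timed c) x (P (A t1) (A 0))" by (auto)
 then show ?case by (auto intro!: exI[of _ t1] exI[of _ "A 0"] pc_WhF pc_intros)
next
 case (ev_WhT c' x t1 v f' t2 y t3 z)
 have cf: "c' = c" "f' = f" using ev_WhT.prems by auto
 have C: "pc (timed c) x (P (A t1) v)" "pc (timed f) x (P (A t2) y)"
  using ev_WhT.prems(1) ev_WhT.hyps(1,3) by (auto simp: cf)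
 from ev_WhT.IH(3)[OF ev_WhT.prems(1) ev_WhT.prems(2)] cf obtain t1' v' where
  w: "pc (timed c) y (P (A t1') v')"
   "!!a. \<exists>t2. pc (Whl (Cmp Snd Snd) b) (P (P (A a) y) (P (A t1') v')) (P (P (A (a + t3 - t2 - 1)) z) (P (A t2) (A 0)))
    \<and> t2 + 1 \<le> t3" by blast
 have "\<exists>u. pc (Whl (Cmp Snd Snd) b) (P (P (A a) x) (P (A t1) v))
   (P (P (A (a + (t1 + t2 + t3 + 1) - u - 1)) z) (P (A u) (A 0))) \<and> u + 1 \<le> t1 + t2 + t3 + 1" for a
 proof -
  from w(2)[of "a + t1 + (t2 + 1)"] obtain u where u:
   "pc (Whl (Cmp Snd Snd) b) (P (P (A (a + t1 + (t2 + 1))) y) (P (A t1') v'))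
    (P (P (A (a + t1 + (t2 + 1) + t3 - u - 1)) z) (P (A u) (A 0)))" "u + 1 \<le> t3" by blast
  have "pc b (P (P (A a) x) (P (A t1) v)) (P (P (A (a + t1 + (t2 + 1))) y) (P (A t1') v'))"
   unfolding b_def by (rule pc_intros C w(1) refl)+
  then have "pc (Whl (Cmp Snd Snd) b) (P (P (A a) x) (P (A t1) v))
    (P (P (A (a + t1 + (t2 + 1) + t3 - u - 1)) z) (P (A u) (A 0)))"
   by (intro pc_WhT[OF _ ev_WhT.hyps(2) _ u(1)]) (auto intro!: pc_intros)
  moreover have "a + t1 + (t2 + 1) + t3 - u - 1 = a + (t1 + t2 + t3 + 1) - u - 1" by simp
  ultimately show ?thesis using u(2) by (auto intro!: exI[of _ u])
 qed
 with C show ?case by blast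
qed auto

text \<open>Induction on the size of the term; loops need the inner rule induction of
  \<open>timed_while\<close>, which uses the claim for the test and the body.\<close>

lemma timed_correct: "pev e x t y ==> pc (timed e) x (P (A t) y)"
proof (induction e arbitrary: x t y rule: measure_induct_rule[of size])
 case (less e)
 note IH = less.IH
 show ?case
 proof (cases "\<exists>c f. e = Whl c f")
  case True
  then obtain c f where e: "e = Whl c f" by blast
  have "\<forall>e' x' t' y'. size e' < size e --> pev e' x' t' y' --> pc (timed e') x' (P (A t') y')"
   using IH by blast
  from timed_while[OF less.prems this e] obtain t1' v t2 where
   w: "pc (timed c) x (P (A t1') v)"
    "pc (Whl (Cmp Snd Snd) (Cmp (Pr (Cmp (Pr (Cmp Fst Fst) (Cmp Snd Fst)) Plus) (Cmp (Cmp Fst Snd) (timed f)))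
    (Pr (Pr (Cmp (Pr Fst (Cmp (Pr (Cmp Snd Fst) (K 1)) Plus)) Plus) (Cmp Snd Snd))
      (Cmp (Cmp Snd Snd) (timed c))))) (P (P (A 0) x) (P (A t1') v)) (P (P (A (0 + t - t2 - 1)) y) (P (A t2) (A 0)))"
    "t2 + 1 \<le> t" by blast
  have "t = (0 + t - t2 - 1) + (t2 + 1)" using w(3) by simp
  then show ?thesis unfolding e timed.simps by - (rule pc_intros w(1,2) refl | assumption)+
 next
  case nw: False
  from less.prems show ?thesis
  proof cases
  case (ev_Pr f t1 y' g t2 z)
  then have "pc (timed f) x (P (A t1) y')" "pc (timed g) x (P (A t2) z)" using IH by auto
  then show ?thesis unfolding ev_Pr timed.simps by - (rule pc_intros refl add.assoc | assumption)+
 next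
  case (ev_Cmp f t1 y' g t2)
  then have "pc (timed f) x (P (A t1) y')" "pc (timed g) y' (P (A t2) y)" using IH by auto
  then show ?thesis unfolding ev_Cmp timed.simps by - (rule pc_intros refl add.assoc | assumption)+
 next
  case (ev_IfT c t1 b f t2 g)
  then have h: "pc (timed c) x (P (A t1) b)" "pc (timed f) x (P (A t2) y)" using IH by auto
  have "pc (If (Cmp Fst Snd) (Cmp Snd (timed f)) (Cmp Snd (timed g))) (P (P (A t1) b) x) (P (A t2) y)"
   by (rule pc_IfT[of _ _ b]) (rule pc_intros h ev_IfT)+
  then show ?thesis unfolding ev_IfT timed.simps using h(1) by - (rule pc_intros refl add.assoc | assumption)+
 next
  case (ev_IfF c t1 g t2 f)
  then have h: "pc (timed c) x (P (A t1) (A 0))" "pc (timed g) x (P (A t2) y)" using IH by auto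
  have "pc (If (Cmp Fst Snd) (Cmp Snd (timed f)) (Cmp Snd (timed g))) (P (P (A t1) (A 0)) x) (P (A t2) y)"
   by (rule pc_IfF) (rule pc_intros h ev_IfF)+
  then show ?thesis unfolding ev_IfF timed.simps using h(1) by - (rule pc_intros refl add.assoc | assumption)+
 next
  qed (use nw in \<open>simp_all\<close>, (rule pc_intros refl)+)
 qed
qed

section \<open>Encoded data, polynomial-time terms and computable terms\<close>

text \<open>Numbers become atoms of size 1 whatever their magnitude, in line with the uniform cost
  measure. Consequently a number cannot bound a loop in polynomial time; only the length of a list
  can.\<close>

class enc =
 fixes enc :: "'a => val"

instantiation nat :: enc begin
definition "enc (n::nat) = A n"
instance ..
end

instantiation bool :: enc begin
definition "enc (b::bool) = A (of_bool b)"
instance ..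
end

instantiation prod :: (enc, enc) enc begin
definition "enc p = P (enc (fst p)) (enc (snd p))"
instance ..
end

instantiation list :: (enc) enc begin
primrec enc_list :: "'a list => val" where
 "enc_list [] = A 0"
| "enc_list (x # xs) = P (enc x) (enc_list xs)"
instance ..
end

lemma enc_Pair [simp]: "enc (a, b) = P (enc a) (enc b)" by (simp add: enc_prod_def)
declare enc_nat_def [simp] enc_bool_def [simp]

lemma enc_nat_list: "enc (w :: nat list) = lv w" by (induction w) auto

abbreviation esz :: "'a::enc => nat" where "esz x \<equiv> tsz (enc x)"

lemma tsz_pos: "1 \<le> tsz v" by (cases v) auto

lemma esz_list: "esz (xs :: 'a::enc list) = 1 + (\<Sum>x\<leftarrow>xs. 1 + esz x)" by (induction xs) auto

lemma esz_append: "esz (xs @ ys) + 1 = esz xs + esz (ys :: 'a::enc list)" by (simp add: esz_list)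

lemma esz_rev [simp]: "esz (rev xs) = esz (xs :: 'a::enc list)" by (induction xs) (auto simp: esz_list)

lemma esz_mem: "x \<in> set xs ==> esz x < esz (xs :: 'a::enc list)"
 by (induction xs) auto

lemma length_esz: "length xs < esz (xs :: 'a::enc list)"
 by (induction xs) auto

lemma esz_list_le: "(!!x. x \<in> set xs ==> esz x \<le> M) ==> esz (xs :: 'a::enc list) \<le> 1 + length xs * (1 + M)"
proof (induction xs)
 case (Cons a xs)
 then have "esz a \<le> M" "esz xs \<le> 1 + length xs * (1 + M)" by simp_all
 then show ?case by (simp add: algebra_simps)
qed simp

lemma esz_prod [simp]: "esz (p :: 'a::enc \<times> 'b::enc) = 1 + esz (fst p) + esz (snd p)"
 by (cases p) auto

subsection \<open>Polynomial bounds\<close>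

text \<open>The shape \<open>(n + c) ^ c\<close> has a single witness and still absorbs sums,
  products and compositions.\<close>

definition polyb :: "(nat => nat) => bool" where
 "polyb T \<longleftrightarrow> (\<exists>c. \<forall>n. T n \<le> (n + c) ^ c)"

lemma pow_self_mono: "a \<le> b ==> n \<le> m ==> (n + a) ^ a \<le> (m + b) ^ (b::nat)"
proof (cases "m + b = 0")
 case False
 assume "a \<le> b" "n \<le> m"
 then have "(n + a) ^ a \<le> (m + b) ^ a" by (intro power_mono) auto
 also have "\<dots> \<le> (m + b) ^ b" using False \<open>a \<le> b\<close> by (intro power_increasing) auto
 finally show ?thesis .
qed auto

lemma polybI: "(!!n. T n \<le> (n + c) ^ c) ==> polyb T" by (auto simp: polyb_def)

lemma polyb_mono: "polyb T ==> (!!n. S n \<le> T n) ==> polyb S"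
 unfolding polyb_def by (meson le_trans)

lemma polyb_const: "polyb (%_. k)"
proof (rule polybI[of _ "k + 1"])
 fix n
 have "k \<le> (n + (k + 1)) ^ 1" by simp
 also have "\<dots> \<le> (n + (k + 1)) ^ (k + 1)" by (intro power_increasing) auto
 finally show "k \<le> (n + (k + 1)) ^ (k + 1)" .
qed

lemma polyb_id: "polyb (%n. n)"
 by (rule polybI[of _ 1]) simp

lemma polyb_add: assumes "polyb S" "polyb T" shows "polyb (%n. S n + T n)"
proof -
 from assms obtain a b where a: "!!n. S n \<le> (n + a) ^ a" and b: "!!n. T n \<le> (n + b) ^ b"
  by (auto simp: polyb_def)
 show ?thesis
 proof (rule polybI[of _ "a + b + 2"])
  fix n
  have "S n \<le> (n + (a + b + 1)) ^ (a + b + 1)" "T n \<le> (n + (a + b + 1)) ^ (a + b + 1)"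
   using a[of n] b[of n] pow_self_mono[of a "a+b+1" n n] pow_self_mono[of b "a+b+1" n n] by simp_all
  then have "S n + T n \<le> 2 * (n + (a + b + 1)) ^ (a + b + 1)" by simp
  also have "\<dots> \<le> (n + (a + b + 2)) * (n + (a + b + 2)) ^ (a + b + 1)"
   by (intro mult_mono power_mono) auto
  finally show "S n + T n \<le> (n + (a + b + 2)) ^ (a + b + 2)" by simp
 qed
qed

lemma polyb_mult: assumes "polyb S" "polyb T" shows "polyb (%n. S n * T n)"
proof -
 from assms obtain a b where a: "!!n. S n \<le> (n + a) ^ a" and b: "!!n. T n \<le> (n + b) ^ b"
  by (auto simp: polyb_def)
 show ?thesis
 proof (rule polybI[of _ "a + b"])
  fix n
  have "S n * T n \<le> (n + a) ^ a * (n + b) ^ b" by (intro mult_mono a b) auto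
  also have "\<dots> \<le> (n + (a + b)) ^ a * (n + (a + b)) ^ b" by (intro mult_mono power_mono) auto
  finally show "S n * T n \<le> (n + (a + b)) ^ (a + b)" by (simp add: power_add)
 qed
qed

lemma polyb_power: "polyb S ==> polyb (%n. S n ^ k)"
 by (induction k) (auto intro: polyb_mult polyb_const)

lemma polyb_bound: assumes "polyb T" obtains U where "polyb U" "mono U" "!!n. T n \<le> U n"
proof -
 from assms obtain c where "!!n. T n \<le> (n + c) ^ c" by (auto simp: polyb_def)
 moreover have "polyb (%n. (n + c) ^ c)" by (rule polybI[of _ c]) simp
 moreover have "mono (%n. (n + c) ^ c)" by (auto intro!: monoI power_mono)
 ultimately show ?thesis using that by blast
qed

lemma polyb_comp: assumes "polyb T" "polyb S" "mono T" shows "polyb (%n. T (S n))"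
proof -
 from assms obtain c where c: "!!n. T n \<le> (n + c) ^ c" by (auto simp: polyb_def)
 have "polyb (%n. (S n + c) ^ c)" by (intro polyb_power polyb_add assms polyb_const)
 then show ?thesis by (rule polyb_mono) (rule c)
qed

lemmas polyb_intros = polyb_const polyb_id polyb_add polyb_mult polyb_power

subsection \<open>Polynomial-time functions on encoded data\<close>

definition cft :: "fn => ('a::enc => 'b::enc) => 'a => nat => bool" where
 "cft e f x n \<longleftrightarrow> (\<exists>t\<le>n. pev e (enc x) t (enc (f x)))"

text \<open>Monotonicity belongs to the witness because a composition evaluates \<open>T\<close> at
  a bound for the size of an intermediate value.\<close>

definition FPw :: "fn => (nat => nat) => ('a::enc => 'b::enc) => bool" where
 "FPw e T f \<longleftrightarrow> polyb T \<and> mono T \<and> (\<forall>x. cft e f x (T (esz x)) \<and> esz (f x) \<le> T (esz x))"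

definition FP :: "('a::enc => 'b::enc) => bool" where
 "FP f \<longleftrightarrow> (\<exists>e T. FPw e T f)"

lemma FPwD: assumes "FPw e T f"
 shows "polyb T" "mono T" "!!x. cft e f x (T (esz x))" "!!x. esz (f x) \<le> T (esz x)"
 using assms unfolding FPw_def by auto

definition CF :: "('a::enc => 'b::enc) => bool" where
 "CF f \<longleftrightarrow> (\<exists>e. \<forall>x. \<exists>n. cft e f x n)"

lemma cftI: "pev e (enc x) t (enc (f x)) ==> t \<le> n ==> cft e f x n" by (auto simp: cft_def)

lemma cft_mono: "cft e f x n ==> n \<le> m ==> cft e f x m" unfolding cft_def by (meson le_trans)

lemma FPI:
 assumes "polyb T" "!!x. cft e f x (T (esz x))" "!!x. esz (f x) \<le> T (esz x)"
 shows "FP f"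
proof -
 from polyb_bound[OF assms(1)] obtain U where "polyb U" "mono U" "!!n. T n \<le> U n" by blast
 then have "cft e f x (U (esz x)) \<and> esz (f x) \<le> U (esz x)" for x
  using cft_mono[OF assms(2)] le_trans[OF assms(3)] by blast
 with \<open>polyb U\<close> \<open>mono U\<close> show ?thesis unfolding FP_def FPw_def by blast
qed

lemma FP_CF: "FP f ==> CF f" unfolding FP_def FPw_def CF_def by blast

lemma cft_Cmp: "cft e f x n ==> cft e' g (f x) m ==> cft (Cmp e e') (%x. g (f x)) x (n + m + 1)"
proof -
 assume "cft e f x n" "cft e' g (f x) m"
 then obtain t s where "t \<le> n" "pev e (enc x) t (enc (f x))" "s \<le> m" "pev e' (enc (f x)) s (enc (g (f x)))"
  unfolding cft_def by blast
 then show ?thesis by (intro cftI[OF ev_Cmp]) auto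
qed

lemma cft_Pr: "cft e f x n ==> cft e' g x m ==> cft (Pr e e') (%x. (f x, g x)) x (n + m + 1)"
proof -
 assume "cft e f x n" "cft e' g x m"
 then obtain t s where t: "t \<le> n" "pev e (enc x) t (enc (f x))" "s \<le> m" "pev e' (enc x) s (enc (g x))"
  unfolding cft_def by blast
 from ev_Pr[OF t(2,4)] t(1,3) show ?thesis unfolding cft_def by (intro exI[of _ "t + s + 1"]) simp
qed

lemma cft_If:
 assumes "cft e c x n" "cft e1 f x m" "cft e2 g x m"
 shows "cft (If e e1 e2) (%x. if c x then f x else g x) x (n + m + 1)"
proof -
 from assms obtain t t1 t2 where t: "t \<le> n" "t1 \<le> m" "t2 \<le> m" "pev e (enc x) t (enc (c x))"
  "pev e1 (enc x) t1 (enc (f x))" "pev e2 (enc x) t2 (enc (g x))" unfolding cft_def by blast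
 show ?thesis
 proof (cases "c x")
  case True
  with t have "pev (If e e1 e2) (enc x) (t + t1 + 1) (enc (f x))" by (intro ev_IfT[of _ _ _ _ _ "enc (c x)"]) auto
  then show ?thesis using t True by (intro cftI) auto
 next
  case False
  with t have "pev (If e e1 e2) (enc x) (t + t2 + 1) (enc (g x))" by (intro ev_IfF) auto
  then show ?thesis using t False by (intro cftI) auto
 qed
qed

lemma FP_comp: assumes "FP g" "FP f" shows "FP (%x. g (f x))"
proof -
 obtain e T where "FPw e T g" using assms(1) unfolding FP_def by blast
 note g = FPwD[OF this]
 obtain e' S where "FPw e' S f" using assms(2) unfolding FP_def by blast
 note f = FPwD[OF this]
 have m: "T (esz (f x)) \<le> T (S (esz x))" for x by (rule monoD[OF g(2) f(4)])
 show ?thesis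
 proof (rule FPI[where T = "%n. S n + T (S n) + 1" and e = "Cmp e' e"])
  show "polyb (%n. S n + T (S n) + 1)" by (intro polyb_add polyb_const f(1) polyb_comp[OF g(1) f(1) g(2)])
  show "cft (Cmp e' e) (%x. g (f x)) x (S (esz x) + T (S (esz x)) + 1)" for x
   by (rule cft_Cmp[OF f(3) cft_mono[OF g(3) m]])
  show "esz (g (f x)) \<le> S (esz x) + T (S (esz x)) + 1" for x using g(4)[of "f x"] m[of x] by simp
 qed
qed

lemma FP_Pair: assumes "FP f" "FP g" shows "FP (%x. (f x, g x))"
proof -
 obtain e T where "FPw e T f" using assms(1) unfolding FP_def by blast
 note f = FPwD[OF this]
 obtain e' S where "FPw e' S g" using assms(2) unfolding FP_def by blast
 note g = FPwD[OF this]
 show ?thesis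
 proof (rule FPI[where T = "%n. T n + S n + 1", OF _ cft_Pr[OF f(3) g(3)]])
  show "polyb (%n. T n + S n + 1)" by (intro polyb_add polyb_const f(1) g(1))
  show "esz (f x, g x) \<le> T (esz x) + S (esz x) + 1" for x using f(4)[of x] g(4)[of x] by simp
 qed
qed

lemma FP_prim:
 assumes "!!x. pev e (enc x) 1 (enc (f x))" "!!x. esz (f x) \<le> esz x"
 shows "FP f"
proof (rule FPI[where e = e and T = "%n. n + 1"])
 show "polyb (%n. n + 1)" by (intro polyb_add polyb_const polyb_id)
 show "cft e f x (esz x + 1)" for x by (rule cftI[OF assms(1)]) simp
 show "esz (f x) \<le> esz x + 1" for x using assms(2)[of x] by simp
qed

lemma FP_id: "FP (%x. x)"
 by (rule FP_prim[where e = Id]) (rule ev_Id, simp)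

lemma FP_fst0: "FP fst"
 by (rule FP_prim[where e = Fst]) (unfold enc_prod_def enc_nat_def, rule ev_Fst, simp)

lemma FP_snd0: "FP snd"
 by (rule FP_prim[where e = Snd]) (unfold enc_prod_def enc_nat_def, rule ev_Snd, simp)

primrec kv :: "val => fn" where
 "kv (A n) = K n"
| "kv (P x y) = Pr (kv x) (kv y)"

lemma ev_kv: "pev (kv v) x (tsz v) v"
proof (induction v)
 case (A n)
 then show ?case using ev_K[of _ _ n x] by simp
next
 case (P v1 v2)
 then show ?case using ev_Pr[OF P] by (simp add: add.commute)
qed

lemma FP_const: "FP (%_. c)"
 by (rule FPI[where e = "kv (enc c)" and T = "%n. esz c"]) (auto intro!: polyb_intros cftI ev_kv)

lemmas FP_fst = FP_comp[OF FP_fst0]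
lemmas FP_snd = FP_comp[OF FP_snd0]

lemma FP_if: assumes "FP c" "FP f" "FP g" shows "FP (%x. if c x then f x else g x)"
proof -
 obtain e R where "FPw e R c" using assms(1) unfolding FP_def by blast
 note c = FPwD[OF this]
 obtain e1 T where "FPw e1 T f" using assms(2) unfolding FP_def by blast
 note f = FPwD[OF this]
 obtain e2 S where "FPw e2 S g" using assms(3) unfolding FP_def by blast
 note g = FPwD[OF this]
 show ?thesis
 proof (rule FPI[where T = "%n. R n + (T n + S n) + 1"])
  show "polyb (%n. R n + (T n + S n) + 1)" by (intro polyb_add polyb_const c(1) f(1) g(1))
  show "cft (If e e1 e2) (%x. if c x then f x else g x) x (R (esz x) + (T (esz x) + S (esz x)) + 1)" for x
   by (rule cft_If[OF c(3) cft_mono[OF f(3)] cft_mono[OF g(3)]]) auto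
  show "esz (if c x then f x else g x) \<le> R (esz x) + (T (esz x) + S (esz x)) + 1" for x
   using f(4)[of x] g(4)[of x] by auto
 qed
qed

lemma FP_add0: "FP (%p. fst p + snd p :: nat)"
 by (rule FP_prim[where e = Plus]) (unfold enc_prod_def enc_nat_def, rule ev_Plus, simp)
lemma FP_sub0: "FP (%p. fst p - snd p :: nat)"
 by (rule FP_prim[where e = Minus]) (unfold enc_prod_def enc_nat_def, rule ev_Minus, simp)
lemma FP_half0: "FP (%p. p div 2 :: nat)"
 by (rule FP_prim[where e = Hf]) (unfold enc_nat_def, rule ev_Hf, simp)

lemma FP_add: "FP f ==> FP g ==> FP (%x. f x + g x :: nat)"
 using FP_comp[OF FP_add0 FP_Pair[of f g]] by simp
lemma FP_sub: "FP f ==> FP g ==> FP (%x. f x - g x :: nat)"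
 using FP_comp[OF FP_sub0 FP_Pair[of f g]] by simp
lemma FP_half: "FP f ==> FP (%x. f x div 2 :: nat)"
 by (rule FP_comp[OF FP_half0])

lemma FP_cond_nat: assumes "FP c" "FP f" "FP g" shows "FP (%x. if c x = (0::nat) then g x else f x)"
proof -
 have "FP (%n::nat. n ~= 0)"
 proof (rule FPI[where e = "If Id (K 1) (K 0)" and T = "%n. 3"])
  show "cft (If Id (K 1) (K 0)) (%n. n ~= 0) n 3" for n :: nat
  proof (rule cftI[of _ _ "1 + 1 + 1"])
   show "pev (fn.If fn.Id (K 1) (K 0)) (enc n) (1 + 1 + 1) (enc (n ~= 0))"
   proof (cases "n = 0")
    case True
    show ?thesis by (rule ev_IfF) (use True ev_Id[of _ _ "A 0"] ev_K[of _ _ 0] in auto)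
   next
    case False
    show ?thesis by (rule ev_IfT[of _ _ _ _ _ "A n"]) (use False ev_Id[of _ _ "A n"] ev_K[of _ _ 1] in auto)
   qed
  qed simp
 qed (auto intro: polyb_intros)
 from FP_if[OF FP_comp[OF this assms(1)] assms(2,3)]
 have "FP (%x. if c x ~= 0 then f x else g x)" .
 moreover have "(%x. if c x ~= 0 then f x else g x) = (%x. if c x = 0 then g x else f x)" by auto
 ultimately show ?thesis by simp
qed

lemma FP_le: assumes "FP f" "FP g" shows "FP (%x. f x \<le> (g x :: nat))"
proof -
 have "FP (%x. if f x - g x = 0 then True else False)"
  by (intro FP_cond_nat FP_sub assms FP_const)
 moreover have "(%x. if f x - g x = 0 then True else False) = (%x. f x \<le> g x)" by auto
 ultimately show ?thesis by simp
qed

lemma FP_not: assumes "FP c" shows "FP (%x. \<not> c x)"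
proof -
 have "(%x. if c x then False else True) = (%x. \<not> c x)" by auto
 with FP_if[OF assms FP_const[of False] FP_const[of True]] show ?thesis by simp
qed
lemma FP_conj: assumes "FP c" "FP d" shows "FP (%x. c x \<and> d x)"
proof -
 have "(%x. if c x then d x else False) = (%x. c x \<and> d x)" by auto
 with FP_if[OF assms FP_const[of False]] show ?thesis by simp
qed
lemma FP_disj: assumes "FP c" "FP d" shows "FP (%x. c x \<or> d x)"
 using FP_not[OF FP_conj[OF FP_not[OF assms(1)] FP_not[OF assms(2)]]] by simp
lemma FP_imp: assumes "FP c" "FP d" shows "FP (%x. c x --> d x)"
 unfolding imp_conv_disj by (rule FP_disj[OF FP_not[OF assms(1)] assms(2)])
lemma FP_less: assumes "FP f" "FP g" shows "FP (%x. f x < (g x :: nat))"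
 using FP_not[OF FP_le[OF assms(2,1)]] by (simp add: not_le)
lemma FP_eq: assumes "FP f" "FP g" shows "FP (%x. f x = (g x :: nat))"
 using FP_conj[OF FP_le[OF assms] FP_le[OF assms(2,1)]] by (simp add: order_eq_iff)
lemma FP_of_bool: assumes "FP f" shows "FP (%x. of_bool (f x) :: nat)"
 using FP_if[OF assms FP_const[of "1::nat"] FP_const[of "0::nat"]] by (simp add: of_bool_def)

lemma FP_Cons: assumes "FP f" "FP g" shows "FP (%x. f x # g x)"
proof -
 obtain e T where "FPw e T (%x. (f x, g x))" using FP_Pair[OF assms] unfolding FP_def by blast
 note g = FPwD[OF this]
 show ?thesis by (rule FPI[where e = e and T = T]) (use g in \<open>auto simp: cft_def\<close>)
qed

text \<open>A nonempty list is represented as the pair of its head and tail, so a case distinction on a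
 list needs no tag.\<close>

lemma FP_case_list:
 assumes "FP l" "FP f" "FP (%p. g (fst p) (fst (snd p)) (snd (snd p)))" (is "FP ?fp7")
 shows "FP (%x. case l x of [] => f x | y # ys => g x y ys)"
proof -
 obtain e1 R where "FPw e1 R l" using assms(1) unfolding FP_def by blast
 note l = FPwD[OF this]
 obtain e2 S where "FPw e2 S f" using assms(2) unfolding FP_def by blast
 note f = FPwD[OF this]
 obtain e3 T where "FPw e3 T ?fp7"
  using assms(3) unfolding FP_def by blast
 note g = FPwD[OF this]
 let ?e = "If e1 (Cmp (Pr Id e1) e3) e2"
 let ?T = "%n. R n + R n + S n + T (n + R n + 1) + 5"
 have "cft ?e (%x. case l x of [] => f x | y # ys => g x y ys) x (?T (esz x)) \<and>
   esz (case l x of [] => f x | y # ys => g x y ys) \<le> ?T (esz x)" for x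
 proof (cases "l x")
  case Nil
  obtain t s where ts: "t \<le> R (esz x)" "pev e1 (enc x) t (A 0)" "s \<le> S (esz x)" "pev e2 (enc x) s (enc (f x))"
   using l(3)[of x] f(3)[of x] Nil unfolding cft_def by auto
  from ev_IfF[OF ts(2,4)] have "pev ?e (enc x) (t + s + 1) (enc (f x))" .
  moreover have "t + s + 1 \<le> ?T (esz x)" using ts by linarith
  moreover have "esz (f x) \<le> ?T (esz x)" using f(4)[of x] by linarith
  ultimately show ?thesis unfolding cft_def Nil list.case by blast
 next
  case (Cons y ys)
  obtain t where t: "t \<le> R (esz x)" "pev e1 (enc x) t (P (enc y) (enc ys))"
   using l(3)[of x] Cons unfolding cft_def by auto
  obtain s where s: "s \<le> T (esz (x, y, ys))" "pev e3 (P (enc x) (P (enc y) (enc ys))) s (enc (g x y ys))"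
   using g(3)[of "(x, y, ys)"] unfolding cft_def by auto
  have sz: "T (esz (x, y, ys)) \<le> T (esz x + R (esz x) + 1)"
   by (rule monoD[OF g(2)]) (use l(4)[of x] Cons in auto)
  have ev: "pev ?e (enc x) (t + ((1 + t + 1) + s + 1) + 1) (enc (g x y ys))"
   by (rule ev_IfT[OF t(2)], simp, rule ev_Cmp[OF ev_Pr[OF ev_Id t(2)] s(2)])
  have tt: "t + ((1 + t + 1) + s + 1) + 1 \<le> ?T (esz x)" using s(1) sz t(1) by linarith
  have "esz (g x y ys) \<le> T (esz (x, y, ys))" using g(4)[of "(x, y, ys)"] by (simp only: fst_conv snd_conv)
  with sz have "esz (g x y ys) \<le> ?T (esz x)" by linarith
  with ev tt show ?thesis unfolding cft_def Cons list.case by blast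
 qed
 moreover have "polyb (%n. n + R n + 1)" by (intro polyb_add polyb_const polyb_id l(1))
 then have "polyb ?T" by (intro polyb_add polyb_const polyb_id l(1) f(1) polyb_comp[OF g(1) _ g(2)])
 ultimately show ?thesis by (intro FPI[where e = ?e and T = ?T]) blast+
qed

text \<open>The state is a fixed context, the accumulator and the list still to be consumed.\<close>

definition foldE :: "fn => fn" where
 "foldE e = Whl (Cmp Snd Snd)
   (Pr Fst (Pr (Cmp (Pr Fst (Pr (Cmp Snd Fst) (Cmp (Cmp Snd Snd) Fst))) e) (Cmp (Cmp Snd Snd) Snd)))"

lemma ev_foldE:
 fixes f :: "'w::enc => 'a::enc => 'b::enc => 'a"
 assumes "!!zs y zs'. ys = zs @ y # zs' ==>
  cft e (%p. f (fst p) (fst (snd p)) (snd (snd p))) (w, foldl (f w) a zs, y) N"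
 shows "\<exists>t \<le> length ys * (N + 25) + 5. pev (foldE e) (P (enc w) (P (enc a) (enc ys))) t
  (P (enc w) (P (enc (foldl (f w) a ys)) (A 0)))"
 using assms
proof (induction ys arbitrary: a)
 case Nil
 have "pev (Cmp Snd Snd) (P (enc w) (P (enc a) (A 0))) (1 + 1 + 1) (A 0)" by (rule ev.intros)+
 then have "pev (foldE e) (P (enc w) (P (enc a) (A 0))) (1 + 1 + 1 + 1) (P (enc w) (P (enc a) (A 0)))"
  unfolding foldE_def by (rule ev_WhF)
 then show ?case by (intro exI[of _ 4]) (simp add: numeral_eq_Suc)
next
 case (Cons y ys)
 from Cons.prems[of "[]" y ys] obtain s where s: "s \<le> N"
  "pev e (P (enc w) (P (enc a) (enc y))) s (enc (f w a y))" unfolding cft_def by auto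
 have h: "cft e (%p. f (fst p) (fst (snd p)) (snd (snd p))) (w, foldl (f w) (f w a y) zs, z) N"
  if "ys = zs @ z # zs'" for zs z zs' using Cons.prems[of "y # zs" z zs'] that by simp
 have "\<exists>t \<le> length ys * (N + 25) + 5. pev (foldE e) (P (enc w) (P (enc (f w a y)) (enc ys))) t
   (P (enc w) (P (enc (foldl (f w) (f w a y) ys)) (A 0)))"
  by (rule Cons.IH) (rule h)
 then obtain t where t: "t \<le> length ys * (N + 25) + 5"
  "pev (foldE e) (P (enc w) (P (enc (f w a y)) (enc ys))) t (P (enc w) (P (enc (foldl (f w) (f w a y) ys)) (A 0)))"
  by blast
 have c: "pev (Cmp Snd Snd) (P (enc w) (P (enc a) (P (enc y) (enc ys)))) (1 + 1 + 1) (P (enc y) (enc ys))" by (rule ev.intros)+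
 let ?st = "P (enc w) (P (enc a) (P (enc y) (enc ys)))"
 have 1: "pev (Pr Fst (Pr (Cmp Snd Fst) (Cmp (Cmp Snd Snd) Fst))) ?st (1 + ((1 + 1 + 1) + ((1 + 1 + 1) + 1 + 1) + 1) + 1)
   (P (enc w) (P (enc a) (enc y)))" by (rule ev.intros)+
 have 2: "pev (Cmp (Cmp Snd Snd) Snd) ?st ((1 + 1 + 1) + 1 + 1) (enc ys)" by (rule ev.intros)+
 have b: "pev (Pr Fst (Pr (Cmp (Pr Fst (Pr (Cmp Snd Fst) (Cmp (Cmp Snd Snd) Fst))) e) (Cmp (Cmp Snd Snd) Snd)))
   ?st (1 + (((1 + ((1 + 1 + 1) + ((1 + 1 + 1) + 1 + 1) + 1) + 1) + s + 1) + ((1 + 1 + 1) + 1 + 1) + 1) + 1) (P (enc w) (P (enc (f w a y)) (enc ys)))"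
  by (rule ev_Pr[OF ev_Fst ev_Pr[OF ev_Cmp[OF 1 s(2)] 2]])
 have "pev (foldE e) ?st (3 + (s + 20) + t + 1) (P (enc w) (P (enc (foldl (f w) (f w a y) ys)) (A 0)))"
  using ev_WhT[OF c _ b t(2)[unfolded foldE_def], folded foldE_def] by (simp add: numeral_eq_Suc)
 then show ?case using s(1) t(1) by (intro exI[of _ "3 + (s + 20) + t + 1"]) auto
qed

text \<open>Iterating a polynomial-time step can make values grow exponentially. The hypothesis on
  \<open>B\<close> therefore bounds the accumulator after every prefix of the list.\<close>

lemma FP_foldl:
 fixes f :: "'w::enc => 'a::enc => 'b::enc => 'a"
 assumes f: "FP (%p. f (fst p) (fst (snd p)) (snd (snd p)))" (is "FP ?fp6") and a: "FP a" and l: "FP l"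
  and B: "polyb B" "!!x zs zs'. l x = zs @ zs' ==> esz (foldl (f x) (a x) zs) \<le> B (esz x)"
 shows "FP (%x. foldl (f x) (a x) (l x))"
proof -
 obtain e T where "FPw e T ?fp6" using f unfolding FP_def by blast
 note T = FPwD[OF this]
 obtain e' S where "FPw e' S (%x. (x, a x, l x))"
  using FP_Pair[OF FP_id FP_Pair[OF a l]] unfolding FP_def by blast
 note S = FPwD[OF this]
 let ?e = "Cmp (Cmp e' (foldE e)) (Cmp Snd Fst)"
 let ?N = "%n. T (n + B n + S n + 5)"
 let ?T = "%n. S n + (S n * (?N n + 25) + 5) + 10 + B n"
 have "cft ?e (%x. foldl (f x) (a x) (l x)) x (?T (esz x))" for x
 proof -
  have len: "length (l x) \<le> S (esz x)" using S(4)[of x] length_esz[of "l x"] by simp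
  have h: "cft e (%p. f (fst p) (fst (snd p)) (snd (snd p))) (x, foldl (f x) (a x) zs, y) (?N (esz x))"
   if "l x = zs @ y # zs'" for zs y zs'
  proof (rule cft_mono[OF T(3)], rule monoD[OF T(2)])
   have "esz (foldl (f x) (a x) zs) \<le> B (esz x)" by (rule B(2)[OF that])
   moreover have "esz y \<le> S (esz x)" using esz_mem[of y "l x"] that S(4)[of x] by simp
   ultimately show "esz (x, foldl (f x) (a x) zs, y) \<le> esz x + B (esz x) + S (esz x) + 5" by simp
  qed
  have "\<exists>t \<le> length (l x) * (?N (esz x) + 25) + 5. pev (foldE e) (P (enc x) (P (enc (a x)) (enc (l x)))) t
   (P (enc x) (P (enc (foldl (f x) (a x) (l x))) (A 0)))"
   by (rule ev_foldE) (rule h)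
  then obtain t where t: "t \<le> length (l x) * (?N (esz x) + 25) + 5"
   "pev (foldE e) (P (enc x) (P (enc (a x)) (enc (l x)))) t (P (enc x) (P (enc (foldl (f x) (a x) (l x))) (A 0)))" by blast
  from S(3)[of x] obtain s where s: "s \<le> S (esz x)" "pev e' (enc x) s (P (enc x) (P (enc (a x)) (enc (l x))))"
   unfolding cft_def by auto
  have ev: "pev ?e (enc x) ((s + t + 1) + (1 + 1 + 1) + 1) (enc (foldl (f x) (a x) (l x)))"
   by (rule ev_Cmp[OF ev_Cmp[OF s(2) t(2)] ev_Cmp[OF ev_Snd ev_Fst]])
  have "length (l x) * (?N (esz x) + 25) \<le> S (esz x) * (?N (esz x) + 25)" using len by simp
  then have "(s + t + 1) + (1 + 1 + 1) + 1 \<le> ?T (esz x)" using s(1) t(1) by linarith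
  with ev show ?thesis by (rule cftI)
 qed
 moreover have "esz (foldl (f x) (a x) (l x)) \<le> ?T (esz x)" for x using B(2)[of x "l x" "[]"] by simp
 moreover have "polyb (%n. n + B n + S n + 5)" by (intro polyb_add polyb_const polyb_id S(1) B(1))
 then have "polyb ?T" by (intro polyb_add polyb_mult polyb_const polyb_id S(1) B(1) polyb_comp[OF T(1) _ T(2)])
 ultimately show ?thesis by (intro FPI[where e = ?e and T = ?T]) blast+
qed

lemma FP_bound: assumes "FP f" obtains T where "polyb T" "mono T" "\<forall>x. esz (f x) \<le> T (esz x)"
proof -
 obtain e T where "FPw e T f" using assms unfolding FP_def by blast
 note FPwD[OF this]
 then show ?thesis using that by blast
qed

lemma foldl_Cons: "foldl (%a y. h y # a) acc zs = rev (map h zs) @ acc"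
 by (induction zs arbitrary: acc) auto

lemma FP_rev0: "FP (rev :: 'a::enc list => 'a list)"
proof -
 have "FP (%x::'a list. foldl (%a y. y # a) [] x)"
 proof (rule FP_foldl[where f = "%x a y. y # a" and B = "%n. n"])
  show "FP (%p::'a list \<times> 'a list \<times> 'a. snd (snd p) # fst (snd p))"
   by (intro FP_Cons FP_snd FP_fst FP_id)
  show "esz (foldl (%a y. y # a) [] zs) \<le> esz x" if "x = zs @ zs'" for x zs zs' :: "'a list"
   using that esz_append[of zs zs'] tsz_pos[of "enc zs'"] foldl_Cons[of "%y. y" "[]" zs] by simp
 qed (intro FP_const FP_id polyb_id)+
 moreover have "foldl (%a y. y # a) [] = (rev :: 'a list => 'a list)"
  using foldl_Cons[of "%y. y" "[]"] by (auto simp: fun_eq_iff)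
 ultimately show ?thesis by simp
qed

lemmas FP_rev = FP_comp[OF FP_rev0]

lemma FP_append: assumes "FP f" "FP g" shows "FP (%x. f x @ g x)"
proof -
 obtain T where T: "polyb T" "mono T" "\<forall>x. esz (f x) \<le> T (esz x)" using assms(1) by (rule FP_bound)
 obtain S where S: "polyb S" "mono S" "\<forall>x. esz (g x) \<le> S (esz x)" using assms(2) by (rule FP_bound)
 have "FP (%x. foldl (%a y. y # a) (g x) (rev (f x)))"
 proof (rule FP_foldl[where f = "%x a y. y # a" and B = "%n. T n + S n"])
  show "esz (foldl (%a y. y # a) (g x) zs) \<le> T (esz x) + S (esz x)" if "rev (f x) = zs @ zs'" for x zs zs'
  proof -
   have "esz zs + esz zs' = esz (f x) + 1" using esz_append[of zs zs'] that[symmetric] by simp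
   moreover have "esz (rev zs @ g x) + 1 = esz zs + esz (g x)" using esz_append[of "rev zs" "g x"] by simp
   moreover have "1 \<le> esz zs'" by (rule tsz_pos)
   moreover have "esz (f x) \<le> T (esz x)" "esz (g x) \<le> S (esz x)" using T S by auto
   ultimately show ?thesis using foldl_Cons[of "%y. y" "g x" zs] by simp
  qed
  show "polyb (%n. T n + S n)" by (intro polyb_add T S)
 qed (intro assms FP_rev FP_Cons FP_snd FP_fst FP_id)+
 moreover have "foldl (%a y. y # a) (g x) (rev (f x)) = f x @ g x" for x
  using foldl_Cons[of "%y. y" "g x" "rev (f x)"] by simp
 ultimately show ?thesis by simp
qed

lemma FP_map:
 assumes f: "FP (%p. f (fst p) (snd p))" and l: "FP l"
 shows "FP (%x. map (f x) (l x))"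
proof -
 obtain T where T: "polyb T" "mono T" "\<forall>p. esz (f (fst p) (snd p)) \<le> T (esz p)" using f by (rule FP_bound)
 obtain S where S: "polyb S" "mono S" "\<forall>x. esz (l x) \<le> S (esz x)" using l by (rule FP_bound)
 let ?B = "%n. 1 + S n * (1 + T (1 + n + S n))"
 have "FP (%x. foldl (%a y. f x y # a) [] (l x))"
 proof (rule FP_foldl[where f = "%x a y. f x y # a" and B = ?B])
  have "FP (%p. (fst p, snd (snd p)))" by (intro FP_Pair FP_fst FP_snd FP_id)
  from FP_comp[OF f this] show "FP (%p. f (fst p) (snd (snd p)) # fst (snd p))"
   by (intro FP_Cons FP_snd FP_fst FP_id) simp
  have "polyb (%n. 1 + n + S n)" by (intro polyb_add polyb_const polyb_id S)
  then have "polyb (%n. T (1 + n + S n))" by (rule polyb_comp[OF T(1) _ T(2)])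
  then show "polyb ?B" by (intro polyb_add polyb_mult polyb_const S(1))
  show "esz (foldl (%a y. f x y # a) [] zs) \<le> ?B (esz x)" if "l x = zs @ zs'" for x zs zs'
  proof -
   have sub: "set zs \<subseteq> set (l x)" "length zs \<le> length (l x)" using that by auto
   have "length zs \<le> S (esz x)" using sub(2) length_esz[of "l x"] S(3) by (meson le_trans less_imp_le)
   have "esz (f x y) \<le> T (1 + esz x + S (esz x))" if "y \<in> set zs" for y
   proof -
    have "esz y \<le> S (esz x)" using esz_mem[of y "l x"] sub that S(3) by (meson le_trans less_imp_le subsetD)
    then have "T (esz (x, y)) \<le> T (1 + esz x + S (esz x))" by (intro monoD[OF T(2)]) simp
    moreover have "esz (f x y) \<le> T (esz (x, y))" using T(3)[rule_format, of "(x, y)"] by (simp only: fst_conv snd_conv)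
    ultimately show ?thesis by linarith
   qed
   then have "esz (map (f x) zs) \<le> 1 + length (map (f x) zs) * (1 + T (1 + esz x + S (esz x)))"
    by (intro esz_list_le) auto
   also have "\<dots> \<le> ?B (esz x)" using \<open>length zs \<le> S (esz x)\<close> by (simp del: add_Suc)
   finally show ?thesis using foldl_Cons[of "f x" "[]" zs] by simp
  qed
 qed (intro l FP_const)+
 from FP_rev[OF this] show ?thesis unfolding foldl_Cons by simp
qed

lemma FP_concat0: "FP (concat :: 'a::enc list list => 'a list)"
proof -
 have fc: "foldl (%a y. a @ y) acc zs = acc @ concat zs" for acc and zs :: "'a list list"
  by (induction zs arbitrary: acc) auto
 have "FP (%x::'a list list. foldl (%a y. a @ y) [] x)"
 proof (rule FP_foldl[where f = "%x a y. a @ y" and B = "%n. n"])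
  show "esz (foldl (%a y. a @ y) [] zs) \<le> esz x" if "x = zs @ zs'" for x zs zs' :: "'a list list"
  proof -
   have c: "esz (concat zs) \<le> esz zs"
   proof (induction zs)
    case (Cons z zs)
    then show ?case using esz_append[of z "concat zs"] by simp
   qed simp
   show ?thesis unfolding fc using that c esz_append[of zs zs'] tsz_pos[of "enc zs'"] by simp
  qed
 qed (intro FP_const FP_id polyb_id FP_append FP_fst FP_snd)+
 moreover have "foldl (%a y. a @ y) [] = (concat :: 'a list list => 'a list)"
  using fc[of "[]"] by (auto simp: fun_eq_iff)
 ultimately show ?thesis by simp
qed

lemmas FP_concat = FP_comp[OF FP_concat0]

lemma FP_filter:
 assumes "FP (%p. f (fst p) (snd p))" "FP l"
 shows "FP (%x. filter (f x) (l x))"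
proof -
 have "FP (%x. concat (map (%y. if f x y then [y] else []) (l x)))"
  by (intro FP_concat FP_map FP_if FP_Cons FP_snd FP_id FP_const assms)
 moreover have "concat (map (%y. if g y then [y] else []) zs) = filter g zs" for g and zs :: "'b list"
  by (induction zs) auto
 ultimately show ?thesis by simp
qed

lemma FP_Bex:
 assumes "FP (%p. f (fst p) (snd p))" "FP l"
 shows "FP (%x. \<exists>y\<in>set (l x). f x y)"
proof -
 have "FP (%x. case filter (f x) (l x) of [] => False | y # ys => True)"
  by (intro FP_case_list FP_filter assms FP_const)
 moreover have "(case filter g zs of [] => False | y # ys => True) \<longleftrightarrow> (\<exists>y\<in>set zs. g y)" for g and zs :: "'b list"
  by (auto split: list.split simp: filter_empty_conv) (metis filter_empty_conv list.distinct(1) list.set_intros(1))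
 ultimately show ?thesis by simp
qed

lemma FP_Ball:
 assumes "FP (%p. f (fst p) (snd p))" "FP l"
 shows "FP (%x. \<forall>y\<in>set (l x). f x y)"
 using FP_not[OF FP_Bex[OF FP_not[OF assms(1)] assms(2)]] by simp

lemma FP_member: assumes "FP f" "FP l" shows "FP (%x. (f x :: nat) \<in> set (l x))"
proof -
 have "FP (%x. \<exists>y\<in>set (l x). y = f x)"
  by (rule FP_Bex) (intro FP_eq FP_snd FP_id FP_comp[OF assms(1)] FP_fst assms(2))+
 then show ?thesis by simp
qed

lemma FP_sum_list: assumes "FP l" shows "FP (%x. sum_list (l x) :: nat)"
proof -
 have "FP (%x. foldl (%a y. a + y) 0 (l x))"
  by (rule FP_foldl[where B = "%_. 1"]) (intro FP_add FP_fst FP_snd FP_id FP_const assms polyb_const | simp)+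
 moreover have "foldl (%a y. a + y) b zs = b + sum_list zs" for b :: nat and zs
  by (induction zs arbitrary: b) auto
 ultimately show ?thesis by simp
qed

lemma FP_length: assumes "FP l" shows "FP (%x. length (l x))"
proof -
 have "FP (%x. sum_list (map (%_. 1::nat) (l x)))" by (intro FP_sum_list FP_map FP_const assms)
 then show ?thesis by (simp add: sum_list_triv)
qed

definition en :: "'a list => (nat \<times> 'a) list" where "en l = zip [0..<length l] l"

text \<open>Positions are obtained as lengths of the result built so far, since numbers cannot be
  enumerated in polynomial time here.\<close>

lemma FP_en: assumes "FP l" shows "FP (%x. en (l x))"
proof -
 have fe: "foldl (%a y. a @ [(length a, y)]) [] zs = en zs" for zs :: "'b list"
  by (induction zs rule: rev_induct) (auto simp: en_def)
 obtain S where S: "polyb S" "mono S" "\<forall>x. esz (l x) \<le> S (esz x)" using assms by (rule FP_bound)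
 have "FP (%x. foldl (%a y. a @ [(length a, y)]) [] (l x))"
 proof (rule FP_foldl[where f = "%x a y. a @ [(length a, y)]" and B = "%n. 1 + S n * (1 + (S n + 2))"])
  show "esz (foldl (%a y. a @ [(length a, y)]) [] zs) \<le> 1 + S (esz x) * (1 + (S (esz x) + 2))" if "l x = zs @ zs'" for x zs zs'
  proof -
   have ln: "length zs \<le> S (esz x)" using that length_esz[of "l x"] S(3)[rule_format, of x] by simp
   have "esz p \<le> S (esz x) + 2" if "p \<in> set (en zs)" for p
   proof -
    have "snd p \<in> set zs" using that unfolding en_def by (metis prod.collapse set_zip_rightD)
    then have "esz (snd p) \<le> S (esz x)" using esz_mem[of "snd p" "l x"] \<open>l x = zs @ zs'\<close> S(3)[rule_format, of x] by simp
    then show ?thesis by simp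
   qed
   then have "esz (en zs) \<le> 1 + length (en zs) * (1 + (S (esz x) + 2))" by (rule esz_list_le)
   also have "\<dots> \<le> 1 + S (esz x) * (1 + (S (esz x) + 2))" using ln by (intro add_mono mult_mono) (auto simp: en_def)
   finally show ?thesis unfolding fe .
  qed
  show "polyb (%n. 1 + S n * (1 + (S n + 2)))" by (intro polyb_add polyb_mult polyb_const S)
 qed (intro FP_append FP_Cons FP_Pair FP_length FP_fst FP_snd FP_id FP_const assms)+
 then show ?thesis unfolding fe .
qed

lemma FP_idx: assumes "FP l" shows "FP (%x. [0..<length (l x)])"
proof -
 have "FP (%x. map fst (en (l x)))" by (intro FP_map FP_fst FP_snd FP_id FP_en assms)
 then show ?thesis by (simp add: en_def)
qed

lemma FP_take: assumes "FP n" "FP l" shows "FP (%x. take (n x) (l x))"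
proof -
 have "FP (%x. map snd (filter (%p. fst p < n x) (en (l x))))"
  by (intro FP_map FP_filter FP_less FP_fst FP_snd FP_id FP_en assms FP_comp[OF assms(1)])
 moreover have "map snd (filter (%p. fst p < n) (en zs)) = take n zs" for n and zs :: "'b list"
  by (induction zs rule: rev_induct) (auto simp: en_def)
 ultimately show ?thesis by simp
qed

lemma FP_drop: assumes "FP n" "FP l" shows "FP (%x. drop (n x) (l x))"
proof -
 have "FP (%x. map snd (filter (%p. n x \<le> fst p) (en (l x))))"
  by (intro FP_map FP_filter FP_le FP_fst FP_snd FP_id FP_en assms FP_comp[OF assms(1)])
 moreover have "map snd (filter (%p. n \<le> fst p) (en zs)) = drop n zs" for n and zs :: "'b list"
  by (induction zs rule: rev_induct) (auto simp: en_def)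
 ultimately show ?thesis by simp
qed

definition nthd :: "'a => 'a list => nat => 'a" where
 "nthd d l n = (if n < length l then l ! n else d)"

lemma FP_nthd: assumes "FP l" "FP n" shows "FP (%x. nthd d (l x) (n x))"
proof -
 have "FP (%x. case drop (n x) (l x) of [] => d | y # ys => y)"
  by (intro FP_case_list FP_drop assms FP_const FP_fst FP_snd FP_id)
 moreover have "(case drop n zs of [] => d | y # ys => y) = nthd d zs n" for n zs
  by (cases "n < length zs") (auto simp: nthd_def Cons_nth_drop_Suc[symmetric])
 ultimately show ?thesis by simp
qed

lemmas FP_rules = FP_Pair FP_fst FP_snd FP_if FP_add FP_sub FP_half FP_le FP_less FP_eq FP_not
 FP_conj FP_disj FP_imp FP_of_bool FP_Cons FP_case_list FP_rev FP_append FP_map FP_concat FP_filter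
 FP_Bex FP_Ball FP_member FP_sum_list FP_length FP_en FP_idx FP_take FP_drop FP_nthd FP_id FP_const

subsection \<open>Computable functions without time bound\<close>

lemma CF_iff: "CF f \<longleftrightarrow> (\<exists>e. \<forall>x. pc e (enc x) (enc (f x)))"
 unfolding CF_def cft_def pc_def by (meson order_refl)

lemma CF_comp: "CF g ==> CF f ==> CF (%x. g (f x))"
 unfolding CF_iff by (meson pc_intros(5))

lemma CF_Pair: "CF f ==> CF g ==> CF (%x. (f x, g x))"
 unfolding CF_iff enc_Pair by (meson pc_intros(4))

lemma CF1: "FP h ==> CF f ==> CF (%x. h (f x))"
 by (rule CF_comp[OF FP_CF])

lemma CF2: "FP (%p. h (fst p) (snd p)) ==> CF f ==> CF g ==> CF (%x. h (f x) (g x))"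
 using CF1[of "%p. h (fst p) (snd p)" "%x. (f x, g x)"] CF_Pair by force

text \<open>\<open>n\<close> only specifies when the loop stops and is not assumed computable; this
  makes unbounded search available in \<open>CF_LEAST\<close>.\<close>

lemma CF_while:
 fixes f :: "'a::enc => 'b::enc => 'b"
 assumes b: "CF (%p. b (fst p) (snd p) :: bool)" and f: "CF (%p. f (fst p) (snd p))" and a: "CF a"
  and n: "!!x. \<not> b x ((f x ^^ n x) (a x))" "!!x i. i < n x ==> b x ((f x ^^ i) (a x))"
 shows "CF (%x. (f x ^^ n x) (a x))"
proof -
 obtain eb ef ea where eb: "!!p. pc eb (enc p) (enc (b (fst p) (snd p)))"
  and ef: "!!p. pc ef (enc p) (enc (f (fst p) (snd p)))" and ea: "!!x. pc ea (enc x) (enc (a x))"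
  using b f a unfolding CF_iff by blast
 have loop: "pc (Whl eb (Pr Fst ef)) (P (enc x) (enc ((f x ^^ (n x - i)) (a x)))) (P (enc x) (enc ((f x ^^ n x) (a x))))"
  if "i \<le> n x" for x i using that
 proof (induction i)
  case 0
  have "pc eb (P (enc x) (enc ((f x ^^ n x) (a x)))) (A 0)" using eb[of "(x, (f x ^^ n x) (a x))"] n(1)[of x] by simp
  then show ?case by (simp add: pc_WhF)
 next
  case (Suc i)
  let ?y = "(f x ^^ (n x - Suc i)) (a x)"
  have c: "pc eb (P (enc x) (enc ?y)) (A 1)" using eb[of "(x, ?y)"] n(2)[of "n x - Suc i" x] Suc.prems by simp
  have e: "n x - i = Suc (n x - Suc i)" using Suc.prems by simp
  have "pc ef (P (enc x) (enc ?y)) (enc ((f x ^^ (n x - i)) (a x)))" unfolding e using ef[of "(x, ?y)"] by simp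
  then have b: "pc (Pr Fst ef) (P (enc x) (enc ?y)) (P (enc x) (enc ((f x ^^ (n x - i)) (a x))))"
   by (rule pc_intros(4)[OF pc_intros(2)])
  have "i \<le> n x" using Suc.prems by simp
  show ?case by (rule pc_WhT[OF c _ b Suc.IH[OF \<open>i \<le> n x\<close>]]) simp
 qed
 have "pc (Cmp (Cmp (Pr Id ea) (Whl eb (Pr Fst ef))) Snd) (enc x) (enc ((f x ^^ n x) (a x)))" for x
 proof -
  have "pc (Pr Id ea) (enc x) (P (enc x) (enc (a x)))" by (rule pc_intros(4)[OF pc_intros(1) ea])
  moreover have "pc (Whl eb (Pr Fst ef)) (P (enc x) (enc (a x))) (P (enc x) (enc ((f x ^^ n x) (a x))))"
   using loop[of "n x" x] by simp
  ultimately show ?thesis by (rule pc_intros(5)[OF pc_intros(5) pc_intros(3)])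
 qed
 then show ?thesis unfolding CF_iff by blast
qed

lemma CF_funpow:
 fixes f :: "'a::enc => 'b::enc => 'b"
 assumes f: "CF (%p. f (fst p) (snd p))" and a: "CF a" and n: "CF n"
 shows "CF (%x. (f x ^^ n x) (a x))"
proof -
 let ?g = "%x (p :: 'b \<times> nat). (f x (fst p), snd p - 1)"
 have g: "(?g x ^^ i) (u, m) = ((f x ^^ i) u, m - i)" for x u m i
  by (induction i) auto
 have f': "CF (%p. f (fst p) (fst (snd p)))"
  using CF_comp[OF f, of "%p. (fst p, fst (snd p))"] FP_CF[OF FP_Pair[OF FP_fst[OF FP_id] FP_fst[OF FP_snd[OF FP_id]]]] by simp
 have "CF (%x. (?g x ^^ n x) (a x, n x))"
 proof (rule CF_while[where b = "%x p. 0 < snd p"])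
  show "CF (%p :: 'a \<times> 'b \<times> nat. 0 < snd (snd p))" by (intro FP_CF FP_rules)
  show "CF (%p :: 'a \<times> 'b \<times> nat. (f (fst p) (fst (snd p)), snd (snd p) - 1))"
   by (intro CF_Pair f' FP_CF FP_rules)
  show "CF (%x. (a x, n x))" by (intro CF_Pair a n)
 qed (auto simp: g[simplified])
 from CF1[OF FP_fst0 this] show ?thesis by (simp add: g[simplified])
qed

lemma CF_LEAST:
 assumes "CF (%p. b (fst p) (snd p) :: bool)" "!!x. \<exists>n. b x n"
 shows "CF (%x. LEAST n. b x (n::nat))"
proof -
 have s: "((%m. m + 1) ^^ n) 0 = n" for n :: nat by (induction n) auto
 have "CF (%x. ((%m. m + 1) ^^ (LEAST n. b x n)) (0::nat))"
 proof (rule CF_while[where b = "%x n. \<not> b x n" and f = "%x m. m + 1"])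
  show "CF (%p. \<not> b (fst p) (snd p))" by (rule CF1[OF FP_not[OF FP_id] assms(1)])
  show "CF (%p :: 'a \<times> nat. snd p + 1)" by (intro FP_CF FP_rules)
  show "CF (%x :: 'a. 0 :: nat)" by (intro FP_CF FP_const)
  show "\<not> \<not> b x (((%m. m + 1) ^^ (LEAST n. b x n)) 0)" for x unfolding s using assms(2) by (auto intro: LeastI_ex)
  show "\<not> b x (((%m. m + 1) ^^ i) 0)" if "i < (LEAST n. b x n)" for x i unfolding s using that by (rule not_less_Least)
 qed
 then show ?thesis unfolding s .
qed

lemma CF_foldl:
 fixes f :: "'w::enc => 'a::enc => 'b::enc => 'a"
 assumes f: "CF (%p. f (fst p) (fst (snd p)) (snd (snd p)))" and a: "CF a" and l: "CF l"
 shows "CF (%x. foldl (f x) (a x) (l x))"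
proof -
 obtain ef ea where ef: "!!p. pc ef (enc p) (enc (f (fst p) (fst (snd p)) (snd (snd p))))"
  and ea: "!!x. pc ea (enc x) (enc (x, a x, l x))"
  using f CF_Pair[OF FP_CF[OF FP_id] CF_Pair[OF a l]] unfolding CF_iff by blast
 have loop: "pc (foldE ef) (P (enc x) (P (enc u) (enc ys))) (P (enc x) (P (enc (foldl (f x) u ys)) (A 0)))" for x u ys
 proof -
  \<comment> \<open>\<open>ev_foldE\<close> wants one cost bound for all steps; the maximum over the
    finitely many prefixes of \<open>ys\<close> serves.\<close>
  have "\<exists>N. \<forall>zs y zs'. ys = zs @ y # zs' --> cft ef (%p. f (fst p) (fst (snd p)) (snd (snd p))) (x, foldl (f x) u zs, y) N"
  proof -
   have "\<exists>N. cft ef (%p. f (fst p) (fst (snd p)) (snd (snd p))) p N" for p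
    using ef[of p] unfolding pc_def cft_def by blast
   then obtain N where N: "!!p. cft ef (%p. f (fst p) (fst (snd p)) (snd (snd p))) p (N p)" by metis
   let ?S = "(%i. (x, foldl (f x) u (take i ys), ys ! i)) ` {..<length ys}"
   have "cft ef (%p. f (fst p) (fst (snd p)) (snd (snd p))) (x, foldl (f x) u zs, y) (Max (N ` ?S))"
    if "ys = zs @ y # zs'" for zs y zs'
   proof (rule cft_mono[OF N])
    have "(x, foldl (f x) u zs, y) \<in> ?S" using that by (intro image_eqI[of _ _ "length zs"]) auto
    then show "N (x, foldl (f x) u zs, y) \<le> Max (N ` ?S)" by (intro Max_ge) auto
   qed
   then show ?thesis by blast
  qed
  then obtain N where N: "!!zs y zs'. ys = zs @ y # zs' ==> cft ef (%p. f (fst p) (fst (snd p)) (snd (snd p))) (x, foldl (f x) u zs, y) N" by blast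
  have "\<exists>t \<le> length ys * (N + 25) + 5. pev (foldE ef) (P (enc x) (P (enc u) (enc ys))) t
   (P (enc x) (P (enc (foldl (f x) u ys)) (A 0)))" by (rule ev_foldE) (rule N)
  then show ?thesis unfolding pc_def by blast
 qed
 have "pc (Cmp (Cmp ea (foldE ef)) (Cmp Snd Fst)) (enc x) (enc (foldl (f x) (a x) (l x)))" for x
  using pc_intros(5)[OF pc_intros(5)[OF ea[of x, unfolded enc_Pair] loop] pc_intros(5)[OF pc_intros(3) pc_intros(2)]] .
 then show ?thesis unfolding CF_iff by blast
qed

lemma CF_map:
 assumes f: "CF (%p. f (fst p) (snd p))" and l: "CF l"
 shows "CF (%x. map (f x) (l x))"
proof -
 have "CF (%p. f (fst p) (snd (snd p)) # fst (snd p))"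
 proof (rule CF2[where h = "(#)"])
  show "CF (%p. f (fst p) (snd (snd p)))"
   using CF_comp[OF f, of "%p. (fst p, snd (snd p))"] FP_CF[OF FP_Pair[OF FP_fst[OF FP_id] FP_snd[OF FP_snd[OF FP_id]]]] by simp
 qed (intro FP_CF FP_rules)+
 then have "CF (%x. foldl (%a y. f x y # a) [] (l x))"
  by (rule CF_foldl[where f = "%x a y. f x y # a", OF _ FP_CF[OF FP_const] l])
 from CF1[OF FP_rev0 this] show ?thesis unfolding foldl_Cons by simp
qed

lemma CF_subseqs: assumes "CF l" shows "CF (%x. subseqs (l x))"
proof -
 have "CF (%x. foldl (%a y. map ((#) y) a @ a) [[]] (rev (l x)))"
  by (rule CF_foldl[where f = "%x a y. map ((#) y) a @ a", OF _ FP_CF[OF FP_const] CF1[OF FP_rev0 assms]])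
   (intro FP_CF FP_rules)
 moreover have "foldl (%a y. map ((#) y) a @ a) [[]] (rev l) = subseqs l" for l :: "'b list"
  by (induction l) (auto simp: Let_def)
 ultimately show ?thesis by simp
qed

lemma CF_upt: assumes "CF n" shows "CF (%x. [0..<n x])"
proof -
 have "CF (%x. ((%l. l @ [length l]) ^^ n x) [])"
  by (rule CF_funpow[where f = "%x l. l @ [length l]", OF _ FP_CF[OF FP_const] assms]) (intro FP_CF FP_rules)
 moreover have "((%l. l @ [length l]) ^^ m) [] = [0..<m]" for m by (induction m) auto
 ultimately show ?thesis by simp
qed

lemma CF_mult: assumes "CF f" "CF g" shows "CF (%x. f x * g x :: nat)"
proof -
 have "CF (%x. ((%s. s + f x) ^^ g x) 0)"
  by (rule CF_funpow[where f = "%x s. s + f x", OF _ FP_CF[OF FP_const] assms(2)],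
   rule CF2[where h = "(+)", OF FP_add0 FP_CF[OF FP_snd0] CF_comp[OF assms(1) FP_CF[OF FP_fst0]]])
 moreover have "((%s. s + a) ^^ b) 0 = a * b" for a b :: nat by (induction b) auto
 ultimately show ?thesis by simp
qed

lemma CF_power: assumes "CF f" "CF g" shows "CF (%x. f x ^ g x :: nat)"
proof -
 have "CF (%x. ((%s. s * f x) ^^ g x) 1)"
  by (rule CF_funpow[where f = "%x s. s * f x", OF _ FP_CF[OF FP_const] assms(2)],
   rule CF_mult[OF FP_CF[OF FP_snd0] CF_comp[OF assms(1) FP_CF[OF FP_fst0]]])
 moreover have "((%s. s * a) ^^ b) 1 = a ^ b" for a b :: nat by (induction b) auto
 ultimately show ?thesis by simp
qed

section \<open>Simulation of machine programs by terms\<close>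

text \<open>Memory as an association list with the newest entry first; absent addresses read 0, as
  in \<open>init\<close>.\<close>

definition look :: "(nat \<times> nat) list => nat => nat" where
 "look M a = (case filter (%p. fst p = a) M of [] => 0 | p # ps => snd p)"

lemma look_Cons: "look ((b, v) # M) = (look M)(b := v)" by (auto simp: look_def)
lemma look_Nil: "look [] = (%_. 0)" by (auto simp: look_def)

lemma FP_look: assumes "FP M" "FP a" shows "FP (%x. look (M x) (a x))"
 unfolding look_def by (intro FP_rules assms FP_comp[OF assms(2)])

type_synonym mach = "(nat \<times> nat) list \<times> nat list"

text \<open>\<open>Query\<close> changes nothing because ordinary runs use the oracle whose answers
  are empty.\<close>

primrec simI :: "instr => mach => mach" where
 "simI (Const r v) S = ((r, v) # fst S, snd S)"
| "simI (Add r a b) S = ((r, look (fst S) a + look (fst S) b) # fst S, snd S)"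
| "simI (Sub r a b) S = ((r, look (fst S) a - look (fst S) b) # fst S, snd S)"
| "simI (Half r a) S = ((r, look (fst S) a div 2) # fst S, snd S)"
| "simI (Load r a) S = ((r, look (fst S) (look (fst S) a)) # fst S, snd S)"
| "simI (Store r a) S = ((look (fst S) r, look (fst S) a) # fst S, snd S)"
| "simI (InLen r) S = ((r, length (snd S)) # fst S, snd S)"
| "simI (Input r a) S = ((r, nthd 0 (snd S) (look (fst S) a)) # fst S, snd S)"
| "simI (Query r l t) S = S"

lemma simI_correct:
 assumes "mem s = look (fst S)" "snd S = x"
 shows "mem (do_instr (%_. []) x i s) = look (fst (simI i S))" "snd (simI i S) = x"
  "steps s + 1 \<le> steps (do_instr (%_. []) x i s)" "length (fst (simI i S)) \<le> length (fst S) + 1"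
 using assms by (cases i; auto simp: look_Cons Let_def nthd_def write_block_def)+

text \<open>Hard-wiring one argument of a polynomial-time function costs the same for all its values
  if these have equal size. This makes the simulation bounds independent of the constants in a
  program.\<close>

lemma FP_spec:
 fixes f :: "'a::enc \<times> 'b::enc => 'c::enc"
 assumes "FP f" "!!a a' :: 'a. esz a = esz a'"
 shows "\<exists>T. polyb T \<and> mono T \<and> (\<forall>a. \<exists>e. \<forall>S. cft e (%S. f (a, S)) S (T (esz S)))"
proof -
 obtain e T where "FPw e T f" using assms(1) unfolding FP_def by blast
 note T = FPwD[OF this]
 obtain n where n: "!!a::'a. esz a = n" using assms(2) by metis
 let ?T = "%k. n + 1 + 1 + T (n + k + 1) + 1"
 have "cft (Cmp (Pr (kv (enc a)) Id) e) (%S. f (a, S)) S (?T (esz S))" for a S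
 proof -
  have "cft (kv (enc a)) (%S. a) S n" using ev_kv[of "enc a" "enc S"] by (intro cftI) (auto simp: n)
  moreover have "cft Id (%S. S) S 1" by (rule cftI[OF ev_Id]) simp
  ultimately have "cft (Pr (kv (enc a)) Id) (%S. (a, S)) S (n + 1 + 1)" by (rule cft_Pr)
  moreover have "cft e f (a, S) (T (n + esz S + 1))" using T(3)[of "(a, S)"] by (simp add: n add_ac)
  ultimately show ?thesis by (rule cft_Cmp)
 qed
 moreover have "polyb (%k. n + k + 1)" by (intro polyb_add polyb_const polyb_id)
 then have "polyb ?T" by (intro polyb_add polyb_const polyb_id polyb_comp[OF T(1) _ T(2)])
 moreover have "mono ?T" by (intro monoI add_mono order_refl monoD[OF T(2)]) simp_all
 ultimately show ?thesis by blast
qed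

text \<open>All instructions are instances of one function \<open>g\<close> of an opcode and three
  operands, so one application of \<open>FP_spec\<close> bounds them uniformly.\<close>

lemma simI_FP: "\<exists>T. polyb T \<and> mono T \<and> (\<forall>i. \<exists>e. \<forall>S. cft e (simI i) S (T (esz S)))"
proof -
 define g :: "nat => (nat \<times> nat \<times> nat) \<times> mach => mach" where
  "g n p = (let r = fst (fst p); a = fst (snd (fst p)); b = snd (snd (fst p)); S = snd p in
    if n = 0 then ((r, a) # fst S, snd S)
    else if n = 1 then ((r, look (fst S) a + look (fst S) b) # fst S, snd S)
    else if n = 2 then ((r, look (fst S) a - look (fst S) b) # fst S, snd S)
    else if n = 3 then ((r, look (fst S) a div 2) # fst S, snd S)
    else if n = 4 then ((r, look (fst S) (look (fst S) a)) # fst S, snd S)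
    else if n = 5 then ((look (fst S) r, look (fst S) a) # fst S, snd S)
    else if n = 6 then ((r, length (snd S)) # fst S, snd S)
    else if n = 7 then ((r, nthd 0 (snd S) (look (fst S) a)) # fst S, snd S)
    else S)" for n p
 have g: "FP (%p. g (fst (fst p)) (snd (fst p), snd p))"
  unfolding g_def Let_def fst_conv snd_conv by (intro FP_rules FP_look)
 have sz: "esz a = esz a'" for a a' :: "nat \<times> nat \<times> nat \<times> nat" by (cases a; cases a') simp
 from FP_spec[OF g sz] obtain T where T: "polyb T" "mono T"
  "!!a. \<exists>e. \<forall>S. cft e (%S. g (fst a) (snd a, S)) S (T (esz S))" unfolding fst_conv snd_conv by blast
 have "\<exists>a. simI i = (%S. g (fst a) (snd a, S))" for i
 proof (cases i)
  case (Const r v) then show ?thesis by (intro exI[of _ "(0, r, v, 0)"]) (auto simp: g_def fun_eq_iff)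
 next
  case (Add r a b) then show ?thesis by (intro exI[of _ "(1, r, a, b)"]) (auto simp: g_def fun_eq_iff)
 next
  case (Sub r a b) then show ?thesis by (intro exI[of _ "(2, r, a, b)"]) (auto simp: g_def fun_eq_iff)
 next
  case (Half r a) then show ?thesis by (intro exI[of _ "(3, r, a, 0)"]) (auto simp: g_def fun_eq_iff)
 next
  case (Load r a) then show ?thesis by (intro exI[of _ "(4, r, a, 0)"]) (auto simp: g_def fun_eq_iff)
 next
  case (Store r a) then show ?thesis by (intro exI[of _ "(5, r, a, 0)"]) (auto simp: g_def fun_eq_iff)
 next
  case (InLen r) then show ?thesis by (intro exI[of _ "(6, r, 0, 0)"]) (auto simp: g_def fun_eq_iff)
 next
  case (Input r a) then show ?thesis by (intro exI[of _ "(7, r, a, 0)"]) (auto simp: g_def fun_eq_iff)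
 next
  case (Query r l t) then show ?thesis by (intro exI[of _ "(8, 0, 0, 0)"]) (auto simp: g_def fun_eq_iff)
 qed
 then show ?thesis using T by metis
qed

lemma test_FP: "\<exists>T. polyb T \<and> mono T \<and> (\<forall>r. \<exists>e. \<forall>S :: mach. cft e (%S. look (fst S) r) S (T (esz S)))"
proof -
 have "FP (%p :: nat \<times> mach. look (fst (snd p)) (fst p))" by (intro FP_rules FP_look)
 moreover have "esz a = esz a'" for a a' :: nat by simp
 ultimately show ?thesis using FP_spec[of "%p :: nat \<times> mach. look (fst (snd p)) (fst p)"] unfolding fst_conv snd_conv by blast
qed

lemma esz_mach: "esz (S :: mach) \<le> 4 * length (fst S) + 2 * length (snd S) + 3"
proof -
 have "esz (fst S) \<le> 1 + length (fst S) * (1 + 3)" by (rule esz_list_le) simp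
 moreover have "esz (snd S) \<le> 1 + length (snd S) * (1 + 1)" by (rule esz_list_le) simp
 ultimately show ?thesis by simp
qed

text \<open>\<open>d\<close> bounds the number of simulated steps. The memory list grows by at most
  one entry per step, so its length stays below \<open>L\<close> and each step costs at most the
  bound for length \<open>L\<close>. The spare unit in \<open>t + 1\<close> pays for joining
  subterms. The term is fixed by an equation so that the induction hypothesis for a loop speaks of
  the same loop term.\<close>

lemma simulate_aux:
 assumes I: "mono T" "!!i S. cft (eI i) (simI i) S (T (esz S))"
  and R: "mono U" "!!r S. cft (eR r) (%S :: mach. look (fst S) r) S (U (esz S))"
 shows "exec (%_. []) x p s s' ==>
  \<forall>e. (e = rec_prog eI (%_ _ a b. Cmp a b) (%r _ _ a b. If (eR r) a b) (%r _ a. Whl (eR r) a) p -->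
  (\<forall>S. mem s = look (fst S) --> snd S = x -->
   (\<exists>S' d. mem s' = look (fst S') \<and> snd S' = x \<and> length (fst S') \<le> length (fst S) + d \<and> 1 \<le> d \<and> steps s + d \<le> steps s' \<and>
    (\<forall>L \<ge> length (fst S) + d. \<exists>t. pev e (enc S) t (enc S') \<and>
     t + 1 \<le> d * (T (4 * L + 2 * length x + 3) + U (4 * L + 2 * length x + 3) + 2)))))"
proof (induction rule: exec.induct)
 case (Do i s)
 show ?case
 proof (intro allI impI)
  fix e S assume S: "mem s = look (fst S)" "snd S = x"
   and e: "e = rec_prog eI (%_ _ a b. Cmp a b) (%r _ _ a b. If (eR r) a b) (%r _ a. Whl (eR r) a) (Do i)"
  note c = simI_correct[OF S, of i]
  have "\<exists>t. pev e (enc S) t (enc (simI i S)) \<and> t + 1 \<le> 1 * (T (4 * L + 2 * length x + 3) + U (4 * L + 2 * length x + 3) + 2)"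
   if "L \<ge> length (fst S) + 1" for L
  proof -
   obtain t where t: "t \<le> T (esz S)" "pev (eI i) (enc S) t (enc (simI i S))" using I(2)[of i S] by (auto simp: cft_def)
   have "T (esz S) \<le> T (4 * L + 2 * length x + 3)" using esz_mach[of S] that S by (intro monoD[OF I(1)]) simp
   then show ?thesis using t e by (intro exI[of _ t]) simp
  qed
  then show "\<exists>S' d. mem (do_instr (%_. []) x i s) = look (fst S') \<and> snd S' = x \<and> length (fst S') \<le> length (fst S) + d \<and> 1 \<le> d \<and>
    steps s + d \<le> steps (do_instr (%_. []) x i s) \<and>
    (\<forall>L \<ge> length (fst S) + d. \<exists>t. pev e (enc S) t (enc S') \<and>
     t + 1 \<le> d * (T (4 * L + 2 * length x + 3) + U (4 * L + 2 * length x + 3) + 2))"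
   using c by (intro exI[of _ "simI i S"] exI[of _ 1]) auto
 qed
next
 case (Seq p s s1 q s2)
 show ?case
 proof (intro allI impI)
  fix e S assume S: "mem s = look (fst S)" "snd S = x"
   and e: "e = rec_prog eI (%_ _ a b. Cmp a b) (%r _ _ a b. If (eR r) a b) (%r _ a. Whl (eR r) a) (Seq p q)"
  let ?W = "%L. T (4 * L + 2 * length x + 3) + U (4 * L + 2 * length x + 3) + 2"
  obtain a b where ab: "a = rec_prog eI (%_ _ a b. Cmp a b) (%r _ _ a b. If (eR r) a b) (%r _ a. Whl (eR r) a) p"
   "b = rec_prog eI (%_ _ a b. Cmp a b) (%r _ _ a b. If (eR r) a b) (%r _ a. Whl (eR r) a) q" by blast
  from Seq.IH(1)[rule_format, OF ab(1) S] obtain S1 d1 where 1: "mem s1 = look (fst S1)" "snd S1 = x" "length (fst S1) \<le> length (fst S) + d1" "1 \<le> d1"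
   "steps s + d1 \<le> steps s1" "!!L. L \<ge> length (fst S) + d1 ==> \<exists>t. pev a (enc S) t (enc S1) \<and> t + 1 \<le> d1 * ?W L" by blast
  from Seq.IH(2)[rule_format, OF ab(2) 1(1,2)] obtain S2 d2 where 2: "mem s2 = look (fst S2)" "snd S2 = x" "length (fst S2) \<le> length (fst S1) + d2" "1 \<le> d2"
   "steps s1 + d2 \<le> steps s2" "!!L. L \<ge> length (fst S1) + d2 ==> \<exists>t. pev b (enc S1) t (enc S2) \<and> t + 1 \<le> d2 * ?W L" by blast
  have "\<exists>t. pev e (enc S) t (enc S2) \<and> t + 1 \<le> (d1 + d2) * ?W L" if "L \<ge> length (fst S) + (d1 + d2)" for L
  proof -
   from 1(6)[of L] 2(6)[of L] that 1(3) obtain t1 t2 where t: "pev a (enc S) t1 (enc S1)" "t1 + 1 \<le> d1 * ?W L"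
    "pev b (enc S1) t2 (enc S2)" "t2 + 1 \<le> d2 * ?W L" by auto
   then show ?thesis using ev_Cmp[OF t(1,3)] unfolding e by (intro exI[of _ "t1 + t2 + 1"]) (simp add: ab distrib_right)
  qed
  then show "\<exists>S' d. mem s2 = look (fst S') \<and> snd S' = x \<and> length (fst S') \<le> length (fst S) + d \<and> 1 \<le> d \<and> steps s + d \<le> steps s2 \<and>
    (\<forall>L \<ge> length (fst S) + d. \<exists>t. pev e (enc S) t (enc S') \<and> t + 1 \<le> d * ?W L)"
   using 1 2 by (intro exI[of _ S2] exI[of _ "d1 + d2"]) auto
 qed
next
 case (IfTrue s r p s1 q)
 show ?case
 proof (intro allI impI)
  fix e S assume S: "mem s = look (fst S)" "snd S = x"
   and e: "e = rec_prog eI (%_ _ a b. Cmp a b) (%r _ _ a b. If (eR r) a b) (%r _ a. Whl (eR r) a) (IfNz r p q)"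
  let ?W = "%L. T (4 * L + 2 * length x + 3) + U (4 * L + 2 * length x + 3) + 2"
  obtain a where a: "a = rec_prog eI (%_ _ a b. Cmp a b) (%r _ _ a b. If (eR r) a b) (%r _ a. Whl (eR r) a) p" by blast
  have S': "mem (tick 1 s) = look (fst S)" using S by simp
  from IfTrue.IH[rule_format, OF a S' S(2)] obtain S1 d1 where 1: "mem s1 = look (fst S1)" "snd S1 = x" "length (fst S1) \<le> length (fst S) + d1" "1 \<le> d1"
   "steps (tick 1 s) + d1 \<le> steps s1" "!!L. L \<ge> length (fst S) + d1 ==> \<exists>t. pev a (enc S) t (enc S1) \<and> t + 1 \<le> d1 * ?W L" by blast
  have "\<exists>t. pev e (enc S) t (enc S1) \<and> t + 1 \<le> (1 + d1) * ?W L" if L: "L \<ge> length (fst S) + (1 + d1)" for L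
  proof -
   from 1(6)[of L] L obtain t1 where t: "pev a (enc S) t1 (enc S1)" "t1 + 1 \<le> d1 * ?W L" by auto
   from R(2)[of r S] obtain u where u: "u \<le> U (esz S)" "pev (eR r) (enc S) u (A (look (fst S) r))" by (auto simp: cft_def)
   have "U (esz S) \<le> U (4 * L + 2 * length x + 3)" using esz_mach[of S] L S by (intro monoD[OF R(1)]) simp
   moreover have "pev e (enc S) (u + t1 + 1) (enc S1)"
    unfolding e using ev_IfT[OF u(2) _ t(1)] IfTrue.hyps(1) S by (simp add: a)
   ultimately show ?thesis using t u by (intro exI[of _ "u + t1 + 1"]) simp
  qed
  then show "\<exists>S' d. mem s1 = look (fst S') \<and> snd S' = x \<and> length (fst S') \<le> length (fst S) + d \<and> 1 \<le> d \<and> steps s + d \<le> steps s1 \<and>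
    (\<forall>L \<ge> length (fst S) + d. \<exists>t. pev e (enc S) t (enc S') \<and> t + 1 \<le> d * ?W L)"
   using 1 by (intro exI[of _ S1] exI[of _ "1 + d1"]) auto
 qed
next
 case (IfFalse s r q s1 p)
 show ?case
 proof (intro allI impI)
  fix e S assume S: "mem s = look (fst S)" "snd S = x"
   and e: "e = rec_prog eI (%_ _ a b. Cmp a b) (%r _ _ a b. If (eR r) a b) (%r _ a. Whl (eR r) a) (IfNz r p q)"
  let ?W = "%L. T (4 * L + 2 * length x + 3) + U (4 * L + 2 * length x + 3) + 2"
  obtain a where a: "a = rec_prog eI (%_ _ a b. Cmp a b) (%r _ _ a b. If (eR r) a b) (%r _ a. Whl (eR r) a) q" by blast
  have S': "mem (tick 1 s) = look (fst S)" using S by simp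
  from IfFalse.IH[rule_format, OF a S' S(2)] obtain S1 d1 where 1: "mem s1 = look (fst S1)" "snd S1 = x" "length (fst S1) \<le> length (fst S) + d1" "1 \<le> d1"
   "steps (tick 1 s) + d1 \<le> steps s1" "!!L. L \<ge> length (fst S) + d1 ==> \<exists>t. pev a (enc S) t (enc S1) \<and> t + 1 \<le> d1 * ?W L" by blast
  have "\<exists>t. pev e (enc S) t (enc S1) \<and> t + 1 \<le> (1 + d1) * ?W L" if L: "L \<ge> length (fst S) + (1 + d1)" for L
  proof -
   from 1(6)[of L] L obtain t1 where t: "pev a (enc S) t1 (enc S1)" "t1 + 1 \<le> d1 * ?W L" by auto
   from R(2)[of r S] obtain u where u: "u \<le> U (esz S)" "pev (eR r) (enc S) u (A 0)"
    using IfFalse.hyps(1) S by (auto simp: cft_def)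
   have "U (esz S) \<le> U (4 * L + 2 * length x + 3)" using esz_mach[of S] L S by (intro monoD[OF R(1)]) simp
   moreover have "pev e (enc S) (u + t1 + 1) (enc S1)"
    unfolding e using ev_IfF[OF u(2) t(1)] by (simp add: a)
   ultimately show ?thesis using t u by (intro exI[of _ "u + t1 + 1"]) simp
  qed
  then show "\<exists>S' d. mem s1 = look (fst S') \<and> snd S' = x \<and> length (fst S') \<le> length (fst S) + d \<and> 1 \<le> d \<and> steps s + d \<le> steps s1 \<and>
    (\<forall>L \<ge> length (fst S) + d. \<exists>t. pev e (enc S) t (enc S') \<and> t + 1 \<le> d * ?W L)"
   using 1 by (intro exI[of _ S1] exI[of _ "1 + d1"]) auto
 qed
next
 case (WhileFalse s r p)
 show ?case
 proof (intro allI impI)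
  fix e S assume S: "mem s = look (fst S)" "snd S = x"
   and e: "e = rec_prog eI (%_ _ a b. Cmp a b) (%r _ _ a b. If (eR r) a b) (%r _ a. Whl (eR r) a) (WhileNz r p)"
  let ?W = "%L. T (4 * L + 2 * length x + 3) + U (4 * L + 2 * length x + 3) + 2"
  have "\<exists>t. pev e (enc S) t (enc S) \<and> t + 1 \<le> 1 * ?W L" if L: "L \<ge> length (fst S) + 1" for L
  proof -
   from R(2)[of r S] obtain u where u: "u \<le> U (esz S)" "pev (eR r) (enc S) u (A 0)"
    using WhileFalse.hyps(1) S by (auto simp: cft_def)
   have "U (esz S) \<le> U (4 * L + 2 * length x + 3)" using esz_mach[of S] L S by (intro monoD[OF R(1)]) simp
   moreover have "pev e (enc S) (u + 1) (enc S)" unfolding e using ev_WhF[OF u(2)] by simp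
   ultimately show ?thesis using u by (intro exI[of _ "u + 1"]) simp
  qed
  then show "\<exists>S' d. mem (tick 1 s) = look (fst S') \<and> snd S' = x \<and> length (fst S') \<le> length (fst S) + d \<and> 1 \<le> d \<and> steps s + d \<le> steps (tick 1 s) \<and>
    (\<forall>L \<ge> length (fst S) + d. \<exists>t. pev e (enc S) t (enc S') \<and> t + 1 \<le> d * ?W L)"
   using S by (intro exI[of _ S] exI[of _ 1]) auto
 qed
next
 case (WhileTrue s r p s1 s2)
 show ?case
 proof (intro allI impI)
  fix e S assume S: "mem s = look (fst S)" "snd S = x"
   and e: "e = rec_prog eI (%_ _ a b. Cmp a b) (%r _ _ a b. If (eR r) a b) (%r _ a. Whl (eR r) a) (WhileNz r p)"
  let ?W = "%L. T (4 * L + 2 * length x + 3) + U (4 * L + 2 * length x + 3) + 2"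
  obtain a where a: "a = rec_prog eI (%_ _ a b. Cmp a b) (%r _ _ a b. If (eR r) a b) (%r _ a. Whl (eR r) a) p" by blast
  have S': "mem (tick 1 s) = look (fst S)" using S by simp
  from WhileTrue.IH(1)[rule_format, OF a S' S(2)] obtain S1 d1 where 1: "mem s1 = look (fst S1)" "snd S1 = x" "length (fst S1) \<le> length (fst S) + d1" "1 \<le> d1"
   "steps (tick 1 s) + d1 \<le> steps s1" "!!L. L \<ge> length (fst S) + d1 ==> \<exists>t. pev a (enc S) t (enc S1) \<and> t + 1 \<le> d1 * ?W L" by blast
  from WhileTrue.IH(2)[rule_format, OF e 1(1,2)] obtain S2 d2 where 2: "mem s2 = look (fst S2)" "snd S2 = x" "length (fst S2) \<le> length (fst S1) + d2" "1 \<le> d2"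
   "steps s1 + d2 \<le> steps s2" "!!L. L \<ge> length (fst S1) + d2 ==> \<exists>t. pev e (enc S1) t (enc S2) \<and> t + 1 \<le> d2 * ?W L" by blast
  have "\<exists>t. pev e (enc S) t (enc S2) \<and> t + 1 \<le> (1 + d1 + d2) * ?W L" if L: "L \<ge> length (fst S) + (1 + d1 + d2)" for L
  proof -
   from 1(6)[of L] 2(6)[of L] L 1(3) obtain t1 t2 where t: "pev a (enc S) t1 (enc S1)" "t1 + 1 \<le> d1 * ?W L"
    "pev e (enc S1) t2 (enc S2)" "t2 + 1 \<le> d2 * ?W L" by auto
   from R(2)[of r S] obtain u where u: "u \<le> U (esz S)" "pev (eR r) (enc S) u (A (look (fst S) r))" by (auto simp: cft_def)
   have "U (esz S) \<le> U (4 * L + 2 * length x + 3)" using esz_mach[of S] L S by (intro monoD[OF R(1)]) simp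
   moreover have e': "e = Whl (eR r) a" unfolding e a by simp
   have "pev e (enc S) (u + t1 + t2 + 1) (enc S2)"
    using ev_WhT[OF u(2) _ t(1) t(3)[unfolded e']] WhileTrue.hyps(1) S unfolding e' by simp
   ultimately show ?thesis using t u by (intro exI[of _ "u + t1 + t2 + 1"]) (simp add: distrib_right)
  qed
  then show "\<exists>S' d. mem s2 = look (fst S') \<and> snd S' = x \<and> length (fst S') \<le> length (fst S) + d \<and> 1 \<le> d \<and> steps s + d \<le> steps s2 \<and>
    (\<forall>L \<ge> length (fst S) + d. \<exists>t. pev e (enc S) t (enc S') \<and> t + 1 \<le> d * ?W L)"
   using 1 2 by (intro exI[of _ S2] exI[of _ "1 + d1 + d2"]) auto
 qed
qed

text \<open>The bound \<open>G\<close> does not depend on the simulated program.\<close>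

lemma simulate:
 "\<exists>G. polyb G \<and> mono G \<and> (\<forall>p. \<exists>e. \<forall>x s. run p x s -->
   (\<exists>t \<le> G (steps s + length x). pev e (enc x) t (enc (mem s 0, mem s 1, mem s 2))))"
proof -
 from simI_FP obtain T where T: "polyb T" "mono T" "\<forall>i. \<exists>e. \<forall>S. cft e (simI i) S (T (esz S))" by blast
 then obtain eI where eI: "!!i S. cft (eI i) (simI i) S (T (esz S))" by metis
 from test_FP obtain U where U: "polyb U" "mono U" "\<forall>r. \<exists>e. \<forall>S :: mach. cft e (%S. look (fst S) r) S (U (esz S))" by blast
 then obtain eR where eR: "!!r S. cft (eR r) (%S :: mach. look (fst S) r) S (U (esz S))" by metis
 have "FP (%S :: mach. (look (fst S) 0, look (fst S) 1, look (fst S) 2))" by (intro FP_rules FP_look)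
 then obtain eo O' where "FPw eo O' (%S :: mach. (look (fst S) 0, look (fst S) 1, look (fst S) 2))" unfolding FP_def by blast
 note O = FPwD[OF this]
 let ?n = "%n. 6 * n + 3"
 let ?G = "%n. (1 + 1 + 1) + n * (T (?n n) + U (?n n) + 2) + 1 + O' (?n n) + 1"
 have pn: "polyb ?n" by (intro polyb_add polyb_mult polyb_const polyb_id)
 have pG: "polyb ?G" by (intro polyb_add polyb_mult polyb_const polyb_id polyb_comp[OF T(1) pn T(2)] polyb_comp[OF U(1) pn U(2)] polyb_comp[OF O(1) pn O(2)])
 have mG: "mono ?G" by (intro monoI add_mono mult_mono order_refl monoD[OF T(2)] monoD[OF U(2)] monoD[OF O(2)]) simp_all
 have "\<exists>e. \<forall>x s. run p x s --> (\<exists>t \<le> ?G (steps s + length x). pev e (enc x) t (enc (mem s 0, mem s 1, mem s 2)))" for p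
 proof -
  obtain e where e: "e = rec_prog eI (%_ _ a b. Cmp a b) (%r _ _ a b. If (eR r) a b) (%r _ a. Whl (eR r) a) p" by blast
  have "\<exists>t \<le> ?G (steps s + length x). pev (Cmp (Cmp (Pr (K 0) Id) e) eo) (enc x) t (enc (mem s 0, mem s 1, mem s 2))" if "run p x s" for x s
  proof -
   have ex: "exec (%_. []) x p init s" using that by (simp add: run_def)
   have i: "mem init = look (fst ([], x))" "snd ([], x) = x" by (auto simp: init_def look_Nil)
   from simulate_aux[OF T(2) eI U(2) eR ex, rule_format, OF e i] obtain S d where S: "mem s = look (fst S)" "snd S = x"
    "length (fst S) \<le> d" "steps init + d \<le> steps s"
    "!!L. L \<ge> d ==> \<exists>t. pev e (enc ([] :: (nat \<times> nat) list, x)) t (enc S) \<and> t + 1 \<le> d * (T (4 * L + 2 * length x + 3) + U (4 * L + 2 * length x + 3) + 2)"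
    by auto
   let ?N = "steps s + length x"
   from S(5)[of d] obtain t where t: "pev e (enc ([] :: (nat \<times> nat) list, x)) t (enc S)"
    "t + 1 \<le> d * (T (4 * d + 2 * length x + 3) + U (4 * d + 2 * length x + 3) + 2)" by auto
   have "d * (T (4 * d + 2 * length x + 3) + U (4 * d + 2 * length x + 3) + 2) \<le> ?N * (T (?n ?N) + U (?n ?N) + 2)"
    using S(4) by (intro mult_mono add_mono monoD[OF T(2)] monoD[OF U(2)]) auto
   then have t1: "t \<le> ?N * (T (?n ?N) + U (?n ?N) + 2)" using t(2) by linarith
   have "O' (esz S) \<le> O' (?n ?N)" using esz_mach[of S] S by (intro monoD[OF O(2)]) simp
   moreover obtain u where u: "u \<le> O' (esz S)" "pev eo (enc S) u (enc (mem s 0, mem s 1, mem s 2))"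
    using O(3)[of S] unfolding cft_def S(1) by blast
   moreover have "pev (Pr (K 0) Id) (enc x) (1 + 1 + 1) (enc ([] :: (nat \<times> nat) list, x))"
    using ev_Pr[OF ev_K ev_Id] by simp
   from ev_Cmp[OF ev_Cmp[OF this t(1)] u(2)]
   have "pev (Cmp (Cmp (Pr (K 0) Id) e) eo) (enc x) ((1 + 1 + 1 + t + 1) + u + 1) (enc (mem s 0, mem s 1, mem s 2))" .
   ultimately show ?thesis using t1 by (intro exI[of _ "(1 + 1 + 1 + t + 1) + u + 1"]) (auto simp del: One_nat_def)
  qed
  then show ?thesis by blast
 qed
 then show ?thesis using pG mG by blast
qed

section \<open>The host graph that encodes cliques\<close>

text \<open>Used twice: for the pattern edges that a copy lacks, and for the color classes that a
  vertex set misses.\<close>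

lemma sum_Pow_toggle:
 fixes f :: "'a set => rat"
 assumes "finite H" "E \<subseteq> H" "E ~= H"
 shows "(\<Sum>S\<in>Pow H. (-1) ^ card S * f (S \<inter> E)) = 0"
proof -
 obtain e where e: "e \<in> H" "e \<notin> E" using assms by blast
 define H' where "H' = H - {e}"
 have H: "H = insert e H'" "e \<notin> H'" "finite H'" using e assms(1) by (auto simp: H'_def)
 have inj: "inj_on (insert e) (Pow H')" using H(2) by (auto simp: inj_on_def)
 have "(\<Sum>S\<in>Pow H. (-1) ^ card S * f (S \<inter> E)) =
   (\<Sum>S\<in>Pow H'. (-1) ^ card S * f (S \<inter> E)) + (\<Sum>S\<in>insert e ` Pow H'. (-1) ^ card S * f (S \<inter> E))"
  unfolding H(1) Pow_insert by (rule sum.union_disjoint) (use H in auto)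
 also have "(\<Sum>S\<in>insert e ` Pow H'. (-1) ^ card S * f (S \<inter> E)) = (\<Sum>S\<in>Pow H'. (-1) ^ card (insert e S) * f (insert e S \<inter> E))"
  using inj by (simp add: sum.reindex)
 also have "\<dots> = (\<Sum>S\<in>Pow H'. - ((-1) ^ card S * f (S \<inter> E)))"
 proof (rule sum.cong)
  fix S assume "S \<in> Pow H'"
  then have "e \<notin> S" "finite S" using H finite_subset by auto
  then show "(-1) ^ card (insert e S) * f (insert e S \<inter> E) = - ((-1) ^ card S * f (S \<inter> E))" using e(2) by simp
 qed simp
 finally show ?thesis by (simp add: sum_negf)
qed

definition is_param :: "(graph => rat) => bool" where
 "is_param \<Phi> \<longleftrightarrow> (\<forall>G H. is_graph G \<and> is_graph H \<and> isomorphic G H --> \<Phi> G = \<Phi> H)"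

definition hatr :: "(graph => rat) => nat => nat set set => rat" where
 "hatr \<Phi> k H = (\<Sum>S\<in>Pow H. (-1) ^ card S * \<Phi> ({..<k}, S))"

locale gadget =
 fixes \<Phi> :: "graph => rat" and k t n :: nat and H :: "nat set set" and adj :: "nat => nat => bool"
 assumes par: "is_param \<Phi>" and H: "H \<subseteq> pairs k" and tk: "2 * t \<le> k"
  and bic: "!!i l. i < t ==> l < t ==> {i, t + l} \<in> H"
  and sym: "!!u v. adj u v ==> adj v u" and irr: "!!u. \<not> adj u u"
begin

text \<open>One more than \<open>n\<close>, so that the single copy 0 is a valid remainder even if
  \<open>n = 0\<close>.\<close>

definition M :: nat where "M = n + 1"

definition copies :: "nat => nat set" where "copies i = (if i < 2 * t then {..<n} else {0})"

text \<open>Only pairs of positions on opposite sides of the biclique are constrained: position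
  \<open>t + i\<close> must repeat the vertex chosen at \<open>i\<close> and must be adjacent to
  those chosen at the other positions of the first side.\<close>

definition rel :: "nat => nat => nat => nat => bool" where
 "rel i u j v \<longleftrightarrow> (i < t \<and> t \<le> j \<and> j < 2 * t --> (if j = t + i then u = v else adj u v)) \<and>
   (j < t \<and> t \<le> i \<and> i < 2 * t --> (if i = t + j then u = v else adj u v))"

definition vs :: "nat set => nat set" where "vs J = {i * M + u | i u. i \<in> J \<and> u \<in> copies i}"

definition adjw :: "nat set set => nat => nat => nat => nat => bool" where
 "adjw S i u j v \<longleftrightarrow> {i, j} \<in> S \<and> rel i u j v"

text \<open>The vertex \<open>i * M + u\<close> is copy \<open>u\<close> of pattern vertex
  \<open>i\<close>. \<open>S\<close> selects the pattern edges that are represented,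
  \<open>J\<close> the color classes that are present.\<close>

definition GG :: "nat set set => nat set => graph" where
 "GG S J = (vs J, {{a, b} | a b. a \<in> vs J \<and> b \<in> vs J \<and> adjw S (a div M) (a mod M) (b div M) (b mod M)})"

lemma rel_sym: "rel i u j v ==> rel j v i u"
 using sym by (auto simp: rel_def)

lemma copies_M: "u \<in> copies i ==> u < M" by (auto simp: copies_def M_def split: if_splits)
lemma code: "u < M ==> (i * M + u) div M = i" "u < M ==> (i * M + u) mod M = u" by auto

lemma vs_iff: "a \<in> vs J \<longleftrightarrow> a div M \<in> J \<and> a mod M \<in> copies (a div M)"
proof
 assume "a \<in> vs J"
 then obtain i u where "a = i * M + u" "i \<in> J" "u \<in> copies i" by (auto simp: vs_def)
 then show "a div M \<in> J \<and> a mod M \<in> copies (a div M)" using copies_M[of u i] code[of u i] by simp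
next
 assume "a div M \<in> J \<and> a mod M \<in> copies (a div M)"
 moreover have "a = (a div M) * M + a mod M" by simp
 ultimately show "a \<in> vs J" unfolding vs_def by blast
qed

lemma finite_vs: "finite J ==> finite (vs J)"
proof -
 assume "finite J"
 have "vs J = (\<Union>i\<in>J. (%u. i * M + u) ` copies i)" by (auto simp: vs_def)
 moreover have "finite (copies i)" for i by (simp add: copies_def)
 ultimately show ?thesis using \<open>finite J\<close> by simp
qed

lemma finite_H: "finite H" using H finite_pairs finite_subset by blast

lemma GG_edge: "{a, b} \<in> edges (GG S J) \<longleftrightarrow> a \<in> vs J \<and> b \<in> vs J \<and> adjw S (a div M) (a mod M) (b div M) (b mod M)"
proof -
 have "adjw S i u j v ==> adjw S j v i u" for i u j v using rel_sym by (auto simp: adjw_def insert_commute)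
 then show ?thesis by (auto simp: GG_def doubleton_eq_iff)
qed

lemma S_neq: "S \<subseteq> H ==> {i, j} \<in> S ==> i ~= j"
 using H by (fastforce simp: pairs_def)

lemma GG_graph: "finite J ==> S \<subseteq> H ==> is_graph (GG S J)"
 unfolding is_graph_def
proof (intro conjI ballI)
 fix e assume S: "S \<subseteq> H" and "e \<in> edges (GG S J)"
 then obtain a b where ab: "e = {a, b}" "a \<in> vs J" "b \<in> vs J" "adjw S (a div M) (a mod M) (b div M) (b mod M)" by (auto simp: GG_def)
 then have "a ~= b" using S_neq[OF S] by (auto simp: adjw_def)
 then show "e \<subseteq> verts (GG S J)" "card e = 2" using ab by (auto simp: GG_def)
qed (simp add: GG_def finite_vs)

text \<open>A choice \<open>g\<close> of one copy per class yields the vertex set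
  \<open>Ag g\<close>; \<open>Eg g\<close> is the set of pattern edges that these copies
  realize.\<close>

definition Ag :: "(nat => nat) => nat set" where "Ag g = (%i. i * M + g i) ` {..<k}"

definition Eg :: "(nat => nat) => nat set set" where
 "Eg g = {{i, j} | i j. {i, j} \<in> H \<and> rel i (g i) j (g j)}"

definition funs :: "(nat => nat) set" where "funs = (\<Pi>\<^sub>E i\<in>{..<k}. copies i)"

lemma Eg_iff: "{i, j} \<in> Eg g \<longleftrightarrow> {i, j} \<in> H \<and> rel i (g i) j (g j)"
 using rel_sym unfolding Eg_def by (auto simp: doubleton_eq_iff insert_commute)

lemma Ag_phi:
 assumes g: "g \<in> funs" and S: "S \<subseteq> H"
 shows "\<Phi> (induced (GG S {..<k}) (Ag g)) = \<Phi> ({..<k}, S \<inter> Eg g)"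
proof -
 have gM: "g i < M" if "i < k" for i using g that copies_M[of "g i" i] by (auto simp: funs_def PiE_def Pi_def)
 have gc: "g i \<in> copies i" if "i < k" for i using g that by (auto simp: funs_def PiE_def Pi_def)
 let ?c = "%i. i * M + g i"
 have inj: "inj_on ?c {..<k}" using gM code(1) by (intro inj_onI) (metis lessThan_iff)
 have Sk: "i < k \<and> j < k" if "{i, j} \<in> S" for i j using that S H by (auto simp: pairs_def)
 have e: "edges (induced (GG S {..<k}) (Ag g)) = (`) ?c ` (S \<inter> Eg g)"
 proof (intro equalityI subsetI)
  fix x assume "x \<in> edges (induced (GG S {..<k}) (Ag g))"
  then obtain a b where ab: "x = {a, b}" "{a, b} \<in> edges (GG S {..<k})" "a \<in> Ag g" "b \<in> Ag g"
   by (auto simp: induced_def GG_def)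
  then obtain i j where ij: "i < k" "j < k" "a = ?c i" "b = ?c j" by (auto simp: Ag_def)
  have "{i, j} \<in> S" "rel i (g i) j (g j)" using ab(2) code gM ij by (auto simp: GG_edge adjw_def)
  then have "{i, j} \<in> S \<inter> Eg g" using S by (auto simp: Eg_iff)
  moreover have "x = ?c ` {i, j}" using ab ij by auto
  ultimately show "x \<in> (`) ?c ` (S \<inter> Eg g)" by blast
 next
  fix x assume "x \<in> (`) ?c ` (S \<inter> Eg g)"
  then obtain d where d: "d \<in> S" "d \<in> Eg g" "x = ?c ` d" by blast
  then obtain i j where ij: "d = {i, j}" by (auto simp: Eg_def)
  have lt: "i < k" "j < k" using Sk d ij by auto
  have "rel i (g i) j (g j)" using d ij by (auto simp: Eg_iff)
  moreover have "(i * M + g i) div M = i" "(i * M + g i) mod M = g i" "(j * M + g j) div M = j" "(j * M + g j) mod M = g j"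
   using code gM lt by blast+
  ultimately have "{?c i, ?c j} \<in> edges (GG S {..<k})" using lt gc d ij by (simp add: GG_edge adjw_def vs_iff)
  then show "x \<in> edges (induced (GG S {..<k}) (Ag g))" using d ij lt by (auto simp: induced_def Ag_def)
 qed
 have "isomorphic ({..<k}, S \<inter> Eg g) (induced (GG S {..<k}) (Ag g))"
  unfolding isomorphic_def
 proof (intro exI conjI)
  show "bij_betw ?c (verts ({..<k}, S \<inter> Eg g)) (verts (induced (GG S {..<k}) (Ag g)))"
   using inj by (auto simp: bij_betw_def induced_def Ag_def)
  show "edges (induced (GG S {..<k}) (Ag g)) = (`) ?c ` edges ({..<k}, S \<inter> Eg g)" using e by simp
 qed
 moreover have "is_graph ({..<k}, S \<inter> Eg g)" using S H by (auto simp: is_graph_def pairs_def)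
 moreover have "is_graph (induced (GG S {..<k}) (Ag g))"
  using GG_graph[OF finite_lessThan S, of k] by (auto simp: is_graph_def induced_def Ag_def)
 ultimately show ?thesis using par unfolding is_param_def by metis
qed

text \<open>A set of \<open>k\<close> vertices that meets all \<open>k\<close> classes has exactly
  one vertex in each, so it is a choice function.\<close>

lemma colorful_bij:
 "bij_betw Ag funs {A. A \<subseteq> vs {..<k} \<and> card A = k \<and> (%v. v div M) ` A = {..<k}}"
 unfolding bij_betw_def
proof
 have gM: "g i < M" if "g \<in> funs" "i < k" for g i using that copies_M[of "g i" i] by (auto simp: funs_def PiE_def Pi_def)
 show "inj_on Ag funs"
 proof (rule inj_onI)
  fix g h assume gh: "g \<in> funs" "h \<in> funs" "Ag g = Ag h"
  have "g i = h i" if i: "i < k" for i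
  proof -
   have "i * M + g i \<in> Ag h" using gh(3) i by (auto simp: Ag_def)
   then obtain l where l: "l < k" "i * M + g i = l * M + h l" by (auto simp: Ag_def)
   have "i = l" using code(1)[OF gM[OF gh(1) i], of i] code(1)[OF gM[OF gh(2) l(1)], of l] l(2) by simp
   then show ?thesis using l(2) by simp
  qed
  moreover have "g i = h i" if "\<not> i < k" for i using gh that by (auto simp: funs_def PiE_def extensional_def)
  ultimately show "g = h" by blast
 qed
 show "Ag ` funs = {A. A \<subseteq> vs {..<k} \<and> card A = k \<and> (%v. v div M) ` A = {..<k}}"
 proof (intro equalityI subsetI)
  fix A assume "A \<in> Ag ` funs"
  then obtain g where g: "g \<in> funs" "A = Ag g" by blast
  have gc: "g i \<in> copies i" if "i < k" for i using g that by (auto simp: funs_def PiE_def Pi_def)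
  have "A \<subseteq> vs {..<k}" using g gc by (auto simp: Ag_def vs_def)
  moreover have d: "(%v. v div M) ` A = {..<k}" using g gM code(1) by (force simp: Ag_def image_image)
  moreover have "card A = k"
  proof -
   have "card A \<le> k" unfolding g(2) Ag_def using card_image_le[of "{..<k}"] by simp
   moreover have "k \<le> card A" using card_image_le[of A "%v. v div M"] d g by (simp add: Ag_def)
   ultimately show ?thesis by simp
  qed
  ultimately show "A \<in> {A. A \<subseteq> vs {..<k} \<and> card A = k \<and> (%v. v div M) ` A = {..<k}}" by blast
 next
  fix A assume "A \<in> {A. A \<subseteq> vs {..<k} \<and> card A = k \<and> (%v. v div M) ` A = {..<k}}"
  then have A: "A \<subseteq> vs {..<k}" "card A = k" "(%v. v div M) ` A = {..<k}" by auto
  have fin: "finite A" using A(1) finite_vs finite_subset by blast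
  have inj: "inj_on (%v. v div M) A" using A by (intro eq_card_imp_inj_on fin) simp
  define g where "g i = (if i < k then (THE v. v \<in> A \<and> v div M = i) mod M else undefined)" for i
  have ga: "g (a div M) = a mod M" if "a \<in> A" for a
  proof -
   have "(THE v. v \<in> A \<and> v div M = a div M) = a" using inj that by (intro the_equality) (auto dest: inj_onD)
   moreover have "a div M < k" using A(3) that by blast
   ultimately show ?thesis by (simp add: g_def)
  qed
  have "Ag g = A"
  proof (intro equalityI subsetI)
   fix v assume "v \<in> Ag g"
   then obtain i where i: "i < k" "v = i * M + g i" by (auto simp: Ag_def)
   then obtain a where a: "a \<in> A" "i = a div M" using A(3) by blast
   then have "v = a" using i ga by simp
   then show "v \<in> A" using a by simp
  next
   fix a assume a: "a \<in> A"
   then have "a div M < k" using A(3) by blast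
   moreover have "a = (a div M) * M + g (a div M)" using ga[OF a] by simp
   ultimately show "a \<in> Ag g" unfolding Ag_def by blast
  qed
  moreover have "g \<in> funs"
  proof -
   have "g i \<in> copies i" if ik: "i < k" for i
   proof -
    obtain a where a: "a \<in> A" "i = a div M" using A(3) ik by blast
    then show ?thesis using ga A(1) by (auto simp: vs_iff)
   qed
   then show ?thesis by (auto simp: funs_def g_def PiE_def extensional_def)
  qed
  ultimately show "A \<in> Ag ` funs" by blast
 qed
qed

lemma cp_sum: "S \<subseteq> H ==> num_cpIndSub \<Phi> ({..<k}, H) (GG S {..<k}) (%v. v div M) = (\<Sum>g\<in>funs. \<Phi> ({..<k}, S \<inter> Eg g))"
proof -
 assume S: "S \<subseteq> H"
 have "num_cpIndSub \<Phi> ({..<k}, H) (GG S {..<k}) (%v. v div M) =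
   (\<Sum>A | A \<subseteq> vs {..<k} \<and> card A = k \<and> (%v. v div M) ` A = {..<k}. \<Phi> (induced (GG S {..<k}) A))"
  by (simp add: num_cpIndSub_def GG_def)
 also have "\<dots> = (\<Sum>g\<in>funs. \<Phi> (induced (GG S {..<k}) (Ag g)))"
  by (rule sum.reindex_bij_betw[OF colorful_bij, symmetric])
 also have "\<dots> = (\<Sum>g\<in>funs. \<Phi> ({..<k}, S \<inter> Eg g))" by (rule sum.cong) (auto simp: Ag_phi S)
 finally show ?thesis .
qed

definition sols :: "(nat => nat) set" where "sols = {g \<in> funs. Eg g = H}"

lemma finite_funs: "finite funs" unfolding funs_def by (intro finite_PiE) (auto simp: copies_def)

text \<open>After exchanging the sums, a choice that misses an edge of \<open>H\<close> contributes
  0 by \<open>sum_Pow_toggle\<close>, and one that realizes all of \<open>H\<close> contributes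
  \<open>hatr\<close>.\<close>

lemma cp_total:
 "(\<Sum>S\<in>Pow H. (-1) ^ card S * num_cpIndSub \<Phi> ({..<k}, H) (GG S {..<k}) (%v. v div M)) = hatr \<Phi> k H * of_nat (card sols)"
proof -
 have "(\<Sum>S\<in>Pow H. (-1) ^ card S * num_cpIndSub \<Phi> ({..<k}, H) (GG S {..<k}) (%v. v div M)) =
   (\<Sum>S\<in>Pow H. \<Sum>g\<in>funs. (-1) ^ card S * \<Phi> ({..<k}, S \<inter> Eg g))"
  by (rule sum.cong) (auto simp: cp_sum sum_distrib_left)
 also have "\<dots> = (\<Sum>g\<in>funs. \<Sum>S\<in>Pow H. (-1) ^ card S * \<Phi> ({..<k}, S \<inter> Eg g))" by (rule sum.swap)
 also have "\<dots> = (\<Sum>g\<in>funs. if Eg g = H then hatr \<Phi> k H else 0)"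
 proof (rule sum.cong)
  fix g
  have EgH: "Eg g \<subseteq> H" by (auto simp: Eg_def)
  show "(\<Sum>S\<in>Pow H. (-1) ^ card S * \<Phi> ({..<k}, S \<inter> Eg g)) = (if Eg g = H then hatr \<Phi> k H else 0)"
  proof (cases "Eg g = H")
   case True
   have "(\<Sum>S\<in>Pow H. (-1) ^ card S * \<Phi> ({..<k}, S \<inter> H)) = hatr \<Phi> k H"
    unfolding hatr_def by (rule sum.cong) (auto simp: Int_absorb2)
   then show ?thesis using True by simp
  next
   case False
   then show ?thesis using sum_Pow_toggle[OF finite_H EgH False, of "%X. \<Phi> ({..<k}, X)"] by simp
  qed
 qed simp
 also have "\<dots> = hatr \<Phi> k H * of_nat (card sols)"
 proof -
  have "(\<Sum>g\<in>funs. if Eg g = H then hatr \<Phi> k H else 0) = (\<Sum>g\<in>sols. hatr \<Phi> k H)"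
   unfolding sols_def using sum.inter_filter[OF finite_funs, of "%_. hatr \<Phi> k H" "%g. Eg g = H"] by simp
  then show ?thesis by simp
 qed
 finally show ?thesis .
qed

text \<open>Inclusion-exclusion over the deleted classes \<open>R\<close> leaves the vertex sets
  that meet every class, which simulates the coloring by uncolored counts.\<close>

lemma indsub_total:
 assumes S: "S \<subseteq> H"
 shows "(\<Sum>R\<in>Pow {..<k}. (-1) ^ card R * num_IndSub \<Phi> k (GG S ({..<k} - R))) = num_cpIndSub \<Phi> ({..<k}, H) (GG S {..<k}) (%v. v div M)"
proof -
 let ?F = "%A. \<Phi> (induced (GG S {..<k}) A)"
 let ?AA = "{A. A \<subseteq> vs {..<k} \<and> card A = k}"
 let ?c = "%A. (%v. v div M) ` A"
 have fin: "finite ?AA" by (rule finite_subset[of _ "Pow (vs {..<k})"]) (auto simp: finite_vs)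
 have ind: "num_IndSub \<Phi> k (GG S ({..<k} - R)) = (\<Sum>A\<in>?AA. if R \<inter> ?c A = {} then ?F A else 0)" for R
 proof -
  have sub: "A \<subseteq> vs ({..<k} - R) \<longleftrightarrow> A \<subseteq> vs {..<k} \<and> R \<inter> ?c A = {}" for A by (auto simp: vs_iff subset_iff)
  have "num_IndSub \<Phi> k (GG S ({..<k} - R)) = (\<Sum>A | A \<subseteq> vs ({..<k} - R) \<and> card A = k. \<Phi> (induced (GG S ({..<k} - R)) A))"
   by (simp add: num_IndSub_def GG_def)
  also have "\<dots> = (\<Sum>A | A \<subseteq> vs ({..<k} - R) \<and> card A = k. ?F A)"
  proof (rule sum.cong)
   fix A assume "A \<in> {A. A \<subseteq> vs ({..<k} - R) \<and> card A = k}"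
   then have A: "A \<subseteq> vs ({..<k} - R)" "A \<subseteq> vs {..<k}" using sub by auto
   have "{e \<in> edges (GG S ({..<k} - R)). e \<subseteq> A} = {e \<in> edges (GG S {..<k}). e \<subseteq> A}"
    using A unfolding GG_def snd_conv by blast
   then show "\<Phi> (induced (GG S ({..<k} - R)) A) = ?F A" by (simp add: induced_def)
  qed simp
  also have "\<dots> = (\<Sum>A\<in>{A \<in> ?AA. R \<inter> ?c A = {}}. ?F A)" by (rule sum.cong) (auto simp: sub)
  also have "\<dots> = (\<Sum>A\<in>?AA. if R \<inter> ?c A = {} then ?F A else 0)" by (rule sum.inter_filter[OF fin])
  finally show ?thesis .
 qed
 have "(\<Sum>R\<in>Pow {..<k}. (-1) ^ card R * num_IndSub \<Phi> k (GG S ({..<k} - R))) =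
   (\<Sum>R\<in>Pow {..<k}. \<Sum>A\<in>?AA. (-1) ^ card R * (if R \<inter> ?c A = {} then ?F A else 0))"
  by (simp add: ind sum_distrib_left)
 also have "\<dots> = (\<Sum>A\<in>?AA. \<Sum>R\<in>Pow {..<k}. (-1) ^ card R * (if R \<inter> ?c A = {} then ?F A else 0))" by (rule sum.swap)
 also have "\<dots> = (\<Sum>A\<in>?AA. if ?c A = {..<k} then ?F A else 0)"
 proof (rule sum.cong)
  fix A assume "A \<in> ?AA"
  then have cA: "?c A \<subseteq> {..<k}" by (auto simp: vs_iff)
  show "(\<Sum>R\<in>Pow {..<k}. (-1) ^ card R * (if R \<inter> ?c A = {} then ?F A else 0)) = (if ?c A = {..<k} then ?F A else 0)"
  proof (cases "?c A = {..<k}")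
   case True
   have "(\<Sum>R\<in>Pow {..<k}. (-1) ^ card R * (if R \<inter> ?c A = {} then ?F A else 0)) =
     (\<Sum>R\<in>Pow {..<k}. if R = {} then ?F A else 0)" unfolding True by (rule sum.cong) (auto simp: Int_absorb2)
   then show ?thesis using True by simp
  next
   case False
   then show ?thesis using sum_Pow_toggle[OF finite_lessThan cA, of "%X. if X = {} then ?F A else 0"] by simp
  qed
 qed simp
 also have "\<dots> = (\<Sum>A\<in>{A \<in> ?AA. ?c A = {..<k}}. ?F A)" by (rule sum.inter_filter[OF fin, symmetric])
 also have "\<dots> = num_cpIndSub \<Phi> ({..<k}, H) (GG S {..<k}) (%v. v div M)"
  unfolding num_cpIndSub_def by (rule sum.cong) (auto simp: GG_def)
 finally show ?thesis .
qed

definition cls :: "nat set set" where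
 "cls = {A. A \<subseteq> {..<n} \<and> card A = t \<and> (\<forall>u\<in>A. \<forall>v\<in>A. u ~= v --> adj u v)}"

definition tups :: "nat list set" where
 "tups = {xs. length xs = t \<and> set xs \<subseteq> {..<n} \<and> (\<forall>i<t. \<forall>l<t. i ~= l --> adj (xs ! i) (xs ! l))}"

text \<open>Since \<open>adj\<close> is irreflexive, the entries of a tuple are distinct, so each
  clique is counted once for each of its orderings.\<close>

lemma card_tups: "card tups = fact t * card cls"
proof -
 have "tups = (\<Union>A\<in>cls. {xs. length xs = t \<and> distinct xs \<and> set xs \<subseteq> A})"
 proof (intro equalityI subsetI)
  fix xs assume "xs \<in> tups"
  then have xs: "length xs = t" "set xs \<subseteq> {..<n}" "!!i l. i < t ==> l < t ==> i ~= l ==> adj (xs ! i) (xs ! l)" by (auto simp: tups_def)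
  have d: "distinct xs" using xs irr by (auto simp: distinct_conv_nth) metis
  have "adj u v" if "u \<in> set xs" "v \<in> set xs" "u ~= v" for u v
   using that xs(1,3) by (metis in_set_conv_nth)
  then have "set xs \<in> cls" using xs d distinct_card[OF d] by (auto simp: cls_def)
  then show "xs \<in> (\<Union>A\<in>cls. {xs. length xs = t \<and> distinct xs \<and> set xs \<subseteq> A})" using xs d by blast
 next
  fix xs assume "xs \<in> (\<Union>A\<in>cls. {xs. length xs = t \<and> distinct xs \<and> set xs \<subseteq> A})"
  then obtain A where A: "A \<in> cls" "length xs = t" "distinct xs" "set xs \<subseteq> A" by blast
  have "adj (xs ! i) (xs ! l)" if "i < t" "l < t" "i ~= l" for i l
  proof -
   have "xs ! i \<in> A" "xs ! l \<in> A" "xs ! i ~= xs ! l" using A that by (auto simp: nth_eq_iff_index_eq)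
   then show ?thesis using A(1) by (auto simp: cls_def)
  qed
  then show "xs \<in> tups" using A by (auto simp: tups_def cls_def)
 qed
 moreover have fc: "finite cls" by (rule finite_subset[of _ "Pow {..<n}"]) (auto simp: cls_def)
 have "card (\<Union>A\<in>cls. {xs. length xs = t \<and> distinct xs \<and> set xs \<subseteq> A}) = (\<Sum>A\<in>cls. card {xs. length xs = t \<and> distinct xs \<and> set xs \<subseteq> A})"
 proof (rule card_UN_disjoint[OF fc])
  have fA: "finite A" if "A \<in> cls" for A using that finite_subset by (auto simp: cls_def)
  show "\<forall>A\<in>cls. finite {xs. length xs = t \<and> distinct xs \<and> set xs \<subseteq> A}"
   using fA by (auto intro: finite_subset[OF _ finite_lists_length_eq[of _ t]])
  have sub: "set xs = A" if "A \<in> cls" "length xs = t" "distinct xs" "set xs \<subseteq> A" for xs A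
   using that fA[OF that(1)] distinct_card[of xs] by (intro card_subset_eq) (auto simp: cls_def)
  show "\<forall>A\<in>cls. \<forall>B\<in>cls. A ~= B --> {xs. length xs = t \<and> distinct xs \<and> set xs \<subseteq> A} \<inter> {xs. length xs = t \<and> distinct xs \<and> set xs \<subseteq> B} = {}"
   using sub by blast
 qed
 moreover have "card {xs. length xs = t \<and> distinct xs \<and> set xs \<subseteq> A} = fact t" if "A \<in> cls" for A
 proof -
  have "finite A" "card A = t" using that finite_subset by (auto simp: cls_def)
  then show ?thesis using card_lists_distinct_length_eq[of A t] by (simp add: fact_prod)
 qed
 ultimately show ?thesis by simp
qed

text \<open>The biclique edges force the second side to repeat the first and the vertices of the
  first side to be pairwise adjacent. All other pattern edges hold for every choice.\<close>

lemma sols_iff: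
 assumes "g \<in> funs"
 shows "Eg g = H \<longleftrightarrow> (\<forall>i<t. g (t + i) = g i) \<and> (\<forall>i<t. \<forall>l<t. i ~= l --> adj (g i) (g l))"
proof
 assume e: "Eg g = H"
 have r: "rel i (g i) (t + l) (g (t + l))" if "i < t" "l < t" for i l using bic[OF that] e Eg_iff by blast
 have "g (t + i) = g i" if "i < t" for i using r[OF that that] that by (simp add: rel_def)
 moreover have "adj (g i) (g l)" if "i < t" "l < t" "i ~= l" for i l
  using r[OF that(1,2)] that calculation by (auto simp: rel_def split: if_splits)
 ultimately show "(\<forall>i<t. g (t + i) = g i) \<and> (\<forall>i<t. \<forall>l<t. i ~= l --> adj (g i) (g l))" by blast
next
 assume a: "(\<forall>i<t. g (t + i) = g i) \<and> (\<forall>i<t. \<forall>l<t. i ~= l --> adj (g i) (g l))"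
 have r1: "if j = t + i then g i = g j else adj (g i) (g j)" if "i < t" "t \<le> j" "j < 2 * t" for i j
 proof -
  obtain l where l: "j = t + l" "l < t" using \<open>t \<le> j\<close> \<open>j < 2 * t\<close> by (metis le_Suc_ex add_less_cancel_left mult_2)
  then have "g j = g l" using a by auto
  then show ?thesis using a that(1) l by (cases "l = i") (auto simp: eq_commute)
 qed
 have r: "rel i (g i) j (g j)" for i j
  unfolding rel_def
 proof (intro conjI impI)
  assume "i < t \<and> t \<le> j \<and> j < 2 * t"
  then show "if j = t + i then g i = g j else adj (g i) (g j)" using r1[of i j] by blast
 next
  assume "j < t \<and> t \<le> i \<and> i < 2 * t"
  then show "if i = t + j then g i = g j else adj (g i) (g j)" using r1[of j i] sym[of "g j" "g i"] by (auto split: if_splits)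
 qed
 show "Eg g = H"
 proof
  show "H \<subseteq> Eg g"
  proof
   fix e assume e: "e \<in> H"
   then obtain i j where "e = {i, j}" using H by (auto simp: pairs_def card_2_iff)
   then show "e \<in> Eg g" using e r Eg_iff by auto
  qed
 qed (auto simp: Eg_def)
qed

text \<open>The inverse repeats the tuple on the second side and takes the only copy 0 at the
  remaining positions.\<close>

lemma card_sols: "card sols = card tups"
proof (rule bij_betw_same_card[of "%g. map g [0..<t]"])
 let ?inv = "%xs i. if i < k then (if i < t then xs ! i else if i < 2 * t then xs ! (i - t) else 0) else undefined"
 show "bij_betw (%g. map g [0..<t]) sols tups"
 proof (rule bij_betw_byWitness[where f' = ?inv])
  show "\<forall>g\<in>sols. ?inv (map g [0..<t]) = g"
  proof
   fix g assume "g \<in> sols"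
   then have g: "g \<in> funs" "!!i. i < t ==> g (t + i) = g i" using sols_iff by (auto simp: sols_def)
   show "?inv (map g [0..<t]) = g"
   proof
    fix i
    have "g i = 0" if "i < k" "\<not> i < 2 * t" using g(1) that by (auto simp: funs_def copies_def PiE_def Pi_def)
    moreover have "g i = undefined" if "\<not> i < k" using g(1) that by (auto simp: funs_def PiE_def extensional_def)
    moreover have "g (i - t) = g i" if "\<not> i < t" "i < 2 * t" using g(2)[of "i - t"] that by auto
    ultimately show "?inv (map g [0..<t]) i = g i" by auto
   qed
  qed
  show "\<forall>xs\<in>tups. map (?inv xs) [0..<t] = xs" using tk by (auto simp: tups_def intro!: nth_equalityI)
  show "(%g. map g [0..<t]) ` sols \<subseteq> tups"
  proof
   fix xs assume "xs \<in> (%g. map g [0..<t]) ` sols"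
   then obtain g where g: "g \<in> funs" "Eg g = H" "xs = map g [0..<t]" by (auto simp: sols_def)
   have "g i < n" if "i < t" for i using PiE_mem[OF g(1)[unfolded funs_def], of i] that tk by (simp add: copies_def)
   then show "xs \<in> tups" using g sols_iff[OF g(1)] by (auto simp: tups_def)
  qed
  show "?inv ` tups \<subseteq> sols"
  proof
   fix g assume "g \<in> ?inv ` tups"
   then obtain xs where xs: "xs \<in> tups" and g: "g = ?inv xs" by blast
   have l: "length xs = t" "set xs \<subseteq> {..<n}" using xs by (auto simp: tups_def)
   have mem: "xs ! i < n" if "i < t" for i using that by (metis l lessThan_iff nth_mem subsetD)
   have f: "g \<in> funs" unfolding g funs_def by (rule PiE_I) (simp_all add: copies_def mem)
   have "\<forall>i<t. g (t + i) = g i" unfolding g using tk by auto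
   moreover have "\<forall>i<t. \<forall>l<t. i ~= l --> adj (g i) (g l)" unfolding g using tk xs by (auto simp: tups_def)
   ultimately show "g \<in> sols" using sols_iff[OF f] f by (simp add: sols_def)
  qed
 qed
qed

lemma GG_coloring: "S \<subseteq> H ==> is_coloring ({..<k}, H) (GG S {..<k}) (%v. v div M)"
 unfolding is_coloring_def by (auto simp: GG_edge adjw_def) (auto simp: GG_def vs_iff)

text \<open>For sorted \<open>J\<close>, this is the vertex order on which \<open>enc_graph\<close>
  is based, with vertices as pairs of position and copy.\<close>

definition vl :: "nat list => (nat \<times> nat) list" where
 "vl J = concat (map (%i. map (%u. (i, u)) (if i < 2 * t then [0..<n] else [0])) J)"

lemma vl_sorted:
 assumes "sorted J" "distinct J"
 shows "sorted_list_of_set (vs (set J)) = map (%p. fst p * M + snd p) (vl J)"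
proof -
 have cset: "set (if i < 2 * t then [0..<n] else [0]) = copies i" for i by (auto simp: copies_def)
 have set: "set (map (%p. fst p * M + snd p) (vl J)) = vs (set J)"
  unfolding vl_def vs_def set_map set_concat image_image using cset by (auto simp: image_iff) (metis cset)+
 have "sorted (map (%p. fst p * M + snd p) (vl J)) \<and> distinct (map (%p. fst p * M + snd p) (vl J))"
  using assms
 proof (induction J)
  case (Cons i J)
  let ?f = "map (%u. i * M + u) (if i < 2 * t then [0..<n] else [0])"
  have e: "map (%p. fst p * M + snd p) (vl (i # J)) = ?f @ map (%p. fst p * M + snd p) (vl J)"
   by (simp add: vl_def o_def)
  have lt: "a < b" if h: "a \<in> set ?f" "b \<in> set (map (%p. fst p * M + snd p) (vl J))" for a b
  proof -
   have "a \<in> (%u. i * M + u) ` copies i" using h(1) unfolding set_map cset .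
   then obtain u where u: "a = i * M + u" "u \<in> copies i" by blast
   obtain j v where v: "b = j * M + v" "j \<in> set J" using h(2) by (auto simp: vl_def)
   have "i < j" using Cons.prems v(2) by (metis distinct.simps(2) le_neq_implies_less sorted_simps(2))
   then have "(i + 1) * M \<le> j * M" by (intro mult_right_mono) auto
   moreover have "a < (i + 1) * M" using u copies_M by simp
   ultimately show ?thesis using v by simp
  qed
  have sd: "sorted ?f" "distinct ?f" by (auto simp: sorted_iff_nth_mono distinct_map inj_on_def)
  let ?g = "map (%p. fst p * M + snd p) (vl J)"
  have IH: "sorted ?g" "distinct ?g" using Cons.IH Cons.prems by simp_all
  have "sorted (?f @ ?g)" unfolding sorted_append using sd(1) IH(1) lt less_imp_le by blast
  moreover have "set ?f \<inter> set ?g = {}" using lt less_irrefl by blast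
  then have "distinct (?f @ ?g)" unfolding distinct_append using sd(2) IH(2) by blast
  ultimately show ?case unfolding e by blast
 qed (simp add: vl_def)
 then show ?thesis using set sorted_list_of_set.idem_if_sorted_distinct by metis
qed

lemma enc_GG:
 assumes "sorted J" "distinct J"
 shows "enc_graph (GG S (set J)) = length (vl J) # concat (map (%a. map (%b. of_bool (adjw S (fst a) (snd a) (fst b) (snd b))) (vl J)) (vl J))"
proof -
 have m: "p \<in> set (vl J) ==> snd p < M \<and> fst p \<in> set J \<and> snd p \<in> copies (fst p)" for p
  by (auto simp: vl_def copies_def M_def split: if_splits)
 have "{fst a * M + snd a, fst b * M + snd b} \<in> edges (GG S (set J)) \<longleftrightarrow> adjw S (fst a) (snd a) (fst b) (snd b)"
  if "a \<in> set (vl J)" "b \<in> set (vl J)" for a b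
  using m[OF that(1)] m[OF that(2)] by (simp add: GG_edge vs_iff)
 then have "concat (map (%a. map (%b. of_bool ({fst a * M + snd a, fst b * M + snd b} \<in> edges (GG S (set J)))) (vl J)) (vl J))
  = (concat (map (%a. map (%b. of_bool (adjw S (fst a) (snd a) (fst b) (snd b))) (vl J)) (vl J)) :: nat list)"
  by (intro arg_cong[of _ _ concat] map_cong refl) auto
 moreover have "verts (GG S (set J)) = vs (set J)" by (simp add: GG_def)
 ultimately show ?thesis unfolding enc_graph_def Let_def using vl_sorted[OF assms] by (simp add: o_def)
qed

end

section \<open>Query words computed from an adjacency matrix\<close>

text \<open>The default values make the relation false outside the matrix.\<close>

definition radj :: "nat list list => nat => nat => bool" where
 "radj rows u v \<longleftrightarrow> nthd 0 (nthd [] rows u) v = 1"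

definition pmem :: "(nat \<times> nat) list => nat => nat => bool" where
 "pmem S i j \<longleftrightarrow> (\<exists>p\<in>set S. fst p = i \<and> snd p = j \<or> fst p = j \<and> snd p = i)"

definition eset :: "(nat \<times> nat) list => nat set set" where "eset S = (%p. {fst p, snd p}) ` set S"

lemma pmem_eset: "pmem S i j \<longleftrightarrow> {i, j} \<in> eset S"
 unfolding pmem_def eset_def image_iff doubleton_eq_iff by metis

text \<open>This is \<open>rel\<close> read off a matrix, with \<open>t + t\<close> for
  \<open>2 * t\<close> because the language has no multiplication.\<close>

definition grel :: "nat => nat list list => nat => nat => nat => nat => bool" where
 "grel t rows i u j v \<longleftrightarrow> (i < t \<and> t \<le> j \<and> j < t + t --> (if j = t + i then u = v else radj rows u v)) \<and>
   (j < t \<and> t \<le> i \<and> i < t + t --> (if i = t + j then u = v else radj rows u v))"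

definition gvl :: "nat => nat list list => nat list => (nat \<times> nat) list" where
 "gvl t rows J = concat (map (%i. map (%u. (i, u)) (if i < t + t then [0..<length rows] else [0])) J)"

definition gword :: "nat => nat list list => (nat \<times> nat) list => nat list => nat list" where
 "gword t rows S J = length (gvl t rows J) # concat (map (%a. map (%b. of_bool (pmem S (fst a) (fst b) \<and>
   grel t rows (fst a) (snd a) (fst b) (snd b))) (gvl t rows J)) (gvl t rows J))"

text \<open>An item consists of a sign, a list of pattern edges and a list of classes. A plan
  consists of the clique size, a prefix shared by all query words, a flag for appending the colors,
  and the items. The plan depends on the pattern alone; the input graph enters only in
  \<open>words\<close>.\<close>

type_synonym item = "bool \<times> (nat \<times> nat) list \<times> nat list"
type_synonym plan = "nat \<times> nat list \<times> bool \<times> item list"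

definition words :: "plan => nat list list => (bool \<times> nat list) list" where
 "words W rows = map (%it. (fst it, fst (snd W) @ gword (fst W) rows (fst (snd it)) (snd (snd it)) @
   (if fst (snd (snd W)) then map fst (gvl (fst W) rows (snd (snd it))) else []))) (snd (snd (snd W)))"

text \<open>The flag \<open>True\<close> stands for a minus sign; the three numbers are an encoded
  rational.\<close>

type_synonym ans = "(bool \<times> nat \<times> nat \<times> nat) list"

definition posn :: "ans => nat" where "posn a = sum_list (map (%p. if fst p then 0 else fst (snd p)) a)"
definition negn :: "ans => nat" where "negn a = sum_list (map (%p. if fst p then fst (snd p) else 0) a)"
text \<open>With cut-off subtraction one of the two summands is 0, so this is an absolute
  difference.\<close>

definition diffn :: "ans => nat" where "diffn a = (posn a - negn a) + (negn a - posn a)"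

lemma FP_words: "FP (%p. words (fst p) (snd p))"
 unfolding words_def gword_def gvl_def pmem_def grel_def radj_def by (intro FP_rules)

lemma FP_diffn: "FP diffn"
 unfolding diffn_def[abs_def] posn_def negn_def by (intro FP_rules)

lemma (in gadget) gword_enc:
 assumes rows: "n = length rows" "adj = radj rows" and J: "sorted J" "distinct J"
 shows "gword t rows S J = enc_graph (GG (eset S) (set J))" "gvl t rows J = vl J"
proof -
 have r: "rel = grel t rows" unfolding rel_def[abs_def] grel_def[abs_def] using rows by (auto simp: mult_2)
 show v: "gvl t rows J = vl J" unfolding gvl_def vl_def mult_2 rows(1)[symmetric] by (rule refl)
 show "gword t rows S J = enc_graph (GG (eset S) (set J))"
  unfolding enc_GG[OF J] gword_def v adjw_def r pmem_eset by (rule refl)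
qed

lemma sum_subseqs:
 fixes f :: "'a set => rat"
 assumes "distinct l"
 shows "(\<Sum>S\<leftarrow>subseqs l. f (set S)) = (\<Sum>S\<in>Pow (set l). f S)"
 using assms
proof (induction l arbitrary: f)
 case (Cons x l)
 have inj: "inj_on (insert x) (Pow (set l))" using Cons.prems by (auto simp: inj_on_def)
 have "(\<Sum>S\<in>Pow (set (x # l)). f S) = (\<Sum>S\<in>Pow (set l). f S) + (\<Sum>S\<in>insert x ` Pow (set l). f S)"
  unfolding list.set Pow_insert by (rule sum.union_disjoint) (use Cons.prems in auto)
 also have "\<dots> = (\<Sum>S\<in>Pow (set l). f S) + (\<Sum>S\<in>Pow (set l). f (insert x S))" using inj by (simp add: sum.reindex)
 also have "\<dots> = (\<Sum>S\<leftarrow>subseqs l. f (set S)) + (\<Sum>S\<leftarrow>subseqs l. f (insert x (set S)))"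
  using Cons.IH[of f] Cons.IH[of "%S. f (insert x S)"] Cons.prems by simp
 finally show ?case by (simp add: Let_def o_def)
qed simp

definition par :: "'a list => bool" where "par l = foldl (%a _. \<not> a) False l"

lemma par_odd: "par l \<longleftrightarrow> odd (length l)"
proof -
 have "foldl (%a _. \<not> a) b l \<longleftrightarrow> (b ~= odd (length l))" for b by (induction l arbitrary: b) auto
 then show ?thesis by (simp add: par_def)
qed

definition sg :: "bool => rat" where "sg b = (if b then - 1 else 1)"

lemma sg_par: "sg (par l) = (- 1) ^ length l" by (auto simp: sg_def par_odd)

definition items_cp :: "nat => (nat \<times> nat) list => item list" where
 "items_cp k Hl = map (%S. (par S, S, [0..<k])) (subseqs Hl)"

text \<open>The sign combines the parities of the edge set and of the set of deleted
  classes.\<close>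

definition items_ind :: "nat => (nat \<times> nat) list => item list" where
 "items_ind k Hl = concat (map (%S. map (%R. (par S ~= par R, S, filter (%i. i \<notin> set R) [0..<k])) (subseqs [0..<k])) (subseqs Hl))"

text \<open>Increasing pairs without repetition, so that subsequences of the list correspond to
  subsets of the edge set.\<close>

definition edge_list :: "nat => (nat \<times> nat) list => bool" where
 "edge_list k Hl \<longleftrightarrow> distinct Hl \<and> (\<forall>p\<in>set Hl. fst p < snd p \<and> snd p < k)"

lemma edge_list_pairs: "edge_list k Hl ==> eset Hl \<subseteq> pairs k"
 by (fastforce simp: edge_list_def eset_def pairs_def card_2_iff)

lemma edge_inj: "edge_list k Hl ==> inj_on (%p. {fst p, snd p}) (set Hl)"
proof (rule inj_onI)
 fix p q assume "edge_list k Hl" "p \<in> set Hl" "q \<in> set Hl" "{fst p, snd p} = {fst q, snd q}"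
 moreover from this have "fst p < snd p" "fst q < snd q" by (auto simp: edge_list_def)
 ultimately show "p = q" by (auto simp: doubleton_eq_iff prod_eq_iff)
qed

lemma subseqs_sub: "S \<in> set (subseqs l) ==> set S \<subseteq> set l \<and> (distinct l --> distinct S)"
proof -
 assume S: "S \<in> set (subseqs l)"
 then have "set S \<in> set ` set (subseqs l)" by simp
 then show ?thesis using subseqs_distinctD[OF S] unfolding subseqs_powset by blast
qed

lemma sum_edges:
 assumes "edge_list k Hl"
 shows "(\<Sum>S\<leftarrow>subseqs Hl. sg (par S) * f (eset S)) = (\<Sum>S\<in>Pow (eset Hl). (-1) ^ card S * f S)"
proof -
 let ?e = "%p :: nat \<times> nat. {fst p, snd p}"
 note inj = edge_inj[OF assms]
 have "(\<Sum>S\<leftarrow>subseqs Hl. sg (par S) * f (eset S)) = (\<Sum>S\<leftarrow>subseqs Hl. (-1) ^ card (?e ` set S) * f (?e ` set S))"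
 proof (rule arg_cong[of _ _ sum_list], rule map_cong[OF refl])
  fix S assume "S \<in> set (subseqs Hl)"
  then have S: "set S \<subseteq> set Hl" "distinct S" using subseqs_sub assms by (auto simp: edge_list_def)
  have "card (?e ` set S) = length S" using card_image[OF inj_on_subset[OF inj S(1)]] distinct_card[OF S(2)] by simp
  then show "sg (par S) * f (eset S) = (-1) ^ card (?e ` set S) * f (?e ` set S)" by (simp add: sg_par eset_def)
 qed
 also have "\<dots> = (\<Sum>S\<in>Pow (set Hl). (-1) ^ card (?e ` S) * f (?e ` S))"
  using sum_subseqs[of Hl "%X. (-1) ^ card (?e ` X) * f (?e ` X)"] assms by (simp add: edge_list_def)
 also have "\<dots> = (\<Sum>S\<in>Pow (eset Hl). (-1) ^ card S * f S)"
 proof (rule sum.reindex_bij_betw)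
  show "bij_betw ((`) ?e) (Pow (set Hl)) (Pow (eset Hl))"
   unfolding eset_def by (rule bij_betw_Pow) (use inj in \<open>simp add: bij_betw_def\<close>)
 qed
 finally show ?thesis .
qed

lemma (in gadget) items_cp_sum:
 assumes "edge_list k Hl" "H = eset Hl"
 shows "(\<Sum>it\<leftarrow>items_cp k Hl. sg (fst it) * num_cpIndSub \<Phi> ({..<k}, H) (GG (eset (fst (snd it))) {..<k}) (%v. v div M)) =
  hatr \<Phi> k H * of_nat (fact t * card cls)"
proof -
 have "(\<Sum>S\<leftarrow>subseqs Hl. sg (par S) * num_cpIndSub \<Phi> ({..<k}, H) (GG (eset S) {..<k}) (%v. v div M)) = hatr \<Phi> k H * of_nat (card sols)"
  using sum_edges[OF assms(1), of "%S. num_cpIndSub \<Phi> ({..<k}, H) (GG S {..<k}) (%v. v div M)"] cp_total assms(2) by simp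
 then show ?thesis unfolding card_sols card_tups by (simp add: items_cp_def o_def)
qed

lemma sum_list_concat: "sum_list (concat xss) = sum_list (map sum_list (xss :: rat list list))"
 by (induction xss) auto

lemma (in gadget) items_ind_sum:
 assumes "edge_list k Hl" "H = eset Hl"
 shows "(\<Sum>it\<leftarrow>items_ind k Hl. sg (fst it) * num_IndSub \<Phi> k (GG (eset (fst (snd it))) (set (snd (snd it))))) =
  hatr \<Phi> k H * of_nat (fact t * card cls)"
proof -
 have sgx: "sg (a ~= b) = sg a * sg b" for a b by (auto simp: sg_def)
 have inner: "(\<Sum>R\<leftarrow>subseqs [0..<k]. sg (par R) * num_IndSub \<Phi> k (GG (eset S) (set (filter (%i. i \<notin> set R) [0..<k])))) =
   num_cpIndSub \<Phi> ({..<k}, H) (GG (eset S) {..<k}) (%v. v div M)" if "S \<in> set (subseqs Hl)" for S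
 proof -
  have "eset S \<subseteq> H" using subseqs_sub[OF that] assms(2) by (auto simp: eset_def)
  have "(\<Sum>R\<leftarrow>subseqs [0..<k]. sg (par R) * num_IndSub \<Phi> k (GG (eset S) (set (filter (%i. i \<notin> set R) [0..<k])))) =
   (\<Sum>R\<leftarrow>subseqs [0..<k]. (-1) ^ card (set R) * num_IndSub \<Phi> k (GG (eset S) ({..<k} - set R)))"
  proof (rule arg_cong[of _ _ sum_list], rule map_cong[OF refl])
   fix R assume "R \<in> set (subseqs [0..<k])"
   then have "distinct R" using subseqs_sub distinct_upt by blast
   moreover have "set (filter (%i. i \<notin> set R) [0..<k]) = {..<k} - set R" by auto
   ultimately show "sg (par R) * num_IndSub \<Phi> k (GG (eset S) (set (filter (%i. i \<notin> set R) [0..<k]))) =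
    (-1) ^ card (set R) * num_IndSub \<Phi> k (GG (eset S) ({..<k} - set R))" by (simp add: sg_par distinct_card)
  qed
  also have "\<dots> = (\<Sum>R\<in>Pow {..<k}. (-1) ^ card R * num_IndSub \<Phi> k (GG (eset S) ({..<k} - R)))"
   using sum_subseqs[of "[0..<k]" "%R. (-1) ^ card R * num_IndSub \<Phi> k (GG (eset S) ({..<k} - R))"]
   by (simp add: atLeast0LessThan)
  finally show ?thesis using indsub_total[OF \<open>eset S \<subseteq> H\<close>] by simp
 qed
 have "(\<Sum>it\<leftarrow>items_ind k Hl. sg (fst it) * num_IndSub \<Phi> k (GG (eset (fst (snd it))) (set (snd (snd it))))) =
   (\<Sum>S\<leftarrow>subseqs Hl. \<Sum>R\<leftarrow>subseqs [0..<k]. sg (par S ~= par R) * num_IndSub \<Phi> k (GG (eset S) (set (filter (%i. i \<notin> set R) [0..<k]))))"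
  unfolding items_ind_def map_concat sum_list_concat by (simp add: o_def)
 also have "\<dots> = (\<Sum>S\<leftarrow>subseqs Hl. sg (par S) * num_cpIndSub \<Phi> ({..<k}, H) (GG (eset S) {..<k}) (%v. v div M))"
 proof (rule arg_cong[of _ _ sum_list], rule map_cong[OF refl])
  fix S assume S: "S \<in> set (subseqs Hl)"
  show "(\<Sum>R\<leftarrow>subseqs [0..<k]. sg (par S ~= par R) * num_IndSub \<Phi> k (GG (eset S) (set (filter (%i. i \<notin> set R) [0..<k])))) =
   sg (par S) * num_cpIndSub \<Phi> ({..<k}, H) (GG (eset S) {..<k}) (%v. v div M)"
   unfolding inner[OF S, symmetric] sum_list_const_mult[symmetric] sgx mult.assoc by (rule refl)
 qed
 also have "\<dots> = hatr \<Phi> k H * of_nat (card sols)"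
  using sum_edges[OF assms(1), of "%S. num_cpIndSub \<Phi> ({..<k}, H) (GG S {..<k}) (%v. v div M)"] cp_total assms(2) by simp
 finally show ?thesis unfolding card_sols card_tups .
qed

text \<open>Only the first component of an answer matters: all values of the parameter are natural numbers.\<close>

lemma diffn_correct:
 fixes F :: "'i => rat"
 assumes "!!it. it \<in> set its ==> F it = of_nat (v it)" "mset bs = mset (map (%it. (s it, v it, 0, 1)) its)"
 shows "of_nat (diffn bs) = \<bar>\<Sum>it\<leftarrow>its. sg (s it) * F it\<bar>"
proof -
 have sm: "sum_list (map f bs) = sum_list (map f (map (%it. (s it, v it, 0, 1)) its))" for f :: "_ => nat"
  unfolding sum_mset_sum_list[symmetric] mset_map assms(2) by (rule refl)
 have p: "posn bs = (\<Sum>it\<leftarrow>its. if s it then 0 else v it)" unfolding posn_def sm by (simp add: o_def cong: if_cong)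
 have q: "negn bs = (\<Sum>it\<leftarrow>its. if s it then v it else 0)" unfolding negn_def sm by (simp add: o_def cong: if_cong)
 have "(\<Sum>it\<leftarrow>its. sg (s it) * F it) = of_nat (\<Sum>it\<leftarrow>its. if s it then 0 else v it) - of_nat (\<Sum>it\<leftarrow>its. if s it then v it else 0)"
  using assms(1) by (induction its) (auto simp: sg_def)
 then show ?thesis unfolding diffn_def p q by (simp add: abs_if of_nat_diff)
qed

section \<open>The sparsification tree on lists\<close>

definition subs :: "nat list => nat list => bool" where "subs c c' \<longleftrightarrow> (\<forall>a\<in>set c. a \<in> set c')"

lemma subs_iff: "subs c c' \<longleftrightarrow> set c \<subseteq> set c'" by (auto simp: subs_def)

text \<open>Removes repetitions up to the order of elements, keeping the first
  representative.\<close>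

definition dd :: "nat list list => nat list list" where
 "dd F = foldl (%acc c. if \<exists>c'\<in>set acc. subs c' c \<and> subs c c' then acc else acc @ [c]) [] F"

definition redl :: "nat list list => nat list list" where
 "redl F = dd (filter (%c. \<not> (\<exists>c'\<in>set F. subs c' c \<and> \<not> subs c c')) F)"

definition petl :: "nat list list => nat list => nat => nat list list" where
 "petl F h q = filter (%c. length c = q \<and> subs h c) F"

definition prs :: "nat list => nat list list" where
 "prs ps = concat (map (%x. map (%y. [x, y]) (filter (%y. y ~= x) ps)) ps)"

text \<open>The order of the three kinds matters: the first candidate is a flower because the kinds
  listed before its own are absent.\<close>

definition cands :: "nat => nat list list => (nat list \<times> nat) list" where
 "cands d F = map (%a. ([a], 2)) (filter (%a. d \<le> length (petl F [a] 2)) (concat F)) @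
   map (%h. (h, 3)) (filter (%h. d \<le> length (petl F h 3)) (prs (concat F))) @
   map (%a. ([a], 3)) (filter (%a. 2 * d * d \<le> length (petl F [a] 3)) (concat F))"

definition kids :: "nat => nat list list => nat list list list" where
 "kids d F = (case cands d F of [] => [] | hq # _ =>
   [redl (fst hq # F), redl (map (%c. filter (%a. a \<notin> set (fst hq)) c) (petl F (fst hq) (snd hq)) @ F)])"

lemma FP_subs: "FP f ==> FP g ==> FP (%x. subs (f x) (g x))"
 unfolding subs_def by (rule FP_Ball) (intro FP_rules FP_comp[of g, OF _ FP_fst0], simp_all)

lemma esz_snoc: "esz (xs @ [c]) = esz (xs :: 'a::enc list) + 1 + esz c"
 using esz_append[of xs "[c]"] by simp

lemma FP_dd: "FP dd"
proof -
 have "FP (%F. foldl (%acc c. if \<exists>c'\<in>set acc. subs c' c \<and> subs c c' then acc else acc @ [c]) [] F)"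
 proof (rule FP_foldl[where f = "%x acc c. if \<exists>c'\<in>set acc. subs c' c \<and> subs c c' then acc else acc @ [c]" and B = "%n. n"])
  have le: "esz (foldl (%acc c. if \<exists>c'\<in>set acc. subs c' c \<and> subs c c' then acc else acc @ [c]) [] zs) \<le> esz zs" for zs :: "nat list list"
   by (induction zs rule: rev_induct) (auto simp: esz_snoc)
  show "esz (foldl (%acc c. if \<exists>c'\<in>set acc. subs c' c \<and> subs c c' then acc else acc @ [c]) [] zs) \<le> esz x"
   if "x = zs @ zs'" for x zs zs' :: "nat list list"
   unfolding that using le[of zs] esz_append[of zs zs'] tsz_pos[of "enc zs'"] by linarith
 qed (intro FP_rules FP_subs polyb_id)+
 then show ?thesis by (simp add: dd_def[abs_def])
qed

lemma FP_kids: "FP (kids d)"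
 unfolding kids_def[abs_def] cands_def petl_def prs_def redl_def
 by (intro FP_rules FP_subs FP_comp[OF FP_dd])

abbreviation sets :: "nat list list => nat set set" where "sets F \<equiv> set ` set F"

text \<open>Under this invariant the lengths of the lists are the cardinalities of the sets that
  they represent.\<close>

definition linv :: "nat list list => bool" where
 "linv F \<longleftrightarrow> distinct (map set F) \<and> (\<forall>c\<in>set F. distinct c)"

lemma dd_props: "sets (dd F) = sets F \<and> distinct (map set (dd F)) \<and> set (dd F) \<subseteq> set F"
proof (induction F rule: rev_induct)
 case (snoc c F)
 let ?a = "dd F"
 have e: "dd (F @ [c]) = (if \<exists>c'\<in>set ?a. set c' = set c then ?a else ?a @ [c])"
 proof -
  have "subs c' c \<and> subs c c' \<longleftrightarrow> set c' = set c" for c' by (auto simp: subs_iff)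
  then show ?thesis unfolding dd_def foldl_append foldl.simps by (simp only:)
 qed
 show ?case
 proof (cases "\<exists>c'\<in>set ?a. set c' = set c")
  case True
  then have "set c \<in> sets ?a" by auto
  then show ?thesis using snoc True unfolding e by auto
 next
  case False
  then have "set c \<notin> sets ?a" by auto
  then show ?thesis using snoc False unfolding e by auto
 qed
qed (simp add: dd_def)

lemma redl_props:
 assumes "!!c. c \<in> set F ==> distinct c"
 shows "sets (redl F) = red (sets F)" "linv (redl F)"
proof -
 let ?G = "filter (%c. \<not> (\<exists>c'\<in>set F. subs c' c \<and> \<not> subs c c')) F"
 have "sets ?G = red (sets F)" by (auto simp: red_def subs_iff psubset_eq)
 then show "sets (redl F) = red (sets F)" using dd_props[of ?G] by (simp add: redl_def)
 show "linv (redl F)" unfolding linv_def redl_def using dd_props[of ?G] assms by auto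
qed

lemma petl_sets: "linv F ==> sets (petl F h q) = petals (sets F) (set h) q"
 by (auto simp: petl_def petals_def subs_iff linv_def distinct_card)

lemma petl_card: assumes "linv F" shows "length (petl F h q) = card (petals (sets F) (set h) q)"
proof -
 have "distinct (map set (petl F h q))" using assms by (auto simp: linv_def petl_def distinct_map intro: inj_on_subset)
 then have "card (set (map set (petl F h q))) = length (petl F h q)" by (metis distinct_card length_map)
 then show ?thesis using petl_sets[OF assms, of h q] by simp
qed

lemma petals_point: "petals (sets F) h q ~= {} ==> a \<in> h ==> a \<in> set (concat F)"
 by (auto simp: petals_def)

lemma petals_notin: "a \<notin> set (concat F) ==> petals (sets F) {a} q = {}"
 by (auto simp: petals_def)

locale lsparse = sparse U d for U :: "nat set" and d :: nat
begin

lemma cands_flower: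
 assumes F: "linv F" "inv (sets F)" and c: "cands d F = (h, q) # z"
 shows "flower (sets F) (set h) q" "distinct h"
proof -
 let ?c2 = "filter (%a. d \<le> length (petl F [a] 2)) (concat F)"
 let ?c3 = "filter (%h. d \<le> length (petl F h 3)) (prs (concat F))"
 let ?c1 = "filter (%a. 2 * d * d \<le> length (petl F [a] 3)) (concat F)"
 have pr: "\<exists>x y. h = [x, y] \<and> x ~= y" if "h \<in> set (prs ps)" for h ps using that by (auto simp: prs_def)
 have prI: "[x, y] \<in> set (prs ps)" if "x \<in> set ps" "y \<in> set ps" "x ~= y" for x y ps using that by (auto simp: prs_def)
 have lt2: "card (petals (sets F) {a} 2) < d" if e: "?c2 = []" for a
 proof (cases "a \<in> set (concat F)")
  case True
  then have "\<not> d \<le> length (petl F [a] 2)" using e unfolding filter_empty_conv by blast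
  then show ?thesis using petl_card[OF F(1), of "[a]" 2] by simp
 next
  case False
  then show ?thesis using d1 petals_notin[OF False, of 2] by simp
 qed
 have lt3: "card (petals (sets F) {x, y} 3) < d" if e: "?c3 = []" and xy: "x ~= y" for x y
 proof (cases "petals (sets F) {x, y} 3 = {}")
  case True
  then show ?thesis using d1 by simp
 next
  case False
  then have "[x, y] \<in> set (prs (concat F))" using petals_point[OF False] xy by (intro prI) auto
  then have "\<not> d \<le> length (petl F [x, y] 3)" using e unfolding filter_empty_conv by blast
  then show ?thesis using petl_card[OF F(1), of "[x, y]" 3] by simp
 qed
 consider (2) a where "a \<in> set ?c2" "h = [a]" "q = 2" | (3) "?c2 = []" "h \<in> set ?c3" "q = 3"
  | (1) a where "?c2 = []" "?c3 = []" "a \<in> set ?c1" "h = [a]" "q = 3"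
  using c unfolding cands_def by (cases ?c2; cases ?c3; cases ?c1) auto
 then have "flower (sets F) (set h) q \<and> distinct h"
 proof cases
  case 2
  then show ?thesis using petl_card[OF F(1), of "[a]" 2] by (auto simp: flower_def)
 next
  case 3
  then obtain x y where xy: "h = [x, y]" "x ~= y" using pr[of h "concat F"] by auto
  then show ?thesis using 3 lt2[OF 3(1)] petl_card[OF F(1), of h 3] by (auto simp: flower_def)
 next
  case 1
  then show ?thesis using lt2[OF 1(1)] lt3[OF 1(2)] petl_card[OF F(1), of "[a]" 3] by (auto simp: flower_def)
 qed
 then show "flower (sets F) (set h) q" "distinct h" by auto
qed

lemma cands_leaf:
 assumes F: "linv F" "inv (sets F)" and c: "cands d F = []"
 shows "\<not> flower (sets F) h q"
proof
 assume fl: "flower (sets F) h q"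
 have e: "a \<in> set (concat F) ==> \<not> d \<le> length (petl F [a] 2)"
  "g \<in> set (prs (concat F)) ==> \<not> d \<le> length (petl F g 3)"
  "a \<in> set (concat F) ==> \<not> 2 * d * d \<le> length (petl F [a] 3)" for a g
  using c unfolding cands_def by (auto simp: filter_empty_conv)
 have "0 < 2 * d * d" using d1 by simp
 then have ne: "petals (sets F) h q ~= {}" using fl d1 by (auto simp: flower_def)
 consider (1) a where "h = {a}" | (2) x y where "h = {x, y}" "x ~= y"
  using fl by (auto simp: flower_def card_1_singleton_iff card_2_iff)
 then show False
 proof cases
  case 1
  have a: "a \<in> set (concat F)" using petals_point[OF ne, of a] 1 by simp
  have "card h = 1" using 1 by simp
  then show False using e(1,3)[OF a] fl petl_card[OF F(1), of "[a]"] 1 by (auto simp: flower_def)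
 next
  case 2
  have "[x, y] \<in> set (prs (concat F))" using petals_point[OF ne, of x] petals_point[OF ne, of y] 2 by (auto simp: prs_def)
  from e(2)[OF this] show False using fl petl_card[OF F(1), of "[x, y]" 3] 2 by (auto simp: flower_def)
 qed
qed

lemma kids_props:
 assumes F: "linv F" "inv (sets F)" and k: "kids d F = k # ks"
 obtains L R where "k = L" "ks = [R]" "linv L" "linv R" "inv (sets L)" "inv (sets R)" "Psi (sets L) \<le> Psi (sets F) - 1"
  "Psi (sets R) \<le> Psi (sets F) - 2 * int d * int d" "!!X. hits X (sets F) \<longleftrightarrow> hits X (sets L) \<or> hits X (sets R)"
proof -
 obtain h q z where c: "cands d F = (h, q) # z" using k by (cases "cands d F") (auto simp: kids_def)
 note fl = cands_flower[OF F c]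
 let ?L = "h # F" and ?R = "map (%c. filter (%a. a \<notin> set h) c) (petl F h q) @ F"
 have kk: "k = redl ?L" "ks = [redl ?R]" using k c by (auto simp: kids_def)
 have dis: "distinct c" if "c \<in> set ?L \<union> set ?R" for c using that F(1) fl(2) by (auto simp: linv_def petl_def)
 have sL: "sets ?L = insert (set h) (sets F)" by simp
 have "sets (map (%c. filter (%a. a \<notin> set h) c) (petl F h q)) = (%c. c - set h) ` sets (petl F h q)"
  by (auto simp: image_image set_diff_eq)
 then have sR: "sets ?R = (%c. c - set h) ` petals (sets F) (set h) q \<union> sets F"
  unfolding petl_sets[OF F(1)] set_append image_Un by simp
 have L: "sets (redl ?L) = red (insert (set h) (sets F))" "linv (redl ?L)" using redl_props[of ?L] dis sL by auto
 have R: "sets (redl ?R) = red ((%c. c - set h) ` petals (sets F) (set h) q \<union> sets F)" "linv (redl ?R)"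
  using redl_props[of ?R] dis sR by auto
 note b = branch[OF F(2) fl(1), folded L(1) R(1)]
 have hl: "hits X (sets (redl ?L)) \<longleftrightarrow> hits X (insert (set h) (sets F))" for X
  unfolding L(1) by (rule hits_red) auto
 have hr: "hits X (sets (redl ?R)) \<longleftrightarrow> hits X ((%c. c - set h) ` petals (sets F) (set h) q \<union> sets F)" for X
  unfolding R(1) sR[symmetric] by (rule hits_red) auto
 have "hits X (sets F) \<longleftrightarrow> hits X (sets (redl ?L)) \<or> hits X (sets (redl ?R))" for X
  unfolding hl hr using hits_branch[of X "sets F" "set h" q] by (auto simp: hits_def)
 then show ?thesis using that[OF kk(1,2)] L(2) R(2) b unfolding kk by blast
qed

text \<open>Depth-first traversal of the branching tree: the first component is the stack of open
  nodes, the second collects the leaves.\<close>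

definition wstep :: "nat list list list \<times> nat list list list => nat list list list \<times> nat list list list" where
 "wstep s = (case fst s of [] => s | F # r => (case kids d F of [] => (r, F # snd s) | k # ks => (k # ks @ r, snd s)))"

lemma kids_Nil: "kids d F = [] \<longleftrightarrow> cands d F = []"
 by (auto simp: kids_def split: list.split)

text \<open>The children have potential at most \<open>n - 1\<close> and
  \<open>n - 2 * d * d\<close>, and the hypothesis on \<eta> says that
  \<open>2 powr (\<eta> * n)\<close> dominates the resulting recurrence. It bounds the leaves, and a
  binary tree has fewer than twice as many nodes. The last conjunct records the invariants of every
  node visited, from which the cost of a step is bounded.\<close>

lemma worklist:
 fixes \<eta> :: real
 assumes eta: "0 \<le> \<eta>" "2 powr (- \<eta>) + 2 powr (- \<eta> * (2 * real d * real d)) \<le> 1"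
 shows "linv F ==> inv (sets F) ==> Psi (sets F) \<le> int n ==>
  \<exists>m ls. (wstep ^^ m) (F # todo, dn) = (todo, ls @ dn) \<and> real m + 1 \<le> 2 * 2 powr (\<eta> * real n) \<and>
   real (length ls) \<le> 2 powr (\<eta> * real n) \<and>
   (\<forall>l\<in>set ls. linv l \<and> inv (sets l) \<and> cands d l = []) \<and>
   (\<forall>X. hits X (sets F) \<longleftrightarrow> (\<exists>l\<in>set ls. hits X (sets l))) \<and>
   (\<forall>i<m. \<exists>G r dn'. (wstep ^^ i) (F # todo, dn) = (G # r, dn') \<and> linv G \<and> inv (sets G))"
proof (induction n arbitrary: F todo dn rule: less_induct)
 case (less n)
 have B1: "1 \<le> 2 powr (\<eta> * real n)" by (rule ge_one_powr_ge_zero) (use eta(1) in auto)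
 show ?case
 proof (cases "kids d F")
  case Nil
  have w: "(wstep ^^ 1) (F # todo, dn) = (todo, [F] @ dn)" using Nil by (simp add: wstep_def)
  show ?thesis
   by (rule exI[of _ 1], rule exI[of _ "[F]"]) (use w B1 Nil kids_Nil less.prems in auto)
 next
  case (Cons k ks)
  from kids_props[OF less.prems(1,2) Cons] obtain L R where k: "k = L" "ks = [R]" and LR: "linv L" "linv R" "inv (sets L)" "inv (sets R)"
   "Psi (sets L) \<le> Psi (sets F) - 1" "Psi (sets R) \<le> Psi (sets F) - 2 * int d * int d"
   "!!X. hits X (sets F) \<longleftrightarrow> hits X (sets L) \<or> hits X (sets R)" by metis
  let ?nl = "n - 1" and ?nr = "n - 2 * d * d"
  have dd: "1 \<le> 2 * d * d" using d1 by simp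
  \<comment> \<open>The right child still has nonnegative potential; hence \<open>n\<close> is large
    enough for the subtraction of natural numbers.\<close>
  have "2 * int d * int d \<le> int n" using Psi_nonneg[OF LR(4)] LR(6) less.prems(3) by linarith
  then have "int (2 * d * d) \<le> int n" by simp
  then have dn: "2 * d * d \<le> n" by (simp only: of_nat_le_iff)
  have n1: "1 \<le> n" using dn dd by linarith
  have nln: "?nl < n" using n1 by simp
  have nrn: "?nr < n" using n1 dd by (intro diff_less) linarith+
  have Pl: "Psi (sets L) \<le> int ?nl" using LR(5) less.prems(3) dn dd by linarith
  have Pr: "Psi (sets R) \<le> int ?nr" using LR(6) less.prems(3) dn by (simp add: of_nat_diff)
  have s0: "wstep (F # todo, dn) = (L # R # todo, dn)" using Cons k by (simp add: wstep_def)
  from less.IH[OF nln LR(1,3) Pl, of "R # todo" dn] obtain m1 l1 where 1: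
   "(wstep ^^ m1) (L # R # todo, dn) = (R # todo, l1 @ dn)" "real m1 + 1 \<le> 2 * 2 powr (\<eta> * real ?nl)"
   "real (length l1) \<le> 2 powr (\<eta> * real ?nl)" "\<forall>l\<in>set l1. linv l \<and> inv (sets l) \<and> cands d l = []"
   "\<forall>X. hits X (sets L) \<longleftrightarrow> (\<exists>l\<in>set l1. hits X (sets l))"
   "\<forall>i<m1. \<exists>G r dn'. (wstep ^^ i) (L # R # todo, dn) = (G # r, dn') \<and> linv G \<and> inv (sets G)" by blast
  from less.IH[OF nrn LR(2,4) Pr, of todo "l1 @ dn"] obtain m2 l2 where 2:
   "(wstep ^^ m2) (R # todo, l1 @ dn) = (todo, l2 @ l1 @ dn)" "real m2 + 1 \<le> 2 * 2 powr (\<eta> * real ?nr)"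
   "real (length l2) \<le> 2 powr (\<eta> * real ?nr)" "\<forall>l\<in>set l2. linv l \<and> inv (sets l) \<and> cands d l = []"
   "\<forall>X. hits X (sets R) \<longleftrightarrow> (\<exists>l\<in>set l2. hits X (sets l))"
   "\<forall>i<m2. \<exists>G r dn'. (wstep ^^ i) (R # todo, l1 @ dn) = (G # r, dn') \<and> linv G \<and> inv (sets G)" by blast
  have bb: "2 powr (\<eta> * real ?nl) + 2 powr (\<eta> * real ?nr) \<le> 2 powr (\<eta> * real n)"
  proof -
   have rl: "real ?nl = real n - 1" and rr: "real ?nr = real n - 2 * real d * real d" using dn n1 by (simp_all add: of_nat_diff)
   have "2 powr (\<eta> * real ?nl) + 2 powr (\<eta> * real ?nr) = 2 powr (\<eta> * real n) * (2 powr (- \<eta>) + 2 powr (- \<eta> * (2 * real d * real d)))"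
    unfolding rl rr distrib_left powr_add[symmetric] by (simp add: algebra_simps)
   also have "\<dots> \<le> 2 powr (\<eta> * real n) * 1" by (rule mult_left_mono[OF eta(2)]) simp
   finally show ?thesis by simp
  qed
  let ?m = "Suc m1 + m2"
  have run1: "(wstep ^^ Suc i) (F # todo, dn) = (wstep ^^ i) (L # R # todo, dn)" for i
   using s0 by (simp add: funpow_swap1)
  have run2: "(wstep ^^ (Suc m1 + i)) (F # todo, dn) = (wstep ^^ i) (R # todo, l1 @ dn)" for i
  proof -
   have "(wstep ^^ (Suc m1 + i)) (F # todo, dn) = (wstep ^^ i) ((wstep ^^ Suc m1) (F # todo, dn))"
    by (simp only: add.commute[of "Suc m1"] funpow_add comp_apply)
   then show ?thesis using run1[of m1] 1(1) by simp
  qed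
  have all: "\<exists>G r dn'. (wstep ^^ i) (F # todo, dn) = (G # r, dn') \<and> linv G \<and> inv (sets G)" if "i < ?m" for i
  proof (cases i)
   case 0
   then show ?thesis using less.prems by simp
  next
   case (Suc i')
   show ?thesis
   proof (cases "i' < m1")
    case True
    then show ?thesis using 1(6) run1[of i'] Suc by simp
   next
    case False
    then have e: "i = Suc m1 + (i - Suc m1)" "i - Suc m1 < m2" using Suc that by auto
    then show ?thesis using 2(6)[rule_format, OF e(2)] run2[of "i - Suc m1"] by simp
   qed
  qed
  show ?thesis
  proof (rule exI[of _ ?m], rule exI[of _ "l2 @ l1"], intro conjI)
   show "(wstep ^^ ?m) (F # todo, dn) = (todo, (l2 @ l1) @ dn)" using run2[of m2] 2(1) by simp
   show "real ?m + 1 \<le> 2 * 2 powr (\<eta> * real n)" using 1(2) 2(2) bb by simp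
   show "real (length (l2 @ l1)) \<le> 2 powr (\<eta> * real n)" using 1(3) 2(3) bb by simp
   show "\<forall>l\<in>set (l2 @ l1). linv l \<and> inv (sets l) \<and> cands d l = []" using 1(4) 2(4) by auto
   show "\<forall>X. hits X (sets F) \<longleftrightarrow> (\<exists>l\<in>set (l2 @ l1). hits X (sets l))" using LR(7) 1(5) 2(5) by auto
   show "\<forall>i<?m. \<exists>G r dn'. (wstep ^^ i) (F # todo, dn) = (G # r, dn') \<and> linv G \<and> inv (sets G)" using all by blast
  qed
 qed
qed

lemma linv_size:
 assumes "linv F" "inv (sets F)"
 shows "length F \<le> card U ^ 3" "esz F \<le> 1 + 8 * card U ^ 3"
proof -
 have "sets F \<subseteq> (%p. {fst p, fst (snd p), snd (snd p)}) ` (U \<times> U \<times> U)"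
 proof
  fix c assume "c \<in> sets F"
  then have c: "c \<subseteq> U" "1 \<le> card c" "card c \<le> 3" using assms(2) by (auto simp: inv_def)
  then consider "card c = 1" | "card c = 2" | "card c = 3" by linarith
  then obtain x y z where "c = {x, y, z}" by cases (auto simp: card_1_singleton_iff card_2_iff card_3_iff)
  then show "c \<in> (%p. {fst p, fst (snd p), snd (snd p)}) ` (U \<times> U \<times> U)" using c(1) by (intro image_eqI[of _ _ "(x, y, z)"]) auto
 qed
 then have "card (sets F) \<le> card ((%p. {fst p, fst (snd p), snd (snd p)}) ` (U \<times> U \<times> U))"
  by (rule card_mono[rotated]) (simp add: finU)
 also have "\<dots> \<le> card (U \<times> U \<times> U)" by (rule card_image_le) (simp add: finU)
 also have "\<dots> = card U ^ 3" by (simp add: card_cartesian_product power3_eq_cube)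
 finally have "card (sets F) \<le> card U ^ 3" .
 moreover have "length F = card (sets F)" using assms(1) by (metis distinct_card length_map linv_def list.set_map)
 ultimately show len: "length F \<le> card U ^ 3" by simp
 have "esz c \<le> 7" if c: "c \<in> set F" for c
 proof -
  have "length c = card (set c)" using assms(1) c by (simp add: linv_def distinct_card)
  then have "length c \<le> 3" using assms(2) c by (auto simp: inv_def)
  moreover have "esz c \<le> 1 + length c * 2" using esz_list_le[of c 1] by simp
  ultimately show ?thesis by simp
 qed
 then have "esz F \<le> 1 + length F * 8" using esz_list_le[of F 7] by simp
 then show "esz F \<le> 1 + 8 * card U ^ 3" using len by simp
qed

end

section \<open>Turing reductions from clique counting\<close>

lemma enc_rat_nat: "enc_rat (of_nat m) = [m, 0, 1]"
proof -
 have "quotient_of (of_nat m) = (int m, 1)"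
  unfolding Fract_of_nat_eq[symmetric] quotient_of_Fract by (simp add: Rat.normalize_def)
 then show ?thesis by (simp add: enc_rat_def)
qed

lemma CF_computable: assumes "CF (f :: nat => nat)" shows "computable_fun f"
proof -
 obtain e where e: "!!k. pc e (A k) (A (f k))" using assms unfolding CF_iff by auto
 let ?e = "Cmp (Cmp Fst e) (Pr Id (Pr (K 0) (K 1)))"
 have "\<exists>s. run (prog_of ?e) [k] s \<and> outputs s (of_nat (f k))" for k
 proof -
  have "pc (Cmp Fst e) (P (A k) (A 0)) (A (f k))" by (rule pc_intros(5)[OF pc_intros(2) e])
  moreover have "pc (Pr Id (Pr (K 0) (K 1))) (A (f k)) (P (A (f k)) (P (A 0) (A 1)))"
   by (rule pc_intros(4)[OF pc_intros(1) pc_intros(4)[OF pc_intros(6) pc_intros(6)]])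
  ultimately have "pc ?e (lv [k]) (P (A (f k)) (P (A 0) (A 1)))" unfolding lv.simps by (rule pc_intros(5))
  then obtain t where "pev ?e (lv [k]) t (P (A (f k)) (P (A 0) (A 1)))" by (auto simp: pc_def)
  from prog_of_correct[OF this] show ?thesis by (auto simp: run_def outputs_def enc_rat_nat)
 qed
 then show ?thesis unfolding computable_fun_def computes_def by blast
qed

definition askE :: fn where
 "askE = Whl Snd (Pr (Pr (Pr (Cmp (Cmp Snd Fst) Fst) (Cmp (Cmp (Cmp Snd Fst) Snd) Ask)) Fst) (Cmp Snd Snd))"

text \<open>Answers are collected in reverse order, which is why later statements compare multisets
  of answers.\<close>

lemma ev_ask:
 assumes "!!w. w \<in> set ws ==> snd w \<in> V \<and> orc (snd w) = [v w, 0, 1]"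
 shows "\<exists>t \<le> (\<Sum>w\<leftarrow>ws. length (snd w) + 30) + 5.
  ev orc V askE (P (enc (acc :: ans)) (enc ws)) t (P (enc (rev (map (%w. (fst w, v w, 0, 1)) ws) @ acc)) (A 0))"
 using assms
proof (induction ws arbitrary: acc)
 case Nil
 have "ev orc V askE (P (enc acc) (A 0)) (1 + 1) (P (enc acc) (A 0))"
  unfolding askE_def by (rule ev_WhF[OF ev_Snd])
 then show ?case by (intro exI[of _ "1 + 1"]) simp
next
 case (Cons w ws)
 let ?st = "P (enc acc) (P (P (enc (fst w)) (lv (snd w))) (enc ws))"
 have w: "snd w \<in> V" "orc (snd w) = [v w, 0, 1]" using Cons.prems[of w] by auto
 have c: "ev orc V Snd ?st 1 (P (P (enc (fst w)) (lv (snd w))) (enc ws))" by (rule ev_Snd)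
 have h: "ev orc V (Cmp Snd Fst) ?st (1 + 1 + 1) (P (enc (fst w)) (lv (snd w)))" by (rule ev_Cmp[OF ev_Snd ev_Fst])
 have b: "ev orc V (Pr (Pr (Pr (Cmp (Cmp Snd Fst) Fst) (Cmp (Cmp (Cmp Snd Fst) Snd) Ask)) Fst) (Cmp Snd Snd)) ?st
   (((((1 + 1 + 1) + 1 + 1) + (((1 + 1 + 1) + 1 + 1) + (length (snd w) + 5) + 1) + 1) + 1 + 1) + (1 + 1 + 1) + 1)
   (P (P (P (enc (fst w)) (P (A (v w)) (P (A 0) (A 1)))) (enc acc)) (enc ws))"
  by (rule ev_Pr[OF ev_Pr[OF ev_Pr[OF ev_Cmp[OF h ev_Fst] ev_Cmp[OF ev_Cmp[OF h ev_Snd] ev_Ask[of "snd w" V orc "v w" 0 1, OF w]]] ev_Fst] ev_Cmp[OF ev_Snd ev_Snd]])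
 have a: "P (P (enc (fst w)) (P (A (v w)) (P (A 0) (A 1)))) (enc acc) = enc ((fst w, v w, 0 :: nat, 1 :: nat) # acc)" by simp
 have "\<exists>t \<le> (\<Sum>w\<leftarrow>ws. length (snd w) + 30) + 5.
  ev orc V askE (P (enc ((fst w, v w, 0, 1) # acc)) (enc ws)) t
   (P (enc (rev (map (%w. (fst w, v w, 0, 1)) ws) @ (fst w, v w, 0, 1) # acc)) (A 0))"
  by (rule Cons.IH) (use Cons.prems in auto)
 then obtain t where t: "t \<le> (\<Sum>w\<leftarrow>ws. length (snd w) + 30) + 5"
  "ev orc V askE (P (P (P (enc (fst w)) (P (A (v w)) (P (A 0) (A 1)))) (enc acc)) (enc ws)) t
   (P (enc (rev (map (%w. (fst w, v w, 0, 1)) (w # ws)) @ acc)) (A 0))" unfolding a by auto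
 have e: "P (enc acc) (enc (w # ws)) = ?st" by (simp add: enc_prod_def enc_nat_list)
 have "ev orc V askE ?st (1 + (((((1 + 1 + 1) + 1 + 1) + (((1 + 1 + 1) + 1 + 1) + (length (snd w) + 5) + 1) + 1) + 1 + 1) + (1 + 1 + 1) + 1) + t + 1)
   (P (enc (rev (map (%w. (fst w, v w, 0, 1)) (w # ws)) @ acc)) (A 0))"
  using ev_WhT[OF c _ b t(2)[unfolded askE_def], folded askE_def] by simp
 then show ?case unfolding e using t(1) by (intro exI[of _ "1 + (((((1 + 1 + 1) + 1 + 1) + (((1 + 1 + 1) + 1 + 1) + (length (snd w) + 5) + 1) + 1) + 1 + 1) + (1 + 1 + 1) + 1) + t + 1"] conjI) simp_all
qed

text \<open>Entry 1 is the number \<open>n\<close> of vertices and the bits start at entry 2. The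
  list \<open>[0..<n]\<close> is filtered out of the positions of the bits, as a number alone cannot
  be enumerated, and the offset \<open>u * n\<close> is a sum with one summand \<open>n\<close> for
  each \<open>y < u\<close>.\<close>

definition rowsI :: "nat list => nat list list" where
 "rowsI inp = (let n = nthd 0 inp 1; bits = drop 2 inp; us = filter (%u. u < n) [0..<length bits] in
   map (%u. take n (drop (sum_list (map (%y. if y < u then n else 0) us)) bits)) us)"

lemma FP_rowsI: "FP rowsI"
 unfolding rowsI_def[abs_def] Let_def by (intro FP_rules)

lemma chunk: "(!!x. x \<in> set xs ==> length (f x) = n) ==> i < length xs ==>
  take n (drop (i * n) (concat (map f xs))) = f (xs ! i)"
proof (induction xs arbitrary: i)
 case (Cons x xs)
 show ?case
 proof (cases i)
  case 0
  then show ?thesis using Cons.prems by simp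
 next
  case (Suc i')
  have "length (f x) = n" using Cons.prems by simp
  then have "drop (i * n) (concat (map f (x # xs))) = drop (i' * n) (concat (map f xs))" using Suc by simp
  then show ?thesis using Cons.IH[of i'] Cons.prems Suc by simp
 qed
qed simp

lemma length_concat_const: "(!!x. x \<in> set xs ==> length (f x) = n) ==> length (concat (map f xs)) = length xs * n"
 by (induction xs) auto

lemma rowsI_enc:
 fixes G :: graph
 defines "vs \<equiv> sorted_list_of_set (verts G)"
 shows "rowsI (k # enc_graph G) = map (%u. map (%v. of_bool ({u, v} \<in> edges G)) vs) vs"
proof -
 let ?f = "%u. map (%v. of_bool ({u, v} \<in> edges G)) vs :: nat list"
 let ?n = "length vs"
 let ?bits = "concat (map ?f vs)"
 have e: "k # enc_graph G = k # ?n # ?bits" by (simp add: enc_graph_def vs_def Let_def)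
 have lb: "length ?bits = ?n * ?n" by (rule length_concat_const) simp
 have us: "filter (%u. u < ?n) [0..<length ?bits] = [0..<?n]"
 proof -
  have "?n \<le> ?n * ?n" by (cases vs) auto
  then have "[0..<length ?bits] = [0..<?n] @ [?n..<?n * ?n]" unfolding lb by (metis le_add_diff_inverse upt_add_eq_append zero_le)
  then show ?thesis by (auto simp: filter_empty_conv)
 qed
 have sm: "sum_list (map (%y. if y < u then ?n else 0) [0..<?n]) = u * ?n" if "u \<le> ?n" for u
 proof -
  have "sum_list (map (%y. if y < u then ?n else 0) [0..<m]) = min u m * ?n" for m
   by (induction m) (auto simp: min_def le_Suc_eq)
  then show ?thesis using that by (simp add: min_def)
 qed
 have "rowsI (k # enc_graph G) = map (%u. take ?n (drop (sum_list (map (%y. if y < u then ?n else 0) [0..<?n])) ?bits)) [0..<?n]"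
 proof -
  have "nthd 0 (k # ?n # ?bits) 1 = ?n" "drop 2 (k # ?n # ?bits) = ?bits" by (simp_all add: nthd_def)
  then show ?thesis unfolding rowsI_def Let_def e us by (simp only: us)
 qed
 also have "\<dots> = map (%u. ?f (vs ! u)) [0..<?n]"
  by (rule map_cong[OF refl]) (simp add: sm chunk[of vs ?f ?n])
 also have "\<dots> = map ?f vs" by (rule nth_equalityI) auto
 finally show ?thesis .
qed

lemma rows_radj:
 fixes G :: graph
 defines "vs \<equiv> sorted_list_of_set (verts G)"
 shows "radj (map (%u. map (%v. of_bool ({u, v} \<in> edges G)) vs) vs) u v \<longleftrightarrow>
  u < length vs \<and> v < length vs \<and> {vs ! u, vs ! v} \<in> edges G"
 by (auto simp: radj_def nthd_def)

lemma cls_num_cliques: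
 fixes G :: graph
 assumes G: "is_graph G"
 defines "vs \<equiv> sorted_list_of_set (verts G)"
 shows "card {A. A \<subseteq> {..<length vs} \<and> card A = t \<and> (\<forall>u\<in>A. \<forall>v\<in>A. u ~= v --> u < length vs \<and> v < length vs \<and> {vs ! u, vs ! v} \<in> edges G)}
  = num_cliques t G"
 unfolding num_cliques_def
proof (rule bij_betw_same_card[of "%A. (!) vs ` A"])
 have fin: "finite (verts G)" using G by (simp add: is_graph_def)
 have vs: "set vs = verts G" "distinct vs" using fin by (auto simp: vs_def)
 have inj: "inj_on ((!) vs) {..<length vs}" using vs(2) by (auto simp: inj_on_def nth_eq_iff_index_eq)
 have im: "(!) vs ` {..<length vs} = verts G" unfolding vs(1)[symmetric] by (auto simp: set_conv_nth)
 let ?X = "{A. A \<subseteq> {..<length vs} \<and> card A = t \<and> (\<forall>u\<in>A. \<forall>v\<in>A. u ~= v --> u < length vs \<and> v < length vs \<and> {vs ! u, vs ! v} \<in> edges G)}"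
 let ?Y = "{A. A \<subseteq> verts G \<and> card A = t \<and> (\<forall>u\<in>A. \<forall>v\<in>A. u ~= v --> {u, v} \<in> edges G)}"
 show "bij_betw (%A. (!) vs ` A) ?X ?Y"
  unfolding bij_betw_def
 proof
  show "inj_on (%A. (!) vs ` A) ?X"
   by (rule inj_onI) (use inj_on_image_eq_iff[OF inj] in auto)
  show "(%A. (!) vs ` A) ` ?X = ?Y"
  proof (intro equalityI subsetI)
   fix B assume "B \<in> (%A. (!) vs ` A) ` ?X"
   then obtain A where A: "A \<in> ?X" "B = (!) vs ` A" by blast
   have "card B = t" using A card_image[OF inj_on_subset[OF inj, of A]] by simp
   moreover have "B \<subseteq> verts G" using A im by blast
   moreover have "\<forall>u\<in>B. \<forall>v\<in>B. u ~= v --> {u, v} \<in> edges G" using A by auto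
   ultimately show "B \<in> ?Y" by blast
  next
   fix B assume B: "B \<in> ?Y"
   then obtain A where A: "A \<subseteq> {..<length vs}" "B = (!) vs ` A" using im subset_image_iff by (metis (no_types, lifting) mem_Collect_eq)
   have "card A = t" using B A card_image[OF inj_on_subset[OF inj A(1)]] by simp
   moreover have "u < length vs \<and> v < length vs \<and> {vs ! u, vs ! v} \<in> edges G" if "u \<in> A" "v \<in> A" "u ~= v" for u v
   proof -
    have "vs ! u ~= vs ! v" using that A(1) vs(2) by (metis nth_eq_iff_index_eq lessThan_iff subsetD)
    then show ?thesis using that A B by auto
   qed
   ultimately show "B \<in> (%A. (!) vs ` A) ` ?X" using A by blast
  qed
 qed
qed

definition dbl :: "nat => nat list => nat list" where
 "dbl D fuel = foldl (%l _. (nthd 0 l 0 + nthd 0 l 0) # l) [D] fuel"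

text \<open>Binary long division whose divisors \<open>D * 2 ^ i\<close> arise by doubling. The list
  \<open>fuel\<close> bounds the number of binary digits of the quotient.\<close>

definition divf :: "nat => nat => nat list => nat" where
 "divf a D fuel = fst (foldl (%s d. if d \<le> snd s then (fst s + fst s + 1, snd s - d) else (fst s + fst s, snd s)) (0, a) (dbl D fuel))"

lemma dbl_eq: "dbl D fuel = rev (map (%i. D * 2 ^ i) [0..<Suc (length fuel)])"
proof (induction fuel rule: rev_induct)
 case (snoc x fuel)
 have "dbl D (fuel @ [x]) = (nthd 0 (dbl D fuel) 0 + nthd 0 (dbl D fuel) 0) # dbl D fuel" by (simp add: dbl_def)
 moreover have "nthd 0 (dbl D fuel) 0 = D * 2 ^ length fuel" unfolding snoc by (simp add: nthd_def)
 ultimately show ?case unfolding snoc by simp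
qed (simp add: dbl_def)

lemma divf_correct: assumes "0 < D" "N < 2 ^ Suc (length fuel)" shows "divf (D * N) D fuel = N"
proof -
 let ?g = "%s d. if d \<le> snd s then (fst s + fst s + 1, snd s - d) else (fst s + fst s, snd s :: nat)"
 have "fst (foldl ?g (q, D * N) (rev (map (%i. D * 2 ^ i) [0..<m]))) = q * 2 ^ m + N" if "N < 2 ^ m" for q m N
  using that
 proof (induction m arbitrary: q N)
  case (Suc m)
  show ?case
  proof (cases "2 ^ m \<le> N")
   case True
   then have "D * 2 ^ m \<le> D * N" by simp
   moreover have "D * N - D * 2 ^ m = D * (N - 2 ^ m)" by (simp add: diff_mult_distrib2)
   moreover have "fst (foldl ?g (q + q + 1, D * (N - 2 ^ m)) (rev (map (%i. D * 2 ^ i) [0..<m]))) = (q + q + 1) * 2 ^ m + (N - 2 ^ m)"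
    using Suc.prems by (intro Suc.IH) auto
   ultimately show ?thesis using True by (simp add: algebra_simps)
  next
   case False
   then have "\<not> D * 2 ^ m \<le> D * N" using assms(1) by simp
   moreover have "fst (foldl ?g (q + q, D * N) (rev (map (%i. D * 2 ^ i) [0..<m]))) = (q + q) * 2 ^ m + N"
    using False by (intro Suc.IH) auto
   ultimately show ?thesis by (simp add: algebra_simps)
  qed
 qed simp
 from this[OF assms(2), of 0] show ?thesis unfolding divf_def dbl_eq by simp
qed

lemma FP_dbl: assumes "FP D" "FP fuel" shows "FP (%x. dbl (D x) (fuel x))"
proof -
 obtain S where S: "polyb S" "mono S" "\<forall>x. esz (fuel x) \<le> S (esz x)" using assms(2) by (rule FP_bound)
 show ?thesis unfolding dbl_def
 proof (rule FP_foldl[where f = "%x l _. (nthd 0 l 0 + nthd 0 l 0) # l" and B = "%n. 3 + 2 * S n"])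
  show "esz (foldl (%l _. (nthd 0 l 0 + nthd 0 l 0) # l) [D x] zs) \<le> 3 + 2 * S (esz x)" if "fuel x = zs @ zs'" for x zs zs'
  proof -
   have "esz (foldl (%l _. (nthd 0 l 0 + nthd 0 l 0) # l) [D x] zs) \<le> 3 + 2 * length zs"
    by (induction zs rule: rev_induct) auto
   moreover have "length zs \<le> S (esz x)" using that length_esz[of "fuel x"] S(3)[rule_format, of x] by simp
   ultimately show ?thesis by linarith
  qed
  show "polyb (%n. 3 + 2 * S n)" by (intro polyb_add polyb_mult polyb_const S(1))
 qed (intro FP_rules assms)+
qed

lemma FP_divf: assumes "FP a" "FP D" "FP fuel" shows "FP (%x. divf (a x) (D x) (fuel x))"
 unfolding divf_def
proof (rule FP_fst, rule FP_foldl[where f = "%x s d. if d \<le> snd s then (fst s + fst s + 1, snd s - d) else (fst s + fst s, snd s)" and B = "%n. 3"])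
 show "FP (%x. dbl (D x) (fuel x))" by (rule FP_dbl[OF assms(2,3)])
qed (intro FP_rules assms polyb_const | simp)+

type_synonym stage = "plan \<times> nat \<times> nat list"

lemma time_bound_arith:
 fixes c w L z :: nat
 assumes "z \<le> w + 3 * L + 3" "1 \<le> L"
 shows "(z + c) ^ c \<le> (w + c + 7) ^ c * L ^ c"
proof -
 have "z + c \<le> (w + c + 7) * L"
 proof -
  have "w \<le> w * L" "c \<le> c * L" "3 \<le> 3 * L" using assms(2) by simp_all
  then have "w + 3 * L + 3 + c \<le> (w + c + 7) * L" unfolding distrib_right by linarith
  then show ?thesis using assms(1) by linarith
 qed
 then show ?thesis unfolding power_mult_distrib[symmetric] by (rule power_mono) simp
qed

text \<open>The plan \<open>W\<close>, the factor \<open>D\<close> and the cost \<open>TW\<close> of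
  computing them depend on \<open>t\<close> alone. No bound for \<open>TW\<close> is known, but it
  is computable by \<open>timed\<close>, and so is the factor \<open>f\<close> built from it.
  Everything else is polynomial in the sizes of the plan and of the input.\<close>

lemma reduction:
 fixes Q :: "'b param_problem" and W :: "nat => plan" and D g :: "nat => nat"
 assumes CFW: "CF W" and CFD: "CF D" and CFg: "CF g" and D: "!!t. 0 < D t"
  and ws: "!!t G w. is_graph G ==> w \<in> set (words (W t) (rowsI (t # enc_graph G))) ==>
   \<exists>y\<in>instances Q. snd w = encode Q y \<and> param Q y \<le> g t \<and> answer Q y \<in> \<nat>"
  and tot: "!!t G bs v. is_graph G ==>
   (!!w y. w \<in> set (words (W t) (rowsI (t # enc_graph G))) ==> y \<in> instances Q ==> snd w = encode Q y ==> answer Q y = of_nat (v w)) ==>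
   mset bs = mset (map (%w. (fst w, v w, 0, 1)) (words (W t) (rowsI (t # enc_graph G)))) ==> diffn bs = D t * num_cliques t G"
 shows "param_turing_reducible CLIQUE Q"
proof -
 have "CF (%t. (W t, D t, [0..<t]))" by (intro CF_Pair CFW CFD CF_upt FP_CF FP_id)
 then obtain eW where "\<forall>t. pc eW (enc t) (enc (W t, D t, [0..<t]))" unfolding CF_iff by blast
 then have "\<forall>t. \<exists>T. pev eW (A t) T (enc (W t, D t, [0..<t]))" by (simp add: pc_def)
 then obtain TW where TW: "!!t. pev eW (A t) (TW t) (enc (W t, D t, [0..<t]))" by metis
 have CFT: "CF TW"
 proof -
  have "pc (Cmp (timed eW) Fst) (A t) (A (TW t))" for t by (rule pc_intros(5)[OF timed_correct[OF TW] pc_intros(2)])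
  then show ?thesis unfolding CF_iff by auto
 qed
 have "FP (%p :: stage \<times> nat list. ((fst (snd (fst p)), concat (map (%_. snd p) (snd (snd (fst p))))), ([] :: ans, words (fst (fst p)) (rowsI (snd p)))))" (is "FP ?fp5")
  by (intro FP_Pair FP_comp[OF FP_words, of "%p. (fst (fst p), rowsI (snd p))", simplified] FP_comp[OF FP_rowsI] FP_rules)
 then obtain e1 T1 where "FPw e1 T1 ?fp5"
  unfolding FP_def by blast
 note f1 = FPwD[OF this]
 have "FP (%p :: (nat \<times> nat list) \<times> (ans \<times> (bool \<times> nat list) list). (divf (diffn (fst (snd p))) (fst (fst p)) (snd (fst p)), 0 :: nat, 1 :: nat))" (is "FP ?fp4")
  by (intro FP_Pair FP_divf FP_comp[OF FP_diffn] FP_rules)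
 then obtain e2 T2 where "FPw e2 T2 ?fp4"
  unfolding FP_def by blast
 note f2 = FPwD[OF this]
 \<comment> \<open>The stages are: the plan from the parameter at the head of the input, the query
   words, the answers, and the division by \<open>D\<close>.\<close>
 let ?e = "Cmp (Cmp (Cmp (Pr (Cmp Fst eW) Id) e1) (Pr Fst (Cmp Snd askE))) e2"
 let ?U = "%n. T1 n + 40 * T1 n + T2 (12 * T1 n + 5) + 50"
 have "polyb (%n. 12 * T1 n + 5)" by (intro polyb_add polyb_mult polyb_const f1(1))
 then have "polyb ?U" by (intro polyb_add polyb_mult polyb_const f1(1) polyb_comp[OF f2(1) _ f2(2)])
 then obtain c where c: "!!n. ?U n \<le> (n + c) ^ c" by (auto simp: polyb_def)
 \<comment> \<open>By \<open>ev_tsz\<close>, \<open>2 ^ TW t\<close> bounds the size of the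
   plan.\<close>
 define f where "f t = 12 * (TW t + (2 ^ TW t + c + 7) ^ c) + 24" for t
 have CFf: "CF f"
  unfolding f_def
  by (rule CF2[where h = "(+)", OF FP_add0] CF_mult CF_power CFT FP_CF[OF FP_const])+
 show ?thesis unfolding param_turing_reducible_def
 proof (rule exI[of _ "prog_of ?e"], rule exI[of _ f], rule exI[of _ g], rule exI[of _ "c + 1"], intro conjI allI impI ballI)
  show "computable_fun f" by (rule CF_computable[OF CFf])
  show "computable_fun g" by (rule CF_computable[OF CFg])
  fix orc x assume orc: "oracle_for Q orc" and "x \<in> instances CLIQUE"
  then obtain t G where x: "x = (t, G)" and G: "is_graph G" by (auto simp: CLIQUE_def)
  define inp where "inp = t # enc_graph G"
  have ex: "encode CLIQUE x = inp" "param CLIQUE x = t" "answer CLIQUE x = of_nat (num_cliques t G)"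
   by (simp_all add: CLIQUE_def x inp_def)
  let ?ws = "words (W t) (rowsI inp)"
  let ?V = "snd ` set ?ws"
  define v where "v w = hd (orc (snd w))" for w :: "bool \<times> nat list"
  have orcw: "orc (snd w) = [v w, 0, 1]" if hw: "w \<in> set ?ws" for w
  proof -
   obtain y where y: "y \<in> instances Q" "snd w = encode Q y" "answer Q y \<in> \<nat>" using ws[OF G hw[unfolded inp_def]] by blast
   then obtain m where "answer Q y = of_nat m" by (auto elim: Nats_cases)
   then have "orc (snd w) = [m, 0, 1]" using orc y by (auto simp: oracle_for_def enc_rat_nat)
   then show ?thesis by (simp add: v_def)
  qed
  have vy: "answer Q y = of_nat (v w)" if hw: "w \<in> set ?ws" "y \<in> instances Q" "snd w = encode Q y" for w y
  proof -
   obtain y' where y': "y' \<in> instances Q" "snd w = encode Q y'" "answer Q y' \<in> \<nat>" using ws[OF G hw(1)[unfolded inp_def]] by blast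
   have "enc_rat (answer Q y) = [v w, 0, 1]" using orc hw orcw[OF hw(1)] by (auto simp: oracle_for_def)
   moreover have "enc_rat q = [m, 0, 1] ==> q = of_nat m" for q m
   proof -
    assume h: "enc_rat q = [m, 0, 1]"
    obtain a b where q: "quotient_of q = (a, b)" by (cases "quotient_of q")
    have "nat a = m" "nat (- a) = 0" "nat b = 1" using h by (auto simp: enc_rat_def q)
    then have "a = int m" "b = 1" by auto
    then show "q = of_nat m" using quotient_of_div[OF q] by simp
   qed
   ultimately show ?thesis by blast
  qed
  let ?bs = "rev (map (%w. (fst w, v w, 0 :: nat, 1 :: nat)) ?ws)"
  let ?fuel = "concat (map (%_. inp) [0..<t])"
  have diff: "diffn ?bs = D t * num_cliques t G"
   by (rule tot[OF G, where v = v]) (use vy in \<open>auto simp: inp_def\<close>)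
  let ?p = "((W t, D t, [0..<t]), inp)"
  let ?z = "esz ?p"
  have s1: "ev orc ?V (Pr (Cmp Fst eW) Id) (enc inp) ((1 + TW t + 1) + 1 + 1) (enc ?p)"
  proof -
   have "enc inp = P (A t) (enc (enc_graph G))" by (simp add: inp_def)
   then have "ev orc ?V (Cmp Fst eW) (enc inp) (1 + TW t + 1) (enc (W t, D t, [0..<t]))"
    using ev_Cmp[OF ev_Fst pev_ev[OF TW]] by simp
   from ev_Pr[OF this ev_Id] show ?thesis by simp
  qed
  obtain t1 where t1: "t1 \<le> T1 ?z" "ev orc ?V e1 (enc ?p) t1 (P (enc (D t, ?fuel)) (P (enc ([] :: ans)) (enc ?ws)))"
   using f1(3)[of ?p] pev_ev unfolding cft_def by fastforce
  have sz1: "esz ?ws \<le> T1 ?z" "esz (D t, ?fuel) \<le> T1 ?z" using f1(4)[of ?p] by simp_all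
  have "\<exists>t2 \<le> (\<Sum>w\<leftarrow>?ws. length (snd w) + 30) + 5.
   ev orc ?V askE (P (enc ([] :: ans)) (enc ?ws)) t2 (P (enc (?bs @ [])) (A 0))"
   by (rule ev_ask) (use orcw in auto)
  then obtain t2 where t2: "t2 \<le> (\<Sum>w\<leftarrow>?ws. length (snd w) + 30) + 5"
   "ev orc ?V askE (P (enc ([] :: ans)) (enc ?ws)) t2 (P (enc ?bs) (A 0))" by auto
  have ln: "(\<Sum>w\<leftarrow>us. length (snd w) + 30) \<le> 30 * esz us" for us :: "(bool \<times> nat list) list"
  proof (induction us)
   case (Cons u us)
   have "length (snd u) < esz (snd u)" by (rule length_esz)
   then show ?case using Cons by simp
  qed simp
  have t2': "t2 \<le> 30 * T1 ?z + 5" using t2(1) ln[of ?ws] sz1(1) by linarith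
  let ?q = "((D t, ?fuel), (?bs, [] :: (bool \<times> nat list) list))"
  have s3: "ev orc ?V (Pr Fst (Cmp Snd askE)) (P (enc (D t, ?fuel)) (P (enc ([] :: ans)) (enc ?ws))) (1 + (1 + t2 + 1) + 1) (enc ?q)"
   using ev_Pr[OF ev_Fst ev_Cmp[OF ev_Snd t2(2)], of "enc (D t, ?fuel)"] by simp
  have "esz ?bs \<le> 1 + length ?bs * (1 + 8)" by (rule esz_list_le) auto
  moreover have "length ?bs \<le> T1 ?z" using length_esz[of ?ws] sz1(1) by simp
  ultimately have szq: "esz ?q \<le> 12 * T1 ?z + 5" using sz1(2) by simp
  obtain t3 where t3: "t3 \<le> T2 (esz ?q)" "ev orc ?V e2 (enc ?q) t3 (enc (divf (diffn ?bs) (D t) ?fuel, 0 :: nat, 1 :: nat))"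
   using f2(3)[of ?q] pev_ev unfolding cft_def by fastforce
  have "T2 (esz ?q) \<le> T2 (12 * T1 ?z + 5)" by (rule monoD[OF f2(2) szq])
  have div: "divf (diffn ?bs) (D t) ?fuel = num_cliques t G"
   unfolding diff
  proof (rule divf_correct[OF D])
   have fin: "finite (verts G)" using G by (simp add: is_graph_def)
   let ?n = "card (verts G)"
   have "num_cliques t G \<le> card {A. A \<subseteq> verts G \<and> card A = t}"
    unfolding num_cliques_def by (rule card_mono) (use fin in \<open>auto intro: finite_subset[of _ "Pow (verts G)"]\<close>)
   also have "\<dots> = ?n choose t" by (rule n_subsets[OF fin])
   also have "\<dots> \<le> 2 ^ ?n" by (rule binomial_le_pow2)
   finally have a: "num_cliques t G \<le> 2 ^ ?n" .
   have lf: "length ?fuel = t * length inp" by (simp add: length_concat_const)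
   show "num_cliques t G < 2 ^ Suc (length ?fuel)"
   \<comment> \<open>The fuel consists of \<open>t\<close> copies of the input. For
     \<open>t = 0\<close> it is empty, but then only the empty clique is counted.\<close>
   proof (cases "t = 0")
    case True
    have "{A. A \<subseteq> verts G \<and> card A = 0 \<and> (\<forall>u\<in>A. \<forall>v\<in>A. u ~= v --> {u, v} \<in> edges G)} \<subseteq> {{}}"
     using finite_subset[OF _ fin] by (auto simp: card_eq_0_iff)
    then have "num_cliques 0 G \<le> card {{} :: nat set}" unfolding num_cliques_def by (rule card_mono[rotated]) simp
    then show ?thesis using True by simp
   next
    case False
    have "length (sorted_list_of_set (verts G)) = ?n" by simp
    then have "length (enc_graph G) = Suc (?n * ?n)"
     unfolding enc_graph_def Let_def using length_concat_const[of "sorted_list_of_set (verts G)" "%u. map (%v. of_bool ({u, v} \<in> edges G)) (sorted_list_of_set (verts G))" ?n] by simp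
    moreover have "?n \<le> ?n * ?n" by (cases "?n") auto
    moreover have "length inp = Suc (length (enc_graph G))" by (simp add: inp_def)
    ultimately have "?n \<le> length inp" by linarith
    also have "\<dots> \<le> length ?fuel" using False lf by simp
    finally have "(2::nat) ^ ?n \<le> 2 ^ length ?fuel" by (intro power_increasing) auto
    with a have "num_cliques t G \<le> 2 ^ length ?fuel" by (rule le_trans)
    also have "\<dots> < 2 ^ Suc (length ?fuel)" by simp
    finally show ?thesis .
   qed
  qed
  have s: "ev orc ?V ?e (enc inp) (((((1 + TW t + 1) + 1 + 1) + t1 + 1) + (1 + (1 + t2 + 1) + 1) + 1) + t3 + 1) (P (A (num_cliques t G)) (P (A 0) (A 1)))"
   using ev_Cmp[OF ev_Cmp[OF ev_Cmp[OF s1 t1(2)] s3] t3(2)] unfolding div by simp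
  obtain st where st': "exec orc inp (prog_of ?e) init st \<and> map (mem st) [0..<3] = [num_cliques t G, 0, 1] \<and>
   steps st \<le> 12 * (((((1 + TW t + 1) + 1 + 1) + t1 + 1) + (1 + (1 + t2 + 1) + 1) + 1) + t3 + 1) + 12 * length inp + 12 \<and>
   queries st \<subseteq> ?V" using prog_of_correct[OF s[unfolded enc_nat_list]] by (rule exE)
  note st = st'[THEN conjunct1] st'[THEN conjunct2, THEN conjunct1] st'[THEN conjunct2, THEN conjunct2, THEN conjunct1]
   st'[THEN conjunct2, THEN conjunct2, THEN conjunct2]
  let ?L = "input_size inp"
  have len: "length inp \<le> ?L" unfolding input_size_def by (induction inp) auto
  have L1: "1 \<le> ?L" using len by (simp add: inp_def)
  have "tsz (enc (W t, D t, [0..<t])) \<le> 2 ^ TW t * 1" using ev_tsz[OF TW[of t]] by simp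
  moreover have "esz inp \<le> 1 + length inp * (1 + 1)" by (rule esz_list_le) simp
  ultimately have z: "?z \<le> 2 ^ TW t + 3 * ?L + 3" using len by (simp del: enc_Pair)
  have "((((1 + TW t + 1) + 1 + 1) + t1 + 1) + (1 + (1 + t2 + 1) + 1) + 1) + t3 + 1 \<le> TW t + ?U ?z"
   using t1(1) t2' t3(1) \<open>T2 (esz ?q) \<le> T2 (12 * T1 ?z + 5)\<close> by linarith
  also have "\<dots> \<le> TW t + (2 ^ TW t + c + 7) ^ c * ?L ^ c"
   using c[of ?z] time_bound_arith[OF z L1, of c] by linarith
  finally have "steps st \<le> 12 * (TW t + (2 ^ TW t + c + 7) ^ c * ?L ^ c) + 12 * ?L + 12" using st(3) len by (simp add: algebra_simps)
  also have "\<dots> \<le> f t * ?L ^ (c + 1)"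
  proof -
   have p: "1 \<le> ?L ^ (c + 1)" "?L \<le> ?L ^ (c + 1)" "?L ^ c \<le> ?L ^ (c + 1)"
    using L1 by (simp_all add: self_le_power)
   have "TW t \<le> TW t * ?L ^ (c + 1)" using p(1) by simp
   moreover have "(2 ^ TW t + c + 7) ^ c * ?L ^ c \<le> (2 ^ TW t + c + 7) ^ c * ?L ^ (c + 1)" by (rule mult_left_mono[OF p(3)]) simp
   ultimately show ?thesis unfolding f_def distrib_right distrib_left mult.assoc using p(1,2) by linarith
  qed
  finally have steps: "steps st \<le> f (param CLIQUE x) * input_size (encode CLIQUE x) ^ (c + 1)" unfolding ex .
  show "\<exists>s. exec orc (encode CLIQUE x) (prog_of ?e) init s \<and> outputs s (answer CLIQUE x) \<and>
    steps s \<le> f (param CLIQUE x) * input_size (encode CLIQUE x) ^ (c + 1) \<and>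
    (\<forall>w\<in>queries s. \<exists>y\<in>instances Q. w = encode Q y \<and> param Q y \<le> g (param CLIQUE x))"
  proof (intro exI[of _ st] conjI ballI)
   show "exec orc (encode CLIQUE x) (prog_of ?e) init st" using st(1) ex by simp
   show "outputs st (answer CLIQUE x)" using st(2) ex by (simp add: outputs_def enc_rat_nat)
   fix w assume "w \<in> queries st"
   then obtain u where "u \<in> set ?ws" "w = snd u" using st(4) by blast
   then show "\<exists>y\<in>instances Q. w = encode Q y \<and> param Q y \<le> g (param CLIQUE x)"
    using ws[OF G, of u t] ex unfolding inp_def by auto
  qed (rule steps)
 qed
qed

section \<open>Existence of a pattern with a large biclique\<close>

lemma hatr_of_int:
 assumes "!!E. E \<subseteq> pairs k ==> \<Phi> ({..<k}, E) = of_int (\<phi> E)" "H \<subseteq> pairs k"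
 shows "hatr \<Phi> k H = of_int (hat \<phi> H)"
 unfolding hatr_def hat_def of_int_sum using assms by (intro sum.cong) auto

lemma graph_k: "E \<subseteq> pairs k ==> is_graph ({..<k}, E)"
 by (auto simp: is_graph_def pairs_def)

lemma iso_k:
 assumes "is_graph G" "card (verts G) = k"
 shows "\<exists>E \<subseteq> pairs k. isomorphic G ({..<k}, E)"
proof -
 have fin: "finite (verts G)" using assms(1) by (simp add: is_graph_def)
 obtain f where f: "bij_betw f (verts G) {..<k}" using finite_same_card_bij[OF fin finite_lessThan[of k]] assms(2) by auto
 have "(`) f ` edges G \<subseteq> pairs k"
 proof
  fix e assume "e \<in> (`) f ` edges G"
  then obtain d where d: "d \<in> edges G" "e = f ` d" by blast
  then have dd: "d \<subseteq> verts G" "card d = 2" using assms(1) by (auto simp: is_graph_def)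
  have "card e = 2" using dd d(2) f card_image[OF inj_on_subset[of f "verts G" d]] by (simp add: bij_betw_def)
  moreover have "e \<subseteq> {..<k}" using dd(1) d(2) f by (auto simp: bij_betw_def)
  ultimately show "e \<in> pairs k" by (simp add: pairs_def)
 qed
 then show ?thesis using f unfolding isomorphic_def by (intro exI[of _ "(`) f ` edges G"]) auto
qed

definition nat_valued :: "(graph => rat) => bool" where
 "nat_valued \<Phi> \<longleftrightarrow> (\<forall>G. is_graph G --> \<Phi> G \<in> \<nat>)"

lemma admissible_facts:
 assumes "admissible \<alpha> \<epsilon> \<Phi>"
 shows "is_param \<Phi>" "nat_valued \<Phi>" "\<exists>p. computes p {G. is_graph G} enc_graph \<Phi>"
 using assms unfolding admissible_def graph_parameter_def is_param_def nat_valued_def bounded_by_def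
 by (blast, fastforce simp: Nats_def, blast)

text \<open>Take \<open>m\<close> with \<open>4 * 2 ^ m \<le> k < 8 * 2 ^ m\<close>, which gives at
  least four blocks, and \<open>j\<close> with \<open>2 ^ j \<le> c < 2 ^ Suc j\<close>. The sides
  \<open>2 ^ (m - j)\<close> of the biclique exceed \<open>k / (8 * c)\<close>, and
  \<open>c \<le> k powr (1 / \<alpha>)\<close> turns this into the exponent
  \<open>1 - 1 / \<alpha>\<close> with the constant 8.\<close>

lemma exists_hat:
 assumes adm: "admissible \<alpha> \<epsilon> \<Phi>" and a: "2 \<le> \<alpha>" "0 < \<epsilon>" and nt: "nontrivial_on \<Phi> k" and k: "64 \<le> k"
  and t: "real t \<le> real k powr (1 - 1 / real \<alpha>) / 8"
 shows "2 * t \<le> k \<and> (\<exists>H \<subseteq> pairs k. hatr \<Phi> k H ~= 0 \<and> (\<forall>i<t. \<forall>l<t. {i, t + l} \<in> H))"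
proof -
 obtain cc where cc: "bounded_by \<Phi> cc" "!!k. int (cc k) = \<lfloor>(1 - \<epsilon>) * real k powr (1 / real \<alpha>)\<rfloor>"
  and mon: "edge_monotone \<Phi>" using adm by (auto simp: admissible_def)
 note par = admissible_facts(1)[OF adm]
 define c where "c = cc k"
 define \<phi> where "\<phi> E = \<lfloor>\<Phi> ({..<k}, E)\<rfloor>" for E
 have val: "\<exists>n \<le> c. \<Phi> ({..<k}, E) = of_nat n" if "E \<subseteq> pairs k" for E
  using cc(1) graph_k[OF that] unfolding bounded_by_def c_def by fastforce
 have phi: "\<Phi> ({..<k}, E) = of_int (\<phi> E)" if "E \<subseteq> pairs k" for E
  using val[OF that] by (auto simp: \<phi>_def)
 interpret ep: edge_param k \<phi> c
 proof
  fix f E assume f: "bij_betw f {..<k} {..<k}" and E: "E \<subseteq> pairs k"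
  have g2: "(`) f ` E \<subseteq> pairs k"
  proof
   fix e assume "e \<in> (`) f ` E"
   then obtain d where d: "d \<in> E" "e = f ` d" by blast
   then have dd: "d \<subseteq> {..<k}" "card d = 2" using E by (auto simp: pairs_def)
   have "card e = 2" using dd d(2) f card_image[OF inj_on_subset[of f "{..<k}" d]] by (simp add: bij_betw_def)
   moreover have "e \<subseteq> {..<k}" using dd(1) d(2) f by (auto simp: bij_betw_def)
   ultimately show "e \<in> pairs k" by (simp add: pairs_def)
  qed
  have "isomorphic ({..<k}, E) ({..<k}, (`) f ` E)" using f by (auto simp: isomorphic_def)
  then show "\<phi> ((`) f ` E) = \<phi> E" using par graph_k[OF E] graph_k[OF g2] by (simp add: is_param_def \<phi>_def)
 next
  fix E F assume "E \<subseteq> F" "F \<subseteq> pairs k"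
  then show "\<phi> F \<le> \<phi> E" using mon graph_k[of E k] graph_k[of F k] unfolding \<phi>_def edge_monotone_def edge_subgraph_def
   by (intro floor_mono) auto
 next
  fix E assume "E \<subseteq> pairs k"
  from val[OF this] obtain n where "n \<le> c" "\<Phi> ({..<k}, E) = of_nat n" by blast
  then show "0 \<le> \<phi> E \<and> \<phi> E \<le> int c" by (simp add: \<phi>_def)
 qed
 have ntr: "\<phi> {} ~= \<phi> (pairs k)"
 proof
  assume e: "\<phi> {} = \<phi> (pairs k)"
  have "\<Phi> G = of_int (\<phi> {})" if G: "is_graph G" "card (verts G) = k" for G
  proof -
   obtain E where E: "E \<subseteq> pairs k" "isomorphic G ({..<k}, E)" using iso_k[OF G] by blast
   then have "\<Phi> G = \<Phi> ({..<k}, E)" using par G(1) graph_k[OF E(1)] unfolding is_param_def by blast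
   moreover have "\<phi> E = \<phi> {}" using ep.mono[of "{}" E] ep.mono[of E "pairs k"] E(1) e by simp
   ultimately show ?thesis using phi[OF E(1)] by simp
  qed
  then show False using nt unfolding nontrivial_on_def by blast
 qed
 \<comment> \<open>A nontrivial parameter takes two values, so \<open>c\<close> is positive and the
   exponent \<open>j\<close> exists.\<close>
 have c1: "1 \<le> c"
 proof (rule ccontr)
  assume "\<not> 1 \<le> c"
  then have "\<phi> {} = 0" "\<phi> (pairs k) = 0" using ep.range[of "{}"] ep.range[of "pairs k"] by auto
  then show False using ntr by simp
 qed
 define y where "y = real k powr (1 / real \<alpha>)"
 have y1: "1 \<le> y" unfolding y_def using k by (intro ge_one_powr_ge_zero) auto
 have cy: "real c \<le> y"
 proof -
  have "real c \<le> (1 - \<epsilon>) * y" using cc(2)[of k] unfolding c_def y_def by linarith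
  also have "\<dots> \<le> 1 * y" using a(2) y1 by (intro mult_right_mono) auto
  finally show ?thesis by simp
 qed
 have ysq: "y \<le> sqrt (real k)"
 proof -
  have "1 / real \<alpha> \<le> 1 / 2" using a(1) by (simp add: field_simps)
  then have "y \<le> real k powr (1 / 2)" unfolding y_def using k by (intro powr_mono) auto
  then show ?thesis using k by (simp add: powr_half_sqrt)
 qed
 \<comment> \<open>With \<alpha> at least 2 and \<open>k\<close> at least 64, \<open>c\<close> is at
   most \<open>k / 8\<close>; this gives \<open>j \<le> m\<close> below.\<close>
 have y8: "y \<le> real k / 8"
 proof -
  have "8 \<le> sqrt (real k)" using k by (intro real_le_rsqrt) simp
  then have "8 * sqrt (real k) \<le> sqrt (real k) * sqrt (real k)" by (intro mult_right_mono) auto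
  then show ?thesis using ysq k by simp
 qed
 have ky: "real k powr (1 - 1 / real \<alpha>) = real k / y" unfolding y_def using k by (simp add: powr_diff)
 obtain m where m: "4 * 2 ^ m \<le> k" "k < 8 * 2 ^ m"
 proof -
  have "\<exists>n. 4 * 2 ^ n \<le> k \<and> \<not> 4 * 2 ^ Suc n \<le> k"
  proof (rule ccontr)
   assume n: "\<not> ?thesis"
   have "4 * 2 ^ n \<le> k" for n by (induction n) (use n k in auto)
   from this[of k] show False using less_exp[of k] by linarith
  qed
  then show ?thesis using that by auto
 qed
 obtain j where j: "2 ^ j \<le> c" "c < 2 ^ Suc j"
  using ex_power_ivl1[of 2 c] c1 by auto
 have jm: "j \<le> m"
 proof (rule ccontr)
  assume "\<not> j \<le> m"
  then have "(2::nat) ^ Suc m \<le> 2 ^ j" by (intro power_increasing) auto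
  then have "2 * (2::nat) ^ m \<le> c" using j(1) by simp
  then have "real (2 * 2 ^ m) \<le> real k / 8" using cy y8 by (meson le_trans of_nat_mono order_trans)
  moreover have "real k < real (8 * 2 ^ m)" using m(2) by (simp only: of_nat_less_iff)
  ultimately show False by simp
 qed
 define r where "r = k div 2 ^ m"
 interpret bl: blocks k \<phi> c r m j
 proof
  show "4 \<le> r" unfolding r_def using m(1) by (simp add: less_eq_div_iff_mult_less_eq mult.commute)
  show "r * 2 ^ m \<le> k" unfolding r_def by simp
  show "k < r * 2 ^ m + 2 ^ m" proof -
   have "k mod 2 ^ m < 2 ^ m" by simp
   then show ?thesis unfolding r_def using div_mult_mod_eq[of k "2 ^ m"] by linarith
  qed
 qed (use jm j ntr in auto)
 have tm: "t \<le> 2 ^ (m - j)"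
 proof -
  have "real k / y \<le> real k / real (2 ^ j)"
  proof (rule divide_left_mono)
   have "real (2 ^ j) \<le> real c" using j(1) by (simp only: of_nat_le_iff)
   then show "real (2 ^ j) \<le> y" using cy by linarith
  qed (use y1 in auto)
  then have "real t \<le> real k / real (2 ^ j) / 8" using t unfolding ky by simp
  also have "\<dots> < real (8 * 2 ^ m) / real (2 ^ j) / 8"
   using m(2) by (intro divide_strict_right_mono) (auto simp del: of_nat_mult simp: of_nat_less_iff)
  also have "\<dots> = real (2 ^ (m - j))" using jm by (simp add: power_diff[of "2::real"])
  finally show ?thesis by (simp only: of_nat_less_iff less_imp_le)
 qed
 have "t \<le> 2 ^ m" by (rule le_trans[OF tm power_increasing]) auto
 then have "2 * t \<le> k" using m(1) by linarith
 moreover obtain T where T: "T \<subseteq> pairs k" "hat \<phi> T ~= 0" "\<forall>i<t. \<forall>l<t. {i, t + l} \<in> T"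
  using bl.exists_hat_positions[OF tm] by blast
 moreover have "hatr \<Phi> k T = of_int (hat \<phi> T)" by (rule hatr_of_int[where \<phi> = \<phi>]) (use phi T in auto)
 moreover from this have "hatr \<Phi> k T ~= 0" using T(2) by simp
 ultimately show ?thesis by blast
qed

section \<open>Computing a pattern for a given clique size\<close>

text \<open>A graph for every list of pairs, well-formed or not, so that evaluating the parameter on
  lists is a total function. On an \<open>edge_list\<close> it is the expected graph.\<close>

definition gr :: "nat => (nat \<times> nat) list => graph" where
 "gr k S = ({..<k}, {{i, j} | i j. pmem S i j \<and> i ~= j \<and> i < k \<and> j < k})"

definition encgr :: "nat => (nat \<times> nat) list => nat list" where
 "encgr k S = k # concat (map (%i. map (%j. of_bool (pmem S i j \<and> i ~= j)) [0..<k]) [0..<k])"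

lemma gr_graph: "is_graph (gr k S)"
 by (auto simp: is_graph_def gr_def)

lemma enc_gr: "enc_graph (gr k S) = encgr k S"
proof -
 have s: "sorted_list_of_set {..<k} = [0..<k]" by (simp add: lessThan_atLeast0)
 have "{i, j} \<in> edges (gr k S) \<longleftrightarrow> pmem S i j \<and> i ~= j" if "i < k" "j < k" for i j
  using that by (auto simp: gr_def doubleton_eq_iff pmem_def)
 then have "concat (map (%i. map (%j. of_bool ({i, j} \<in> edges (gr k S))) [0..<k]) [0..<k])
  = (concat (map (%i. map (%j. of_bool (pmem S i j \<and> i ~= j)) [0..<k]) [0..<k]) :: nat list)"
  by (intro arg_cong[of _ _ concat] map_cong refl) auto
 then show ?thesis by (simp add: enc_graph_def encgr_def Let_def gr_def s)
qed

lemma gr_eset: "edge_list k S ==> gr k S = ({..<k}, eset S)"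
proof -
 assume e: "edge_list k S"
 have "{{i, j} | i j. pmem S i j \<and> i ~= j \<and> i < k \<and> j < k} = eset S"
 proof (intro equalityI subsetI)
  fix c assume "c \<in> eset S"
  then obtain p where "p \<in> set S" "c = {fst p, snd p}" by (auto simp: eset_def)
  moreover from this have "fst p < snd p" "snd p < k" using e by (auto simp: edge_list_def)
  ultimately show "c \<in> {{i, j} | i j. pmem S i j \<and> i ~= j \<and> i < k \<and> j < k}"
   unfolding pmem_def by (intro CollectI exI[of _ "fst p"] exI[of _ "snd p"]) auto
 qed (auto simp: pmem_eset)
 then show "gr k S = ({..<k}, eset S)" by (simp add: gr_def)
qed

lemma CF_encgr: assumes "CF f" "CF g" shows "CF (%x. encgr (f x) (g x))"
proof -
 have "FP (%p :: nat list \<times> (nat \<times> nat) list. length (fst p) # concat (map (%i. map (%j. of_bool (pmem (snd p) i j \<and> i ~= j)) (fst p)) (fst p)))"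
  unfolding pmem_def by (intro FP_rules)
 from CF1[OF this CF_Pair[OF CF_upt[OF assms(1)] assms(2)]] show ?thesis by (simp add: encgr_def)
qed

definition ap :: "nat => (nat \<times> nat) list" where
 "ap k = concat (map (%j. map (%i. (i, j)) [0..<j]) [0..<k])"

lemma set_ap: "set (ap k) = {p. fst p < snd p \<and> snd p < k}" by (auto simp: ap_def)

lemma edge_list_ap: "edge_list k (ap k)"
proof -
 have "distinct (ap k)" unfolding ap_def by (induction k) (auto simp: distinct_map inj_on_def)
 then show ?thesis by (auto simp: edge_list_def set_ap)
qed

lemma edge_list_sub: "edge_list k l ==> S \<in> set (subseqs l) ==> edge_list k S"
 using subseqs_sub[of S l] by (auto simp: edge_list_def)

lemma filter_subseqs: "filter f l \<in> set (subseqs l)" by (induction l) (auto simp: Let_def)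

lemma ap_eset: assumes "H \<subseteq> pairs k" shows "\<exists>Hl \<in> set (subseqs (ap k)). eset Hl = H"
proof (rule bexI[OF _ filter_subseqs])
 show "eset (filter (%p. {fst p, snd p} \<in> H) (ap k)) = H"
 proof (intro equalityI subsetI)
  fix e assume e: "e \<in> H"
  then have e2: "e \<subseteq> {..<k}" "card e = 2" using assms by (auto simp: pairs_def)
  then obtain x y where xy: "e = {x, y}" "x ~= y" unfolding card_2_iff by blast
  then have "x < k" "y < k" using e2 by auto
  with xy have xy: "e = {x, y}" "x ~= y" "x < k" "y < k" by auto
  then have "\<exists>i j. e = {i, j} \<and> i < j \<and> j < k" by (metis insert_commute linorder_neqE_nat)
  then obtain i j where "e = {i, j}" "i < j" "j < k" by blast
  then show "e \<in> eset (filter (%p. {fst p, snd p} \<in> H) (ap k))"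
   using e by (auto simp: eset_def set_ap intro!: image_eqI[of _ _ "(i, j)"])
 qed (auto simp: eset_def)
qed

lemma CF_ap: "CF f ==> CF (%x. ap (f x))"
proof -
 assume f: "CF f"
 have "CF (%p :: 'a \<times> nat. map (%i. (i, snd p)) [0..<snd p])"
  by (rule CF_map[where f = "%p i. (i, snd p)"]) (intro FP_CF FP_rules CF_upt)+
 then have "CF (%x. map (%j. map (%i. (i, j)) [0..<j]) [0..<f x])"
  by (intro CF_map[where f = "%x j. map (%i. (i, j)) [0..<j]"] CF_upt f)
 from CF1[OF FP_concat0 this] show ?thesis by (simp add: ap_def)
qed

lemma CF_filter:
 assumes "CF (%p. f (fst p) (snd p))" "CF l" shows "CF (%x. filter (f x) (l x))"
proof -
 have "CF (%p. (f (fst p) (snd p), snd p))" by (intro CF_Pair assms(1) FP_CF FP_rules)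
 then have "CF (%x. map (%y. (f x y, y)) (l x))" by (intro CF_map[where f = "%x y. (f x y, y)"] assms(2))
 moreover have "FP (%l :: (bool \<times> 'b) list. map snd (filter fst l))" by (intro FP_rules)
 ultimately have "CF (%x. map snd (filter fst (map (%y. (f x y, y)) (l x))))" by (rule CF1[rotated])
 moreover have "map snd (filter fst (map (%y. (g y, y)) ys)) = filter g ys" for g and ys :: "'b list"
  by (induction ys) auto
 ultimately show ?thesis by simp
qed

lemma num_IndSub_nat: assumes "nat_valued \<Phi>" "is_graph G" shows "num_IndSub \<Phi> k G \<in> \<nat>" "num_cpIndSub \<Phi> H G c \<in> \<nat>"
proof -
 have "\<Phi> (induced G X) \<in> \<nat>" if "X \<subseteq> verts G" for X
 proof -
  have "is_graph (induced G X)" using assms(2) that finite_subset by (auto simp: is_graph_def induced_def)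
  then show ?thesis using assms(1) unfolding nat_valued_def by blast
 qed
 note ind = this
 have sm: "(!!x. x \<in> X ==> f x \<in> \<nat>) ==> sum f X \<in> \<nat>" for X and f :: "nat set => rat"
  by (induction X rule: infinite_finite_induct) auto
 show "num_IndSub \<Phi> k G \<in> \<nat>" unfolding num_IndSub_def by (rule sm, rule ind) simp
 show "num_cpIndSub \<Phi> H G c \<in> \<nat>" unfolding num_cpIndSub_def by (rule sm, rule ind) simp
qed

text \<open>The counterpart of \<open>gadget\<close> on data: the pattern is an edge list, and the
  adjacency relation is read off a matrix.\<close>

locale reduct =
 fixes \<Phi> :: "graph => rat" and k t :: nat and Hl :: "(nat \<times> nat) list" and rows :: "nat list list"
 assumes par: "is_param \<Phi>" and nv: "nat_valued \<Phi>" and Hl: "edge_list k Hl" and tk: "2 * t \<le> k"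
  and bic: "!!i l. i < t ==> l < t ==> {i, t + l} \<in> eset Hl"
  and sym: "!!u v. radj rows u v ==> radj rows v u" and irr: "!!u. \<not> radj rows u u"
begin

sublocale gd: gadget \<Phi> k t "length rows" "eset Hl" "radj rows"
 using par edge_list_pairs[OF Hl] tk bic sym irr by unfold_locales auto

definition Gof :: "item => graph" where "Gof it = gd.GG (eset (fst (snd it))) (set (snd (snd it)))"

lemma item_ok:
 assumes "fst (snd it) \<in> set (subseqs Hl)" "sorted (snd (snd it))" "distinct (snd (snd it))"
 shows "is_graph (Gof it)" "gword t rows (fst (snd it)) (snd (snd it)) = enc_graph (Gof it)"
proof -
 have "eset (fst (snd it)) \<subseteq> eset Hl" using subseqs_sub[OF assms(1)] by (auto simp: eset_def)
 then show "is_graph (Gof it)" unfolding Gof_def by (intro gd.GG_graph) auto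
 show "gword t rows (fst (snd it)) (snd (snd it)) = enc_graph (Gof it)"
  unfolding Gof_def by (rule gd.gword_enc(1)[OF refl refl assms(2,3)])
qed

lemma ind_items:
 assumes "it \<in> set (items_ind k Hl)"
 shows "is_graph (Gof it)" "gword t rows (fst (snd it)) (snd (snd it)) = enc_graph (Gof it)"
proof -
 have it: "fst (snd it) \<in> set (subseqs Hl)" "\<exists>R. snd (snd it) = filter (%i. i \<notin> set R) [0..<k]"
  using assms by (auto simp: items_ind_def)
 then have "sorted (snd (snd it))" "distinct (snd (snd it))" by (auto simp: sorted_wrt_filter)
 then show "is_graph (Gof it)" "gword t rows (fst (snd it)) (snd (snd it)) = enc_graph (Gof it)" using item_ok it(1) by blast+
qed

text \<open>Colors are encoded as positions in the order of \<open>{..<k}\<close>, so the color of a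
  vertex is encoded by its class index itself.\<close>

lemma cp_items:
 assumes "it \<in> set (items_cp k Hl)"
 shows "is_graph (Gof it)" "snd (snd it) = [0..<k]" "is_coloring ({..<k}, eset Hl) (Gof it) (%v. v div gd.M)"
  "encgr k Hl @ gword t rows (fst (snd it)) (snd (snd it)) @ map fst (gvl t rows (snd (snd it))) =
    enc_colored (({..<k}, eset Hl), Gof it, (%v. v div gd.M))"
proof -
 have it: "fst (snd it) \<in> set (subseqs Hl)" "snd (snd it) = [0..<k]" using assms by (auto simp: items_cp_def)
 have sd: "sorted (snd (snd it))" "distinct (snd (snd it))" using it by auto
 have sub: "eset (fst (snd it)) \<subseteq> eset Hl" using subseqs_sub[OF it(1)] by (auto simp: eset_def)
 have J: "set (snd (snd it)) = {..<k}" using it by auto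
 show "is_graph (Gof it)" by (rule item_ok(1)[OF it(1) sd])
 show "is_coloring ({..<k}, eset Hl) (Gof it) (%v. v div gd.M)" unfolding Gof_def J by (rule gd.GG_coloring[OF sub])
 have v: "verts (Gof it) = gd.vs (set (snd (snd it)))" by (simp add: Gof_def gd.GG_def)
 have "map (%v. card {w \<in> {..<k}. w < v div gd.M}) (sorted_list_of_set (verts (Gof it))) = map fst (gvl t rows (snd (snd it)))"
  unfolding v gd.vl_sorted[OF sd] gd.gword_enc(2)[OF refl refl sd] map_map
 proof (rule map_cong[OF refl])
  fix p assume "p \<in> set (gd.vl (snd (snd it)))"
  then have "p \<in> set (gvl t rows (snd (snd it)))" by (simp only: gd.gword_enc(2)[OF refl refl sd])
  then have "\<exists>i\<in>set (snd (snd it)). p \<in> (%u. (i, u)) ` set (if i < t + t then [0..<length rows] else [0])"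
   unfolding gvl_def by (simp only: set_concat set_map UN_iff bex_simps)
  then obtain i where i: "i \<in> set (snd (snd it))" "p \<in> (%u. (i, u)) ` set (if i < t + t then [0..<length rows] else [0])" by blast
  have "set (if i < t + t then [0..<length rows] else [0]) \<subseteq> {..<gd.M}" by (auto simp: gd.M_def)
  then have p: "fst p < k" "snd p < gd.M" using i J by auto
  have "{w \<in> {..<k}. w < (fst p * gd.M + snd p) div gd.M} = {..<fst p}" using p gd.code(1) by auto
  then show "((%v. card {w \<in> {..<k}. w < v div gd.M}) \<circ> (%p. fst p * gd.M + snd p)) p = fst p" by simp
 qed
 moreover have "encgr k Hl = enc_graph ({..<k}, eset Hl)" using enc_gr[of k Hl] gr_eset[OF Hl] by simp
 ultimately show "encgr k Hl @ gword t rows (fst (snd it)) (snd (snd it)) @ map fst (gvl t rows (snd (snd it))) =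
    enc_colored (({..<k}, eset Hl), Gof it, (%v. v div gd.M))"
  using item_ok(2)[OF it(1) sd] by (simp add: enc_colored_def)
qed (use assms in \<open>auto simp: items_cp_def\<close>)

lemma ind_tot:
 assumes "!!it. it \<in> set (items_ind k Hl) ==> num_IndSub \<Phi> k (Gof it) = of_nat (v it)"
  "mset bs = mset (map (%it. (fst it, v it, 0, 1)) (items_ind k Hl))"
 shows "of_nat (diffn bs) = \<bar>hatr \<Phi> k (eset Hl)\<bar> * of_nat (fact t * card gd.cls)"
 using diffn_correct[OF assms] gd.items_ind_sum[OF Hl refl] unfolding Gof_def by (simp add: abs_mult)

lemma cp_tot:
 assumes "!!it. it \<in> set (items_cp k Hl) ==> num_cpIndSub \<Phi> ({..<k}, eset Hl) (Gof it) (%v. v div gd.M) = of_nat (v it)"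
  "mset bs = mset (map (%it. (fst it, v it, 0, 1)) (items_cp k Hl))"
 shows "of_nat (diffn bs) = \<bar>hatr \<Phi> k (eset Hl)\<bar> * of_nat (fact t * card gd.cls)"
proof -
 have "(\<Sum>it\<leftarrow>items_cp k Hl. sg (fst it) * num_cpIndSub \<Phi> ({..<k}, eset Hl) (Gof it) (%v. v div gd.M)) =
  hatr \<Phi> k (eset Hl) * of_nat (fact t * card gd.cls)"
  unfolding gd.items_cp_sum[OF Hl refl, symmetric]
 proof (rule arg_cong[of _ _ sum_list], rule map_cong[OF refl])
  fix it assume "it \<in> set (items_cp k Hl)"
  then have "set (snd (snd it)) = {..<k}" using cp_items(2) by auto
  then show "sg (fst it) * num_cpIndSub \<Phi> ({..<k}, eset Hl) (Gof it) (%v. v div gd.M) =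
   sg (fst it) * num_cpIndSub \<Phi> ({..<k}, eset Hl) (gd.GG (eset (fst (snd it))) {..<k}) (%v. v div gd.M)" by (simp add: Gof_def)
 qed
 then show ?thesis using diffn_correct[OF assms] by (simp add: abs_mult)
qed

end

definition ph :: "(graph => rat) => nat => (nat \<times> nat) list => nat" where
 "ph \<Phi> k S = nat \<lfloor>\<Phi> (gr k S)\<rfloor>"

lemma ph_eq: assumes "nat_valued \<Phi>" shows "\<Phi> (gr k S) = of_nat (ph \<Phi> k S)"
proof -
 have "\<Phi> (gr k S) \<in> \<nat>" using assms gr_graph unfolding nat_valued_def by blast
 then obtain m where "\<Phi> (gr k S) = of_nat m" by (auto elim: Nats_cases)
 then show ?thesis by (simp add: ph_def)
qed

text \<open>The given program for \<Phi> is simulated on the encoded graph; for a natural number the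
  first output cell contains the whole value.\<close>

lemma CF_ph:
 assumes "nat_valued \<Phi>" "computes p {G. is_graph G} enc_graph \<Phi>"
 shows "CF (%x. ph \<Phi> (fst x) (snd x))"
proof -
 from simulate obtain G where "\<forall>p. \<exists>e. \<forall>x s. run p x s -->
   (\<exists>t \<le> G (steps s + length x). pev e (enc x) t (enc (mem s 0, mem s 1, mem s 2)))" by blast
 then obtain e where e: "\<forall>x s. run p x s -->
   (\<exists>t \<le> G (steps s + length x). pev e (enc x) t (enc (mem s 0, mem s 1, mem s 2)))" by blast
 have "CF (%x :: nat \<times> (nat \<times> nat) list. encgr (fst x) (snd x))"
  by (rule CF_encgr[OF FP_CF[OF FP_fst0] FP_CF[OF FP_snd0]])
 then obtain e0 where e0: "!!x :: nat \<times> (nat \<times> nat) list. pc e0 (enc x) (enc (encgr (fst x) (snd x)))" unfolding CF_iff by blast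
 have "pc (Cmp e0 (Cmp e Fst)) (enc x) (enc (ph \<Phi> (fst x) (snd x)))" for x
 proof -
  let ?G = "gr (fst x) (snd x)"
  obtain s where s: "run p (enc_graph ?G) s" "outputs s (\<Phi> ?G)" using assms(2) gr_graph unfolding computes_def by blast
  have m: "mem s 0 = ph \<Phi> (fst x) (snd x)" using s(2)[unfolded ph_eq[OF assms(1)]] by (simp add: outputs_def enc_rat_nat numeral_3_eq_3)
  obtain t where "pev e (enc (encgr (fst x) (snd x))) t (enc (mem s 0, mem s 1, mem s 2))"
   using e s(1) unfolding enc_gr by blast
  then have "pc e (enc (encgr (fst x) (snd x))) (P (enc (mem s 0)) (enc (mem s 1, mem s 2)))" by (auto simp: pc_def)
  from pc_intros(5)[OF e0 pc_intros(5)[OF this pc_intros(2)]] show ?thesis unfolding m .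
 qed
 then show ?thesis unfolding CF_iff by blast
qed

text \<open>For an edge list this is the absolute value of \<open>hatr\<close>. It serves both as
  the test for a usable pattern and as part of the divisor in the reduction.\<close>

definition dh :: "(graph => rat) => nat => (nat \<times> nat) list => nat" where
 "dh \<Phi> k Hl = diffn (map (%S. (par S, ph \<Phi> k S, 0, 1)) (subseqs Hl))"

lemma dh_eq: assumes "nat_valued \<Phi>" "edge_list k Hl" shows "of_nat (dh \<Phi> k Hl) = \<bar>hatr \<Phi> k (eset Hl)\<bar>"
proof -
 have "of_nat (dh \<Phi> k Hl) = \<bar>\<Sum>S\<leftarrow>subseqs Hl. sg (par S) * \<Phi> (gr k S)\<bar>"
  unfolding dh_def by (rule diffn_correct[where v = "ph \<Phi> k"]) (auto simp: ph_eq[OF assms(1)])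
 also have "(\<Sum>S\<leftarrow>subseqs Hl. sg (par S) * \<Phi> (gr k S)) = (\<Sum>S\<leftarrow>subseqs Hl. sg (par S) * \<Phi> ({..<k}, eset S))"
  by (rule arg_cong[of _ _ sum_list], rule map_cong[OF refl]) (simp add: gr_eset[OF edge_list_sub[OF assms(2)]])
 also have "\<dots> = hatr \<Phi> k (eset Hl)" using sum_edges[OF assms(2), of "%S. \<Phi> ({..<k}, S)"] by (simp add: hatr_def)
 finally show ?thesis .
qed

lemma FP_par: "FP (par :: 'a::enc list => bool)"
proof -
 have "FP (%l :: 'a list. foldl (%a _. \<not> a) False l)"
  by (rule FP_foldl[where f = "%x a y. \<not> a" and B = "%n. 1"]) (intro FP_rules polyb_const | simp)+
 then show ?thesis by (simp add: par_def[abs_def])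
qed

lemma CF_dh: assumes "CF (%x. ph \<Phi> (fst x) (snd x))" shows "CF (%x. dh \<Phi> (fst x) (snd x))"
proof -
 have 1: "CF (%p :: (nat \<times> (nat \<times> nat) list) \<times> (nat \<times> nat) list. ph \<Phi> (fst (fst p)) (snd p))"
  using CF_comp[OF assms FP_CF[OF FP_Pair[OF FP_fst[OF FP_fst0] FP_snd0]]] by simp
 have "CF (%p :: (nat \<times> (nat \<times> nat) list) \<times> (nat \<times> nat) list. (par (snd p), ph \<Phi> (fst (fst p)) (snd p), 0 :: nat, 1 :: nat))"
  by (intro CF_Pair 1 FP_CF[OF FP_comp[OF FP_par FP_snd0]] FP_CF[OF FP_const])
 then have "CF (%x :: nat \<times> (nat \<times> nat) list. map (%S. (par S, ph \<Phi> (fst x) S, 0 :: nat, 1 :: nat)) (subseqs (snd x)))"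
  by (rule CF_map[where f = "%x S. (par S, ph \<Phi> (fst x) S, 0, 1)", OF _ CF_subseqs[OF FP_CF[OF FP_snd0]]])
 from CF1[OF FP_diffn this] show ?thesis by (simp add: dh_def)
qed

definition good :: "(graph => rat) => nat => nat => (nat \<times> nat) list => bool" where
 "good \<Phi> t k Hl \<longleftrightarrow> t + t \<le> k \<and> 0 < dh \<Phi> k Hl \<and> (\<forall>i\<in>set [0..<t]. \<forall>l\<in>set [0..<t]. pmem Hl i (t + l))"

lemma CF_good: assumes "CF (%x. ph \<Phi> (fst x) (snd x))" shows "CF (%x. good \<Phi> (fst (fst x)) (snd (fst x)) (snd x))"
proof -
 have "FP (%p :: (nat list \<times> nat) \<times> (nat \<times> (nat \<times> nat) list) \<times> nat. snd (fst p) + snd (fst p) \<le> fst (fst (snd p)) \<and>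
   0 < snd (snd p) \<and> (\<forall>i\<in>set (fst (fst p)). \<forall>l\<in>set (fst (fst p)). pmem (snd (fst (snd p))) i (snd (fst p) + l)))"
  unfolding pmem_def by (intro FP_rules)
 moreover have "CF (%x :: (nat \<times> nat) \<times> (nat \<times> nat) list. dh \<Phi> (snd (fst x)) (snd x))"
  using CF_comp[OF CF_dh[OF assms] FP_CF[OF FP_Pair[OF FP_snd[OF FP_fst0] FP_snd0]]] by simp
 then have "CF (%x :: (nat \<times> nat) \<times> (nat \<times> nat) list. (([0..<fst (fst x)], fst (fst x)), (snd (fst x), snd x), dh \<Phi> (snd (fst x)) (snd x)))"
  by (intro CF_Pair CF_upt FP_CF[OF FP_fst[OF FP_fst0]] FP_CF[OF FP_snd[OF FP_fst0]] FP_CF[OF FP_snd0])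
 ultimately have "CF (%x. (%p. snd (fst p) + snd (fst p) \<le> fst (fst (snd p)) \<and>
   0 < snd (snd p) \<and> (\<forall>i\<in>set (fst (fst p)). \<forall>l\<in>set (fst (fst p)). pmem (snd (fst (snd p))) i (snd (fst p) + l)))
   (([0..<fst (fst x)], fst (fst x)), (snd (fst x), snd x), dh \<Phi> (snd (fst x)) (snd x)))" by (rule CF1)
 then show ?thesis by (simp add: good_def)
qed

definition cand :: "(graph => rat) => nat => nat => (nat \<times> nat) list list" where
 "cand \<Phi> t k = filter (good \<Phi> t k) (subseqs (ap k))"

text \<open>An unbounded search; it ends for every \<open>t\<close> when the parameter is nontrivial
  on arbitrarily large \<open>k\<close>, by \<open>ex_cand\<close>.\<close>

definition KK :: "(graph => rat) => nat => nat" where "KK \<Phi> t = (LEAST k. 0 < length (cand \<Phi> t k))"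
definition HH :: "(graph => rat) => nat => (nat \<times> nat) list" where "HH \<Phi> t = nthd [] (cand \<Phi> t (KK \<Phi> t)) 0"

lemma CF_cand: assumes "CF (%x. ph \<Phi> (fst x) (snd x))" shows "CF (%x. cand \<Phi> (fst x) (snd x))"
 unfolding cand_def
 by (rule CF_filter[where f = "%x Hl. good \<Phi> (fst x) (snd x) Hl", OF CF_good[OF assms] CF_subseqs[OF CF_ap[OF FP_CF[OF FP_snd0]]]])

lemma CF_KH:
 assumes "CF (%x. ph \<Phi> (fst x) (snd x))" "!!t. \<exists>k. 0 < length (cand \<Phi> t k)"
 shows "CF (KK \<Phi>)" "CF (HH \<Phi>)"
proof -
 have "FP (%l :: (nat \<times> nat) list list. 0 < length l)" by (intro FP_rules)
 from CF1[OF this CF_cand[OF assms(1)]] have "CF (%x. LEAST k. 0 < length (cand \<Phi> x k))"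
  by (rule CF_LEAST[where b = "%t k. 0 < length (cand \<Phi> t k)", OF _ assms(2)])
 then show k: "CF (KK \<Phi>)" by (simp add: KK_def[abs_def])
 have "CF (%t. cand \<Phi> t (KK \<Phi> t))" using CF_comp[OF CF_cand[OF assms(1)] CF_Pair[OF FP_CF[OF FP_id] k]] by simp
 moreover have "FP (%l :: (nat \<times> nat) list list. nthd [] l 0)" by (intro FP_rules)
 ultimately have "CF (%t. nthd [] (cand \<Phi> t (KK \<Phi> t)) 0)" by (rule CF1[rotated])
 then show "CF (HH \<Phi>)" by (simp add: HH_def[abs_def])
qed

lemma KH_good:
 assumes "\<exists>k. 0 < length (cand \<Phi> t k)"
 shows "HH \<Phi> t \<in> set (subseqs (ap (KK \<Phi> t)))" "good \<Phi> t (KK \<Phi> t) (HH \<Phi> t)"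
proof -
 have l: "0 < length (cand \<Phi> t (KK \<Phi> t))" unfolding KK_def by (rule LeastI_ex[OF assms])
 then have "HH \<Phi> t \<in> set (cand \<Phi> t (KK \<Phi> t))" by (simp add: HH_def nthd_def)
 then show "HH \<Phi> t \<in> set (subseqs (ap (KK \<Phi> t)))" "good \<Phi> t (KK \<Phi> t) (HH \<Phi> t)" by (auto simp: cand_def)
qed

lemma CF_fact: assumes "CF f" shows "CF (%x. fact (f x) :: nat)"
proof -
 have "CF (%x. foldl (%a i. a * (i + 1)) 1 [0..<f x])"
  by (rule CF_foldl[where f = "%x a i. a * (i + 1)", OF _ FP_CF[OF FP_const] CF_upt[OF assms]]) (intro CF_mult FP_CF FP_rules)
 moreover have "foldl (%a i. a * (i + 1)) 1 [0..<n] = (fact n :: nat)" for n by (induction n) simp_all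
 ultimately show ?thesis by simp
qed

lemma CF_items_cp: assumes "CF k" "CF h" shows "CF (%x. items_cp (k x) (h x))"
proof -
 have "FP (%p :: nat list \<times> (nat \<times> nat) list list. map (%S. (par S, S, fst p)) (snd p))"
  by (intro FP_rules FP_comp[OF FP_par])
 from CF1[OF this CF_Pair[OF CF_upt[OF assms(1)] CF_subseqs[OF assms(2)]]] show ?thesis by (simp add: items_cp_def)
qed

lemma CF_items_ind: assumes "CF k" "CF h" shows "CF (%x. items_ind (k x) (h x))"
proof -
 have x: "(a ~= b) = (a \<and> \<not> b \<or> \<not> a \<and> b)" for a b by blast
 have "FP (%p :: (nat list \<times> nat list list) \<times> (nat \<times> nat) list list.
   concat (map (%S. map (%R. (par S ~= par R, S, filter (%i. i \<notin> set R) (fst (fst p)))) (snd (fst p))) (snd p)))"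
  unfolding x by (intro FP_rules FP_comp[OF FP_par])
 from CF1[OF this CF_Pair[OF CF_Pair[OF CF_upt[OF assms(1)] CF_subseqs[OF CF_upt[OF assms(1)]]] CF_subseqs[OF assms(2)]]]
 show ?thesis by (simp add: items_ind_def)
qed

text \<open>About \<open>64 * t * t\<close> vertices suffice: \<open>1 - 1 / \<alpha>\<close> is at
  least 1/2, so \<open>k powr (1 - 1 / \<alpha>)\<close> is at least \<open>sqrt k\<close>, hence at
  least \<open>8 * t\<close>.\<close>

lemma ex_cand:
 assumes "admissible \<alpha> \<epsilon> \<Phi>" "2 \<le> \<alpha>" "0 < \<epsilon>" "nontrivial \<Phi>"
 shows "\<exists>k. 0 < length (cand \<Phi> t k)"
proof -
 obtain k where k: "64 + 64 * t * t \<le> k" "nontrivial_on \<Phi> k"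
  using assms(4) unfolding nontrivial_def finite_nat_set_iff_bounded by (metis mem_Collect_eq not_less)
 have "1 / real \<alpha> \<le> 1 / 2" using assms(2) by (simp add: field_simps)
 then have "real k powr (1 / 2) \<le> real k powr (1 - 1 / real \<alpha>)" using k by (intro powr_mono) auto
 moreover have "8 * real t \<le> sqrt (real k)"
 proof (rule real_le_rsqrt)
  have "real (64 * t * t) \<le> real k" using k(1) by (simp only: of_nat_le_iff)
  then show "(8 * real t)\<^sup>2 \<le> real k" by (simp add: power2_eq_square)
 qed
 ultimately have "real t \<le> real k powr (1 - 1 / real \<alpha>) / 8" using k by (simp add: powr_half_sqrt)
 note tk = this
 have k64: "64 \<le> k" using k(1) by simp
 from exists_hat[OF assms(1-3) k(2) k64 tk] obtain H where H: "2 * t \<le> k" "H \<subseteq> pairs k" "hatr \<Phi> k H ~= 0" "\<forall>i<t. \<forall>l<t. {i, t + l} \<in> H"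
  by blast
 obtain Hl where Hl: "Hl \<in> set (subseqs (ap k))" "eset Hl = H" using ap_eset[OF H(2)] by blast
 have "of_nat (dh \<Phi> k Hl) ~= (0 :: rat)"
  using dh_eq[OF admissible_facts(2)[OF assms(1)] edge_list_sub[OF edge_list_ap Hl(1)]] H(3) Hl(2) by simp
 then have "good \<Phi> t k Hl" using H(1,4) Hl(2) by (auto simp: good_def pmem_eset)
 then have "Hl \<in> set (cand \<Phi> t k)" using Hl(1) by (simp add: cand_def)
 then show ?thesis by (auto intro!: exI[of _ k] length_pos_if_in_set)
qed

lemma rowsI_graph:
 fixes G :: graph and t :: nat
 assumes G: "is_graph G"
 defines "R \<equiv> rowsI (t # enc_graph G)"
 shows "radj R u v ==> radj R v u" "\<not> radj R u u"
  "card {A. A \<subseteq> {..<length R} \<and> card A = t \<and> (\<forall>u\<in>A. \<forall>v\<in>A. u ~= v --> radj R u v)} = num_cliques t G"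
proof -
 show "radj R u v ==> radj R v u" unfolding R_def rowsI_enc rows_radj by (simp add: insert_commute)
 show "\<not> radj R u u" unfolding R_def rowsI_enc rows_radj using G by (fastforce simp: is_graph_def)
 show "card {A. A \<subseteq> {..<length R} \<and> card A = t \<and> (\<forall>u\<in>A. \<forall>v\<in>A. u ~= v --> radj R u v)} = num_cliques t G"
  unfolding R_def rowsI_enc rows_radj length_map by (rule cls_num_cliques[OF G])
qed

lemma reduct_KH:
 assumes "is_param \<Phi>" "nat_valued \<Phi>" "\<exists>k. 0 < length (cand \<Phi> t k)" "is_graph G"
 shows "reduct \<Phi> (KK \<Phi> t) t (HH \<Phi> t) (rowsI (t # enc_graph G))" "0 < dh \<Phi> (KK \<Phi> t) (HH \<Phi> t)"
  "of_nat (dh \<Phi> (KK \<Phi> t) (HH \<Phi> t)) = \<bar>hatr \<Phi> (KK \<Phi> t) (eset (HH \<Phi> t))\<bar>"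
proof -
 note g = KH_good[OF assms(3)]
 have e: "edge_list (KK \<Phi> t) (HH \<Phi> t)" by (rule edge_list_sub[OF edge_list_ap g(1)])
 show "0 < dh \<Phi> (KK \<Phi> t) (HH \<Phi> t)" using g(2) by (simp add: good_def)
 show "of_nat (dh \<Phi> (KK \<Phi> t) (HH \<Phi> t)) = \<bar>hatr \<Phi> (KK \<Phi> t) (eset (HH \<Phi> t))\<bar>" by (rule dh_eq[OF assms(2) e])
 show "reduct \<Phi> (KK \<Phi> t) t (HH \<Phi> t) (rowsI (t # enc_graph G))"
  by unfold_locales (use assms(1,2) e g(2) rowsI_graph[OF assms(4)] in \<open>auto simp: good_def pmem_eset mult_2\<close>)
qed

lemma of_nat_diffn_eq:
 assumes "of_nat x = (of_nat d :: rat) * of_nat (fact t * c)" shows "x = d * fact t * c"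
proof -
 have "(of_nat x :: rat) = of_nat (d * (fact t * c))" using assms by (simp only: of_nat_mult)
 then show ?thesis by (simp only: of_nat_eq_iff mult.assoc)
qed

section \<open>Parameterized hardness of both problems\<close>

text \<open>The two problems differ only in the prefix, the color flag and the items of the plan. In
  both cases the signed sum of the answers is, up to sign, \<open>dh\<close> times
  \<open>fact t\<close> times the number of cliques.\<close>

theorem W1_hard_both:
 assumes adm: "admissible \<alpha> \<epsilon> \<Phi>" "2 \<le> \<alpha>" "0 < \<epsilon>" "nontrivial \<Phi>"
 shows "W1_hard (INDSUB \<Phi>)" "W1_hard (CPINDSUB \<Phi>)"
proof -
 note af = admissible_facts[OF adm(1)]
 obtain p where p: "computes p {G. is_graph G} enc_graph \<Phi>" using af(3) by blast
 note ex = ex_cand[OF adm]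
 note CFph = CF_ph[OF af(2) p]
 note KH = CF_KH[OF CFph ex]
 note rk = reduct_KH[OF af(1,2) ex]
 let ?D = "%t. dh \<Phi> (KK \<Phi> t) (HH \<Phi> t) * fact t"
 have CFD: "CF ?D" using CF_mult[OF CF_comp[OF CF_dh[OF CFph] CF_Pair[OF KH]] CF_fact[OF FP_CF[OF FP_id]]] by simp
 have D0: "0 < ?D t" for t using KH_good(2)[OF ex, of t] by (simp add: good_def)
 have CF1K: "CF (%t. [KK \<Phi> t])" by (rule CF1[OF _ KH(1), of "%k. [k]"]) (intro FP_rules)
 let ?Wi = "%t. (t, [KK \<Phi> t], False, items_ind (KK \<Phi> t) (HH \<Phi> t))"
 let ?Wc = "%t. (t, encgr (KK \<Phi> t) (HH \<Phi> t), True, items_cp (KK \<Phi> t) (HH \<Phi> t))"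
 show "W1_hard (INDSUB \<Phi>)" unfolding W1_hard_def
 proof (rule reduction[where W = ?Wi and D = ?D and g = "KK \<Phi>", OF _ CFD KH(1) D0])
  show "CF ?Wi" by (intro CF_Pair CF_items_ind KH CF1K FP_CF[OF FP_id] FP_CF[OF FP_const])
 next
  fix t and G :: graph and w assume G: "is_graph G" and w: "w \<in> set (words (?Wi t) (rowsI (t # enc_graph G)))"
  interpret rd: reduct \<Phi> "KK \<Phi> t" t "HH \<Phi> t" "rowsI (t # enc_graph G)" by (rule rk(1)[OF G])
  obtain it where it: "it \<in> set (items_ind (KK \<Phi> t) (HH \<Phi> t))" "snd w = [KK \<Phi> t] @ enc_graph (rd.Gof it)"
   using w rd.ind_items(2) by (auto simp: words_def)
  show "\<exists>y\<in>instances (INDSUB \<Phi>). snd w = encode (INDSUB \<Phi>) y \<and> param (INDSUB \<Phi>) y \<le> KK \<Phi> t \<and> answer (INDSUB \<Phi>) y \<in> \<nat>"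
   by (rule bexI[of _ "(KK \<Phi> t, rd.Gof it)"])
    (use it rd.ind_items(1)[OF it(1)] num_IndSub_nat(1)[OF af(2)] in \<open>auto simp: INDSUB_def\<close>)
 next
  fix t and G :: graph and bs :: ans and v :: "bool \<times> nat list => nat" assume G: "is_graph G"
   and v: "!!w y. w \<in> set (words (?Wi t) (rowsI (t # enc_graph G))) ==> y \<in> instances (INDSUB \<Phi>) ==>
    snd w = encode (INDSUB \<Phi>) y ==> answer (INDSUB \<Phi>) y = of_nat (v w)"
   and bs: "mset bs = mset (map (%w. (fst w, v w, 0, 1)) (words (?Wi t) (rowsI (t # enc_graph G))))"
  let ?R = "rowsI (t # enc_graph G)"
  interpret rd: reduct \<Phi> "KK \<Phi> t" t "HH \<Phi> t" ?R by (rule rk(1)[OF G])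
  let ?mk = "%it :: item. (fst it, KK \<Phi> t # gword t ?R (fst (snd it)) (snd (snd it)))"
  have ws: "words (?Wi t) ?R = map ?mk (items_ind (KK \<Phi> t) (HH \<Phi> t))" by (simp add: words_def)
  have "of_nat (diffn bs) = \<bar>hatr \<Phi> (KK \<Phi> t) (eset (HH \<Phi> t))\<bar> * of_nat (fact t * card rd.gd.cls)"
  proof (rule rd.ind_tot[where v = "%it. v (?mk it)"])
   fix it assume it: "it \<in> set (items_ind (KK \<Phi> t) (HH \<Phi> t))"
   have "answer (INDSUB \<Phi>) (KK \<Phi> t, rd.Gof it) = of_nat (v (?mk it))"
    by (rule v) (use it rd.ind_items[OF it] in \<open>auto simp: ws INDSUB_def\<close>)
   then show "num_IndSub \<Phi> (KK \<Phi> t) (rd.Gof it) = of_nat (v (?mk it))" by (simp add: INDSUB_def)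
  qed (use bs in \<open>simp add: ws o_def\<close>)
  then show "diffn bs = ?D t * num_cliques t G"
   unfolding rk(3)[OF G, symmetric] rd.gd.cls_def rowsI_graph(3)[OF G] by (rule of_nat_diffn_eq)
 qed
 show "W1_hard (CPINDSUB \<Phi>)" unfolding W1_hard_def
 proof (rule reduction[where W = ?Wc and D = ?D and g = "KK \<Phi>", OF _ CFD KH(1) D0])
  show "CF ?Wc" by (intro CF_Pair CF_items_cp CF_encgr KH FP_CF[OF FP_id] FP_CF[OF FP_const])
 next
  fix t and G :: graph and w assume G: "is_graph G" and w: "w \<in> set (words (?Wc t) (rowsI (t # enc_graph G)))"
  interpret rd: reduct \<Phi> "KK \<Phi> t" t "HH \<Phi> t" "rowsI (t # enc_graph G)" by (rule rk(1)[OF G])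
  obtain it where it: "it \<in> set (items_cp (KK \<Phi> t) (HH \<Phi> t))"
    "snd w = enc_colored (({..<KK \<Phi> t}, eset (HH \<Phi> t)), rd.Gof it, (%v. v div rd.gd.M))"
   using w rd.cp_items(4) by (auto simp: words_def)
  show "\<exists>y\<in>instances (CPINDSUB \<Phi>). snd w = encode (CPINDSUB \<Phi>) y \<and> param (CPINDSUB \<Phi>) y \<le> KK \<Phi> t \<and> answer (CPINDSUB \<Phi>) y \<in> \<nat>"
   by (rule bexI[of _ "(({..<KK \<Phi> t}, eset (HH \<Phi> t)), rd.Gof it, (%v. v div rd.gd.M))"])
    (use it rd.cp_items(1,3)[OF it(1)] num_IndSub_nat(2)[OF af(2)] graph_k[OF edge_list_pairs[OF rd.Hl]]
     in \<open>auto simp: CPINDSUB_def colored_graphs_def\<close>)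
 next
  fix t and G :: graph and bs :: ans and v :: "bool \<times> nat list => nat" assume G: "is_graph G"
   and v: "!!w y. w \<in> set (words (?Wc t) (rowsI (t # enc_graph G))) ==> y \<in> instances (CPINDSUB \<Phi>) ==>
    snd w = encode (CPINDSUB \<Phi>) y ==> answer (CPINDSUB \<Phi>) y = of_nat (v w)"
   and bs: "mset bs = mset (map (%w. (fst w, v w, 0, 1)) (words (?Wc t) (rowsI (t # enc_graph G))))"
  let ?R = "rowsI (t # enc_graph G)"
  interpret rd: reduct \<Phi> "KK \<Phi> t" t "HH \<Phi> t" ?R by (rule rk(1)[OF G])
  let ?mk = "%it :: item. (fst it, encgr (KK \<Phi> t) (HH \<Phi> t) @ gword t ?R (fst (snd it)) (snd (snd it)) @ map fst (gvl t ?R (snd (snd it))))"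
  have ws: "words (?Wc t) ?R = map ?mk (items_cp (KK \<Phi> t) (HH \<Phi> t))" by (simp add: words_def)
  have "of_nat (diffn bs) = \<bar>hatr \<Phi> (KK \<Phi> t) (eset (HH \<Phi> t))\<bar> * of_nat (fact t * card rd.gd.cls)"
  proof (rule rd.cp_tot[where v = "%it. v (?mk it)"])
   fix it assume it: "it \<in> set (items_cp (KK \<Phi> t) (HH \<Phi> t))"
   have "answer (CPINDSUB \<Phi>) (({..<KK \<Phi> t}, eset (HH \<Phi> t)), rd.Gof it, (%v. v div rd.gd.M)) = of_nat (v (?mk it))"
    by (rule v) (use it rd.cp_items[OF it] graph_k[OF edge_list_pairs[OF rd.Hl]] in \<open>auto simp: ws CPINDSUB_def colored_graphs_def\<close>)
   then show "num_cpIndSub \<Phi> ({..<KK \<Phi> t}, eset (HH \<Phi> t)) (rd.Gof it) (%v. v div rd.gd.M) = of_nat (v (?mk it))" by (simp add: CPINDSUB_def)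
  qed (use bs in \<open>simp add: ws o_def\<close>)
  then show "diffn bs = ?D t * num_cliques t G"
   unfolding rk(3)[OF G, symmetric] rd.gd.cls_def rowsI_graph(3)[OF G] by (rule of_nat_diffn_eq)
 qed
qed

section \<open>Cliques from sparse formulas\<close>

text \<open>Literals are coded as \<open>2 * v + b\<close>. The set must be consistent and must
  mention variables below \<open>n\<close> only, which also rules out padding points.\<close>

definition lit_ok :: "nat => nat set => bool" where
 "lit_ok n X \<longleftrightarrow> (\<forall>a\<in>X. a div 2 < n \<and> (\<forall>b\<in>X. a div 2 = b div 2 --> a = b))"

text \<open>The list \<open>[0..<g]\<close>, where \<open>g\<close> is the number of clauses divided
  by the length of \<open>ts\<close>, rounded up; it represents the group size by a list. The sum
  over \<open>ts\<close> is a product.\<close>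

definition gl :: "nat list => nat list list => nat list" where
 "gl ts F = filter (%i. sum_list (map (%_. i) ts) < length F) [0..<length F]"

definition grp :: "nat list => nat list => nat list list => nat => nat list list" where
 "grp gs ts F j = take (length gs) (drop (sum_list (map (%y. if y < j then length gs else 0) ts)) F)"

text \<open>The choices of one literal from each clause. Truncation to the length of
  \<open>pad\<close> makes the fold polynomial in the size of its arguments; when \<open>pad\<close>
  is long enough, nothing is cut off.\<close>

definition chs :: "nat list => nat list list => nat list list" where
 "chs pad G = foldl (%acc c. take (length pad) (concat (map (%a. map (%x. a # x) acc) c))) [[]] G"

definition VL :: "nat list => nat list => nat list => nat list list => (nat \<times> nat list) list" where
 "VL ts pad gs F = concat (map (%j. map (%x. (j, x)) (chs pad (grp gs ts F j))) ts)"

definition lrows :: "nat => (nat \<times> nat list) list => nat list list" where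
 "lrows n vl = map (%u. map (%v. of_bool (fst u ~= fst v \<and> lit_ok n (set (snd u @ snd v)))) vl) vl"

text \<open>A list of length \<open>3 ^ length gs\<close>, to be used as \<open>pad\<close>: the
  exponential factor enters as the size of an argument.\<close>

definition trip :: "nat list => nat list" where
 "trip gs = foldl (%acc _. acc @ acc @ acc) [0] gs"

lemma FP_gl: "FP ts ==> FP F ==> FP (%x. gl (ts x) (F x))"
proof -
 have "FP (%p. gl (fst p) (snd p))" unfolding gl_def by (intro FP_rules)
 then show "FP ts ==> FP F ==> ?thesis" using FP_comp[OF _ FP_Pair, of "%p. gl (fst p) (snd p)" ts F] by simp
qed

lemma esz_nats: "esz (x :: nat list) = 1 + 2 * length x" by (induction x) auto

lemma chs_size:
 "length (chs pad G) \<le> 1 + length pad \<and> (\<forall>x\<in>set (chs pad G). length x \<le> length G)"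
proof (induction G rule: rev_induct)
 case (snoc c G)
 have e: "chs pad (G @ [c]) = take (length pad) (concat (map (%a. map (%x. a # x) (chs pad G)) c))" by (simp add: chs_def)
 have "length x \<le> length (G @ [c])" if "x \<in> set (chs pad (G @ [c]))" for x
 proof -
  have "x \<in> set (concat (map (%a. map (%x. a # x) (chs pad G)) c))" using that unfolding e by (rule in_set_takeD)
  then show ?thesis using snoc by auto
 qed
 moreover have "length (chs pad (G @ [c])) \<le> 1 + length pad" unfolding e length_take by linarith
 ultimately show ?case by blast
qed (simp add: chs_def)

lemma FP_chs: assumes "FP pad" "FP G" shows "FP (%x. chs (pad x) (G x))"
proof -
 obtain S where S: "polyb S" "mono S" "\<forall>x. esz (pad x) \<le> S (esz x)" using assms(1) by (rule FP_bound)
 obtain R where R: "polyb R" "mono R" "\<forall>x. esz (G x) \<le> R (esz x)" using assms(2) by (rule FP_bound)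
 show ?thesis unfolding chs_def
 proof (rule FP_foldl[where f = "%x acc c. take (length (pad x)) (concat (map (%a. map (%x. a # x) acc) c))"
    and B = "%n. 1 + (1 + S n) * (1 + (1 + R n * 2))"])
  show "esz (foldl (%acc c. take (length (pad x)) (concat (map (%a. map (%x. a # x) acc) c))) [[]] zs) \<le>
   1 + (1 + S (esz x)) * (1 + (1 + R (esz x) * 2))" if h: "G x = zs @ zs'" for x zs zs'
  proof -
   have l: "length (pad x) \<le> S (esz x)" using length_esz[of "pad x"] S(3) by (meson le_trans less_imp_le)
   have g: "length zs \<le> R (esz x)" using length_esz[of "G x"] R(3)[rule_format, of x] h by simp
   have "esz y \<le> 1 + R (esz x) * 2" if "y \<in> set (chs (pad x) zs)" for y
    using chs_size[of "pad x" zs] that g esz_nats[of y] by fastforce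
   then have "esz (chs (pad x) zs) \<le> 1 + length (chs (pad x) zs) * (1 + (1 + R (esz x) * 2))" by (rule esz_list_le)
   also have "\<dots> \<le> 1 + (1 + S (esz x)) * (1 + (1 + R (esz x) * 2))"
    using chs_size[of "pad x" zs] l by (intro add_left_mono mult_right_mono) auto
   finally show ?thesis by (simp add: chs_def)
  qed
  show "polyb (%n. 1 + (1 + S n) * (1 + (1 + R n * 2)))" by (intro polyb_add polyb_mult polyb_const S(1) R(1))
  show "FP (%p. take (length (pad (fst p))) (concat (map (%a. map (%x. a # x) (fst (snd p))) (snd (snd p)))))"
   by (intro FP_rules FP_comp[OF assms(1)])
 qed (intro FP_rules assms)+
qed

lemma FP_lrows:
 "FP (%p :: nat \<times> nat list \<times> nat list \<times> nat list \<times> nat list list.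
   lrows (fst p) (VL (fst (snd p)) (fst (snd (snd p))) (fst (snd (snd (snd p)))) (snd (snd (snd (snd p))))))"
proof -
 have 1: "FP (%p :: nat list \<times> nat list \<times> nat list \<times> nat list list. VL (fst p) (fst (snd p)) (fst (snd (snd p))) (snd (snd (snd p))))"
  unfolding VL_def grp_def by (intro FP_rules FP_chs)
 have 2: "FP (%p. lrows (fst p) (snd p))" unfolding lrows_def lit_ok_def by (intro FP_rules)
 show ?thesis using FP_comp[OF 2 FP_Pair[OF FP_fst0 FP_comp[OF 1 FP_snd0]]] by simp
qed

lemma length_trip: "length (trip gs) = 3 ^ length gs"
 unfolding trip_def by (induction gs rule: rev_induct) auto

lemma gl_length:
 assumes "1 \<le> t"
 shows "length F \<le> t * length (gl [0..<t] F)" "t * length (gl [0..<t] F) \<le> length F + t"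
proof -
 let ?n = "length F"
 define g where "g = (LEAST m. ?n \<le> t * m)"
 have n: "?n \<le> t * ?n" using assms by simp
 have g1: "?n \<le> t * g" unfolding g_def by (rule LeastI[of _ ?n]) (rule n)
 have gn: "g \<le> ?n" unfolding g_def by (rule Least_le) (rule n)
 have lt: "t * i < ?n" if "i < g" for i using not_less_Least[of i "%m. ?n \<le> t * m"] that unfolding g_def by simp
 have ge: "\<not> t * i < ?n" if "g \<le> i" for i using g1 mult_le_mono2[OF that, of t] by linarith
 have s: "sum_list (map (%_. i) [0..<t]) = t * i" for i :: nat by (simp add: sum_list_triv)
 have "[0..<?n] = [0..<g] @ [g..<?n]" using gn by (metis le_add_diff_inverse upt_add_eq_append zero_le)
 moreover have "filter (%i. t * i < ?n) [0..<g] = [0..<g]" using lt by (intro filter_True) auto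
 moreover have "filter (%i. t * i < ?n) [g..<?n] = []" using ge by (intro filter_False) auto
 ultimately have e: "gl [0..<t] F = [0..<g]" unfolding gl_def s by simp
 show "?n \<le> t * length (gl [0..<t] F)" unfolding e using g1 by simp
 show "t * length (gl [0..<t] F) \<le> ?n + t"
 proof (cases g)
  case (Suc h)
  have "t * h < ?n" by (rule lt) (simp add: Suc)
  then show ?thesis unfolding e Suc by simp
 qed (simp add: e)
qed

lemma chs_props:
 assumes "!!c. c \<in> set G ==> length c \<le> 3" "3 ^ length G \<le> length pad"
 shows "length (chs pad G) \<le> 3 ^ length G \<and> (\<forall>x\<in>set (chs pad G). \<forall>c\<in>set G. set c \<inter> set x ~= {}) \<and>
  (\<forall>X. hits X (sets G) --> (\<exists>x\<in>set (chs pad G). set x \<subseteq> X))"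
 using assms
proof (induction G rule: rev_induct)
 case (snoc c G)
 have le: "(3::nat) ^ length G \<le> length pad" using snoc.prems(2) by simp
 note IH = snoc.IH[OF _ le]
 have h: "length (chs pad G) \<le> 3 ^ length G" "\<forall>x\<in>set (chs pad G). \<forall>c\<in>set G. set c \<inter> set x ~= {}"
  "\<forall>X. hits X (sets G) --> (\<exists>x\<in>set (chs pad G). set x \<subseteq> X)" using IH snoc.prems(1) by auto
 let ?l = "concat (map (%a. map (%x. a # x) (chs pad G)) c)"
 have ll: "length ?l = length c * length (chs pad G)" by (rule length_concat_const) simp
 also have "\<dots> \<le> 3 * 3 ^ length G" using h(1) snoc.prems(1)[of c] by (intro mult_le_mono) auto
 finally have l3: "length ?l \<le> 3 * 3 ^ length G" .
 then have e: "chs pad (G @ [c]) = ?l" using snoc.prems(2) by (simp add: chs_def)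
 have 1: "set c' \<inter> set x ~= {}" if hx: "x \<in> set ?l" "c' \<in> set (G @ [c])" for x c'
 proof -
  obtain a y where y: "x = a # y" "a \<in> set c" "y \<in> set (chs pad G)" using hx(1) by auto
  then show ?thesis using hx(2) h(2) by auto
 qed
 have 2: "\<exists>x\<in>set ?l. set x \<subseteq> X" if "hits X (sets (G @ [c]))" for X
 proof -
  have "hits X (sets G)" "set c \<inter> X ~= {}" using that by (auto simp: hits_def)
  then obtain y a where "y \<in> set (chs pad G)" "set y \<subseteq> X" "a \<in> set c" "a \<in> X" using h(3) by blast
  then show ?thesis by (intro bexI[of _ "a # y"]) auto
 qed
 show ?case unfolding e using l3 1 2 by simp
qed (simp add: chs_def hits_def)

lemma radj_lrows: "radj (lrows n vl) u v \<longleftrightarrow> u < length vl \<and> v < length vl \<and> fst (vl ! u) ~= fst (vl ! v) \<and>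
  lit_ok n (set (snd (vl ! u)) \<union> set (snd (vl ! v)))"
 by (auto simp: radj_def nthd_def lrows_def)

text \<open>Vertices of one group are never adjacent, so a \<open>t\<close>-clique takes one choice
  from each group, and pairwise consistency of the chosen literal sets is consistency of their
  union. With \<open>2 \<le> t\<close> every vertex of the clique lies on an edge, and only edges
  test the consistency of its own literals.\<close>

lemma leaf_clique:
 fixes t n :: nat and F :: "nat list list"
 assumes t: "2 \<le> t" and F: "!!c. c \<in> set F ==> length c \<le> 3"
 defines "gs \<equiv> gl [0..<t] F"
 defines "vl \<equiv> VL [0..<t] (trip gs) gs F"
 shows "length vl \<le> t * 3 ^ length gs"
  "(\<exists>B \<subseteq> {..<length vl}. card B = t \<and> (\<forall>u\<in>B. \<forall>v\<in>B. u ~= v --> radj (lrows n vl) u v)) \<longleftrightarrow> (\<exists>X. lit_ok n X \<and> hits X (sets F))"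
proof -
 let ?g = "length gs" and ?G = "grp gs [0..<t] F"
 have sm: "sum_list (map (%y. if y < j then ?g else 0) [0..<t]) = j * ?g" if "j \<le> t" for j
 proof -
  have "sum_list (map (%y. if y < j then ?g else 0) [0..<m]) = min j m * ?g" for m
   by (induction m) (auto simp: min_def le_Suc_eq)
  then show ?thesis using that by (simp add: min_def)
 qed
 have G: "?G j = take ?g (drop (j * ?g) F)" if "j < t" for j using sm[of j] that by (simp add: grp_def)
 have G3: "length c \<le> 3" if "c \<in> set (?G j)" for c j
  using that F unfolding grp_def by (meson in_set_dropD in_set_takeD)
 have "length (?G j) \<le> ?g" for j by (simp add: grp_def)
 then have G4: "(3::nat) ^ length (?G j) \<le> 3 ^ ?g" for j by (intro power_increasing) auto
 have cp: "length (chs (trip gs) (?G j)) \<le> 3 ^ length (?G j) \<and> (\<forall>x\<in>set (chs (trip gs) (?G j)). \<forall>c\<in>set (?G j). set c \<inter> set x ~= {}) \<and>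
  (\<forall>X. hits X (sets (?G j)) --> (\<exists>x\<in>set (chs (trip gs) (?G j)). set x \<subseteq> X))" for j
 proof (rule chs_props)
  show "length c \<le> 3" if "c \<in> set (?G j)" for c by (rule G3[OF that])
  show "3 ^ length (?G j) \<le> length (trip gs)" using G4[of j] by (simp add: length_trip)
 qed
 have c1: "length (chs (trip gs) (?G j)) \<le> 3 ^ ?g" for j using cp[of j] G4[of j] by linarith
 have cov: "\<exists>j<t. c \<in> set (?G j)" if "c \<in> set F" for c
 proof -
  obtain i where i: "i < length F" "c = F ! i" using \<open>c \<in> set F\<close> by (auto simp: in_set_conv_nth)
  have "i < t * ?g" using i(1) gl_length(1)[of t F] t by (simp add: gs_def)
  then have g0: "0 < ?g" by (cases ?g) auto
  have j: "i div ?g < t" using \<open>i < t * ?g\<close> by (simp add: less_mult_imp_div_less)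
  have m: "i mod ?g < ?g" "i div ?g * ?g + i mod ?g = i" using g0 by simp_all
  have le: "i div ?g * ?g \<le> length F" "i mod ?g < length F - i div ?g * ?g" using m(2) i(1) by linarith+
  have "drop (i div ?g * ?g) F ! (i mod ?g) = F ! i" using nth_drop[OF le(1)] m(2) by simp
  then have "?G (i div ?g) ! (i mod ?g) = F ! i" using G[OF j] m(1) by simp
  moreover have "i mod ?g < length (?G (i div ?g))" using G[OF j] m(1) le(2) by simp
  ultimately have "c \<in> set (?G (i div ?g))" using i(2) nth_mem by metis
  then show ?thesis using j by blast
 qed
 have sF: "c \<in> set F" if "c \<in> set (?G j)" for c j using that unfolding grp_def by (meson in_set_dropD in_set_takeD)
 have "length (concat (map f xs)) \<le> length xs * b" if "!!x. length (f x) \<le> b" for f :: "nat => (nat \<times> nat list) list" and xs b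
  using that by (induction xs) (auto intro: add_mono)
 from this[of "%j. map (%x. (j, x)) (chs (trip gs) (?G j))" "3 ^ ?g" "[0..<t]"] c1
 show "length vl \<le> t * 3 ^ ?g" by (simp add: vl_def VL_def)
 have vl: "(j, x) \<in> set vl \<longleftrightarrow> j < t \<and> x \<in> set (chs (trip gs) (?G j))" for j x by (auto simp: vl_def VL_def)
 show "(\<exists>B \<subseteq> {..<length vl}. card B = t \<and> (\<forall>u\<in>B. \<forall>v\<in>B. u ~= v --> radj (lrows n vl) u v)) \<longleftrightarrow> (\<exists>X. lit_ok n X \<and> hits X (sets F))"
 proof
  assume "\<exists>B \<subseteq> {..<length vl}. card B = t \<and> (\<forall>u\<in>B. \<forall>v\<in>B. u ~= v --> radj (lrows n vl) u v)"
  then obtain B where B: "B \<subseteq> {..<length vl}" "card B = t" "!!u v. u \<in> B ==> v \<in> B ==> u ~= v ==> radj (lrows n vl) u v" by blast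
  let ?X = "\<Union>u\<in>B. set (snd (vl ! u))"
  have fB: "finite B" using B(1) finite_subset by blast
  have ne: "fst (vl ! u) ~= fst (vl ! v)" and ok: "lit_ok n (set (snd (vl ! u)) \<union> set (snd (vl ! v)))"
   if "u \<in> B" "v \<in> B" "u ~= v" for u v using B(3)[OF that] by (simp_all add: radj_lrows)
  have in_vl: "fst (vl ! u) < t \<and> snd (vl ! u) \<in> set (chs (trip gs) (?G (fst (vl ! u))))" if "u \<in> B" for u
  proof -
   have "vl ! u \<in> set vl" using B(1) that by auto
   then show ?thesis using vl[of "fst (vl ! u)" "snd (vl ! u)"] by simp
  qed
  have inj: "inj_on (%u. fst (vl ! u)) B" using ne by (meson inj_onI)
  have "(%u. fst (vl ! u)) ` B = {..<t}"
   by (rule card_subset_eq) (use in_vl card_image[OF inj] B(2) in auto)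
  then have onto: "\<exists>u\<in>B. fst (vl ! u) = j" if "j < t" for j using that by (metis (no_types, lifting) imageE lessThan_iff)
  have other: "\<exists>v\<in>B. v ~= u" for u
  proof (rule ccontr)
   assume "\<not> ?thesis"
   then have "B \<subseteq> {u}" by blast
   then have "card B \<le> 1" using card_mono[of "{u}" B] by simp
   then show False using B(2) t by simp
  qed
  have "lit_ok n ?X" unfolding lit_ok_def
  proof (intro ballI conjI impI)
   fix a assume "a \<in> ?X"
   then obtain u where u: "u \<in> B" "a \<in> set (snd (vl ! u))" by blast
   obtain w where w: "w \<in> B" "w ~= u" using other by blast
   show "a div 2 < n" using ok[OF u(1) w(1)] w(2) u(2) by (auto simp: lit_ok_def)
   fix b assume "b \<in> ?X" and ab: "a div 2 = b div 2"
   then obtain v where v: "v \<in> B" "b \<in> set (snd (vl ! v))" by blast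
   show "a = b"
   proof (cases "u = v")
    case True
    have "lit_ok n (set (snd (vl ! u)) \<union> set (snd (vl ! w)))" by (rule ok) (use u w in auto)
    then show ?thesis using u v ab True unfolding lit_ok_def by blast
   next
    case False
    have "lit_ok n (set (snd (vl ! u)) \<union> set (snd (vl ! v)))" by (rule ok) (use u v False in auto)
    then show ?thesis using u v ab unfolding lit_ok_def by blast
   qed
  qed
  moreover have "hits ?X (sets F)" unfolding hits_def
  proof
   fix c assume "c \<in> sets F"
   then obtain c0 where c0: "c0 \<in> set F" "c = set c0" by blast
   obtain j where j: "j < t" "c0 \<in> set (?G j)" using cov[OF c0(1)] by blast
   obtain u where u: "u \<in> B" "fst (vl ! u) = j" using onto[OF j(1)] by blast
   have "snd (vl ! u) \<in> set (chs (trip gs) (?G j))" using in_vl[OF u(1)] u(2) by simp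
   then have "set c0 \<inter> set (snd (vl ! u)) ~= {}" using cp[of j] j(2) by blast
   then show "c \<inter> ?X ~= {}" using u(1) c0(2) by blast
  qed
  ultimately show "\<exists>X. lit_ok n X \<and> hits X (sets F)" by blast
 next
  assume "\<exists>X. lit_ok n X \<and> hits X (sets F)"
  then obtain X where X: "lit_ok n X" "hits X (sets F)" by blast
  have "\<exists>u<length vl. fst (vl ! u) = j \<and> set (snd (vl ! u)) \<subseteq> X" if "j < t" for j
  proof -
   have "hits X (sets (?G j))" using X(2) sF unfolding hits_def by blast
   then obtain x where "x \<in> set (chs (trip gs) (?G j))" "set x \<subseteq> X" using cp[of j] by blast
   moreover from this have "(j, x) \<in> set vl" using vl that by blast
   ultimately show ?thesis by (metis fst_conv snd_conv in_set_conv_nth)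
  qed
  then obtain u where u: "!!j. j < t ==> u j < length vl \<and> fst (vl ! u j) = j \<and> set (snd (vl ! u j)) \<subseteq> X" by metis
  have inj: "inj_on u {..<t}" using u by (metis inj_onI lessThan_iff)
  show "\<exists>B \<subseteq> {..<length vl}. card B = t \<and> (\<forall>u\<in>B. \<forall>v\<in>B. u ~= v --> radj (lrows n vl) u v)"
  proof (intro exI[of _ "u ` {..<t}"] conjI ballI impI)
   show "u ` {..<t} \<subseteq> {..<length vl}" using u by auto
   show "card (u ` {..<t}) = t" using card_image[OF inj] by simp
   fix x y assume "x \<in> u ` {..<t}" "y \<in> u ` {..<t}" and xy: "x ~= y"
   then obtain i j where ij: "x = u i" "i < t" "y = u j" "j < t" by auto
   have "i ~= j" using ij xy by blast
   have "set (snd (vl ! u i)) \<union> set (snd (vl ! u j)) \<subseteq> X" using u ij by blast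
   then have "lit_ok n (set (snd (vl ! u i)) \<union> set (snd (vl ! u j)))" using X(1) unfolding lit_ok_def by blast
   then show "radj (lrows n vl) x y" unfolding ij radj_lrows using u[OF ij(2)] u[OF ij(4)] \<open>i ~= j\<close> by simp
  qed
 qed
qed

section \<open>Cost of deciding a leaf with a hypothetical program\<close>

text \<open>The number of variables, the list \<open>[0..<t]\<close> and the plan.\<close>

type_synonym ctx = "nat \<times> nat list \<times> plan"

definition res :: "prog => nat list => nat \<times> nat \<times> nat" where
 "res p x = (let s = SOME s. run p x s in (mem s 0, mem s 1, mem s 2))"

lemma res_run: assumes "run p x s" shows "res p x = (mem s 0, mem s 1, mem s 2)"
proof -
 have "run p x (SOME s. run p x s)" using assms by (rule someI)
 then have "(SOME s. run p x s) = s" using assms exec_deterministic unfolding run_def by blast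
 then show ?thesis by (simp add: res_def)
qed

definition bsl :: "prog => plan => nat list list => ans" where
 "bsl p W R = rev (map (%w. (fst w, res p (snd w))) (words W R))"

definition leafR :: "ctx => nat list list => nat list list" where
 "leafR c F = lrows (fst c) (VL (fst (snd c)) (trip (gl (fst (snd c)) F)) (gl (fst (snd c)) F) F)"

text \<open>If the program \<open>decides\<close>, the accumulator becomes positive as soon as some
  leaf has a clique.\<close>

definition lstep :: "prog => ctx => nat => nat list list => nat" where
 "lstep p c a F = a + diffn (bsl p (snd (snd c)) (leafR c F))"

definition gsym :: "nat list list => bool" where
 "gsym R \<longleftrightarrow> (\<forall>u v. radj R u v --> radj R v u) \<and> (\<forall>u. \<not> radj R u u)"

text \<open>\<open>cheap\<close> and \<open>decides\<close> are all that the formula solver knows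
  about the hypothetical program; they hide which of the two counting problems it solves.\<close>

abbreviation cheap :: "prog => plan => nat => nat => bool" where
 "cheap p W C E \<equiv> \<forall>R. gsym R --> (\<forall>w\<in>set (words W R). \<exists>s. run p (snd w) s \<and> steps s \<le> C * (length R + 1) ^ E)"

abbreviation decides :: "prog => plan => bool" where
 "decides p W \<equiv> \<forall>R. gsym R --> (0 < diffn (bsl p W R) \<longleftrightarrow> (\<exists>B \<subseteq> {..<length R}. card B = fst W \<and> (\<forall>u\<in>B. \<forall>v\<in>B. u ~= v --> radj R u v)))"

lemma gsym_lrows: "gsym (lrows n vl)"
 by (auto simp: gsym_def radj_lrows Un_commute)

text \<open>Collects the cost of a leaf into a constant times a power of \<open>b\<close>.
  \<open>M\<close> bounds the polynomial stages, and \<open>st\<close> bounds a run of the program.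
  Since \<open>1 \<le> E\<close>, a factor \<open>E\<close> can be pulled out of the whole
  exponent.\<close>

lemma leaf_arith:
 fixes Q M N3 x1 x2 x3 b K2 q q' r C st ln E K t s :: nat
 assumes b: "1 \<le> b" and E: "1 \<le> E" and M: "M \<le> K2 * b ^ q" and K2: "1 \<le> K2" and q': "q \<le> q'" "1 \<le> q'"
  and st: "st \<le> C * (t * b + 1) ^ E" and ln: "ln \<le> M"
 shows "100 * M * M * ((st + ln + r) ^ r + 100) + 100 \<le> 200 * K2 * K2 * ((C * (t + 1) ^ E + K2 + r) ^ r + 100) * b ^ ((2 * q + q' * r) * E)"
proof -
 have "st + ln + r \<le> (C * (t + 1) ^ E + K2 + r) * b ^ (q' * E)"
 proof -
  have "t * b + 1 \<le> (t + 1) * b" using b by simp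
  then have "(t * b + 1) ^ E \<le> ((t + 1) * b) ^ E" by (rule power_mono) simp
  then have "st \<le> C * ((t + 1) * b) ^ E" using st by (meson le_trans mult_le_mono2)
  moreover have "b ^ E \<le> b ^ (q' * E)" using b q' by (intro power_increasing) auto
  then have "C * ((t + 1) * b) ^ E \<le> C * (t + 1) ^ E * b ^ (q' * E)"
   by (simp only: power_mult_distrib mult.assoc mult_le_mono2)
  moreover have "b ^ q \<le> b ^ (q' * E)" using b q' E by (intro power_increasing) (auto intro: le_trans[OF q'(1)])
  then have "ln \<le> K2 * b ^ (q' * E)" using ln M by (meson le_trans mult_le_mono2)
  moreover have "r \<le> r * b ^ (q' * E)" using b by simp
  ultimately show ?thesis unfolding distrib_right by linarith
 qed
 then have "(st + ln + r) ^ r \<le> ((C * (t + 1) ^ E + K2 + r) * b ^ (q' * E)) ^ r" by (rule power_mono) simp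
 also have "\<dots> = (C * (t + 1) ^ E + K2 + r) ^ r * b ^ (q' * E * r)" by (simp only: power_mult_distrib power_mult)
 finally have 1: "(st + ln + r) ^ r + 100 \<le> ((C * (t + 1) ^ E + K2 + r) ^ r + 100) * b ^ (q' * E * r)" (is "?l \<le> ?K * _")
  using b by (simp add: distrib_right add_mono)
 have "M * M \<le> (K2 * b ^ q) * (K2 * b ^ q)" using M by (intro mult_le_mono)
 note mm = mult_le_mono2[OF mult_le_mono[OF this 1], of 100]
 have "100 * M * M * ?l \<le> 100 * ((K2 * b ^ q) * (K2 * b ^ q)) * (?K * b ^ (q' * E * r))"
  using mm by (simp only: mult.assoc)
 also have "\<dots> = 100 * K2 * K2 * ?K * b ^ (q + q + q' * E * r)" by (simp add: power_add algebra_simps)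
 finally have 2: "100 * M * M * ?l \<le> 100 * K2 * K2 * ?K * b ^ (q + q + q' * E * r)" .
 have "q + q + q' * E * r \<le> (2 * q + q' * r) * E" using E by (cases E) (simp_all add: algebra_simps)
 then have 3: "b ^ (q + q + q' * E * r) \<le> b ^ ((2 * q + q' * r) * E)" using b by (intro power_increasing)
 have 4: "1 \<le> b ^ ((2 * q + q' * r) * E)" using b by simp
 define Z where "Z = K2 * K2 * ?K * b ^ ((2 * q + q' * r) * E)"
 have "1 \<le> K2 * K2 * ?K" using K2 by (simp add: Suc_le_eq)
 then have "1 * 1 \<le> Z" unfolding Z_def using 4 by (intro mult_le_mono)
 moreover have "100 * K2 * K2 * ?K * b ^ (q + q + q' * E * r) \<le> 100 * K2 * K2 * ?K * b ^ ((2 * q + q' * r) * E)"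
  by (rule mult_le_mono2[OF 3])
 moreover have "100 * K2 * K2 * ?K * b ^ ((2 * q + q' * r) * E) = 100 * Z" "200 * K2 * K2 * ?K * b ^ ((2 * q + q' * r) * E) = 200 * Z"
  unfolding Z_def by (simp_all only: mult.assoc)
 ultimately show ?thesis using 2 by linarith
qed

text \<open>The order of quantifiers is the point: \<open>c\<close> is fixed before the program, the
  plan and \<open>E\<close>, and only the term and \<open>K\<close> may depend on them. This is
  possible because the simulation bound is the same for all programs and because the plan is an
  argument of the polynomial-time stages, not part of them.\<close>

lemma leaf_cost:
 "\<exists>c. \<forall>p W C E. 1 \<le> E --> 2 \<le> fst W -->
  cheap p W C E -->
  (\<exists>e K. \<forall>n a F. (\<forall>c\<in>set F. length c \<le> 3) -->
   cft e (%q. lstep p (fst q) (fst (snd q)) (snd (snd q))) ((n, [0..<fst W], W), a, F)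
    (K * ((esz F + 1) * 3 ^ length (gl [0..<fst W] F)) ^ (c * E)))"
proof -
 from simulate obtain G where G: "polyb G" "mono G" "\<forall>p. \<exists>e. \<forall>x s. run p x s -->
   (\<exists>t \<le> G (steps s + length x). pev e (enc x) t (enc (mem s 0, mem s 1, mem s 2)))" by blast
 obtain r where r: "!!n. G n \<le> (n + r) ^ r" using G(1) by (auto simp: polyb_def)
 have "FP (%q :: ctx \<times> nat \<times> nat list list. (q, [0 :: nat], gl (fst (snd (fst q))) (snd (snd q))))" (is "FP ?fp3")
  by (intro FP_rules FP_gl)
 then obtain e1 T1 where "FPw e1 T1 ?fp3" unfolding FP_def by blast
 note f1 = FPwD[OF this]
 have "FP (%p :: (ctx \<times> nat \<times> nat list list) \<times> nat list \<times> nat. fst (snd p) @ fst (snd p) @ fst (snd p))" (is "FP ?fp2") by (intro FP_rules)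
 then obtain e2 T2 where "FPw e2 T2 ?fp2" unfolding FP_def by blast
 note f2 = FPwD[OF this]
 let ?h = "%p :: (ctx \<times> nat \<times> nat list list) \<times> nat list \<times> nat. (fst (snd (fst p)), [] :: ans, words (snd (snd (fst (fst p))))
   (lrows (fst (fst (fst p))) (VL (fst (snd (fst (fst p)))) (fst (snd p)) (gl (fst (snd (fst (fst p)))) (snd (snd (fst p)))) (snd (snd (fst p))))))"
 have "FP ?h"
 proof -
  have l0: "FP (%p :: (ctx \<times> nat \<times> nat list list) \<times> nat list \<times> nat. (fst (fst (fst p)), fst (snd (fst (fst p))), fst (snd p), gl (fst (snd (fst (fst p)))) (snd (snd (fst p))), snd (snd (fst p))))"
   by (intro FP_rules FP_gl)
  let ?lr = "%p :: (ctx \<times> nat \<times> nat list list) \<times> nat list \<times> nat. lrows (fst (fst (fst p))) (VL (fst (snd (fst (fst p)))) (fst (snd p)) (gl (fst (snd (fst (fst p)))) (snd (snd (fst p)))) (snd (snd (fst p))))"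
  from FP_comp[OF FP_lrows l0] have lr: "FP ?lr" by simp
  have "FP (%p :: (ctx \<times> nat \<times> nat list list) \<times> nat list \<times> nat. snd (snd (fst (fst p))))" by (intro FP_rules)
  from FP_comp[OF FP_words FP_Pair[OF this lr]] have w: "FP (%p. words (snd (snd (fst (fst p)))) (?lr p))" by simp
  show ?thesis by (intro FP_Pair w) (intro FP_rules)+
 qed
 then obtain e3 T3 where "FPw e3 T3 ?h" unfolding FP_def by blast
 note f3 = FPwD[OF this]
 have "FP (%p :: nat \<times> ans \<times> nat. fst p + diffn (fst (snd p)))" (is "FP ?fp1") by (intro FP_rules FP_comp[OF FP_diffn])
 then obtain e5 T5 where "FPw e5 T5 ?fp1" unfolding FP_def by blast
 note f5 = FPwD[OF this]
 let ?Q = "%n. T1 n + T2 n + T3 n + T5 (9 * T3 n + 5) + 1"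
 have pn: "polyb (%n. 9 * T3 n + 5)" by (intro polyb_add polyb_mult polyb_const f3(1))
 have "polyb ?Q" by (intro polyb_add polyb_const f1(1) f2(1) f3(1) polyb_comp[OF f5(1) pn f5(2)])
 then obtain q where q: "!!n. ?Q n \<le> (n + q) ^ q" by (auto simp: polyb_def)
 define q' where "q' = q + 1"
 show ?thesis
 proof (rule exI[of _ "2 * q + q' * r"], intro allI impI)
  fix p and W :: plan and C E :: nat
  assume E: "1 \<le> E" and t: "2 \<le> fst W"
   and H: "cheap p W C E"
  obtain ep where ep: "!!x s. run p x s ==> \<exists>t \<le> G (steps s + length x). pev ep (enc x) t (enc (mem s 0, mem s 1, mem s 2))" using G(3) by blast
  let ?ts = "[0..<fst W]"
  let ?e4 = "Pr (Pr (Cmp Snd (Cmp Snd Fst)) (Cmp (Cmp Snd (Cmp Snd Snd)) ep)) (Cmp Snd Fst)"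
  let ?e = "Cmp (Cmp (Cmp (Cmp e1 (foldE e2)) e3) (foldE ?e4)) e5"
  define k0 where "k0 = esz ?ts + esz W + 40"
  define K2 where "K2 = (k0 + 3 + q + 1) ^ q"
  let ?K = "200 * K2 * K2 * ((C * (fst W + 1) ^ E + K2 + r) ^ r + 100)"
  show "\<exists>e K. \<forall>n a F. (\<forall>c\<in>set F. length c \<le> 3) -->
   cft e (%q. lstep p (fst q) (fst (snd q)) (snd (snd q))) ((n, ?ts, W), a, F)
    (K * ((esz F + 1) * 3 ^ length (gl ?ts F)) ^ ((2 * q + q' * r) * E))"
  proof (rule exI[of _ ?e], rule exI[of _ ?K], intro allI impI)
   fix n a :: nat and F :: "nat list list" assume F: "\<forall>c\<in>set F. length c \<le> 3"
   let ?q = "((n, ?ts, W), a, F)" and ?gs = "gl ?ts F"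
   let ?b = "(esz F + 1) * 3 ^ length ?gs"
   have y: "1 \<le> (3::nat) ^ length ?gs" by simp
   have b1: "1 \<le> ?b" using y by (simp add: Suc_le_eq)
   have yb: "3 ^ length ?gs \<le> ?b" by simp
   have "esz F \<le> (esz F + 1) * 1" by simp
   also have "\<dots> \<le> ?b" by (rule mult_le_mono2[OF y])
   finally have bF: "esz F \<le> ?b" .
   \<comment> \<open>A common size bound for the arguments of the first stages: the data together
     with the pad of length \<open>3 ^ length ?gs\<close>.\<close>
   define x1 where "x1 = esz ?q + 2 * 3 ^ length ?gs + 20"
   have x1: "x1 \<le> k0 + 3 * ?b" unfolding x1_def k0_def using yb bF by simp
   define M where "M = ?Q x1"
   have M: "M \<le> K2 * ?b ^ q"
   proof -
    have "M \<le> (x1 + q) ^ q" unfolding M_def by (rule q)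
    also have "\<dots> \<le> ((k0 + 3 + q + 1) * ?b) ^ q"
    proof (rule power_mono)
     have "k0 \<le> k0 * ?b" "q \<le> q * ?b" using b1 by simp_all
     then have "k0 + 3 * ?b + q \<le> (k0 + 3 + q + 1) * ?b" unfolding distrib_right by linarith
     then show "x1 + q \<le> (k0 + 3 + q + 1) * ?b" using x1 by linarith
    qed simp
    finally show ?thesis unfolding K2_def power_mult_distrib .
   qed
   have K2: "1 \<le> K2" unfolding K2_def by simp
   let ?R = "leafR (n, ?ts, W) F"
   let ?ws = "words W ?R"
   have lR: "length ?R \<le> fst W * ?b"
   proof -
    have "length ?R \<le> fst W * 3 ^ length ?gs" using leaf_clique(1)[OF t, of F] F by (simp add: leafR_def lrows_def)
    then show ?thesis using mult_le_mono2[OF yb, of "fst W"] by (rule le_trans)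
   qed
   have m1: "T1 (esz ?q) \<le> M" "T2 x1 \<le> M" "T3 x1 \<le> M" "T5 (9 * T3 x1 + 5) \<le> M" "1 \<le> M"
    using monoD[OF f1(2), of "esz ?q" x1] unfolding M_def x1_def by simp_all
   have s1: "\<exists>s\<le>M. pev e1 (enc ?q) s (P (enc ?q) (P (enc [0 :: nat]) (enc ?gs)))"
    using f1(3)[of ?q] m1(1) unfolding cft_def fst_conv snd_conv enc_Pair by (meson le_trans)
   then obtain s1 where s1: "s1 \<le> M" "pev e1 (enc ?q) s1 (P (enc ?q) (P (enc [0 :: nat]) (enc ?gs)))" by blast
   have lg: "length ?gs \<le> M" using f1(4)[of ?q] length_esz[of ?gs] m1(1) by simp
   \<comment> \<open>The pad is exponentially long in the group size, so its fold is costed directly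
     instead of through \<open>FP_foldl\<close>.\<close>
   have "\<exists>s \<le> length ?gs * (M + 25) + 5. pev (foldE e2) (P (enc ?q) (P (enc [0 :: nat]) (enc ?gs))) s
    (P (enc ?q) (P (enc (foldl ((%q acc (y :: nat). acc @ acc @ acc) ?q) [0 :: nat] ?gs)) (A 0)))"
   proof (rule ev_foldE)
    fix zs zs' and z :: nat assume gs: "?gs = zs @ z # zs'"
    have "esz (foldl (%acc (y :: nat). acc @ acc @ acc) [0 :: nat] zs) = 1 + 2 * 3 ^ length zs"
     using length_trip[of zs] by (simp add: esz_nats trip_def)
    moreover have "(3::nat) ^ length zs \<le> 3 ^ length ?gs" unfolding gs by (intro power_increasing) auto
    moreover have "esz (?q, foldl (%acc (y :: nat). acc @ acc @ acc) [0 :: nat] zs, z) =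
     1 + esz ?q + (1 + esz (foldl (%acc (y :: nat). acc @ acc @ acc) [0 :: nat] zs) + esz z)" by (simp only: esz_prod fst_conv snd_conv)
    moreover have "esz z = 1" by simp
    ultimately have "esz (?q, foldl (%acc (y :: nat). acc @ acc @ acc) [0 :: nat] zs, z) \<le> x1" unfolding x1_def by linarith
    then have "T2 (esz (?q, foldl (%acc (y :: nat). acc @ acc @ acc) [0 :: nat] zs, z)) \<le> M" using monoD[OF f2(2)] m1(2) le_trans by blast
    then show "cft e2 (%p. fst (snd p) @ fst (snd p) @ fst (snd p)) (?q, foldl (%acc (y :: nat). acc @ acc @ acc) [0 :: nat] zs, z) M"
     by (rule cft_mono[OF f2(3)])
   qed
   then obtain s2 where s2: "s2 \<le> length ?gs * (M + 25) + 5"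
    "pev (foldE e2) (P (enc ?q) (P (enc [0 :: nat]) (enc ?gs))) s2 (P (enc ?q) (P (enc (trip ?gs)) (A 0)))" unfolding trip_def by blast
   let ?q2 = "(?q, trip ?gs, 0 :: nat)"
   have z2: "esz ?q2 \<le> x1" unfolding x1_def using length_trip[of ?gs] by (simp add: esz_nats)
   have h: "?h ?q2 = (a, [], ?ws)" by (simp add: leafR_def)
   have t3: "T3 (esz ?q2) \<le> T3 x1" by (rule monoD[OF f3(2) z2])
   obtain s3 where s3: "s3 \<le> T3 (esz ?q2)" "pev e3 (enc ?q2) s3 (P (enc a) (P (enc ([] :: ans)) (enc ?ws)))"
    using f3(3)[of ?q2] unfolding cft_def h by auto
   have ezw: "esz ?ws \<le> T3 x1" using f3(4)[of ?q2] t3 unfolding h by simp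
   have lw: "length ?ws \<le> T3 x1" using length_esz[of ?ws] ezw by linarith
   define st where "st = C * (fst W * ?b + 1) ^ E"
   let ?N3 = "(st + M + r) ^ r + 30"
   have step4: "cft ?e4 (%p :: nat \<times> ans \<times> (bool \<times> nat list). (fst (snd (snd p)), res prg (snd (snd (snd p)))) # fst (snd p)) (w', acc, y) ?N3"
    if y: "y \<in> set ?ws" and prg: "prg = p" for w' acc y prg
   proof -
    have "gsym ?R" unfolding leafR_def by (rule gsym_lrows)
    then obtain s where s: "run p (snd y) s" "steps s \<le> C * (length ?R + 1) ^ E" using H y by blast
    have "(length ?R + 1) ^ E \<le> (fst W * ?b + 1) ^ E" using lR by (intro power_mono) auto
    then have ss: "steps s \<le> st" using s(2) unfolding st_def by (meson le_trans mult_le_mono2)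
    have "esz y < esz ?ws" by (rule esz_mem[OF y])
    then have ly: "length (snd y) \<le> M" using length_esz[of "snd y"] ezw m1(3) by simp
    obtain u where u: "u \<le> G (steps s + length (snd y))" "pev ep (enc (snd y)) u (enc (res p (snd y)))"
     using ep[OF s(1)] res_run[OF s(1)] by metis
    have "G (steps s + length (snd y)) \<le> G (st + M)" using ss ly by (intro monoD[OF G(2)] add_mono)
    then have u1: "u \<le> (st + M + r) ^ r" using u(1) r[of "st + M"] by linarith
    have i: "enc (w', acc, y) = P (enc w') (P (enc acc) (P (enc (fst y)) (enc (snd y))))" by (simp add: enc_prod_def)
    have "pev ?e4 (P (enc w') (P (enc acc) (P (enc (fst y)) (enc (snd y)))))
     (((1 + (1 + 1 + 1) + 1) + ((1 + (1 + 1 + 1) + 1) + u + 1) + 1) + (1 + 1 + 1) + 1) (P (P (enc (fst y)) (enc (res p (snd y)))) (enc acc))"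
     by (rule ev_Pr[OF ev_Pr[OF ev_Cmp[OF ev_Snd ev_Cmp[OF ev_Snd ev_Fst]] ev_Cmp[OF ev_Cmp[OF ev_Snd ev_Cmp[OF ev_Snd ev_Snd]] u(2)]] ev_Cmp[OF ev_Snd ev_Fst]])
    then show ?thesis unfolding prg by (intro cftI[of _ _ "(((1 + (1 + 1 + 1) + 1) + ((1 + (1 + 1 + 1) + 1) + u + 1) + 1) + (1 + 1 + 1) + 1)"]) (use u1 i in simp_all)
   qed
   have "\<exists>s \<le> length ?ws * (?N3 + 25) + 5. pev (foldE ?e4) (P (enc a) (P (enc ([] :: ans)) (enc ?ws))) s
    (P (enc a) (P (enc (foldl ((%w' acc y. (fst y, res p (snd y)) # acc) a) ([] :: ans) ?ws)) (A 0)))"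
    by (rule ev_foldE) (rule step4, auto)
   then obtain s4 where s4: "s4 \<le> length ?ws * (?N3 + 25) + 5" "pev (foldE ?e4) (P (enc a) (P (enc ([] :: ans)) (enc ?ws))) s4
    (P (enc a) (P (enc (bsl p W ?R)) (A 0)))" unfolding foldl_Cons bsl_def by auto
   let ?q5 = "(a, bsl p W ?R, 0 :: nat)"
   have "esz (bsl p W ?R) \<le> 1 + length (bsl p W ?R) * (1 + 7)" by (rule esz_list_le) (auto simp: bsl_def res_def Let_def)
   then have z5: "esz ?q5 \<le> 9 * T3 x1 + 5" using lw by (simp add: bsl_def)
   obtain s5 where s5: "s5 \<le> T5 (esz ?q5)" "pev e5 (enc ?q5) s5 (enc (lstep p (n, ?ts, W) a F))"
    using f5(3)[of ?q5] unfolding cft_def lstep_def by auto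
   have t5: "T5 (esz ?q5) \<le> M" using monoD[OF f5(2) z5] m1(4) by linarith
   have s3': "pev e3 (P (enc ?q) (P (enc (trip ?gs)) (A 0))) s3 (P (enc a) (P (enc ([] :: ans)) (enc ?ws)))"
    using s3(2) by (simp only: enc_Pair enc_nat_def)
   have s5': "pev e5 (P (enc a) (P (enc (bsl p W ?R)) (A 0))) s5 (enc (lstep p (n, ?ts, W) a F))"
    using s5(2) by (simp only: enc_Pair enc_nat_def)
   let ?s = "(((s1 + s2 + 1) + s3 + 1) + s4 + 1) + s5 + 1"
   have "pev ?e (enc ?q) ?s (enc (lstep p (n, ?ts, W) a F))"
    by (rule ev_Cmp[OF ev_Cmp[OF ev_Cmp[OF ev_Cmp[OF s1(2) s2(2)] s3'] s4(2)] s5'])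
   moreover have "?s \<le> ?K * ?b ^ ((2 * q + q' * r) * E)"
   proof -
    have "length ?gs * (M + 25) \<le> M * (M + 25)" using lg by (rule mult_le_mono1)
    moreover have "M * 25 \<le> 25 * M * M" "M \<le> M * M" using m1(5) by simp_all
    moreover have "length ?ws * (?N3 + 25) \<le> M * (?N3 + 25)" using lw m1(3) by (intro mult_le_mono1) linarith
    moreover have "M * (?N3 + 25) \<le> M * M * (?N3 + 25)" using m1(5) by simp
    moreover have "M * M * (?N3 + 25) = M * M * (st + M + r) ^ r + 55 * (M * M)" by (simp add: algebra_simps)
    ultimately have "?s \<le> 100 * M * M * ((st + M + r) ^ r + 100) + 100"
     using s1(1) s2(1) s3(1) t3 m1(3) s4(1) s5(1) t5 by (simp add: algebra_simps)
    also have "\<dots> \<le> ?K * ?b ^ ((2 * q + q' * r) * E)"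
     by (rule leaf_arith[OF b1 E M K2]) (auto simp: q'_def st_def)
    finally show ?thesis .
   qed
   ultimately show "cft ?e (%q. lstep p (fst q) (fst (snd q)) (snd (snd q))) ?q (?K * ?b ^ ((2 * q + q' * r) * E))"
    by (intro cftI[of _ _ ?s]) simp_all
  qed
 qed
qed

section \<open>Reading a formula\<close>

definition ddn :: "nat list => nat list" where "ddn cl = concat (dd (map (%a. [a]) cl))"

lemma ddn: "set (ddn cl) = set cl" "distinct (ddn cl)"
proof -
 let ?F = "map (%a. [a]) cl"
 have d: "sets (dd ?F) = sets ?F" "distinct (map set (dd ?F))" "set (dd ?F) \<subseteq> set ?F" using dd_props[of ?F] by auto
 have "set (ddn cl) = \<Union> (sets (dd ?F))" by (simp add: ddn_def)
 also have "\<dots> = set cl" unfolding d(1) by auto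
 finally show "set (ddn cl) = set cl" .
 have "distinct (map set L) ==> (!!x. x \<in> set L ==> \<exists>a. x = [a]) ==> distinct (concat L)" for L :: "nat list list"
 proof (induction L)
  case (Cons x L)
  obtain a where a: "x = [a]" using Cons.prems(2)[of x] by auto
  have "a \<notin> set (concat L)"
  proof
   assume "a \<in> set (concat L)"
   then obtain y where y: "y \<in> set L" "a \<in> set y" by auto
   moreover from this obtain b where "y = [b]" using Cons.prems(2)[of y] by auto
   ultimately have "[a] \<in> set L" by auto
   then show False using Cons.prems(1) a by force
  qed
  then show ?case using Cons a by auto
 qed simp
 from this[OF d(2)] d(3) show "distinct (ddn cl)" unfolding ddn_def by auto
qed

text \<open>Clauses are padded with the points \<open>2 * n\<close>, \<open>2 * n + 1\<close> and \<open>2 * n + 2\<close>, which are not literals.\<close>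

definition pdc :: "nat => nat list => nat list" where
 "pdc n cl = take 3 (ddn cl @ [n + n, n + n + 1, n + n + 2])"

text \<open>After padding all sets have exactly three points. The initial system, without
  repetitions, is therefore an antichain with no two-element sets, as the invariant of the
  sparsification demands.\<close>

lemma pdc:
 assumes "length cl \<le> 3" "!!a. a \<in> set cl ==> a < 2 * n"
 shows "length (pdc n cl) = 3" "distinct (pdc n cl)" "set (pdc n cl) \<subseteq> {..<2 * n + 3}" "set cl \<subseteq> set (pdc n cl)"
  "!!x. x \<in> set (pdc n cl) ==> x < 2 * n ==> x \<in> set cl"
proof -
 let ?ys = "[n + n, n + n + 1, n + n + 2]"
 have lt: "a < n + n" if "a \<in> set (ddn cl)" for a using assms(2)[of a] that ddn(1) by auto
 have len: "length (ddn cl) \<le> 3" using distinct_card[OF ddn(2), of cl] card_length[of cl] assms(1) by (simp add: ddn(1))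
 show "length (pdc n cl) = 3" by (simp add: pdc_def)
 have "distinct (ddn cl @ ?ys)" using ddn(2) lt by fastforce
 then show "distinct (pdc n cl)" unfolding pdc_def by (rule distinct_take)
 have sub: "set (pdc n cl) \<subseteq> set (ddn cl @ ?ys)" unfolding pdc_def by (rule set_take_subset)
 then show "set (pdc n cl) \<subseteq> {..<2 * n + 3}" using lt by fastforce
 have "pdc n cl = ddn cl @ take (3 - length (ddn cl)) ?ys" unfolding pdc_def using len by simp
 then show "set cl \<subseteq> set (pdc n cl)" using ddn(1) by auto
 show "x \<in> set cl" if "x \<in> set (pdc n cl)" "x < 2 * n" for x using that sub ddn(1) by auto
qed

text \<open>The state is the number of literals still expected and the clauses so far, the current
  one in front; at 0 the next entry is the length of a new clause. Literals and clauses come out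
  reversed, which does not affect satisfiability.\<close>

definition pstep :: "nat \<times> nat list list => nat => nat \<times> nat list list" where
 "pstep s x = (if fst s = 0 then (x, [] # snd s) else (fst s - 1, case snd s of [] => [] | c # r => (x # c) # r))"

definition parse :: "nat list => nat list list" where
 "parse inp = snd (foldl pstep (0, []) (drop 2 inp))"

lemma FP_parse: "FP parse"
proof -
 have "FP (%inp. foldl pstep (0, []) (drop 2 inp))"
 proof (rule FP_foldl[where f = "%w. pstep" and B = "%n. 3 + 2 * n"])
  show "FP (%p :: nat list \<times> (nat \<times> nat list list) \<times> nat. pstep (fst (snd p)) (snd (snd p)))"
   unfolding pstep_def by (intro FP_rules)
  have s: "esz (pstep s x) \<le> esz s + 2" for s x by (cases "snd s") (auto simp: pstep_def)
  have "esz (foldl pstep (0, []) zs) \<le> 3 + 2 * length zs" for zs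
  proof (induction zs rule: rev_induct)
   case (snoc z zs)
   then show ?case using s[of "foldl pstep (0, []) zs" z] by simp
  qed simp
  moreover have "length zs \<le> esz inp" if "drop 2 inp = zs @ zs'" for inp zs zs' :: "nat list"
   using arg_cong[OF that, of length] length_esz[of inp] by simp
  ultimately show "esz (foldl pstep (0, []) zs) \<le> 3 + 2 * esz inp" if "drop 2 inp = zs @ zs'" for inp zs zs' :: "nat list"
   using that by (meson add_left_mono le_trans mult_le_mono2)
 qed (intro FP_rules polyb_add polyb_mult polyb_const polyb_id)+
 from FP_snd[OF this] show ?thesis by (simp add: parse_def[abs_def])
qed

lemma parse_enc: "parse (enc_cnf (n, cls)) = rev (map rev (map (map (%(v, b). 2 * v + of_bool b)) cls))"
proof -
 have 1: "foldl pstep (length xs, c # r) xs = (0, (rev xs @ c) # r)" for xs c r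
  by (induction xs arbitrary: c) (auto simp: pstep_def)
 have "foldl pstep (0, acc) (concat (map (%cl. length cl # cl) cs)) = (0, rev (map rev cs) @ acc)" for acc cs
 proof (induction cs arbitrary: acc)
  case (Cons cl cs)
  have "pstep (0, acc) (length cl) = (length cl, [] # acc)" by (simp add: pstep_def)
  then show ?case using 1[of cl "[]" acc] Cons.IH by simp
 qed simp
 from this[of "[]" "map (map (%(v, b). 2 * v + of_bool b)) cls"] show ?thesis
  by (simp add: parse_def enc_cnf_def o_def)
qed

lemma FP_init: "FP (%inp. ((nthd 0 inp 0, [0..<fst W], W :: plan), ([dd (map (pdc (nthd 0 inp 0)) (parse inp))], [] :: nat list list list)))"
proof -
 have "FP (%inp. dd (map (%cl. pdc (nthd 0 inp 0) cl) (parse inp)))"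
  unfolding pdc_def ddn_def by (intro FP_comp[OF FP_dd] FP_rules FP_parse)
 then show ?thesis by (intro FP_Pair FP_rules)
qed

text \<open>The true literals of a satisfying assignment form a hitting set. Conversely,
  \<open>lit_ok\<close> excludes padding points, so every clause is met in a genuine literal, and
  \<open>v\<close> is made true iff \<open>2 * v + 1\<close> is in the set.\<close>

lemma initial:
 assumes f: "(n, cls) \<in> three_cnf"
 defines "F \<equiv> dd (map (pdc n) (parse (enc_cnf (n, cls))))"
 shows "linv F" "!!c. c \<in> set F ==> length c = 3 \<and> distinct c \<and> set c \<subseteq> {..<2 * n + 3}"
  "satisfiable (n, cls) \<longleftrightarrow> (\<exists>X. lit_ok n X \<and> hits X (sets F))"
proof -
 let ?code = "%(v, b). 2 * v + of_bool b :: nat"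
 let ?cs = "rev (map rev (map (map ?code) cls))"
 have F: "F = dd (map (pdc n) ?cs)" by (simp only: F_def parse_enc)
 have wf: "length cl \<le> 3" "!!v b. (v, b) \<in> set cl ==> v < n" if "cl \<in> set cls" for cl
  using f that by (auto simp: three_cnf_def)
 have cs: "length c \<le> 3 \<and> (\<forall>a\<in>set c. a < 2 * n)" if "c \<in> set ?cs" for c
 proof -
  obtain cl where cl: "cl \<in> set cls" "c = rev (map ?code cl)" using \<open>c \<in> set ?cs\<close> by auto
  have "a < 2 * n" if "a \<in> set c" for a
  proof -
   obtain v b where "(v, b) \<in> set cl" "a = 2 * v + of_bool b" using \<open>a \<in> set c\<close> cl(2) by auto
   then show ?thesis using wf(2)[OF cl(1), of v b] by (cases b) auto
  qed
  then show ?thesis using wf(1)[OF cl(1)] cl(2) by simp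
 qed
 have p: "length (pdc n c) = 3" "distinct (pdc n c)" "set (pdc n c) \<subseteq> {..<2 * n + 3}" "set c \<subseteq> set (pdc n c)"
  "!!x. x \<in> set (pdc n c) ==> x < 2 * n ==> x \<in> set c" if hc: "c \<in> set ?cs" for c
 proof -
  show "length (pdc n c) = 3" by (rule pdc(1)) (use cs[OF hc] in auto)
  show "distinct (pdc n c)" by (rule pdc(2)) (use cs[OF hc] in auto)
  show "set (pdc n c) \<subseteq> {..<2 * n + 3}" by (rule pdc(3)) (use cs[OF hc] in auto)
  show "set c \<subseteq> set (pdc n c)" by (rule pdc(4)) (use cs[OF hc] in auto)
  show "x \<in> set c" if "x \<in> set (pdc n c)" "x < 2 * n" for x by (rule pdc(5)[OF _ _ that]) (use cs[OF hc] in auto)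
 qed
 note d = dd_props[of "map (pdc n) ?cs"]
 have el: "\<exists>c0\<in>set ?cs. c = pdc n c0" if "c \<in> set F" for c using that d unfolding F by auto
 show a: "!!c. c \<in> set F ==> length c = 3 \<and> distinct c \<and> set c \<subseteq> {..<2 * n + 3}" using el p by blast
 show "linv F" unfolding linv_def using d a unfolding F by blast
 have sF: "sets F = (%c. set (pdc n c)) ` set ?cs" unfolding F using d by auto
 show "satisfiable (n, cls) \<longleftrightarrow> (\<exists>X. lit_ok n X \<and> hits X (sets F))"
 proof
  assume "satisfiable (n, cls)"
  then obtain a where a: "\<forall>cl\<in>set cls. \<exists>(v, b)\<in>set cl. a v = b" by (auto simp: satisfiable_def)
  let ?X = "{2 * v + of_bool (a v) | v. v < n}"
  have "lit_ok n ?X" unfolding lit_ok_def by auto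
  moreover have "hits ?X (sets F)" unfolding hits_def
  proof
   fix c assume "c \<in> sets F"
   then obtain cl where cl: "cl \<in> set cls" "c = set (pdc n (rev (map ?code cl)))" unfolding sF by auto
   then have mem: "rev (map ?code cl) \<in> set ?cs" by auto
   obtain v where v: "(v, a v) \<in> set cl" using a cl(1) by blast
   have "?code (v, a v) \<in> set (rev (map ?code cl))" using v by (metis image_eqI set_map set_rev)
   then have "2 * v + of_bool (a v) \<in> c" using p(4)[OF mem] cl(2) by auto
   then show "c \<inter> ?X ~= {}" using wf(2)[OF cl(1) v] by blast
  qed
  ultimately show "\<exists>X. lit_ok n X \<and> hits X (sets F)" by blast
 next
  assume "\<exists>X. lit_ok n X \<and> hits X (sets F)"
  then obtain X where X: "lit_ok n X" "hits X (sets F)" by blast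
  have "\<exists>(v, b)\<in>set cl. (2 * v + 1 \<in> X) = b" if cl: "cl \<in> set cls" for cl
  proof -
   have mem: "rev (map ?code cl) \<in> set ?cs" using cl by auto
   then have "set (pdc n (rev (map ?code cl))) \<inter> X ~= {}" using X(2) unfolding hits_def sF by blast
   then obtain x where x: "x \<in> set (pdc n (rev (map ?code cl)))" "x \<in> X" by blast
   have "x div 2 < n" using X(1) x(2) by (auto simp: lit_ok_def)
   then have "x < 2 * n" by linarith
   then have "x \<in> set (rev (map ?code cl))" by (rule p(5)[OF mem x(1)])
   then obtain v b where vb: "(v, b) \<in> set cl" "x = 2 * v + of_bool b" by auto
   have "(2 * v + 1 \<in> X) = b"
   proof (cases b)
    case False
    have "2 * v + 1 \<notin> X"
    proof
     assume "2 * v + 1 \<in> X"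
     moreover have "(2 * v + 1) div 2 = x div 2" using vb(2) False by simp
     ultimately have "2 * v + 1 = x" using X(1) x(2) unfolding lit_ok_def by blast
     then show False using vb(2) False by simp
    qed
    then show ?thesis using False by simp
   qed (use x(2) vb(2) in simp)
   then show ?thesis using vb(1) by blast
  qed
  then show "satisfiable (n, cls)" unfolding satisfiable_def by (auto intro!: exI[of _ "%v. 2 * v + 1 \<in> X"])
 qed
qed

section \<open>A satisfiability algorithm from the hypothetical program\<close>

text \<open>The stack and the list of leaves may be exponentially long, so this loop is costed by
  hand: a step evaluates \<open>kids\<close> once on the top node and only passes on references to
  the rest.\<close>

definition loopE :: "fn => fn" where
 "loopE ek = Whl Fst (Cmp (Pr (Cmp (Cmp Fst Fst) ek) Id) (If Fst
   (Pr (Pr (Cmp Fst Fst) (Pr (Cmp Fst (Cmp Snd Fst)) (Cmp Snd (Cmp Fst Snd)))) (Cmp Snd Snd))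
   (Pr (Cmp Snd (Cmp Fst Snd)) (Pr (Cmp Snd (Cmp Fst Fst)) (Cmp Snd Snd)))))"

lemma le_ex: "pev e x t y ==> t \<le> n ==> \<exists>t\<le>n. pev e x t y" by blast

lemma (in lsparse) step_ev:
 assumes "pev ek (enc G) k (enc (kids d G))"
 shows "\<exists>t \<le> k + 40. pev (Cmp (Pr (Cmp (Cmp Fst Fst) ek) Id) (If Fst
   (Pr (Pr (Cmp Fst Fst) (Pr (Cmp Fst (Cmp Snd Fst)) (Cmp Snd (Cmp Fst Snd)))) (Cmp Snd Snd))
   (Pr (Cmp Snd (Cmp Fst Snd)) (Pr (Cmp Snd (Cmp Fst Fst)) (Cmp Snd Snd))))) (enc (G # r, dn)) t (enc (wstep (G # r, dn)))"
proof -
 let ?s = "P (P (enc G) (enc r)) (enc dn)"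
 have s: "enc (G # r, dn) = ?s" by simp
 have 1: "pev (Pr (Cmp (Cmp Fst Fst) ek) Id) ?s (((1 + 1 + 1) + k + 1) + 1 + 1) (P (enc (kids d G)) ?s)"
  by (rule ev_Pr[OF ev_Cmp[OF ev_Cmp[OF ev_Fst ev_Fst] assms] ev_Id])
 show ?thesis
 proof (cases "cands d G")
  case Nil
  then have k: "kids d G = []" by (simp add: kids_def)
  have m: "pev (Pr (Cmp Snd (Cmp Fst Snd)) (Pr (Cmp Snd (Cmp Fst Fst)) (Cmp Snd Snd))) (P (A 0) ?s)
   ((1 + (1 + 1 + 1) + 1) + ((1 + (1 + 1 + 1) + 1) + (1 + 1 + 1) + 1) + 1) (P (enc r) (P (enc G) (enc dn)))"
   by (rule ev.intros)+
  have "pev Fst (P (A 0) ?s) 1 (A 0)" by (rule ev_Fst)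
  note f = this
  have w: "enc (wstep (G # r, dn)) = P (enc r) (P (enc G) (enc dn))" by (simp add: wstep_def k)
  show ?thesis unfolding s w by (rule le_ex[OF ev_Cmp[OF 1[unfolded k enc_list.simps] ev_IfF[OF f m]]]) simp
 next
  case (Cons hq z)
  then obtain L R where k: "kids d G = [L, R]" by (simp add: kids_def)
  let ?k = "P (enc L) (P (enc R) (A 0))"
  have ek: "enc (kids d G) = ?k" by (simp add: k)
  have m: "pev (Pr (Pr (Cmp Fst Fst) (Pr (Cmp Fst (Cmp Snd Fst)) (Cmp Snd (Cmp Fst Snd)))) (Cmp Snd Snd)) (P ?k ?s)
   (((1 + 1 + 1) + ((1 + (1 + 1 + 1) + 1) + (1 + (1 + 1 + 1) + 1) + 1) + 1) + (1 + 1 + 1) + 1) (P (P (enc L) (P (enc R) (enc r))) (enc dn))"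
   by (rule ev.intros)+
  have f: "pev Fst (P ?k ?s) 1 ?k" by (rule ev_Fst)
  have ne: "?k ~= A 0" by simp
  have w: "enc (wstep (G # r, dn)) = P (P (enc L) (P (enc R) (enc r))) (enc dn)" by (simp add: wstep_def k)
  show ?thesis unfolding s w by (rule le_ex[OF ev_Cmp[OF 1[unfolded ek] ev_IfT[OF f ne m]]]) simp
 qed
qed

lemma (in lsparse) loop_ev:
 assumes ek: "!!G. cft ek (kids d) G (Tk (esz G))" and mT: "mono Tk"
 shows "(wstep ^^ m) (todo, dn) = ([], dn') ==> (!!i. i < m ==> \<exists>G r dn''. (wstep ^^ i) (todo, dn) = (G # r, dn'') \<and> esz G \<le> Z) ==>
  \<exists>t \<le> m * (Tk Z + 50) + 2. pev (loopE ek) (enc (todo, dn)) t (enc ([] :: nat list list list, dn'))"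
proof (induction m arbitrary: todo dn)
 case 0
 then have e: "enc (todo, dn) = P (A 0) (enc dn')" "todo = []" "dn = dn'" by auto
 have "pev (loopE ek) (P (A 0) (enc dn')) (1 + 1) (P (A 0) (enc dn'))" unfolding loopE_def by (rule ev_WhF[OF ev_Fst])
 then show ?case unfolding e by (intro exI[of _ "1 + 1"]) simp
next
 case (Suc m)
 from Suc.prems(2)[of 0] obtain G r dn'' where G: "(todo, dn) = (G # r, dn'')" "esz G \<le> Z" by auto
 obtain k where k: "k \<le> Tk (esz G)" "pev ek (enc G) k (enc (kids d G))" using ek[of G] unfolding cft_def by blast
 have kz: "k \<le> Tk Z" using k(1) monoD[OF mT G(2)] by linarith
 from step_ev[OF k(2), of r dn''] obtain t1 where t1: "t1 \<le> k + 40"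
  "pev (Cmp (Pr (Cmp (Cmp Fst Fst) ek) Id) (If Fst
   (Pr (Pr (Cmp Fst Fst) (Pr (Cmp Fst (Cmp Snd Fst)) (Cmp Snd (Cmp Fst Snd)))) (Cmp Snd Snd))
   (Pr (Cmp Snd (Cmp Fst Snd)) (Pr (Cmp Snd (Cmp Fst Fst)) (Cmp Snd Snd))))) (enc (todo, dn)) t1 (enc (wstep (todo, dn)))"
  unfolding G(1) by blast
 obtain todo1 dn1 where w: "wstep (todo, dn) = (todo1, dn1)" by fastforce
 have sh: "(wstep ^^ Suc i) (todo, dn) = (wstep ^^ i) (todo1, dn1)" for i using w by (simp add: funpow_swap1)
 have "\<exists>t \<le> m * (Tk Z + 50) + 2. pev (loopE ek) (enc (todo1, dn1)) t (enc ([] :: nat list list list, dn'))"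
 proof (rule Suc.IH)
  show "(wstep ^^ m) (todo1, dn1) = ([], dn')" using Suc.prems(1) unfolding sh .
  show "\<exists>G r dn''. (wstep ^^ i) (todo1, dn1) = (G # r, dn'') \<and> esz G \<le> Z" if "i < m" for i
   using Suc.prems(2)[of "Suc i"] that unfolding sh by simp
 qed
 then obtain t2 where t2: "t2 \<le> m * (Tk Z + 50) + 2" "pev (loopE ek) (enc (todo1, dn1)) t2 (enc ([] :: nat list list list, dn'))" by blast
 have c: "pev Fst (enc (todo, dn)) 1 (P (enc G) (enc r))" using ev_Fst G(1) by simp
 have "P (enc G) (enc r) ~= A 0" by simp
 from ev_WhT[OF c this t1(2)[unfolded w] t2(2)[unfolded loopE_def], folded loopE_def]
 have "pev (loopE ek) (enc (todo, dn)) (1 + t1 + t2 + 1) (enc ([] :: nat list list list, dn'))" .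
 then show ?case using t1(1) t2(1) kz by (intro exI[of _ "1 + t1 + t2 + 1"]) simp
qed

text \<open>The cost is that of reading, of the branching tree and of one \<open>lstep\<close> per
  leaf. The points are \<open>2 * n\<close> literals and three padding points, so the initial
  potential is at most \<open>4 * d * (2 * n + 3)\<close>. By \<open>leaf_card\<close> a leaf has at
  most \<open>(2 * n + 3) * (1 + d + 2 * d * d)\<close> clauses, which are cut into
  \<open>fst W\<close> groups; this gives the exponent of 3.\<close>

lemma threesat_solver:
 fixes \<eta> :: real and d :: nat
 assumes d: "1 \<le> d" and eta: "0 \<le> \<eta>" "2 powr (- \<eta>) + 2 powr (- \<eta> * (2 * real d * real d)) \<le> 1"
 shows "\<exists>c Tk. polyb Tk \<and> (\<forall>p W C E. 1 \<le> E --> 2 \<le> fst W -->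
  cheap p W C E -->
  decides p W -->
  (\<exists>p' K T0. polyb T0 \<and> computes p' three_cnf enc_cnf (%F. of_bool (satisfiable F)) \<and>
   (\<forall>F\<in>three_cnf. \<forall>s. run p' (enc_cnf F) s --> real (steps s) \<le> real (T0 (length (enc_cnf F))) +
    24 * 2 powr (\<eta> * real (4 * d * (2 * fst F + 3))) * (real (Tk (1 + 8 * (2 * fst F + 3) ^ 3)) +
     real (K * ((2 + 8 * (2 * fst F + 3) ^ 3) * 3 ^ (((2 * fst F + 3) * (1 + d + 2 * d * d) + fst W) div fst W)) ^ (c * E)) + 100))))"
proof -
 obtain ek Tk where "FPw ek Tk (kids d)" using FP_kids unfolding FP_def by blast
 note fk = FPwD[OF this]
 from leaf_cost obtain c where c: "\<forall>p W C E. 1 \<le> E --> 2 \<le> fst W -->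
  cheap p W C E -->
  (\<exists>e K. \<forall>n a F. (\<forall>c\<in>set F. length c \<le> 3) -->
   cft e (%q. lstep p (fst q) (fst (snd q)) (snd (snd q))) ((n, [0..<fst W], W), a, F)
    (K * ((esz F + 1) * 3 ^ length (gl [0..<fst W] F)) ^ (c * E)))" by (rule exE)
 have "FP (%p :: ctx \<times> nat \<times> nat. (of_bool (0 < fst (snd p)) :: nat, 0 :: nat, 1 :: nat))" (is "FP ?fp0") by (intro FP_rules)
 then obtain e6 T6 where "FPw e6 T6 ?fp0" unfolding FP_def by blast
 note f6 = FPwD[OF this]
 show ?thesis
 proof (rule exI[of _ c], rule exI[of _ Tk], intro conjI allI impI)
  show "polyb Tk" by (rule fk(1))
  fix p and W :: plan and C E :: nat
  assume E: "1 \<le> E" and t: "2 \<le> fst W"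
   and H: "cheap p W C E"
   and Hc: "decides p W"
  from c[rule_format, OF E t H[rule_format]] obtain el K where el: "!!n a F. (\<forall>c\<in>set F. length c \<le> 3) ==>
   cft el (%q. lstep p (fst q) (fst (snd q)) (snd (snd q))) ((n, [0..<fst W], W), a, F)
    (K * ((esz F + 1) * 3 ^ length (gl [0..<fst W] F)) ^ (c * E))" by blast
  obtain e0 S0 where "FPw e0 S0 (%inp. ((nthd 0 inp 0, [0..<fst W], W), ([dd (map (pdc (nthd 0 inp 0)) (parse inp))], [] :: nat list list list)))"
   using FP_init[of W] unfolding FP_def by blast
  note f0 = FPwD[OF this]
  let ?e = "Cmp (Cmp (Cmp e0 (Pr Fst (Cmp Snd (loopE ek)))) (foldE el)) e6"
  define k6 where "k6 = T6 (esz ((0 :: nat, [0..<fst W], W), 0 :: nat, 0 :: nat))"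
  let ?T0 = "%l. 12 * S0 (1 + 2 * l) + 12 * l + 12 * (k6 + 30)"
  let ?U = "%F :: cnf. 2 * fst F + 3"
  let ?X = "%F. 2 powr (\<eta> * real (4 * d * ?U F))"
  let ?N = "%F. K * ((2 + 8 * ?U F ^ 3) * 3 ^ ((?U F * (1 + d + 2 * d * d) + fst W) div fst W)) ^ (c * E)"
  have main: "\<exists>s. run (prog_of ?e) (enc_cnf F) s \<and> outputs s (of_bool (satisfiable F)) \<and> real (steps s) \<le> real (?T0 (length (enc_cnf F))) +
    24 * ?X F * (real (Tk (1 + 8 * ?U F ^ 3)) + real (?N F) + 100)" if F: "F \<in> three_cnf" for F
  proof -
   obtain n cls where Fn: "F = (n, cls)" by (cases F)
   let ?u = "2 * n + 3" and ?inp = "enc_cnf (n, cls)"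
   define F0 where "F0 = dd (map (pdc n) (parse ?inp))"
   note ini = initial[OF F[unfolded Fn], folded F0_def]
   interpret sp: lsparse "{..<?u}" d by unfold_locales (use d in auto)
   have c3: "card c = 3 \<and> c \<subseteq> {..<?u}" if "c \<in> sets F0" for c using that ini(2) by (auto simp: distinct_card)
   have inv0: "sp.inv (sets F0)" unfolding sp.inv_def
   proof (intro conjI ballI allI)
    fix x assume x: "x \<in> sets F0"
    show "x \<subseteq> {..<?u}" "1 \<le> card x" "card x \<le> 3" using c3[OF x] by auto
    fix y assume y: "y \<in> sets F0"
    show "\<not> y \<subset> x" using psubset_card_mono[of x y] c3[OF x] c3[OF y] finite_subset[of x "{..<?u}"] by auto
   next
    fix a show "card (petals (sets F0) {a} 2) \<le> 2 * d"
    proof -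
     have "petals (sets F0) {a} 2 = {}" using c3 by (fastforce simp: petals_def)
     then show ?thesis by simp
    qed
   qed
   have Psi0: "sp.Psi (sets F0) \<le> int (4 * d * ?u)"
   proof -
    have "4 * int d * (int (card {..<?u}) - int (card (lev (sets F0) 1))) \<le> 4 * int d * int ?u" by (intro mult_left_mono) auto
    then show ?thesis unfolding sp.Psi_def by simp
   qed
   have "\<exists>m ls. (sp.wstep ^^ m) (F0 # [], []) = ([], ls @ []) \<and> real m + 1 \<le> 2 * 2 powr (\<eta> * real (4 * d * ?u)) \<and>
    real (length ls) \<le> 2 powr (\<eta> * real (4 * d * ?u)) \<and>
    (\<forall>l\<in>set ls. linv l \<and> sp.inv (sets l) \<and> cands d l = []) \<and>
    (\<forall>X. hits X (sets F0) \<longleftrightarrow> (\<exists>l\<in>set ls. hits X (sets l))) \<and>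
    (\<forall>i<m. \<exists>G r dn'. (sp.wstep ^^ i) (F0 # [], []) = (G # r, dn') \<and> linv G \<and> sp.inv (sets G))"
    by (rule sp.worklist[OF eta ini(1) inv0 Psi0])
   then obtain m ls where w: "(sp.wstep ^^ m) (F0 # [], []) = ([], ls)" "real m + 1 \<le> 2 * ?X F"
    "real (length ls) \<le> ?X F" "\<forall>l\<in>set ls. linv l \<and> sp.inv (sets l) \<and> cands d l = []"
    "\<forall>X. hits X (sets F0) \<longleftrightarrow> (\<exists>l\<in>set ls. hits X (sets l))"
    "\<forall>i<m. \<exists>G r dn'. (sp.wstep ^^ i) (F0 # [], []) = (G # r, dn') \<and> linv G \<and> sp.inv (sets G)" unfolding Fn by auto
   let ?Z = "1 + 8 * ?u ^ 3"
   have zs: "esz G \<le> ?Z" if "linv G" "sp.inv (sets G)" for G using sp.linv_size(2)[OF that] by simp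
   have "\<exists>tt \<le> m * (Tk ?Z + 50) + 2. pev (loopE ek) (enc (F0 # [], [] :: nat list list list)) tt (enc ([] :: nat list list list, ls))"
   proof (rule sp.loop_ev[OF fk(3) fk(2) w(1)])
    fix i assume "i < m"
    then show "\<exists>G r dn''. (sp.wstep ^^ i) (F0 # [], []) = (G # r, dn'') \<and> esz G \<le> ?Z" using w(6) zs by blast
   qed
   then obtain tl where tl: "tl \<le> m * (Tk ?Z + 50) + 2" "pev (loopE ek) (enc (F0 # [], [] :: nat list list list)) tl (enc ([] :: nat list list list, ls))" by blast
   let ?c = "(n, [0..<fst W], W)"
   have l3: "length x \<le> 3" if "l \<in> set ls" "x \<in> set l" for l x
   proof -
    have "distinct x" "card (set x) \<le> 3" using w(4) that by (auto simp: linv_def sp.inv_def)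
    then show ?thesis by (simp add: distinct_card)
   qed
   have gb: "length (gl [0..<fst W] l) \<le> (?u * (1 + d + 2 * d * d) + fst W) div fst W" if l: "l \<in> set ls" for l
   proof -
    have li: "linv l" "sp.inv (sets l)" "cands d l = []" using w(4) l by auto
    have "card (sets l) \<le> card {..<?u} * (1 + d + 2 * d * d)"
     by (rule sp.leaf_card[OF li(2)]) (rule sp.cands_leaf[OF li])
    moreover have "length l = card (sets l)" using li(1) by (metis distinct_card length_map linv_def list.set_map)
    ultimately have "length l \<le> ?u * (1 + d + 2 * d * d)" by simp
    then have "fst W * length (gl [0..<fst W] l) \<le> ?u * (1 + d + 2 * d * d) + fst W" using gl_length(2)[of "fst W" l] t by linarith
    then have "fst W * length (gl [0..<fst W] l) div fst W \<le> (?u * (1 + d + 2 * d * d) + fst W) div fst W" by (rule div_le_mono)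
    moreover have "fst W * length (gl [0..<fst W] l) div fst W = length (gl [0..<fst W] l)"
     by (rule nonzero_mult_div_cancel_left) (use t in simp)
    ultimately show ?thesis by (simp only:)
   qed
   have lc: "cft el (%q. lstep p (fst q) (fst (snd q)) (snd (snd q))) (?c, a, l) (?N F)" if l: "l \<in> set ls" for a l
   proof (rule cft_mono[OF el])
    show "\<forall>c\<in>set l. length c \<le> 3" using l3[OF l] by blast
    have "esz l + 1 \<le> 2 + 8 * ?u ^ 3" using zs[of l] w(4) l by auto
    moreover have "(3::nat) ^ length (gl [0..<fst W] l) \<le> 3 ^ ((?u * (1 + d + 2 * d * d) + fst W) div fst W)"
     using gb[OF l] by (intro power_increasing) auto
    ultimately show "K * ((esz l + 1) * 3 ^ length (gl [0..<fst W] l)) ^ (c * E) \<le> ?N F"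
     unfolding Fn fst_conv by (intro mult_le_mono2 power_mono mult_le_mono) auto
   qed
   have "\<exists>tt \<le> length ls * (?N F + 25) + 5. pev (foldE el) (P (enc ?c) (P (enc (0 :: nat)) (enc ls))) tt
    (P (enc ?c) (P (enc (foldl (lstep p ?c) 0 ls)) (A 0)))"
    by (rule ev_foldE) (rule lc, simp)
   then obtain tf where tf: "tf \<le> length ls * (?N F + 25) + 5" "pev (foldE el) (P (enc ?c) (P (enc (0 :: nat)) (enc ls))) tf
    (P (enc ?c) (P (enc (foldl (lstep p ?c) 0 ls)) (A 0)))" by blast
   let ?r = "foldl (lstep p ?c) 0 ls"
   have rp: "0 < foldl (lstep p ?c) a L \<longleftrightarrow> 0 < a \<or> (\<exists>l\<in>set L. 0 < diffn (bsl p W (leafR ?c l)))" for a L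
    by (induction L arbitrary: a) (auto simp: lstep_def)
   have "0 < diffn (bsl p W (leafR ?c l)) \<longleftrightarrow> (\<exists>X. lit_ok n X \<and> hits X (sets l))" if l: "l \<in> set ls" for l
   proof -
    let ?vl = "VL [0..<fst W] (trip (gl [0..<fst W] l)) (gl [0..<fst W] l) l"
    have R: "leafR ?c l = lrows n ?vl" by (simp add: leafR_def)
    have "0 < diffn (bsl p W (leafR ?c l)) \<longleftrightarrow> (\<exists>B \<subseteq> {..<length ?vl}. card B = fst W \<and> (\<forall>u\<in>B. \<forall>v\<in>B. u ~= v --> radj (lrows n ?vl) u v))"
     using Hc gsym_lrows[of n ?vl] unfolding R by (simp add: lrows_def)
    also have "\<dots> \<longleftrightarrow> (\<exists>X. lit_ok n X \<and> hits X (sets l))" by (rule leaf_clique(2)[OF t l3[OF l]])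
    finally show ?thesis .
   qed
   then have sat: "0 < ?r \<longleftrightarrow> satisfiable F" unfolding rp Fn ini(3) using w(5) by blast
   have nth0: "nthd 0 ?inp 0 = n" by (simp add: enc_cnf_def nthd_def)
   from f0(3)[of ?inp] obtain t0 where t00: "t0 \<le> S0 (esz ?inp)"
    "pev e0 (enc ?inp) t0 (enc ((nthd 0 ?inp 0, [0..<fst W], W), ([dd (map (pdc (nthd 0 ?inp 0)) (parse ?inp))], [] :: nat list list list)))"
    unfolding cft_def by blast
   have t0: "t0 \<le> S0 (esz ?inp)" "pev e0 (enc ?inp) t0 (P (enc ?c) (enc (F0 # [], [] :: nat list list list)))"
    using t00 by (simp_all only: enc_Pair nth0 F0_def)
   have k6: "T6 (esz (?c, ?r, 0 :: nat)) = k6" unfolding k6_def by simp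
   from f6(3)[of "(?c, ?r, 0)"] obtain t6 where t60: "t6 \<le> T6 (esz (?c, ?r, 0 :: nat))"
    "pev e6 (enc (?c, ?r, 0 :: nat)) t6 (enc (of_bool (0 < fst (snd (?c, ?r, 0 :: nat))) :: nat, 0 :: nat, 1 :: nat))" unfolding cft_def by blast
   have t6: "t6 \<le> k6" "pev e6 (P (enc ?c) (P (enc ?r) (A 0))) t6 (P (A (of_bool (satisfiable F))) (P (A 0) (A 1)))"
    using t60 unfolding k6 by (simp_all only: enc_Pair enc_nat_def fst_conv snd_conv sat)
   have l1: "pev (Pr Fst (Cmp Snd (loopE ek))) (P (enc ?c) (enc (F0 # [], [] :: nat list list list))) (1 + (1 + tl + 1) + 1)
     (P (enc ?c) (P (enc (0 :: nat)) (enc ls)))"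
    using ev_Pr[OF ev_Fst ev_Cmp[OF ev_Snd tl(2)], of "enc ?c"] by simp
   let ?tt = "(((t0 + (1 + (1 + tl + 1) + 1) + 1) + tf + 1) + t6 + 1)"
   have "pev ?e (lv ?inp) ?tt (P (A (of_bool (satisfiable F))) (P (A 0) (A 1)))"
    unfolding enc_nat_list[symmetric] by (rule ev_Cmp[OF ev_Cmp[OF ev_Cmp[OF t0(2) l1] tf(2)] t6(2)])
   from prog_of_correct[OF this] obtain s where s: "run (prog_of ?e) ?inp s" "map (mem s) [0..<3] = [of_bool (satisfiable F), 0, 1]"
    "steps s \<le> 12 * ?tt + 12 * length ?inp + 12" unfolding run_def by (elim exE conjE) (rule that[unfolded run_def], assumption+)
   have "outputs s (of_bool (satisfiable F))"
    using s(2) enc_rat_nat[of "of_bool (satisfiable F)"] by (simp add: outputs_def)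
   moreover have "real (steps s) \<le> real (?T0 (length (enc_cnf F))) + 24 * ?X F * (real (Tk (1 + 8 * ?U F ^ 3)) + real (?N F) + 100)"
   proof -
    have ei: "esz ?inp = 1 + 2 * length ?inp" by (rule esz_nats)
    have "steps s \<le> ?T0 (length ?inp) + 12 * (m * (Tk ?Z + 50)) + 12 * (length ls * (?N F + 25))"
     using s(3) t0(1)[unfolded ei] tl(1) tf(1) t6(1) by (simp add: algebra_simps)
    then have "real (steps s) \<le> real (?T0 (length ?inp) + 12 * (m * (Tk ?Z + 50)) + 12 * (length ls * (?N F + 25)))"
     by (simp only: of_nat_le_iff)
    also have "\<dots> = real (?T0 (length ?inp)) + 12 * (real m * (real (Tk ?Z) + 50)) + 12 * (real (length ls) * (real (?N F) + 25))"
     by (simp only: of_nat_add of_nat_mult of_nat_numeral)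
    also have "\<dots> \<le> real (?T0 (length ?inp)) + 12 * (2 * ?X F * (real (Tk ?Z) + 50)) + 12 * (?X F * (real (?N F) + 25))"
     using w(2,3) by (intro add_mono mult_left_mono mult_right_mono order_refl) auto
    also have "\<dots> = real (?T0 (length ?inp)) + 24 * ?X F * (real (Tk ?Z) + 50) + 12 * ?X F * (real (?N F) + 25)" by simp
    also have "\<dots> \<le> real (?T0 (length ?inp)) + 24 * ?X F * (real (Tk ?Z) + real (?N F) + 100)"
    proof -
     define x y z where "x = ?X F" and "y = real (Tk ?Z)" and "z = real (?N F)"
     have "0 \<le> x" "0 \<le> z" unfolding x_def z_def by simp_all
     then have "0 \<le> x * z" by simp
     then have "24 * x * (y + 50) + 12 * x * (z + 25) \<le> 24 * x * (y + z + 100)" using \<open>0 \<le> x\<close> by (simp add: algebra_simps)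
     then show ?thesis unfolding x_def y_def z_def by linarith
    qed
    finally show ?thesis by (simp add: Fn)
   qed
   ultimately show ?thesis using s(1) Fn by blast
  qed
  show "\<exists>p' K T0. polyb T0 \<and> computes p' three_cnf enc_cnf (%F. of_bool (satisfiable F)) \<and>
   (\<forall>F\<in>three_cnf. \<forall>s. run p' (enc_cnf F) s --> real (steps s) \<le> real (T0 (length (enc_cnf F))) +
    24 * 2 powr (\<eta> * real (4 * d * (2 * fst F + 3))) * (real (Tk (1 + 8 * (2 * fst F + 3) ^ 3)) +
     real (K * ((2 + 8 * (2 * fst F + 3) ^ 3) * 3 ^ (((2 * fst F + 3) * (1 + d + 2 * d * d) + fst W) div fst W)) ^ (c * E)) + 100))"
  proof (rule exI[of _ "prog_of ?e"], rule exI[of _ K], rule exI[of _ ?T0], intro conjI ballI allI impI)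
   have "polyb (%l. 1 + 2 * l)" by (intro polyb_add polyb_mult polyb_const polyb_id)
   then show "polyb ?T0" by (intro polyb_add polyb_mult polyb_const polyb_id polyb_comp[OF f0(1) _ f0(2)])
   show "computes (prog_of ?e) three_cnf enc_cnf (%F. of_bool (satisfiable F))" unfolding computes_def using main by blast
   fix F s assume F: "F \<in> three_cnf" and s: "run (prog_of ?e) (enc_cnf F) s"
   from main[OF F] obtain s' where s': "run (prog_of ?e) (enc_cnf F) s'" "real (steps s') \<le> real (?T0 (length (enc_cnf F))) +
    24 * ?X F * (real (Tk (1 + 8 * ?U F ^ 3)) + real (?N F) + 100)" by blast
   have "s' = s" using exec_deterministic s s'(1) unfolding run_def by blast
   then show "real (steps s) \<le> real (?T0 (length (enc_cnf F))) +
    24 * ?X F * (real (Tk (1 + 8 * ?U F ^ 3)) + real (?N F) + 100)" using s'(2) by simp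
  qed
 qed
qed

section \<open>From running times to answered queries\<close>

text \<open>Every instruction costs at least one step and reads at most one input cell.\<close>

lemma exec_reads:
 "exec orc x p s s' ==> finite (inputs_read s) ==>
  finite (inputs_read s') \<and> card (inputs_read s') + steps s \<le> card (inputs_read s) + steps s'"
proof (induction rule: exec.induct)
 case (Do i s)
 then show ?case by (cases i) (auto simp: tick_def assign_def Let_def card_insert_if)
qed (auto simp: tick_def)

lemma reads_steps: assumes "run p x s" "{..<length x} \<subseteq> inputs_read s" shows "length x \<le> steps s"
proof -
 have "finite (inputs_read s) \<and> card (inputs_read s) + steps init \<le> card (inputs_read init) + steps s"
  by (rule exec_reads[of _ x p]) (use assms(1) in \<open>auto simp: run_def init_def\<close>)
 then have "card (inputs_read s) \<le> steps s" "finite (inputs_read s)" by (auto simp: init_def)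
 then show ?thesis using card_mono[of "inputs_read s" "{..<length x}"] assms(2) by simp
qed

text \<open>There are inputs of measure \<open>n\<close> with at least \<open>n * n\<close> cells,
  all of which are read. So an exponent below 2 is impossible for large \<open>n\<close>, whatever
  is computed.\<close>

lemma small_exponent:
 assumes rw: "reads_whole_input p X ec" and cm: "computes p X ec F" and tm: "runs_in_O p X ec \<mu> (%n. real n powr e)"
  and e: "e < 2" and ex: "!!n. \<exists>x\<in>X. \<mu> x = n \<and> n * n \<le> length (ec x)"
 shows False
proof -
 obtain C N where CN: "runs_within p {x \<in> X. N \<le> \<mu> x} ec (%x. C * real (\<mu> x) powr e)" using tm by (auto simp: runs_in_O_def)
 obtain n0 :: nat where n0: "(\<bar>C\<bar> + 1) powr (1 / (2 - e)) \<le> real n0" using real_arch_simple by blast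
 define n where "n = n0 + N + 1"
 obtain x where x: "x \<in> X" "\<mu> x = n" "n * n \<le> length (ec x)" using ex by blast
 obtain s where s: "run p (ec x) s" using cm x(1) by (auto simp: computes_def)
 have "length (ec x) \<le> steps s" by (rule reads_steps[OF s]) (use rw x(1) s in \<open>auto simp: reads_whole_input_def\<close>)
 then have "real (n * n) \<le> real (steps s)" using x(3) by (simp only: of_nat_le_iff)
 also have "\<dots> \<le> C * real n powr e" using CN x s unfolding runs_within_def n_def by auto
 also have "\<dots> \<le> \<bar>C\<bar> * real n powr e" by (intro mult_right_mono) auto
 finally have 1: "real n * real n \<le> \<bar>C\<bar> * real n powr e" by simp
 have n1: "0 < real n" by (simp add: n_def)
 have "real n powr e * real n powr (2 - e) = real n powr 2" by (simp add: powr_add[symmetric])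
 also have "\<dots> = real n * real n" using n1 by (simp add: powr_numeral power2_eq_square)
 finally have "real n powr e * real n powr (2 - e) \<le> real n powr e * \<bar>C\<bar>" using 1 by (simp add: mult.commute)
 then have 2: "real n powr (2 - e) \<le> \<bar>C\<bar>" using n1 by simp
 have "\<bar>C\<bar> + 1 = ((\<bar>C\<bar> + 1) powr (1 / (2 - e))) powr (2 - e)" using e by (simp add: powr_powr)
 also have "\<dots> \<le> real n powr (2 - e)" using n0 e by (intro powr_mono2) (auto simp: n_def)
 finally show False using 2 by linarith
qed

text \<open>Below the threshold \<open>N\<close> there are only finitely many encoded inputs, so
  \<open>C\<close> can absorb their running times; the real exponent is rounded up to
  \<open>E\<close>.\<close>

lemma run_bound:
 assumes cm: "computes p X ec F" and tm: "runs_in_O p X ec \<mu> (%n. real n powr e)"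
  and fin: "!!N. finite (ec ` {x \<in> X. \<mu> x < N})" and e: "0 \<le> e" "e \<le> real E"
 shows "\<exists>C. \<forall>x\<in>X. \<exists>s. run p (ec x) s \<and> outputs s (F x) \<and> steps s \<le> C * (\<mu> x + 1) ^ E"
proof -
 obtain C0 N where CN: "runs_within p {x \<in> X. N \<le> \<mu> x} ec (%x. C0 * real (\<mu> x) powr e)" using tm by (auto simp: runs_in_O_def)
 define st where "st w = steps (SOME s. run p w s)" for w
 define B where "B = Max (insert 0 (st ` (ec ` {x \<in> X. \<mu> x < N})))"
 define C where "C = B + nat \<lceil>\<bar>C0\<bar>\<rceil>"
 have "\<exists>s. run p (ec x) s \<and> outputs s (F x) \<and> steps s \<le> C * (\<mu> x + 1) ^ E" if x: "x \<in> X" for x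
 proof -
  obtain s where s: "run p (ec x) s" "outputs s (F x)" using cm x by (auto simp: computes_def)
  have "steps s \<le> C * (\<mu> x + 1) ^ E"
  proof (cases "\<mu> x < N")
   case True
   have "run p (ec x) (SOME s. run p (ec x) s)" using s(1) by (rule someI)
   then have "st (ec x) = steps s" using exec_deterministic s(1) unfolding run_def st_def by metis
   then have "steps s = st (ec x)" by simp
   then have "steps s \<in> insert 0 (st ` (ec ` {x \<in> X. \<mu> x < N}))" using True x by blast
   then have "steps s \<le> B" unfolding B_def using fin[of N] by (intro Max_ge) simp_all
   also have "B \<le> C * 1" by (simp add: C_def)
   also have "\<dots> \<le> C * (\<mu> x + 1) ^ E" by (intro mult_le_mono2) simp
   finally show ?thesis .
  next
   case False
   let ?m = "real (\<mu> x + 1)"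
   have "real (steps s) \<le> C0 * real (\<mu> x) powr e" using CN x False s(1) by (auto simp: runs_within_def)
   also have "\<dots> \<le> \<bar>C0\<bar> * ?m powr e" using e(1) by (intro mult_mono powr_mono2) auto
   also have "\<dots> \<le> real (nat \<lceil>\<bar>C0\<bar>\<rceil>) * ?m powr real E" using e(2) by (intro mult_mono powr_mono real_nat_ceiling_ge) auto
   also have "?m powr real E = ?m ^ E" by (rule powr_realpow) simp
   also have "real (nat \<lceil>\<bar>C0\<bar>\<rceil>) * ?m ^ E \<le> real C * ?m ^ E" by (intro mult_right_mono) (auto simp: C_def)
   also have "\<dots> = real (C * (\<mu> x + 1) ^ E)" by (simp only: of_nat_mult of_nat_power)
   finally show ?thesis by (simp only: of_nat_le_iff)
  qed
  then show ?thesis using s by blast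
 qed
 then show ?thesis by blast
qed

definition clq :: "nat => nat list list => nat set set" where
 "clq t R = {B. B \<subseteq> {..<length R} \<and> card B = t \<and> (\<forall>u\<in>B. \<forall>v\<in>B. u ~= v --> radj R u v)}"

lemma finite_clq: "finite (clq t R)"
 by (rule finite_subset[of _ "Pow {..<length R}"]) (auto simp: clq_def)

text \<open>Treats both counting problems at once: \<open>inst\<close> is the instance of an item,
  \<open>ec\<close> its encoding and \<mu> its number of vertices. As \<open>h\<close> is nonzero,
  the absolute value of the signed sum of answers is positive exactly when there is a
  clique.\<close>

lemma query:
 fixes F :: "'x => rat" and h :: rat
 assumes run: "\<forall>x\<in>X. \<exists>s. run p (ec x) s \<and> outputs s (F x) \<and> steps s \<le> C * (\<mu> x + 1) ^ E"
  and x: "!!R it. gsym R ==> it \<in> set its ==> inst R it \<in> X \<and> F (inst R it) \<in> \<nat> \<and> \<mu> (inst R it) \<le> k * (length R + 1)"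
  and ws: "!!R. gsym R ==> words W R = map (%it. (fst it, ec (inst R it))) its"
  and tot: "!!R bs v. gsym R ==> (!!it. it \<in> set its ==> F (inst R it) = of_nat (v it)) ==>
   mset bs = mset (map (%it. (fst it, v it, 0, 1)) its) ==> of_nat (diffn bs) = \<bar>h\<bar> * of_nat (fact t * card (clq t R))"
  and h: "h ~= 0" and t: "fst W = t"
 shows "\<forall>R. gsym R --> (\<forall>w\<in>set (words W R). \<exists>s. run p (snd w) s \<and> steps s \<le> C * (k + 1) ^ E * (length R + 1) ^ E)"
  "decides p W"
proof -
 show "\<forall>R. gsym R --> (\<forall>w\<in>set (words W R). \<exists>s. run p (snd w) s \<and> steps s \<le> C * (k + 1) ^ E * (length R + 1) ^ E)"
 proof (intro allI impI ballI)
  fix R w assume R: "gsym R" and w: "w \<in> set (words W R)"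
  then obtain it where it: "it \<in> set its" "snd w = ec (inst R it)" unfolding ws[OF R] by auto
  obtain s where s: "run p (snd w) s" "steps s \<le> C * (\<mu> (inst R it) + 1) ^ E" using run x[OF R it(1)] it(2) by metis
  have "\<mu> (inst R it) + 1 \<le> (k + 1) * (length R + 1)" using x[OF R it(1)] by simp
  then have "(\<mu> (inst R it) + 1) ^ E \<le> ((k + 1) * (length R + 1)) ^ E" by (rule power_mono) simp
  then have "steps s \<le> C * ((k + 1) * (length R + 1)) ^ E" using s(2) by (meson le_trans mult_le_mono2)
  then show "\<exists>s. run p (snd w) s \<and> steps s \<le> C * (k + 1) ^ E * (length R + 1) ^ E"
   using s(1) unfolding power_mult_distrib mult.assoc by blast
 qed
 show "decides p W"
 proof (intro allI impI)
  fix R assume R: "gsym R"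
  have "\<exists>v. F (inst R it) = of_nat v \<and> res p (ec (inst R it)) = (v, 0, 1)" if it: "it \<in> set its" for it
  proof -
   obtain v where v: "F (inst R it) = of_nat v" using x[OF R it] by (auto elim: Nats_cases)
   obtain s where s: "run p (ec (inst R it)) s" "outputs s (of_nat v)" using run x[OF R it] v by metis
   have "mem s 0 = v" "mem s 1 = 0" "mem s 2 = 1" using s(2) by (simp_all add: outputs_def enc_rat_nat numeral_3_eq_3 numeral_2_eq_2)
   then have "res p (ec (inst R it)) = (v, 0, 1)" using res_run[OF s(1)] by (simp only:)
   then show ?thesis using v by blast
  qed
  then obtain v where v: "!!it. it \<in> set its ==> F (inst R it) = of_nat (v it) \<and> res p (ec (inst R it)) = (v it, 0, 1)" by metis
  have "mset (bsl p W R) = mset (map (%it. (fst it, v it, 0, 1)) its)"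
  proof -
   have "map (%w. (fst w, res p (snd w))) (words W R) = map (%it. (fst it, v it, 0, 1)) its"
    unfolding ws[OF R] map_map by (rule map_cong[OF refl]) (simp add: v)
   then show ?thesis by (simp add: bsl_def)
  qed
  from tot[OF R conjunct1[OF v] this] have d: "of_nat (diffn (bsl p W R)) = \<bar>h\<bar> * of_nat (fact t * card (clq t R))" .
  have "0 < diffn (bsl p W R) \<longleftrightarrow> (of_nat (diffn (bsl p W R)) :: rat) ~= 0" by simp
  also have "\<dots> \<longleftrightarrow> card (clq t R) ~= 0" unfolding d using h by simp
  also have "\<dots> \<longleftrightarrow> clq t R ~= {}" using finite_clq by simp
  finally show "0 < diffn (bsl p W R) \<longleftrightarrow> (\<exists>B \<subseteq> {..<length R}. card B = fst W \<and> (\<forall>u\<in>B. \<forall>v\<in>B. u ~= v --> radj R u v))"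
   unfolding t clq_def by blast
 qed
qed

lemma length_enc_graph: "length (enc_graph G) = Suc (card (verts G) * card (verts G))"
 unfolding enc_graph_def Let_def
 using length_concat_const[of "sorted_list_of_set (verts G)" "%u. map (%v. of_bool ({u, v} \<in> edges G)) (sorted_list_of_set (verts G))" "card (verts G)"]
 by simp

lemma set_enc_graph: "set (enc_graph G) \<subseteq> {..card (verts G) + 1}"
 by (auto simp: enc_graph_def Let_def)

lemma finite_enc_graph: "finite (enc_graph ` {G \<in> {G. is_graph G}. card (verts G) < N})"
proof (rule finite_subset)
 show "enc_graph ` {G \<in> {G. is_graph G}. card (verts G) < N} \<subseteq> {xs. set xs \<subseteq> {..N + 1} \<and> length xs \<le> Suc (N * N)}"
 proof
  fix w assume "w \<in> enc_graph ` {G \<in> {G. is_graph G}. card (verts G) < N}"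
  then obtain G where G: "w = enc_graph G" "card (verts G) < N" by blast
  have "set w \<subseteq> {..N + 1}" using set_enc_graph[of G] G by fastforce
  moreover have "length w \<le> Suc (N * N)" unfolding G(1) length_enc_graph using G(2) by (simp add: mult_le_mono)
  ultimately show "w \<in> {xs. set xs \<subseteq> {..N + 1} \<and> length xs \<le> Suc (N * N)}" by blast
 qed
qed (rule finite_lists_length_le, simp)

lemma finite_enc_colored:
 "finite (enc_colored ` {x \<in> {(H, G, c) \<in> colored_graphs. card (verts H) = k}. (%(H, G, c). card (verts G)) x < N})"
proof (rule finite_subset)
 let ?L = "Suc (k * k) + (Suc (N * N) + N)"
 show "enc_colored ` {x \<in> {(H, G, c) \<in> colored_graphs. card (verts H) = k}. (%(H, G, c). card (verts G)) x < N} \<subseteq>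
   {xs. set xs \<subseteq> {..k + N + 1} \<and> length xs \<le> ?L}"
 proof
  fix w assume "w \<in> enc_colored ` {x \<in> {(H, G, c) \<in> colored_graphs. card (verts H) = k}. (%(H, G, c). card (verts G)) x < N}"
  then obtain H G c where w: "w = enc_colored (H, G, c)" "is_graph H" "card (verts H) = k" "card (verts G) < N"
   by (auto simp: colored_graphs_def)
  have fH: "finite (verts H)" using w(2) by (simp add: is_graph_def)
  have "card {u \<in> verts H. u < c v} \<le> card (verts H)" for v by (rule card_mono[OF fH]) auto
  then have ck: "card {u \<in> verts H. u < c v} \<le> k + N + 1" for v using w(3) by (metis add.assoc trans_le_add1)
  have "set (map (%v. card {u \<in> verts H. u < c v}) (sorted_list_of_set (verts G))) \<subseteq> {..k + N + 1}"
   unfolding set_map by (intro image_subsetI) (simp only: atMost_iff ck)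
  moreover have "set (enc_graph H) \<subseteq> {..k + N + 1}" "set (enc_graph G) \<subseteq> {..k + N + 1}"
   using set_enc_graph[of H] set_enc_graph[of G] w by fastforce+
  ultimately have "set w \<subseteq> {..k + N + 1}" unfolding w(1) enc_colored_def by auto
  moreover have "length w \<le> ?L"
  proof -
   have "card (verts G) * card (verts G) \<le> N * N" using w(4) by (intro mult_le_mono) auto
   then show ?thesis unfolding w(1) enc_colored_def using w by (simp add: length_enc_graph)
  qed
  ultimately show "w \<in> {xs. set xs \<subseteq> {..k + N + 1} \<and> length xs \<le> ?L}" by blast
 qed
qed (rule finite_lists_length_le, simp)

lemma (in reduct) Gof_card:
 assumes "set (snd (snd it)) \<subseteq> {..<k}" shows "card (verts (Gof it)) \<le> k * (length rows + 1)"
proof -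
 have "verts (Gof it) \<subseteq> {..<k * gd.M}"
 proof
  fix a assume "a \<in> verts (Gof it)"
  then have "a \<in> gd.vs (set (snd (snd it)))" by (simp add: Gof_def gd.GG_def)
  then have "a div gd.M < k" using assms unfolding gd.vs_iff by auto
  then show "a \<in> {..<k * gd.M}" by (simp add: gd.M_def div_less_iff_less_mult)
 qed
 then have "card (verts (Gof it)) \<le> card {..<k * gd.M}" by (rule card_mono[rotated]) simp
 then show ?thesis by (simp add: gd.M_def)
qed

lemma gsym_reduct:
 assumes "is_param \<Phi>" "nat_valued \<Phi>" "edge_list k Hl" "2 * t \<le> k" "\<forall>i<t. \<forall>l<t. {i, t + l} \<in> eset Hl" "gsym R"
 shows "reduct \<Phi> k t Hl R"
 by unfold_locales (use assms in \<open>auto simp: gsym_def\<close>)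

text \<open>The common consequence of a fast algorithm for either problem, to be refuted under ETH
  when \<open>E\<close> is small compared with \<open>t\<close>.\<close>

abbreviation good_query :: "nat => nat => bool" where
 "good_query t E \<equiv> \<exists>p W C. fst W = t \<and>
  cheap p W C E \<and>
  decides p W"

text \<open>For fixed \<open>k\<close> the program for uncolored counting gets only the graph, so
  the prefix of its query words is empty; in the colored case the prefix is the encoded
  pattern.\<close>

lemma queries:
 assumes par: "is_param \<Phi>" and nv: "nat_valued \<Phi>" and tk: "2 * t \<le> k" and H: "H \<subseteq> pairs k" "hatr \<Phi> k H ~= 0" "\<forall>i<t. \<forall>l<t. {i, t + l} \<in> H"
  and e: "0 \<le> e" "e \<le> real E"
 shows "IndSub_in_time \<Phi> k (%n. real n powr e) ==> good_query t E"
  "cpIndSub_in_time \<Phi> k (%n. real n powr e) ==> good_query t E"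
proof -
 obtain Hl where Hl: "Hl \<in> set (subseqs (ap k))" "eset Hl = H" using ap_eset[OF H(1)] by blast
 have el: "edge_list k Hl" by (rule edge_list_sub[OF edge_list_ap Hl(1)])
 note rd = gsym_reduct[OF par nv el tk H(3)[folded Hl(2)]]
 show "good_query t E" if I: "IndSub_in_time \<Phi> k (%n. real n powr e)"
 proof -
  obtain p where p: "computes p {G. is_graph G} enc_graph (num_IndSub \<Phi> k)"
   "runs_in_O p {G. is_graph G} enc_graph (%G. card (verts G)) (%n. real n powr e)" using I by (auto simp: IndSub_in_time_def)
  obtain C where C: "\<forall>x\<in>{G. is_graph G}. \<exists>s. run p (enc_graph x) s \<and> outputs s (num_IndSub \<Phi> k x) \<and> steps s \<le> C * (card (verts x) + 1) ^ E"
   using run_bound[OF p finite_enc_graph e] by blast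
  let ?W = "(t, [] :: nat list, False, items_ind k Hl)"
  have 1: "reduct.Gof t R it \<in> {G. is_graph G} \<and> num_IndSub \<Phi> k (reduct.Gof t R it) \<in> \<nat> \<and>
    card (verts (reduct.Gof t R it)) \<le> k * (length R + 1)" if R: "gsym R" and it: "it \<in> set (items_ind k Hl)" for R it
  proof -
   interpret r: reduct \<Phi> k t Hl R by (rule rd[OF R])
   have "set (snd (snd it)) \<subseteq> {..<k}" using it by (auto simp: items_ind_def)
   then show ?thesis using r.Gof_card r.ind_items(1)[OF it] num_IndSub_nat(1)[OF nv] by simp
  qed
  have 2: "words ?W R = map (%it. (fst it, enc_graph (reduct.Gof t R it))) (items_ind k Hl)" if R: "gsym R" for R
  proof -
   interpret r: reduct \<Phi> k t Hl R by (rule rd[OF R])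
   show ?thesis unfolding words_def by (simp add: r.ind_items(2))
  qed
  have 3: "of_nat (diffn bs) = \<bar>hatr \<Phi> k H\<bar> * of_nat (fact t * card (clq t R))"
   if R: "gsym R" and v: "!!it. it \<in> set (items_ind k Hl) ==> num_IndSub \<Phi> k (reduct.Gof t R it) = of_nat (v it)"
    and bs: "mset bs = mset (map (%it. (fst it, v it, 0, 1)) (items_ind k Hl))" for R bs v
  proof -
   interpret r: reduct \<Phi> k t Hl R by (rule rd[OF R])
   show ?thesis using r.ind_tot[OF v bs] unfolding r.gd.cls_def clq_def Hl(2) .
  qed
  have q1: "\<forall>R. gsym R --> (\<forall>w\<in>set (words ?W R). \<exists>s. run p (snd w) s \<and> steps s \<le> C * (k + 1) ^ E * (length R + 1) ^ E)"
   by (rule query(1)[where ec = enc_graph and \<mu> = "%G. card (verts G)" and W = ?W and its = "items_ind k Hl" and inst = "reduct.Gof t" and k = k and t = t and h = "hatr \<Phi> k H", OF C _ _ _ H(2) fst_conv]) (fact 1 2 3)+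
  have q2: "\<forall>R. gsym R --> (0 < diffn (bsl p ?W R) \<longleftrightarrow> (\<exists>B \<subseteq> {..<length R}. card B = fst ?W \<and> (\<forall>u\<in>B. \<forall>v\<in>B. u ~= v --> radj R u v)))"
   by (rule query(2)[where ec = enc_graph and \<mu> = "%G. card (verts G)" and W = ?W and its = "items_ind k Hl" and inst = "reduct.Gof t" and k = k and t = t and h = "hatr \<Phi> k H", OF C _ _ _ H(2) fst_conv]) (fact 1 2 3)+
  show ?thesis
   by (rule exI[of _ p], rule exI[of _ ?W], rule exI[of _ "C * (k + 1) ^ E"], intro conjI, rule fst_conv, rule q1, rule q2)
 qed
 show "good_query t E" if I: "cpIndSub_in_time \<Phi> k (%n. real n powr e)"
 proof -
  let ?X = "{(H, G, c) \<in> colored_graphs. card (verts H) = k}"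
  let ?F = "%(H, G, c). num_cpIndSub \<Phi> H G c" and ?\<mu> = "%(H :: graph, G :: graph, c :: nat => nat). card (verts G)"
  obtain p where p: "computes p ?X enc_colored ?F" "runs_in_O p ?X enc_colored ?\<mu> (%n. real n powr e)"
   using I by (auto simp: cpIndSub_in_time_def Let_def)
  obtain C where C: "\<forall>x\<in>?X. \<exists>s. run p (enc_colored x) s \<and> outputs s (?F x) \<and> steps s \<le> C * (?\<mu> x + 1) ^ E"
   using run_bound[OF p finite_enc_colored e] by blast
  let ?W = "(t, encgr k Hl, True, items_cp k Hl)"
  let ?inst = "%R it. (({..<k}, eset Hl), reduct.Gof t R it, (%v. v div (length R + 1)))"
  have 1: "?inst R it \<in> ?X \<and> ?F (?inst R it) \<in> \<nat> \<and> ?\<mu> (?inst R it) \<le> k * (length R + 1)" if R: "gsym R" and it: "it \<in> set (items_cp k Hl)" for R it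
  proof -
   interpret r: reduct \<Phi> k t Hl R by (rule rd[OF R])
   have "set (snd (snd it)) \<subseteq> {..<k}" using it by (auto simp: items_cp_def)
   then show ?thesis using r.Gof_card r.cp_items(1,3)[OF it] num_IndSub_nat(2)[OF nv] graph_k[OF edge_list_pairs[OF el]]
    by (simp add: colored_graphs_def r.gd.M_def)
  qed
  have 2: "words ?W R = map (%it. (fst it, enc_colored (?inst R it))) (items_cp k Hl)" if R: "gsym R" for R
  proof -
   interpret r: reduct \<Phi> k t Hl R by (rule rd[OF R])
   show ?thesis unfolding words_def using r.cp_items(4) by (simp add: r.gd.M_def)
  qed
  have 3: "of_nat (diffn bs) = \<bar>hatr \<Phi> k H\<bar> * of_nat (fact t * card (clq t R))"
   if R: "gsym R" and v: "!!it. it \<in> set (items_cp k Hl) ==> ?F (?inst R it) = of_nat (v it)"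
    and bs: "mset bs = mset (map (%it. (fst it, v it, 0, 1)) (items_cp k Hl))" for R bs v
  proof -
   interpret r: reduct \<Phi> k t Hl R by (rule rd[OF R])
   have "of_nat (diffn bs) = \<bar>hatr \<Phi> k (eset Hl)\<bar> * of_nat (fact t * card r.gd.cls)"
    by (rule r.cp_tot[OF _ bs]) (use v in \<open>simp add: r.gd.M_def\<close>)
   then show ?thesis unfolding r.gd.cls_def clq_def Hl(2) .
  qed
  have q1: "\<forall>R. gsym R --> (\<forall>w\<in>set (words ?W R). \<exists>s. run p (snd w) s \<and> steps s \<le> C * (k + 1) ^ E * (length R + 1) ^ E)"
   by (rule query(1)[where ec = enc_colored and \<mu> = ?\<mu> and W = ?W and its = "items_cp k Hl" and inst = ?inst and k = k and t = t and h = "hatr \<Phi> k H", OF C _ _ _ H(2) fst_conv]) (fact 1 2 3)+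
  have q2: "\<forall>R. gsym R --> (0 < diffn (bsl p ?W R) \<longleftrightarrow> (\<exists>B \<subseteq> {..<length R}. card B = fst ?W \<and> (\<forall>u\<in>B. \<forall>v\<in>B. u ~= v --> radj R u v)))"
   by (rule query(2)[where ec = enc_colored and \<mu> = ?\<mu> and W = ?W and its = "items_cp k Hl" and inst = ?inst and k = k and t = t and h = "hatr \<Phi> k H", OF C _ _ _ H(2) fst_conv]) (fact 1 2 3)+
  show ?thesis
   by (rule exI[of _ p], rule exI[of _ ?W], rule exI[of _ "C * (k + 1) ^ E"], intro conjI, rule fst_conv, rule q1, rule q2)
 qed
qed

section \<open>The lower bound under ETH\<close>

text \<open>The potential is about \<open>8 * d * n\<close>, so the branching exponent
  \<open>\<delta> / (32 * d)\<close> costs about \<open>2 powr (\<delta> * n / 4)\<close>. With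
  \<open>x = a / (32 * d)\<close> and \<open>y = a * d / 16\<close> the summands are
  \<open>exp (- x)\<close>, at most \<open>1 - x / 2\<close>, and \<open>exp (- y)\<close>, at most
  \<open>2 / y ^ 2\<close>. The latter is at most \<open>x / 2\<close> once
  \<open>32768 / a ^ 3 \<le> d\<close>.\<close>

lemma choose_d:
 fixes \<delta> :: real assumes "0 < \<delta>"
 shows "\<exists>d::nat. 1 \<le> d \<and> 2 powr (- (\<delta> / (32 * real d))) + 2 powr (- (\<delta> / (32 * real d)) * (2 * real d * real d)) \<le> 1"
proof -
 define a where "a = \<delta> * ln 2"
 have a: "0 < a" using assms by (simp add: a_def)
 obtain d0 :: nat where d0: "32768 / a ^ 3 + a + 1 \<le> real d0" using real_arch_simple by blast
 have a3: "0 < 32768 / a ^ 3" using a by simp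
 have d: "1 \<le> real d0" "a \<le> real d0" "32768 / a ^ 3 \<le> real d0" using d0 a a3 by linarith+
 define x where "x = a / (32 * real d0)"
 define y where "y = a * real d0 / 16"
 have x: "0 < x" "x \<le> 1" using a d by (simp_all add: x_def)
 have y: "0 < y" using a d by (simp add: y_def)
 have "2 powr (- (\<delta> / (32 * real d0))) = exp (- x)" by (simp add: powr_def x_def a_def)
 moreover have "exp (- x) \<le> 1 - x / 2"
 proof -
  have "exp (- x) = 1 / exp x" by (simp add: exp_minus field_simps)
  also have "\<dots> \<le> 1 / (1 + x)" using x exp_ge_add_one_self[of x] by (intro divide_left_mono) auto
  also have "\<dots> \<le> 1 - x / 2"
  proof -
   have "1 \<le> (1 - x / 2) * (1 + x)" using x mult_left_mono[of x 1 x] by (simp add: algebra_simps)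
   then show ?thesis using x by (simp add: divide_le_eq)
  qed
  finally show ?thesis .
 qed
 moreover have "2 powr (- (\<delta> / (32 * real d0)) * (2 * real d0 * real d0)) = exp (- y)"
  using d by (simp add: powr_def y_def a_def field_simps)
 moreover have "exp (- y) \<le> x / 2"
 proof -
  have "y\<^sup>2 / 2 \<le> exp y" using exp_lower_Taylor_quadratic[of y] y by linarith
  then have "1 / exp y \<le> 1 / (y\<^sup>2 / 2)" using y by (intro divide_left_mono) auto
  also have "\<dots> = 512 / (a\<^sup>2 * (real d0)\<^sup>2)" by (simp add: y_def power_divide power_mult_distrib)
  also have "\<dots> \<le> a / (64 * real d0)"
  proof -
   have "32768 \<le> real d0 * a ^ 3" using d(3) a by (simp add: divide_le_eq)
   then have "32768 * real d0 \<le> (real d0 * a ^ 3) * real d0" using d(1) by (intro mult_right_mono) auto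
   then have "512 * (64 * real d0) \<le> a * (a\<^sup>2 * (real d0)\<^sup>2)" by (simp add: power2_eq_square power3_eq_cube mult_ac)
   then show ?thesis using a d(1) by (simp add: divide_le_eq pos_le_divide_eq field_simps)
  qed
  also have "\<dots> = x / 2" by (simp add: x_def)
  finally show ?thesis by (simp add: exp_minus field_simps)
 qed
 ultimately have "2 powr (- (\<delta> / (32 * real d0))) + 2 powr (- (\<delta> / (32 * real d0)) * (2 * real d0 * real d0)) \<le> 1" by linarith
 moreover have "1 \<le> d0" using d(1) by simp
 ultimately show ?thesis by blast
qed

text \<open>The inequality \<open>1 + z \<le> exp z\<close> at \<open>z = b * n\<close>, raised to
  the power \<open>j\<close>: polynomial factors cost only an arbitrarily small exponential.\<close>

lemma poly_le_exp:
 fixes a :: real assumes "0 < a"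
 shows "\<exists>K\<ge>1. \<forall>n. real ((2 * n + 3) ^ j) \<le> K * 2 powr (a * real n)"
proof (cases "j = 0")
 case True
 then show ?thesis using assms by (intro exI[of _ 1]) (auto intro!: ge_one_powr_ge_zero)
next
 case False
 define b where "b = a * ln 2 / real j"
 have b: "0 < b" using assms False by (simp add: b_def)
 define L where "L = 3 + 2 / b"
 have L: "3 \<le> L" "2 \<le> L * b" using b by (simp_all add: L_def field_simps)
 have "real ((2 * n + 3) ^ j) \<le> L ^ j * 2 powr (a * real n)" for n
 proof -
  have "real (2 * n + 3) \<le> L * (1 + b * real n)"
  proof -
   have "2 * real n \<le> L * b * real n" using L(2) by (intro mult_right_mono) auto
   then show ?thesis using L(1) by (simp add: algebra_simps)
  qed
  also have "\<dots> \<le> L * exp (b * real n)" using L(1) exp_ge_add_one_self[of "b * real n"] by (intro mult_left_mono) auto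
  finally have "real (2 * n + 3) ^ j \<le> (L * exp (b * real n)) ^ j" by (rule power_mono) simp
  also have "\<dots> = L ^ j * exp (real j * (b * real n))" by (simp only: power_mult_distrib exp_of_nat_mult)
  also have "real j * (b * real n) = a * real n * ln 2" using False by (simp add: b_def)
  also have "exp (a * real n * ln 2) = 2 powr (a * real n)" by (simp add: powr_def)
  finally show ?thesis by simp
 qed
 moreover have "1 \<le> L ^ j" using L(1) by simp
 ultimately show ?thesis by blast
qed

lemma length_input_size: "length x \<le> input_size x"
 unfolding input_size_def by (induction x) auto

text \<open>With \<open>a = \<delta>0 / 4\<close>, a factor \<open>2 powr (a * n)\<close> is granted
  to the branching tree, one to polynomial factors and one to the clique search at the leaves. The
  last is a power of 3, at most \<open>2 powr 2\<close>, with exponent \<open>c * E\<close> times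
  the group size, which is about \<open>2 * n * D / t\<close>. So
  \<open>E \<le> \<delta> * t\<close> with \<open>\<delta> = \<delta>0 / (16 * D * (c + 1))\<close>
  keeps it within \<open>a * n\<close> up to a constant.\<close>

lemma eth_core:
 assumes ETH
 shows "\<exists>\<delta>::real. 0 < \<delta> \<and> (\<forall>t E. 1 \<le> E --> 2 \<le> t --> real E \<le> \<delta> * real t --> \<not> good_query t E)"
proof -
 obtain \<delta>0 :: real where d0: "0 < \<delta>0" and no: "\<not> (\<exists>p C d. computes p three_cnf enc_cnf (%F. of_bool (satisfiable F)) \<and>
     runs_within p three_cnf enc_cnf (%F. C * 2 powr (\<delta>0 * real (fst F)) * real (input_size (enc_cnf F)) ^ d))"
  using assms unfolding ETH_def by blast
 obtain d :: nat where d: "1 \<le> d" "2 powr (- (\<delta>0 / (32 * real d))) + 2 powr (- (\<delta>0 / (32 * real d)) * (2 * real d * real d)) \<le> 1"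
  using choose_d[OF d0] by blast
 define \<eta> where "\<eta> = \<delta>0 / (32 * real d)"
 have eta: "0 \<le> \<eta>" "2 powr (- \<eta>) + 2 powr (- \<eta> * (2 * real d * real d)) \<le> 1" using d0 d by (simp_all add: \<eta>_def)
 define D where "D = 1 + d + 2 * d * d"
 obtain c Tk where Tk: "polyb Tk" and solver: "\<forall>p W C E. 1 \<le> E --> 2 \<le> fst W -->
  cheap p W C E -->
  decides p W -->
  (\<exists>p' K T0. polyb T0 \<and> computes p' three_cnf enc_cnf (%F. of_bool (satisfiable F)) \<and>
   (\<forall>F\<in>three_cnf. \<forall>s. run p' (enc_cnf F) s --> real (steps s) \<le> real (T0 (length (enc_cnf F))) +
    24 * 2 powr (\<eta> * real (4 * d * (2 * fst F + 3))) * (real (Tk (1 + 8 * (2 * fst F + 3) ^ 3)) +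
     real (K * ((2 + 8 * (2 * fst F + 3) ^ 3) * 3 ^ (((2 * fst F + 3) * D + fst W) div fst W)) ^ (c * E)) + 100)))"
  using threesat_solver[OF d(1) eta, folded D_def] by blast
 define a where "a = \<delta>0 / 4"
 have a0: "0 < a" using d0 by (simp add: a_def)
 define \<delta> where "\<delta> = \<delta>0 / (16 * real D * (real c + 1))"
 have D1: "1 \<le> D" by (simp add: D_def)
 have dp: "0 < \<delta>" using d0 D1 by (simp add: \<delta>_def)
 have dc: "4 * real c * real D * \<delta> \<le> a"
 proof -
  have "4 * x * y * (z / (16 * y * w)) = z / 4 * (x / w)" if "y ~= 0" "w ~= 0" for x y z w :: real
   using that by (simp add: field_simps)
  then have "4 * real c * real D * \<delta> = a * (real c / (real c + 1))"
   unfolding \<delta>_def a_def by this (use D1 in auto)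
  also have "\<dots> \<le> a * 1" using a0 by (intro mult_left_mono) auto
  finally show ?thesis by simp
 qed
 have "\<not> good_query t E" if E: "1 \<le> E" and t: "2 \<le> t" and Et: "real E \<le> \<delta> * real t" for t E
 proof
  assume "good_query t E"
  then obtain p and W :: plan and C where W: "fst W = t"
   "cheap p W C E"
   "decides p W" by blast
  have t': "2 \<le> fst W" using t W(1) by simp
  from solver[THEN spec, THEN spec, THEN spec, THEN spec, THEN mp, OF E, THEN mp, OF t', THEN mp, OF W(2), THEN mp, OF W(3)]
  obtain p' K T0 where P: "polyb T0" "computes p' three_cnf enc_cnf (%F. of_bool (satisfiable F))"
   "!!F s. F \<in> three_cnf ==> run p' (enc_cnf F) s ==> real (steps s) \<le> real (T0 (length (enc_cnf F))) +
    24 * 2 powr (\<eta> * real (4 * d * (2 * fst F + 3))) * (real (Tk (1 + 8 * (2 * fst F + 3) ^ 3)) +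
     real (K * ((2 + 8 * (2 * fst F + 3) ^ 3) * 3 ^ (((2 * fst F + 3) * D + fst W) div fst W)) ^ (c * E)) + 100)" by blast
  define x where "x n = 2 powr (a * real n)" for n :: nat
  have x1: "1 \<le> x n" for n unfolding x_def by (rule ge_one_powr_ge_zero) (use a0 in auto)
  have x0: "0 \<le> x n" for n using x1[of n] by linarith
  have "\<exists>K1\<ge>0. \<forall>n. 2 powr (\<eta> * real (4 * d * (2 * n + 3))) \<le> K1 * x n"
  proof (rule exI[of _ "2 powr (12 * real d * \<eta>)"], intro conjI allI)
   fix n
   have "\<eta> * real (4 * d * (2 * n + 3)) = 12 * real d * \<eta> + a * real n" using d(1) by (simp add: \<eta>_def a_def field_simps)
   then show "2 powr (\<eta> * real (4 * d * (2 * n + 3))) \<le> 2 powr (12 * real d * \<eta>) * x n" by (simp add: x_def powr_add)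
  qed simp
  then obtain K1 where K1: "0 \<le> K1" "!!n. 2 powr (\<eta> * real (4 * d * (2 * n + 3))) \<le> K1 * x n" by blast
  have "\<exists>K2\<ge>0. \<forall>n. real (Tk (1 + 8 * (2 * n + 3) ^ 3)) \<le> K2 * x n"
  proof -
   obtain r where r: "!!n. Tk n \<le> (n + r) ^ r" using Tk by (auto simp: polyb_def)
   obtain L where L: "1 \<le> L" "!!n. real ((2 * n + 3) ^ (3 * r)) \<le> L * x n" using poly_le_exp[OF a0, of "3 * r"] unfolding x_def by blast
   have "real (Tk (1 + 8 * (2 * n + 3) ^ 3)) \<le> real ((9 + r) ^ r) * L * x n" for n
   proof -
    let ?u = "(2 * n + 3) ^ 3"
    have "1 \<le> ?u" by simp
    then have "1 + 8 * ?u + r \<le> (9 + r) * ?u" using mult_le_mono2[of 1 ?u r] unfolding distrib_right by linarith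
    then have "(1 + 8 * ?u + r) ^ r \<le> ((9 + r) * ?u) ^ r" by (rule power_mono) simp
    also have "\<dots> = (9 + r) ^ r * (2 * n + 3) ^ (3 * r)" by (simp only: power_mult_distrib power_mult)
    finally have "Tk (1 + 8 * ?u) \<le> (9 + r) ^ r * (2 * n + 3) ^ (3 * r)" using r[of "1 + 8 * ?u"] by linarith
    then have "real (Tk (1 + 8 * ?u)) \<le> real ((9 + r) ^ r * (2 * n + 3) ^ (3 * r))" by (simp only: of_nat_le_iff)
    also have "\<dots> = real ((9 + r) ^ r) * real ((2 * n + 3) ^ (3 * r))" by (rule of_nat_mult)
    also have "\<dots> \<le> real ((9 + r) ^ r) * (L * x n)" by (rule mult_left_mono[OF L(2)]) simp
    finally show ?thesis by simp
   qed
   then show ?thesis using L(1) by (intro exI[of _ "real ((9 + r) ^ r) * L"]) auto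
  qed
  then obtain K2 where K2: "0 \<le> K2" "!!n. real (Tk (1 + 8 * (2 * n + 3) ^ 3)) \<le> K2 * x n" by blast
  have "\<exists>K3\<ge>0. \<forall>n. real (K * ((2 + 8 * (2 * n + 3) ^ 3) * 3 ^ (((2 * n + 3) * D + t) div t)) ^ (c * E)) \<le> K3 * (x n * x n)"
  proof -
   obtain L where L: "1 \<le> L" "!!n. real ((2 * n + 3) ^ (3 * (c * E))) \<le> L * x n" using poly_le_exp[OF a0, of "3 * (c * E)"] unfolding x_def by blast
   define M where "M = 2 powr (6 * real c * real D * \<delta> + 2 * real c * real E)"
   let ?K3 = "real K * (real (10 ^ (c * E)) * L) * M"
   have "real (K * ((2 + 8 * (2 * n + 3) ^ 3) * 3 ^ (((2 * n + 3) * D + t) div t)) ^ (c * E)) \<le> ?K3 * (x n * x n)" for n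
   proof -
    let ?u = "(2 * n + 3) ^ 3" and ?g = "((2 * n + 3) * D + t) div t"
    have "2 + 8 * ?u \<le> 10 * ?u" by simp
    then have "(2 + 8 * ?u) ^ (c * E) \<le> (10 * ?u) ^ (c * E)" by (rule power_mono) simp
    also have "\<dots> = 10 ^ (c * E) * (2 * n + 3) ^ (3 * (c * E))" by (simp only: power_mult_distrib power_mult)
    finally have "real ((2 + 8 * ?u) ^ (c * E)) \<le> real (10 ^ (c * E) * (2 * n + 3) ^ (3 * (c * E)))" by (simp only: of_nat_le_iff)
    also have "\<dots> = real (10 ^ (c * E)) * real ((2 * n + 3) ^ (3 * (c * E)))" by (rule of_nat_mult)
    also have "\<dots> \<le> real (10 ^ (c * E)) * (L * x n)" by (rule mult_left_mono[OF L(2)]) simp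
    finally have 1: "real ((2 + 8 * ?u) ^ (c * E)) \<le> real (10 ^ (c * E)) * L * x n" by simp
    have g: "real ?g * real (c * E) \<le> real c * real D * \<delta> * (2 * real n + 3) + real c * real E"
    proof -
     have "real ?g \<le> real ((2 * n + 3) * D + t) / real t" by (rule of_nat_div_le_of_nat)
     also have "\<dots> = real ((2 * n + 3) * D) / real t + 1" using t by (simp add: add_divide_distrib)
     finally have "real ?g * real (c * E) \<le> (real ((2 * n + 3) * D) / real t + 1) * real (c * E)" by (rule mult_right_mono) simp
     also have "\<dots> = real c * real ((2 * n + 3) * D) * (real E / real t) + real c * real E" by (simp add: algebra_simps add_divide_distrib)
     also have "\<dots> \<le> real c * real ((2 * n + 3) * D) * \<delta> + real c * real E"
      using Et t by (intro add_right_mono mult_left_mono) (auto simp: divide_le_eq)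
     finally show ?thesis by (simp add: algebra_simps)
    qed
    have "real ((3 ^ ?g) ^ (c * E)) = 3 powr (real ?g * real (c * E))" by (simp add: powr_realpow[symmetric] powr_powr)
    also have "\<dots> \<le> (2 powr 2) powr (real ?g * real (c * E))" by (intro powr_mono2) auto
    also have "\<dots> = 2 powr (2 * (real ?g * real (c * E)))" by (simp only: powr_powr)
    also have "\<dots> \<le> 2 powr (6 * real c * real D * \<delta> + 2 * real c * real E + a * real n)"
    proof (rule powr_mono)
     have "4 * real c * real D * \<delta> * real n \<le> a * real n" using dc by (rule mult_right_mono) simp
     then show "2 * (real ?g * real (c * E)) \<le> 6 * real c * real D * \<delta> + 2 * real c * real E + a * real n"
      using g by (simp add: algebra_simps)
    qed simp
    also have "\<dots> = M * x n" by (simp add: M_def x_def powr_add)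
    finally have 2: "real ((3 ^ ?g) ^ (c * E)) \<le> M * x n" .
    have "real (K * ((2 + 8 * ?u) * 3 ^ ?g) ^ (c * E)) = real K * (real ((2 + 8 * ?u) ^ (c * E)) * real ((3 ^ ?g) ^ (c * E)))"
     by (simp only: power_mult_distrib of_nat_mult)
    also have "\<dots> \<le> real K * ((real (10 ^ (c * E)) * L * x n) * (M * x n))"
     using x0 L(1) by (intro mult_left_mono mult_mono 1 2) auto
    finally show ?thesis by (simp add: mult_ac)
   qed
   moreover have "0 \<le> ?K3" using L(1) by (simp add: M_def)
   ultimately show ?thesis by blast
  qed
  then obtain K3 where K3: "0 \<le> K3" "!!n. real (K * ((2 + 8 * (2 * n + 3) ^ 3) * 3 ^ (((2 * n + 3) * D + t) div t)) ^ (c * E)) \<le> K3 * (x n * x n)" by blast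
  obtain r where r: "!!n. T0 n \<le> (n + r) ^ r" using P(1) by (auto simp: polyb_def)
  define CC where "CC = real ((1 + r) ^ r) + 24 * K1 * (K2 + K3 + 100)"
  have "runs_within p' three_cnf enc_cnf (%F. CC * 2 powr (\<delta>0 * real (fst F)) * real (input_size (enc_cnf F)) ^ r)"
   unfolding runs_within_def
  proof (intro ballI allI impI)
   fix F s assume F: "F \<in> three_cnf" and s: "run p' (enc_cnf F) s"
   let ?n = "fst F" and ?L = "length (enc_cnf F)" and ?S = "input_size (enc_cnf F)"
   let ?y = "2 powr (\<delta>0 * real ?n)"
   have LS: "?L \<le> ?S" by (rule length_input_size)
   have S1: "1 \<le> ?S" using LS by (cases F) (simp add: enc_cnf_def)
   have y1: "1 \<le> ?y" by (rule ge_one_powr_ge_zero) (use d0 in auto)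
   \<comment> \<open>Three factors \<open>2 powr (a * n)\<close> use up only three quarters of the
     exponent that ETH forbids.\<close>
   have xy: "x ?n * (x ?n * x ?n) \<le> ?y"
   proof -
    have "x ?n * (x ?n * x ?n) = 2 powr (3 * a * real ?n)" by (simp add: x_def powr_add[symmetric] mult.assoc)
    also have "\<dots> \<le> ?y" using d0 by (intro powr_mono) (auto simp: a_def)
    finally show ?thesis .
   qed
   have S1': "1 \<le> real ?S ^ r" using S1 by simp
   have "T0 ?L \<le> (1 + r) ^ r * ?S ^ r"
   proof -
    have "?L + r \<le> (1 + r) * ?S" using LS S1 mult_le_mono2[of 1 ?S r] unfolding distrib_right by linarith
    then have "(?L + r) ^ r \<le> ((1 + r) * ?S) ^ r" by (rule power_mono) simp
    then show ?thesis using r[of ?L] unfolding power_mult_distrib by linarith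
   qed
   then have "real (T0 ?L) \<le> real ((1 + r) ^ r * ?S ^ r)" by (simp only: of_nat_le_iff)
   also have "\<dots> = real ((1 + r) ^ r) * (1 * real ?S ^ r)" by (simp only: of_nat_mult of_nat_power mult_1)
   also have "\<dots> \<le> real ((1 + r) ^ r) * (?y * real ?S ^ r)" using y1 S1' by (intro mult_left_mono mult_right_mono) auto
   finally have 1: "real (T0 ?L) \<le> real ((1 + r) ^ r) * (?y * real ?S ^ r)" .
   have "24 * 2 powr (\<eta> * real (4 * d * (2 * ?n + 3))) * (real (Tk (1 + 8 * (2 * ?n + 3) ^ 3)) +
     real (K * ((2 + 8 * (2 * ?n + 3) ^ 3) * 3 ^ (((2 * ?n + 3) * D + t) div t)) ^ (c * E)) + 100)
    \<le> 24 * (K1 * x ?n) * (K2 * (x ?n * x ?n) + K3 * (x ?n * x ?n) + 100 * (x ?n * x ?n))"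
   proof (intro mult_mono add_mono K1(2) K3(2) order_refl)
    have xx: "x ?n * 1 \<le> x ?n * x ?n" using x1[of ?n] x0[of ?n] by (intro mult_left_mono) auto
    then show "real (Tk (1 + 8 * (2 * ?n + 3) ^ 3)) \<le> K2 * (x ?n * x ?n)"
     using K2(2)[of ?n] mult_left_mono[OF xx K2(1)] by simp
    show "100 \<le> 100 * (x ?n * x ?n)" using xx x1[of ?n] by linarith
   qed (use K1(1) x0[of ?n] in auto)
   also have "\<dots> = 24 * K1 * (K2 + K3 + 100) * (x ?n * (x ?n * x ?n))" by (simp add: algebra_simps)
   also have "\<dots> \<le> 24 * K1 * (K2 + K3 + 100) * ?y" using K1(1) K2(1) K3(1) xy by (intro mult_left_mono) auto
   also have "\<dots> \<le> 24 * K1 * (K2 + K3 + 100) * (?y * real ?S ^ r)"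
   proof (rule mult_left_mono)
    show "?y \<le> ?y * real ?S ^ r" using y1 S1' mult_left_mono[of 1 "real ?S ^ r" ?y] by simp
   qed (use K1(1) K2(1) K3(1) in auto)
   finally have "real (steps s) \<le> real ((1 + r) ^ r) * (?y * real ?S ^ r) + 24 * K1 * (K2 + K3 + 100) * (?y * real ?S ^ r)"
    using P(3)[OF F s] 1 unfolding W(1) by linarith
   also have "\<dots> = CC * (?y * real ?S ^ r)" by (simp only: CC_def distrib_right)
   finally show "real (steps s) \<le> CC * ?y * real ?S ^ r" by (simp only: mult.assoc)
  qed
  then show False using no P(2) by blast
 qed
 then show ?thesis using dp by blast
qed

text \<open>For the lower bound the exponent \<open>\<delta> * q\<close> decides: below 2, reading
  the input already takes too long; from 2 on, \<open>q\<close> and \<open>k\<close> are at least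
  64, so a pattern for \<open>t\<close> about \<open>q / 8\<close> exists and
  \<open>eth_core\<close> applies.\<close>

theorem theorem2:
  fixes \<alpha> :: nat and \<epsilon> :: real
  assumes "\<alpha> \<ge> 2" and "\<epsilon> > 0"
  shows "(\<forall>\<Phi>. admissible \<alpha> \<epsilon> \<Phi> \<longrightarrow> nontrivial \<Phi> \<longrightarrow>
            W1_hard (INDSUB \<Phi>) \<and> W1_hard (CPINDSUB \<Phi>)) \<and>
    (ETH \<longrightarrow>
      (\<exists>\<delta>::real. \<delta> > 0 \<and>
        (\<forall>\<Phi> k. admissible \<alpha> \<epsilon> \<Phi> \<longrightarrow> k \<ge> 3 \<longrightarrow> nontrivial_on \<Phi> k \<longrightarrow>
           \<not> IndSub_in_time \<Phi> k (\<lambda>n. real n powr (\<delta> * real k powr (1 - 1 / real \<alpha>))) \<and>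
           \<not> cpIndSub_in_time \<Phi> k (\<lambda>n. real n powr (\<delta> * real k powr (1 - 1 / real \<alpha>))))))"
proof (intro conjI allI impI)
 fix \<Phi> assume "admissible \<alpha> \<epsilon> \<Phi>" "nontrivial \<Phi>"
 then show "W1_hard (INDSUB \<Phi>)" "W1_hard (CPINDSUB \<Phi>)" using W1_hard_both assms by blast+
next
 assume ETH
 then obtain \<delta>1 :: real where d1: "0 < \<delta>1" "!!t E. 1 \<le> E ==> 2 \<le> t ==> real E \<le> \<delta>1 * real t ==> \<not> good_query t E"
  using eth_core by blast
 \<comment> \<open>The bound 1/32 turns \<open>2 \<le> \<delta> * q\<close> into
   \<open>64 \<le> q\<close>. The bound \<open>\<delta>1 / 32\<close> covers the rounding:
   \<open>t\<close> is at least \<open>q / 16\<close>, and \<open>E\<close> is at most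
   \<open>2 * \<delta> * q\<close>.\<close>
 define \<delta> where "\<delta> = min (1 / 32) (\<delta>1 / 32)"
 have dl: "0 < \<delta>" "\<delta> \<le> 1 / 32" "32 * \<delta> \<le> \<delta>1" using d1(1) by (auto simp: \<delta>_def)
 have "\<not> IndSub_in_time \<Phi> k (%n. real n powr (\<delta> * real k powr (1 - 1 / real \<alpha>))) \<and>
      \<not> cpIndSub_in_time \<Phi> k (%n. real n powr (\<delta> * real k powr (1 - 1 / real \<alpha>)))"
  if adm: "admissible \<alpha> \<epsilon> \<Phi>" and k3: "3 \<le> k" and nt: "nontrivial_on \<Phi> k" for \<Phi> k
 proof -
  define q where "q = real k powr (1 - 1 / real \<alpha>)"
  have q0: "0 \<le> q" by (simp add: q_def)
  show ?thesis unfolding q_def[symmetric]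
  proof (cases "\<delta> * q < 2")
   case True
   have "\<not> IndSub_in_time \<Phi> k (%n. real n powr (\<delta> * q))"
   proof
    assume "IndSub_in_time \<Phi> k (%n. real n powr (\<delta> * q))"
    then obtain p where p: "reads_whole_input p {G. is_graph G} enc_graph" "computes p {G. is_graph G} enc_graph (num_IndSub \<Phi> k)"
     "runs_in_O p {G. is_graph G} enc_graph (%G. card (verts G)) (%n. real n powr (\<delta> * q))" by (auto simp: IndSub_in_time_def)
    show False
    proof (rule small_exponent[OF p True])
     show "\<exists>x\<in>{G. is_graph G}. card (verts x) = n \<and> n * n \<le> length (enc_graph x)" for n
      by (rule bexI[of _ "({..<n}, {})"]) (auto simp: is_graph_def length_enc_graph)
    qed
   qed
   moreover have "\<not> cpIndSub_in_time \<Phi> k (%n. real n powr (\<delta> * q))"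
   proof
    let ?X = "{(H, G, c) \<in> colored_graphs. card (verts H) = k}"
    assume "cpIndSub_in_time \<Phi> k (%n. real n powr (\<delta> * q))"
    then obtain p where p: "reads_whole_input p ?X enc_colored" "computes p ?X enc_colored (%(H, G, c). num_cpIndSub \<Phi> H G c)"
     "runs_in_O p ?X enc_colored (%(H, G, c). card (verts G)) (%n. real n powr (\<delta> * q))" by (auto simp: cpIndSub_in_time_def Let_def)
    show False
    proof (rule small_exponent[OF p True])
     show "\<exists>x\<in>?X. (%(H, G, c). card (verts G)) x = n \<and> n * n \<le> length (enc_colored x)" for n
      by (rule bexI[of _ "(({..<k}, {}), ({..<n}, {}), %_. 0)"])
       (use k3 in \<open>auto simp: colored_graphs_def is_graph_def is_coloring_def enc_colored_def length_enc_graph\<close>)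
    qed
   qed
   ultimately show "\<not> IndSub_in_time \<Phi> k (%n. real n powr (\<delta> * q)) \<and> \<not> cpIndSub_in_time \<Phi> k (%n. real n powr (\<delta> * q))" by blast
  next
   case False
   then have dq: "2 \<le> \<delta> * q" by simp
   have "\<delta> * q \<le> 1 / 32 * q" using dl(2) q0 by (rule mult_right_mono)
   then have q64: "64 \<le> q" using dq by simp
   have "q \<le> real k powr 1" unfolding q_def using k3 by (intro powr_mono) auto
   then have k64: "64 \<le> k" using q64 k3 by simp
   define t where "t = nat \<lfloor>q / 8\<rfloor>"
   define E where "E = nat \<lceil>\<delta> * q\<rceil>"
   have t: "real t \<le> q / 8" "q / 16 \<le> real t" using q64 unfolding t_def by linarith+
   have t2: "2 \<le> t" using t(2) q64 by linarith
   have E: "\<delta> * q \<le> real E" "real E \<le> \<delta> * q + 1" using dq unfolding E_def by linarith+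
   have E1: "1 \<le> E" using E(1) dq by linarith
   have "\<delta> * q \<le> \<delta> * (16 * real t)" using t(2) dl(1) by (intro mult_left_mono) auto
   then have "real E \<le> 32 * \<delta> * real t" using E(2) dq by (simp add: algebra_simps)
   also have "\<dots> \<le> \<delta>1 * real t" using dl(3) by (rule mult_right_mono) simp
   finally have nq: "\<not> good_query t E" by (rule d1(2)[OF E1 t2])
   obtain H where H: "2 * t \<le> k" "H \<subseteq> pairs k" "hatr \<Phi> k H ~= 0" "\<forall>i<t. \<forall>l<t. {i, t + l} \<in> H"
    using exists_hat[OF adm assms nt k64 t(1)[unfolded q_def]] by blast
   have e0: "0 \<le> \<delta> * q" using dq by linarith
   note qs = queries[OF admissible_facts(1,2)[OF adm] H e0 E(1)]
   show "\<not> IndSub_in_time \<Phi> k (%n. real n powr (\<delta> * q)) \<and> \<not> cpIndSub_in_time \<Phi> k (%n. real n powr (\<delta> * q))"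
    using nq qs by blast
  qed
 qed
 then show "\<exists>\<delta>::real. \<delta> > 0 \<and>
    (\<forall>\<Phi> k. admissible \<alpha> \<epsilon> \<Phi> --> k \<ge> 3 --> nontrivial_on \<Phi> k -->
      \<not> IndSub_in_time \<Phi> k (%n. real n powr (\<delta> * real k powr (1 - 1 / real \<alpha>))) \<and>
      \<not> cpIndSub_in_time \<Phi> k (%n. real n powr (\<delta> * real k powr (1 - 1 / real \<alpha>))))" using dl(1) by blast
qed

end
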